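(* Let $\mathcal{C}$ be a Grothendieck category and let $\mathcal{L}_0$ and $\mathcal{L}_1$ be stable localizing subcategories of $\mathcal{C}$. Let $\mathcal{D} := (\mathcal{C}/\mathcal{L}_0) \prod_{\mathcal{C}/(\mathcal{L}_0 \vee \mathcal{L}_1)} (\mathcal{C}/\mathcal{L}_1)$ be the recollement category, and let $R : \mathcal{C}/(\mathcal{L}_0 \cap \mathcal{L}_1) \to \mathcal{D}$ and $V : \mathcal{D} \to \mathcal{C}/(\mathcal{L}_0 \cap \mathcal{L}_1)$ be the functors described in the context. Then the morphisms $$ \big(\gamma_{0,X_0} \circ Q_0(\pi_{0,\Theta}),\ \gamma_{1,X_1} \circ Q_1(\pi_{1,\Theta})\big) : R V(X_0,X_1,\sigma) \longrightarrow (X_0,X_1,\sigma), \qquad \Theta = (X_0,X_1,\sigma), $$ form a natural isomorphism $R\circ V \cong \operatorname{id}_{\mathcal{D}}$ between functors on $\mathcal{D}$, and $R : \mathcal{C}/(\mathcal{L}_0 \cap \mathcal{L}_1) \to \mathcal{D}$ is an equivalence of categories.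
   Context: A Grothendieck category is an abelian category which has small coproducts, exact filtered colimits and a generator. A localizing subcategory is a full subcategory closed under subobjects, quotient objects, extensions and arbitrary direct sums; it is stable if it is also closed under essential extensions. $\mathcal{L}_0 \vee \mathcal{L}_1$ is the smallest localizing subcategory containing $\mathcal{L}_0$ and $\mathcal{L}_1$. Quotient categories are taken to have the same objects as the categories they are quotients of. For $i=0,1$ let $Q_i : \mathcal{C}/(\mathcal{L}_0\cap\mathcal{L}_1) \to \mathcal{C}/\mathcal{L}_i$ and $F_i : \mathcal{C}/\mathcal{L}_i \to \mathcal{C}/(\mathcal{L}_0\vee\mathcal{L}_1)$ be the natural exact quotient functors, so that $F_0 Q_0 = F_1 Q_1$. They have right adjoints (section functors) $U_i$ of $Q_i$ and $H_i$ of $F_i$. Let $\gamma_i : Q_i U_i \to \operatorname{id}$ be the counit (an isomorphism) of the adjunction $(Q_i,U_i)$ and $\eta_i : \operatorname{id} \to H_i F_i$ the unit of the adjunction $(F_i,H_i)$. Since $U_0H_0$ and $U_1H_1$ are both right adjoint to $F_0Q_0=F_1Q_1$, there is a unique natural isomorphism $\iota : U_0 H_0 \to U_1 H_1$ compatible with the units and counits of these two adjunctions. Recollement: objects of $\mathcal{D}$ are triples $(X_0,X_1,\sigma)$ with $X_i$ an object of $\mathcal{C}/\mathcal{L}_i$ and $\sigma : F_0(X_0) \to F_1(X_1)$ an isomorphism; morphisms $(X_0,X_1,\sigma)\to(X_0',X_1',\sigma')$ are pairs of morphisms $f_i : X_i \to X_i'$ with $\sigma' F_0(f_0) = F_1(f_1)\sigma$.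 The functor $R$ is $R(X) = (Q_0(X),Q_1(X),\operatorname{id})$, where $\operatorname{id}: F_0Q_0(X) = F_1Q_1(X)$ is the identity, and $R(f)=(Q_0(f),Q_1(f))$. The functor $V$ sends $\Theta=(X_0,X_1,\sigma)$ to the fiber product in $\mathcal{C}/(\mathcal{L}_0\cap\mathcal{L}_1)$ of the two morphisms $$U_0(X_0) \xrightarrow{U_0(\eta_{0,X_0})} U_0H_0F_0(X_0) \xrightarrow{U_0H_0(\sigma)} U_0H_0F_1(X_1) \xrightarrow{\iota_{F_1(X_1)}} U_1H_1F_1(X_1)$$ and $$U_1(X_1) \xrightarrow{U_1(\eta_{1,X_1})} U_1H_1F_1(X_1),$$ with projections $\pi_{0,\Theta} : V(\Theta) \to U_0(X_0)$ and $\pi_{1,\Theta} : V(\Theta) \to U_1(X_1)$. *)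

theory Defs
  imports "HOL-Library.Equipollence" "HOL-Algebra.Group"
begin

section \<open>Universes\<close>

text \<open>
  Smallness is relative to a type \<open>'u\<close> playing the role of a Grothendieck universe: a set
  (of elements of any type) is small if its cardinality is strictly below that of \<open>'u\<close>.  The
  universe axioms say that small sets are closed under power sets and small unions, i.e. that the
  cardinality of \<open>'u\<close> is regular and a strong limit.  As with the universe of hereditarily finite
  sets, a countable \<open>'u\<close> is not excluded; small then means finite.
\<close>

definition small :: "'u itself \<Rightarrow> 'a set \<Rightarrow> bool" where
  "small u A \<longleftrightarrow> A \<prec> (UNIV :: 'u set)"

definition universe :: "'u itself \<Rightarrow> bool" where
  "universe u \<longleftrightarrow>
     infinite (UNIV :: 'u set) \<and>
     (\<forall>A :: 'u set. small u A \<longrightarrow> small u (Pow A)) \<and>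
     (\<forall>(I :: 'u set) (A :: 'u \<Rightarrow> 'u set).
        small u I \<longrightarrow> (\<forall>i\<in>I. small u (A i)) \<longrightarrow> small u (\<Union>i\<in>I. A i))"


section \<open>Categories, functors, natural transformations\<close>

text \<open>\<open>Comp C g f\<close> is the composite \<open>g \<circ> f\<close>; it is meaningful only if \<open>Cod C f = Dom C g\<close>.\<close>

record ('o, 'm) cat =
  Ob :: "'o set"
  Ar :: "'m set"
  Dom :: "'m \<Rightarrow> 'o"
  Cod :: "'m \<Rightarrow> 'o"
  Idn :: "'o \<Rightarrow> 'm"
  Comp :: "'m \<Rightarrow> 'm \<Rightarrow> 'm"

definition Hom :: "('o, 'm) cat \<Rightarrow> 'o \<Rightarrow> 'o \<Rightarrow> 'm set" where
  "Hom C X Y = {f \<in> Ar C. Dom C f = X \<and> Cod C f = Y}"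

definition is_category :: "('o, 'm) cat \<Rightarrow> bool" where
  "is_category C \<longleftrightarrow>
     (\<forall>f\<in>Ar C. Dom C f \<in> Ob C \<and> Cod C f \<in> Ob C) \<and>
     (\<forall>X\<in>Ob C. Idn C X \<in> Hom C X X) \<and>
     (\<forall>f\<in>Ar C. \<forall>g\<in>Ar C. Cod C f = Dom C g \<longrightarrow> Comp C g f \<in> Hom C (Dom C f) (Cod C g)) \<and>
     (\<forall>f\<in>Ar C. Comp C f (Idn C (Dom C f)) = f \<and> Comp C (Idn C (Cod C f)) f = f) \<and>
     (\<forall>f\<in>Ar C. \<forall>g\<in>Ar C. \<forall>h\<in>Ar C. Cod C f = Dom C g \<longrightarrow> Cod C g = Dom C h \<longrightarrow>
        Comp C h (Comp C g f) = Comp C (Comp C h g) f)"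

definition is_iso :: "('o, 'm) cat \<Rightarrow> 'm \<Rightarrow> bool" where
  "is_iso C f \<longleftrightarrow> f \<in> Ar C \<and>
     (\<exists>g\<in>Hom C (Cod C f) (Dom C f).
        Comp C g f = Idn C (Dom C f) \<and> Comp C f g = Idn C (Cod C f))"

record ('o, 'm, 'p, 'n) ftr =
  fob :: "'o \<Rightarrow> 'p"
  far :: "'m \<Rightarrow> 'n"

definition is_functor :: "('o, 'm) cat \<Rightarrow> ('p, 'n) cat \<Rightarrow> ('o, 'm, 'p, 'n) ftr \<Rightarrow> bool" where
  "is_functor C D F \<longleftrightarrow> is_category C \<and> is_category D \<and>
     (\<forall>X\<in>Ob C. fob F X \<in> Ob D) \<and>
     (\<forall>f\<in>Ar C. far F f \<in> Hom D (fob F (Dom C f)) (fob F (Cod C f))) \<and>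
     (\<forall>X\<in>Ob C. far F (Idn C X) = Idn D (fob F X)) \<and>
     (\<forall>f\<in>Ar C. \<forall>g\<in>Ar C. Cod C f = Dom C g \<longrightarrow>
        far F (Comp C g f) = Comp D (far F g) (far F f))"

definition fid :: "('o, 'm, 'o, 'm) ftr" where
  "fid = \<lparr>fob = (\<lambda>X. X), far = (\<lambda>f. f)\<rparr>"

definition fcomp :: "('p, 'n, 'q, 'k) ftr \<Rightarrow> ('o, 'm, 'p, 'n) ftr \<Rightarrow> ('o, 'm, 'q, 'k) ftr"
    (infixr "\<odot>" 75) where
  "G \<odot> F = \<lparr>fob = (\<lambda>X. fob G (fob F X)), far = (\<lambda>f. far G (far F f))\<rparr>"

definition nat_trans ::
  "('o, 'm) cat \<Rightarrow> ('p, 'n) cat \<Rightarrow> ('o, 'm, 'p, 'n) ftr \<Rightarrow> ('o, 'm, 'p, 'n) ftr \<Rightarrow> ('o \<Rightarrow> 'n) \<Rightarrow> bool" where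
  "nat_trans C D F G \<alpha> \<longleftrightarrow> is_functor C D F \<and> is_functor C D G \<and>
     (\<forall>X\<in>Ob C. \<alpha> X \<in> Hom D (fob F X) (fob G X)) \<and>
     (\<forall>f\<in>Ar C. Comp D (far G f) (\<alpha> (Dom C f)) = Comp D (\<alpha> (Cod C f)) (far F f))"

definition nat_iso ::
  "('o, 'm) cat \<Rightarrow> ('p, 'n) cat \<Rightarrow> ('o, 'm, 'p, 'n) ftr \<Rightarrow> ('o, 'm, 'p, 'n) ftr \<Rightarrow> ('o \<Rightarrow> 'n) \<Rightarrow> bool" where
  "nat_iso C D F G \<alpha> \<longleftrightarrow> nat_trans C D F G \<alpha> \<and> (\<forall>X\<in>Ob C. is_iso D (\<alpha> X))"

definition is_equivalence :: "('o, 'm) cat \<Rightarrow> ('p, 'n) cat \<Rightarrow> ('o, 'm, 'p, 'n) ftr \<Rightarrow> bool" where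
  "is_equivalence C D F \<longleftrightarrow> is_functor C D F \<and>
     (\<exists>G \<alpha> \<beta>. is_functor D C G \<and> nat_iso C C (G \<odot> F) fid \<alpha> \<and> nat_iso D D (F \<odot> G) fid \<beta>)"

text \<open>\<open>F\<close> is left adjoint to \<open>G\<close>, with unit \<open>\<eta>\<close> and counit \<open>\<epsilon>\<close>.\<close>

definition adjunction ::
  "('o, 'm) cat \<Rightarrow> ('p, 'n) cat \<Rightarrow> ('o, 'm, 'p, 'n) ftr \<Rightarrow> ('p, 'n, 'o, 'm) ftr \<Rightarrow>
   ('o \<Rightarrow> 'm) \<Rightarrow> ('p \<Rightarrow> 'n) \<Rightarrow> bool" where
  "adjunction A B F G \<eta> \<epsilon> \<longleftrightarrow>
     is_functor A B F \<and> is_functor B A G \<and>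
     nat_trans A A fid (G \<odot> F) \<eta> \<and> nat_trans B B (F \<odot> G) fid \<epsilon> \<and>
     (\<forall>X\<in>Ob A. Comp B (\<epsilon> (fob F X)) (far F (\<eta> X)) = Idn B (fob F X)) \<and>
     (\<forall>Y\<in>Ob B. Comp A (far G (\<epsilon> Y)) (\<eta> (fob G Y)) = Idn A (fob G Y))"

text \<open>
  Unit and counit of the composite of the adjunctions \<open>(F, G, \<eta>, \<epsilon>)\<close> between \<open>A\<close> and \<open>B\<close> and
  \<open>(F', G', \<eta>', \<epsilon>')\<close> between \<open>B\<close> and \<open>E\<close>.
\<close>

definition comp_unit ::
  "('o, 'm) cat \<Rightarrow> ('o, 'm, 'p, 'n) ftr \<Rightarrow> ('p, 'n, 'o, 'm) ftr \<Rightarrow> ('o \<Rightarrow> 'm) \<Rightarrow> ('p \<Rightarrow> 'n) \<Rightarrow>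
   'o \<Rightarrow> 'm" where
  "comp_unit A F G \<eta> \<eta>' X = Comp A (far G (\<eta>' (fob F X))) (\<eta> X)"

definition comp_counit ::
  "('q, 'k) cat \<Rightarrow> ('p, 'n, 'q, 'k) ftr \<Rightarrow> ('q, 'k, 'p, 'n) ftr \<Rightarrow> ('p \<Rightarrow> 'n) \<Rightarrow> ('q \<Rightarrow> 'k) \<Rightarrow>
   'q \<Rightarrow> 'k" where
  "comp_counit E F' G' \<epsilon> \<epsilon>' Y = Comp E (\<epsilon>' Y) (far F' (\<epsilon> (fob G' Y)))"

text \<open>
  \<open>\<iota>\<close> is the canonical isomorphism \<open>G \<rightarrow> G'\<close> between two right adjoints of \<open>F\<close>, the one compatible
  with the units and counits of the two adjunctions.
\<close>

definition adjoint_comparison ::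
  "('o, 'm) cat \<Rightarrow> ('p, 'n) cat \<Rightarrow> ('o, 'm, 'p, 'n) ftr \<Rightarrow>
   ('p, 'n, 'o, 'm) ftr \<Rightarrow> ('o \<Rightarrow> 'm) \<Rightarrow> ('p \<Rightarrow> 'n) \<Rightarrow>
   ('p, 'n, 'o, 'm) ftr \<Rightarrow> ('o \<Rightarrow> 'm) \<Rightarrow> ('p \<Rightarrow> 'n) \<Rightarrow> ('p \<Rightarrow> 'm) \<Rightarrow> bool" where
  "adjoint_comparison A B F G \<eta> \<epsilon> G' \<eta>' \<epsilon>' \<iota> \<longleftrightarrow>
     nat_iso B A G G' \<iota> \<and>
     (\<forall>X\<in>Ob A. Comp A (\<iota> (fob F X)) (\<eta> X) = \<eta>' X) \<and>
     (\<forall>Y\<in>Ob B. Comp B (\<epsilon>' Y) (far F (\<iota> Y)) = \<epsilon> Y)"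


section \<open>Limits and colimits\<close>

definition zero_object :: "('o, 'm) cat \<Rightarrow> 'o \<Rightarrow> bool" where
  "zero_object C Z \<longleftrightarrow> Z \<in> Ob C \<and> (\<forall>X\<in>Ob C. (\<exists>!f. f \<in> Hom C X Z) \<and> (\<exists>!f. f \<in> Hom C Z X))"

definition zero_arrow :: "('o, 'm) cat \<Rightarrow> 'm \<Rightarrow> bool" where
  "zero_arrow C f \<longleftrightarrow>
     (\<exists>Z g h. zero_object C Z \<and> g \<in> Hom C (Dom C f) Z \<and> h \<in> Hom C Z (Cod C f) \<and> f = Comp C h g)"

definition is_mono :: "('o, 'm) cat \<Rightarrow> 'm \<Rightarrow> bool" where
  "is_mono C f \<longleftrightarrow> f \<in> Ar C \<and>
     (\<forall>g\<in>Ar C. \<forall>h\<in>Ar C. Dom C g = Dom C h \<longrightarrow> Cod C g = Dom C f \<longrightarrow> Cod C h = Dom C f \<longrightarrow>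
        Comp C f g = Comp C f h \<longrightarrow> g = h)"

definition is_epi :: "('o, 'm) cat \<Rightarrow> 'm \<Rightarrow> bool" where
  "is_epi C f \<longleftrightarrow> f \<in> Ar C \<and>
     (\<forall>g\<in>Ar C. \<forall>h\<in>Ar C. Cod C g = Cod C h \<longrightarrow> Dom C g = Cod C f \<longrightarrow> Dom C h = Cod C f \<longrightarrow>
        Comp C g f = Comp C h f \<longrightarrow> g = h)"

definition is_kernel :: "('o, 'm) cat \<Rightarrow> 'm \<Rightarrow> 'm \<Rightarrow> bool" where
  "is_kernel C f k \<longleftrightarrow> f \<in> Ar C \<and> k \<in> Ar C \<and> Cod C k = Dom C f \<and> zero_arrow C (Comp C f k) \<and>
     (\<forall>g\<in>Ar C. Cod C g = Dom C f \<longrightarrow> zero_arrow C (Comp C f g) \<longrightarrow>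
        (\<exists>!u. u \<in> Hom C (Dom C g) (Dom C k) \<and> Comp C k u = g))"

definition is_cokernel :: "('o, 'm) cat \<Rightarrow> 'm \<Rightarrow> 'm \<Rightarrow> bool" where
  "is_cokernel C f c \<longleftrightarrow> f \<in> Ar C \<and> c \<in> Ar C \<and> Dom C c = Cod C f \<and> zero_arrow C (Comp C c f) \<and>
     (\<forall>g\<in>Ar C. Dom C g = Cod C f \<longrightarrow> zero_arrow C (Comp C g f) \<longrightarrow>
        (\<exists>!u. u \<in> Hom C (Cod C c) (Cod C g) \<and> Comp C u c = g))"

text \<open>\<open>0 \<rightarrow> Dom f \<rightarrow> Cod f = Dom g \<rightarrow> Cod g \<rightarrow> 0\<close> is exact.\<close>

definition short_exact :: "('o, 'm) cat \<Rightarrow> 'm \<Rightarrow> 'm \<Rightarrow> bool" where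
  "short_exact C f g \<longleftrightarrow> is_kernel C g f \<and> is_cokernel C f g"

definition is_product :: "('o, 'm) cat \<Rightarrow> 'o \<Rightarrow> 'o \<Rightarrow> 'm \<Rightarrow> 'm \<Rightarrow> bool" where
  "is_product C X Y p q \<longleftrightarrow> p \<in> Hom C (Dom C p) X \<and> q \<in> Hom C (Dom C p) Y \<and>
     (\<forall>f\<in>Ar C. \<forall>g\<in>Ar C. Dom C f = Dom C g \<longrightarrow> Cod C f = X \<longrightarrow> Cod C g = Y \<longrightarrow>
        (\<exists>!u. u \<in> Hom C (Dom C f) (Dom C p) \<and> Comp C p u = f \<and> Comp C q u = g))"

text \<open>\<open>p\<close> and \<open>q\<close> are the projections of a fiber product of \<open>f\<close> and \<open>g\<close>.\<close>

definition is_pullback :: "('o, 'm) cat \<Rightarrow> 'm \<Rightarrow> 'm \<Rightarrow> 'm \<Rightarrow> 'm \<Rightarrow> bool" where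
  "is_pullback C f g p q \<longleftrightarrow> f \<in> Ar C \<and> g \<in> Ar C \<and> Cod C f = Cod C g \<and>
     p \<in> Hom C (Dom C p) (Dom C f) \<and> q \<in> Hom C (Dom C p) (Dom C g) \<and> Comp C f p = Comp C g q \<and>
     (\<forall>h\<in>Ar C. \<forall>k\<in>Ar C. Dom C h = Dom C k \<longrightarrow> Cod C h = Dom C f \<longrightarrow> Cod C k = Dom C g \<longrightarrow>
        Comp C f h = Comp C g k \<longrightarrow>
        (\<exists>!u. u \<in> Hom C (Dom C h) (Dom C p) \<and> Comp C p u = h \<and> Comp C q u = k))"

definition is_coproduct ::
  "('o, 'm) cat \<Rightarrow> 'i set \<Rightarrow> ('i \<Rightarrow> 'o) \<Rightarrow> 'o \<Rightarrow> ('i \<Rightarrow> 'm) \<Rightarrow> bool" where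
  "is_coproduct C I X S j \<longleftrightarrow> S \<in> Ob C \<and> (\<forall>i\<in>I. j i \<in> Hom C (X i) S) \<and>
     (\<forall>Y\<in>Ob C. \<forall>f. (\<forall>i\<in>I. f i \<in> Hom C (X i) Y) \<longrightarrow>
        (\<exists>!u. u \<in> Hom C S Y \<and> (\<forall>i\<in>I. Comp C u (j i) = f i)))"

definition is_cocone ::
  "('j, 'k) cat \<Rightarrow> ('o, 'm) cat \<Rightarrow> ('j, 'k, 'o, 'm) ftr \<Rightarrow> 'o \<Rightarrow> ('j \<Rightarrow> 'm) \<Rightarrow> bool" where
  "is_cocone J C F A l \<longleftrightarrow> A \<in> Ob C \<and> (\<forall>j\<in>Ob J. l j \<in> Hom C (fob F j) A) \<and>
     (\<forall>t\<in>Ar J. Comp C (l (Cod J t)) (far F t) = l (Dom J t))"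

definition is_colimit ::
  "('j, 'k) cat \<Rightarrow> ('o, 'm) cat \<Rightarrow> ('j, 'k, 'o, 'm) ftr \<Rightarrow> 'o \<Rightarrow> ('j \<Rightarrow> 'm) \<Rightarrow> bool" where
  "is_colimit J C F A l \<longleftrightarrow> is_functor J C F \<and> is_cocone J C F A l \<and>
     (\<forall>Y f. is_cocone J C F Y f \<longrightarrow>
        (\<exists>!u. u \<in> Hom C A Y \<and> (\<forall>j\<in>Ob J. Comp C u (l j) = f j)))"

definition filtered :: "('j, 'k) cat \<Rightarrow> bool" where
  "filtered J \<longleftrightarrow> is_category J \<and> Ob J \<noteq> {} \<and>
     (\<forall>i\<in>Ob J. \<forall>j\<in>Ob J. \<exists>k\<in>Ob J. Hom J i k \<noteq> {} \<and> Hom J j k \<noteq> {}) \<and>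
     (\<forall>s\<in>Ar J. \<forall>t\<in>Ar J. Dom J s = Dom J t \<longrightarrow> Cod J s = Cod J t \<longrightarrow>
        (\<exists>w\<in>Ar J. Dom J w = Cod J s \<and> Comp J w s = Comp J w t))"


section \<open>Grothendieck categories\<close>

definition preadditive :: "('o, 'm) cat \<Rightarrow> ('m \<Rightarrow> 'm \<Rightarrow> 'm) \<Rightarrow> ('o \<Rightarrow> 'o \<Rightarrow> 'm) \<Rightarrow> bool" where
  "preadditive C add z \<longleftrightarrow> is_category C \<and>
     (\<forall>X\<in>Ob C. \<forall>Y\<in>Ob C. comm_group \<lparr>carrier = Hom C X Y, mult = add, one = z X Y\<rparr>) \<and>
     (\<forall>X\<in>Ob C. \<forall>Y\<in>Ob C. \<forall>W\<in>Ob C. \<forall>f\<in>Hom C X Y. \<forall>f'\<in>Hom C X Y. \<forall>g\<in>Hom C Y W. \<forall>g'\<in>Hom C Y W.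
        Comp C g (add f f') = add (Comp C g f) (Comp C g f') \<and>
        Comp C (add g g') f = add (Comp C g f) (Comp C g' f))"

definition abelian :: "('o, 'm) cat \<Rightarrow> bool" where
  "abelian C \<longleftrightarrow>
     (\<exists>add z. preadditive C add z) \<and>
     (\<exists>Z. zero_object C Z) \<and>
     (\<forall>X\<in>Ob C. \<forall>Y\<in>Ob C. \<exists>p q. is_product C X Y p q) \<and>
     (\<forall>f\<in>Ar C. (\<exists>k. is_kernel C f k) \<and> (\<exists>c. is_cokernel C f c)) \<and>
     (\<forall>f. is_mono C f \<longrightarrow> (\<exists>g. is_kernel C g f)) \<and>
     (\<forall>f. is_epi C f \<longrightarrow> (\<exists>g. is_cokernel C g f))"

definition small_coproducts :: "'u itself \<Rightarrow> ('o, 'm) cat \<Rightarrow> bool" where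
  "small_coproducts u C \<longleftrightarrow>
     (\<forall>(I :: 'u set) X. small u I \<longrightarrow> (\<forall>i\<in>I. X i \<in> Ob C) \<longrightarrow> (\<exists>S j. is_coproduct C I X S j))"

text \<open>
  Up to isomorphism, every small category is one with a small set of objects and a small set of
  arrows, all elements of \<open>'u\<close>.
\<close>

definition exact_filtered_colimits :: "'u itself \<Rightarrow> ('o, 'm) cat \<Rightarrow> bool" where
  "exact_filtered_colimits u C \<longleftrightarrow>
     (\<forall>J :: ('u, 'u) cat. filtered J \<longrightarrow> small u (Ob J) \<longrightarrow> small u (Ar J) \<longrightarrow>
        (\<forall>F. is_functor J C F \<longrightarrow> (\<exists>A l. is_colimit J C F A l)) \<and>
        (\<forall>F G H \<alpha> \<beta> A l B m K n a b.
           nat_trans J C F G \<alpha> \<longrightarrow> nat_trans J C G H \<beta> \<longrightarrow>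
           (\<forall>j\<in>Ob J. short_exact C (\<alpha> j) (\<beta> j)) \<longrightarrow>
           is_colimit J C F A l \<longrightarrow> is_colimit J C G B m \<longrightarrow> is_colimit J C H K n \<longrightarrow>
           a \<in> Hom C A B \<longrightarrow> (\<forall>j\<in>Ob J. Comp C a (l j) = Comp C (m j) (\<alpha> j)) \<longrightarrow>
           b \<in> Hom C B K \<longrightarrow> (\<forall>j\<in>Ob J. Comp C b (m j) = Comp C (n j) (\<beta> j)) \<longrightarrow>
           short_exact C a b))"

definition is_generator :: "('o, 'm) cat \<Rightarrow> 'o \<Rightarrow> bool" where
  "is_generator C G \<longleftrightarrow> G \<in> Ob C \<and>
     (\<forall>f\<in>Ar C. \<forall>g\<in>Ar C. Dom C f = Dom C g \<longrightarrow> Cod C f = Cod C g \<longrightarrow> f \<noteq> g \<longrightarrow>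
        (\<exists>h\<in>Hom C G (Dom C f). Comp C f h \<noteq> Comp C g h))"

definition grothendieck :: "'u itself \<Rightarrow> ('o, 'm) cat \<Rightarrow> bool" where
  "grothendieck u C \<longleftrightarrow>
     is_category C \<and> (\<forall>X\<in>Ob C. \<forall>Y\<in>Ob C. small u (Hom C X Y)) \<and>
     abelian C \<and> small_coproducts u C \<and> exact_filtered_colimits u C \<and> (\<exists>G. is_generator C G)"


section \<open>Localizing subcategories\<close>

text \<open>A full subcategory is given by its set of objects.\<close>

definition localizing :: "'u itself \<Rightarrow> ('o, 'm) cat \<Rightarrow> 'o set \<Rightarrow> bool" where
  "localizing u C L \<longleftrightarrow> L \<subseteq> Ob C \<and>
     (\<forall>f. is_mono C f \<longrightarrow> Cod C f \<in> L \<longrightarrow> Dom C f \<in> L) \<and>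
     (\<forall>f. is_epi C f \<longrightarrow> Dom C f \<in> L \<longrightarrow> Cod C f \<in> L) \<and>
     (\<forall>f g. short_exact C f g \<longrightarrow> Dom C f \<in> L \<longrightarrow> Cod C g \<in> L \<longrightarrow> Cod C f \<in> L) \<and>
     (\<forall>(I :: 'u set) X S j. small u I \<longrightarrow> (\<forall>i\<in>I. X i \<in> L) \<longrightarrow> is_coproduct C I X S j \<longrightarrow> S \<in> L)"

definition essential_mono :: "('o, 'm) cat \<Rightarrow> 'm \<Rightarrow> bool" where
  "essential_mono C m \<longleftrightarrow> is_mono C m \<and>
     (\<forall>g\<in>Ar C. Dom C g = Cod C m \<longrightarrow> is_mono C (Comp C g m) \<longrightarrow> is_mono C g)"

definition stable_localizing :: "'u itself \<Rightarrow> ('o, 'm) cat \<Rightarrow> 'o set \<Rightarrow> bool" where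
  "stable_localizing u C L \<longleftrightarrow> localizing u C L \<and>
     (\<forall>m. essential_mono C m \<longrightarrow> Dom C m \<in> L \<longrightarrow> Cod C m \<in> L)"

definition localizing_join :: "'u itself \<Rightarrow> ('o, 'm) cat \<Rightarrow> 'o set \<Rightarrow> 'o set \<Rightarrow> 'o set" where
  "localizing_join u C L0 L1 = \<Inter>{L. localizing u C L \<and> L0 \<subseteq> L \<and> L1 \<subseteq> L}"


section \<open>Quotient categories\<close>

text \<open>
  The quotient \<open>C/L\<close> is the localization of \<open>C\<close> at the arrows whose kernel and cokernel lie in
  \<open>L\<close>.  These admit a calculus of right fractions, so an arrow \<open>X \<rightarrow> Y\<close> of \<open>C/L\<close> is a class of
  fractions \<open>(s, f)\<close>, representing \<open>f \<circ> s\<^sup>-\<^sup>1\<close>, where \<open>s : Z \<rightarrow> X\<close> is such an arrow and \<open>f : Z \<rightarrow> Y\<close>.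
  The class is tagged with \<open>X\<close> and \<open>Y\<close>.
\<close>

definition quot_inverted :: "('o, 'm) cat \<Rightarrow> 'o set \<Rightarrow> 'm \<Rightarrow> bool" where
  "quot_inverted C L s \<longleftrightarrow> s \<in> Ar C \<and>
     (\<exists>k. is_kernel C s k \<and> Dom C k \<in> L) \<and> (\<exists>c. is_cokernel C s c \<and> Cod C c \<in> L)"

definition fractions :: "('o, 'm) cat \<Rightarrow> 'o set \<Rightarrow> 'o \<Rightarrow> 'o \<Rightarrow> ('m \<times> 'm) set" where
  "fractions C L X Y = {(s, f). quot_inverted C L s \<and> f \<in> Ar C \<and>
     Dom C s = Dom C f \<and> Cod C s = X \<and> Cod C f = Y}"

definition fraction_rel :: "('o, 'm) cat \<Rightarrow> 'o set \<Rightarrow> 'o \<Rightarrow> 'o \<Rightarrow> (('m \<times> 'm) \<times> ('m \<times> 'm)) set" where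
  "fraction_rel C L X Y = {((s, f), (s', f')).
     (s, f) \<in> fractions C L X Y \<and> (s', f') \<in> fractions C L X Y \<and>
     (\<exists>u\<in>Ar C. \<exists>u'\<in>Ar C. Dom C u = Dom C u' \<and> Cod C u = Dom C s \<and> Cod C u' = Dom C s' \<and>
        Comp C s u = Comp C s' u' \<and> quot_inverted C L (Comp C s u) \<and>
        Comp C f u = Comp C f' u')}"

type_synonym ('o, 'm) qarr = "'o \<times> 'o \<times> ('m \<times> 'm) set"

text \<open>
  \<open>(t, g)\<close> after \<open>(s, f)\<close> is \<open>(s \<circ> u, g \<circ> v)\<close> for any commuting square \<open>f \<circ> u = t \<circ> v\<close> with \<open>u\<close>
  inverted.  All choices give the same class, so the union below is a single class.
\<close>

definition quot_comp :: "('o, 'm) cat \<Rightarrow> 'o set \<Rightarrow> ('o, 'm) qarr \<Rightarrow> ('o, 'm) qarr \<Rightarrow> ('o, 'm) qarr" where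
  "quot_comp C L = (\<lambda>(Y', Z, d) (X, Y, c). (X, Z,
     \<Union>{fraction_rel C L X Z `` {(Comp C s u, Comp C g v)} | s f t g u v.
        (s, f) \<in> c \<and> (t, g) \<in> d \<and> quot_inverted C L u \<and> v \<in> Ar C \<and> Dom C u = Dom C v \<and>
        Cod C u = Dom C f \<and> Cod C v = Dom C t \<and> Comp C f u = Comp C t v}))"

definition quot_cat :: "('o, 'm) cat \<Rightarrow> 'o set \<Rightarrow> ('o, ('o, 'm) qarr) cat" where
  "quot_cat C L = \<lparr>
     Ob = Ob C,
     Ar = {(X, Y, c). X \<in> Ob C \<and> Y \<in> Ob C \<and> c \<in> fractions C L X Y // fraction_rel C L X Y},
     Dom = (\<lambda>(X, Y, c). X),
     Cod = (\<lambda>(X, Y, c). Y),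
     Idn = (\<lambda>X. (X, X, fraction_rel C L X X `` {(Idn C X, Idn C X)})),
     Comp = quot_comp C L\<rparr>"

text \<open>
  The natural functor \<open>C/L \<rightarrow> C/L'\<close> for \<open>L \<subseteq> L'\<close>: the identity on objects and on fractions.  Each
  class for \<open>L\<close> is contained in one class for \<open>L'\<close>, so the union below is a single class.
\<close>

definition quot_functor ::
  "('o, 'm) cat \<Rightarrow> 'o set \<Rightarrow> ('o, ('o, 'm) qarr, 'o, ('o, 'm) qarr) ftr" where
  "quot_functor C L' = \<lparr>
     fob = (\<lambda>X. X),
     far = (\<lambda>(X, Y, c). (X, Y, fraction_rel C L' X Y `` c))\<rparr>"


section \<open>Recollement\<close>

type_synonym ('o0, 'o1, 'e) robj = "'o0 \<times> 'o1 \<times> 'e"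
type_synonym ('o0, 'm0, 'o1, 'm1, 'e) rarr =
  "('o0, 'o1, 'e) robj \<times> ('o0, 'o1, 'e) robj \<times> 'm0 \<times> 'm1"

text \<open>An arrow is a pair \<open>(f0, f1)\<close> tagged with its domain and codomain.\<close>

definition recollement ::
  "('o0, 'm0) cat \<Rightarrow> ('o1, 'm1) cat \<Rightarrow> ('q, 'e) cat \<Rightarrow>
   ('o0, 'm0, 'q, 'e) ftr \<Rightarrow> ('o1, 'm1, 'q, 'e) ftr \<Rightarrow>
   (('o0, 'o1, 'e) robj, ('o0, 'm0, 'o1, 'm1, 'e) rarr) cat" where
  "recollement A0 A1 E F0 F1 =
     (let obs = {(X0, X1, \<sigma>). X0 \<in> Ob A0 \<and> X1 \<in> Ob A1 \<and>
                   \<sigma> \<in> Hom E (fob F0 X0) (fob F1 X1) \<and> is_iso E \<sigma>}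
      in \<lparr>
        Ob = obs,
        Ar = {((X0, X1, \<sigma>), (X0', X1', \<sigma>'), f0, f1) | X0 X1 \<sigma> X0' X1' \<sigma>' f0 f1.
                (X0, X1, \<sigma>) \<in> obs \<and> (X0', X1', \<sigma>') \<in> obs \<and>
                f0 \<in> Hom A0 X0 X0' \<and> f1 \<in> Hom A1 X1 X1' \<and>
                Comp E \<sigma>' (far F0 f0) = Comp E (far F1 f1) \<sigma>},
        Dom = (\<lambda>(\<Theta>, \<Theta>', f0, f1). \<Theta>),
        Cod = (\<lambda>(\<Theta>, \<Theta>', f0, f1). \<Theta>'),
        Idn = (\<lambda>(X0, X1, \<sigma>). ((X0, X1, \<sigma>), (X0, X1, \<sigma>), Idn A0 X0, Idn A1 X1)),
        Comp = (\<lambda>(\<Theta>', \<Theta>'', g0, g1) (\<Theta>, _, f0, f1). (\<Theta>, \<Theta>'', Comp A0 g0 f0, Comp A1 g1 f1))\<rparr>)"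

text \<open>The functor \<open>X \<mapsto> (Q0 X, Q1 X, id)\<close>, for \<open>F0 \<odot> Q0\<close> and \<open>F1 \<odot> Q1\<close> equal on \<open>B\<close>.\<close>

definition restriction_functor ::
  "('o, 'm) cat \<Rightarrow> ('q, 'e) cat \<Rightarrow>
   ('o, 'm, 'o0, 'm0) ftr \<Rightarrow> ('o, 'm, 'o1, 'm1) ftr \<Rightarrow> ('o0, 'm0, 'q, 'e) ftr \<Rightarrow>
   ('o, 'm, ('o0, 'o1, 'e) robj, ('o0, 'm0, 'o1, 'm1, 'e) rarr) ftr" where
  "restriction_functor B E Q0 Q1 F0 =
     (let r = (\<lambda>X. (fob Q0 X, fob Q1 X, Idn E (fob F0 (fob Q0 X))))
      in \<lparr>fob = r, far = (\<lambda>f. (r (Dom B f), r (Cod B f), far Q0 f, far Q1 f))\<rparr>)"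

text \<open>
  The cospan \<open>U0 X0 \<rightarrow> U1 H1 F1 X1 \<leftarrow> U1 X1\<close> attached to \<open>(X0, X1, \<sigma>)\<close>; its first leg is
  \<open>\<iota> \<circ> U0 H0 \<sigma> \<circ> U0 \<eta>0\<close> and its second leg is \<open>U1 \<eta>1\<close>.
\<close>

definition glue_leg0 ::
  "('o, 'm) cat \<Rightarrow> ('o0, 'm0, 'o, 'm) ftr \<Rightarrow> ('q, 'e, 'o0, 'm0) ftr \<Rightarrow> ('o1, 'm1, 'q, 'e) ftr \<Rightarrow>
   ('o0 \<Rightarrow> 'm0) \<Rightarrow> ('q \<Rightarrow> 'm) \<Rightarrow> ('o0, 'o1, 'e) robj \<Rightarrow> 'm" where
  "glue_leg0 B U0 H0 F1 \<eta>0 \<iota> = (\<lambda>(X0, X1, \<sigma>).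
     Comp B (\<iota> (fob F1 X1)) (Comp B (far U0 (far H0 \<sigma>)) (far U0 (\<eta>0 X0))))"

definition glue_leg1 ::
  "('o1, 'm1, 'o, 'm) ftr \<Rightarrow> ('o1 \<Rightarrow> 'm1) \<Rightarrow> ('o0, 'o1, 'e) robj \<Rightarrow> 'm" where
  "glue_leg1 U1 \<eta>1 = (\<lambda>(X0, X1, \<sigma>). far U1 (\<eta>1 X1))"

text \<open>
  The functor given on objects by a choice of fiber products with projections \<open>\<pi>0\<close>, \<open>\<pi>1\<close>, and on an
  arrow \<open>(f0, f1)\<close> by the arrow that \<open>U0 f0\<close> and \<open>U1 f1\<close> induce between fiber products.
\<close>

definition glue_functor ::
  "('o, 'm) cat \<Rightarrow> ('o0, 'm0, 'o, 'm) ftr \<Rightarrow> ('o1, 'm1, 'o, 'm) ftr \<Rightarrow>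
   (('o0, 'o1, 'e) robj \<Rightarrow> 'm) \<Rightarrow> (('o0, 'o1, 'e) robj \<Rightarrow> 'm) \<Rightarrow>
   (('o0, 'o1, 'e) robj, ('o0, 'm0, 'o1, 'm1, 'e) rarr, 'o, 'm) ftr" where
  "glue_functor B U0 U1 \<pi>0 \<pi>1 = \<lparr>
     fob = (\<lambda>\<Theta>. Dom B (\<pi>0 \<Theta>)),
     far = (\<lambda>(\<Theta>, \<Theta>', f0, f1). THE h. h \<in> Hom B (Dom B (\<pi>0 \<Theta>)) (Dom B (\<pi>0 \<Theta>')) \<and>
        Comp B (\<pi>0 \<Theta>') h = Comp B (far U0 f0) (\<pi>0 \<Theta>) \<and>
        Comp B (\<pi>1 \<Theta>') h = Comp B (far U1 f1) (\<pi>1 \<Theta>))\<rparr>"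

text \<open>The arrow \<open>(\<gamma>0 \<circ> Q0 \<pi>0, \<gamma>1 \<circ> Q1 \<pi>1) : R V \<Theta> \<rightarrow> \<Theta>\<close>, for \<open>RV = R \<odot> V\<close>.\<close>

definition glue_counit ::
  "('o0, 'm0) cat \<Rightarrow> ('o1, 'm1) cat \<Rightarrow> ('o, 'm, 'o0, 'm0) ftr \<Rightarrow> ('o, 'm, 'o1, 'm1) ftr \<Rightarrow>
   ('o0 \<Rightarrow> 'm0) \<Rightarrow> ('o1 \<Rightarrow> 'm1) \<Rightarrow>
   (('o0, 'o1, 'e) robj \<Rightarrow> 'm) \<Rightarrow> (('o0, 'o1, 'e) robj \<Rightarrow> 'm) \<Rightarrow>
   (('o0, 'o1, 'e) robj, ('o0, 'm0, 'o1, 'm1, 'e) rarr,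
    ('o0, 'o1, 'e) robj, ('o0, 'm0, 'o1, 'm1, 'e) rarr) ftr \<Rightarrow>
   ('o0, 'o1, 'e) robj \<Rightarrow> ('o0, 'm0, 'o1, 'm1, 'e) rarr" where
  "glue_counit A0 A1 Q0 Q1 \<gamma>0 \<gamma>1 \<pi>0 \<pi>1 RV = (\<lambda>(X0, X1, \<sigma>).
     (fob RV (X0, X1, \<sigma>), (X0, X1, \<sigma>),
      Comp A0 (\<gamma>0 X0) (far Q0 (\<pi>0 (X0, X1, \<sigma>))),
      Comp A1 (\<gamma>1 X1) (far Q1 (\<pi>1 (X0, X1, \<sigma>)))))"

end

theory Submission
  imports Defs
begin

text \<open>
  The idea is to avoid section functors: \<open>R\<close> is shown to be full, faithful and surjective up to
  isomorphism by computing with fractions, and the assertion on \<open>RV\<close> then is formal, because the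
  pullback property of \<open>V \<Theta>\<close> makes \<open>R V \<Theta> \<rightarrow> \<Theta>\<close> universal among arrows from objects \<open>R Y\<close> to \<open>\<Theta>\<close>.

  Stability enters through two facts.  If \<open>L\<close> is stable and \<open>K \<subseteq> X\<close> lies in \<open>L\<close>, take \<open>M \<subseteq> X\<close>
  maximal with \<open>M \<inter> K = 0\<close>; then \<open>X/M\<close> is an essential extension of \<open>K\<close>, hence lies in \<open>L\<close>.  So
  the arrows in a fraction, if inverted, may be taken to be monic.  Secondly, every object of
  \<open>L0 \<or> L1\<close> is an extension of an object of \<open>L1\<close> by one of \<open>L0\<close>, and also the other way round.
  Hence a mono inverted for \<open>L0 \<or> L1\<close> is a mono inverted for \<open>L0\<close> after one inverted for \<open>L1\<close>, in
  either order.  Fullness and surjectivity of \<open>R\<close> follow by splitting monos in this way and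
  forming pushouts, which again are inverted for \<open>L0\<close> or \<open>L1\<close>.
\<close>

text \<open>The quotient by the intersection behaves like a space covered by two open sets, with the
  quotient by the join as their overlap. Uniqueness of glueing is formal: an arrow inverted for both
  \<open>L0\<close> and \<open>L1\<close> is inverted for \<open>L0 \<inter> L1\<close>. Existence
  is the obstacle, because data on the two pieces agree only after inverting arrows for the join,
  and such arrows must be separated into an \<open>L0\<close>-part and an \<open>L1\<close>-part.
  For a mono, being inverted is a condition on the cokernel alone, and a two-step filtration of the
  cokernel becomes a factorization of the mono by taking preimages; a kernel would spoil this. Both
  orders of filtration occur, since the pushout that glues has one leg of each kind. The Zorn
  argument for maximal subobjects is where exactness of filtered colimits enters; smallness of the
  set of subobjects comes from the generator. Stability is not self-dual, whereas abelian categories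
  and Serre subcategories are, so facts on epis, cokernels and pushouts are obtained by passing to
  \<open>opc C\<close>.\<close>

declare Hom_def [simp]

section \<open>Opposite categories\<close>

definition opc :: "('o, 'm) cat \<Rightarrow> ('o, 'm) cat" where
  "opc C = \<lparr>Ob = Ob C, Ar = Ar C, Dom = Cod C, Cod = Dom C, Idn = Idn C,
     Comp = (\<lambda>g f. Comp C f g)\<rparr>"

lemma opc_simps [simp]:
  "Ob (opc C) = Ob C" "Ar (opc C) = Ar C" "Dom (opc C) = Cod C" "Cod (opc C) = Dom C"
  "Idn (opc C) = Idn C" "Comp (opc C) g f = Comp C f g"
  by (simp_all add: opc_def)

lemma opc_opc [simp]: "opc (opc C) = C"
  by (simp add: opc_def)

lemma is_category_opc: "is_category C \<Longrightarrow> is_category (opc C)"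
  unfolding is_category_def by auto

lemma zero_object_opc [simp]: "zero_object (opc C) Z \<longleftrightarrow> zero_object C Z"
  unfolding zero_object_def by (auto simp: conj_commute)

lemma zero_arrow_opc [simp]: "zero_arrow (opc C) f \<longleftrightarrow> zero_arrow C f"
  unfolding zero_arrow_def zero_object_opc by (simp add: conj_commute) blast

lemma is_mono_opc [simp]: "is_mono (opc C) f \<longleftrightarrow> is_epi C f"
  unfolding is_mono_def is_epi_def by simp

lemma is_epi_opc [simp]: "is_epi (opc C) f \<longleftrightarrow> is_mono C f"
  unfolding is_mono_def is_epi_def by simp

lemma is_kernel_opc [simp]: "is_kernel (opc C) f k \<longleftrightarrow> is_cokernel C f k"
  unfolding is_kernel_def is_cokernel_def by (simp add: conj_ac)

lemma is_cokernel_opc [simp]: "is_cokernel (opc C) f k \<longleftrightarrow> is_kernel C f k"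
  unfolding is_kernel_def is_cokernel_def by (simp add: conj_ac)

lemma short_exact_opc [simp]: "short_exact (opc C) f g \<longleftrightarrow> short_exact C g f"
  unfolding short_exact_def by auto

section \<open>Categories\<close>

locale category =
  fixes C :: "('o, 'm) cat"
  assumes cat: "is_category C"
begin

abbreviation cmp (infixr "\<cdot>" 70) where "g \<cdot> f \<equiv> Comp C g f"

lemma Dom_Cod_Ob [simp]: "f \<in> Ar C \<Longrightarrow> Dom C f \<in> Ob C" "f \<in> Ar C \<Longrightarrow> Cod C f \<in> Ob C"
  using cat unfolding is_category_def by auto

lemma Idn_simps [simp]:
  "X \<in> Ob C \<Longrightarrow> Idn C X \<in> Ar C" "X \<in> Ob C \<Longrightarrow> Dom C (Idn C X) = X"
  "X \<in> Ob C \<Longrightarrow> Cod C (Idn C X) = X"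
  using cat unfolding is_category_def by auto

lemma cmp_simps [simp]:
  assumes "f \<in> Ar C" "g \<in> Ar C" "Cod C f = Dom C g"
  shows "g \<cdot> f \<in> Ar C" "Dom C (g \<cdot> f) = Dom C f" "Cod C (g \<cdot> f) = Cod C g"
  using cat assms unfolding is_category_def by auto

lemma cmp_Idn [simp]:
  "f \<in> Ar C \<Longrightarrow> Dom C f = X \<Longrightarrow> f \<cdot> Idn C X = f"
  "f \<in> Ar C \<Longrightarrow> Cod C f = X \<Longrightarrow> Idn C X \<cdot> f = f"
  using cat unfolding is_category_def by auto

lemma assoc [simp]:
  "f \<in> Ar C \<Longrightarrow> g \<in> Ar C \<Longrightarrow> h \<in> Ar C \<Longrightarrow> Cod C f = Dom C g \<Longrightarrow> Cod C g = Dom C h \<Longrightarrow>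
    (h \<cdot> g) \<cdot> f = h \<cdot> g \<cdot> f"
  using cat unfolding is_category_def by auto

text \<open>Composites are kept in right-associated normal form, where an equation between two-fold
  composites no longer matches once a further factor \<open>e\<close> follows. This restores it in
  that form.\<close>

lemma cmp_eq_left:
  assumes "a \<cdot> b = c \<cdot> d" "e \<in> Ar C" "b \<in> Ar C" "a \<in> Ar C" "c \<in> Ar C" "d \<in> Ar C"
    "Cod C e = Dom C b" "Cod C b = Dom C a" "Cod C d = Dom C c" "Cod C e = Dom C d"
  shows "a \<cdot> b \<cdot> e = c \<cdot> d \<cdot> e"
  using assms assoc by metis

lemma cmp_eq_left1:
  assumes "a \<cdot> b = c" "e \<in> Ar C" "b \<in> Ar C" "a \<in> Ar C"
    "Cod C e = Dom C b" "Cod C b = Dom C a"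
  shows "a \<cdot> b \<cdot> e = c \<cdot> e"
  using assms assoc by metis

lemma monoD:
  assumes "is_mono C f" "f \<cdot> g = f \<cdot> h" "g \<in> Ar C" "h \<in> Ar C" "Dom C g = Dom C h"
    "Cod C g = Dom C f" "Cod C h = Dom C f"
  shows "g = h"
  using assms unfolding is_mono_def by blast

lemma mono_Ar [simp]: "is_mono C f \<Longrightarrow> f \<in> Ar C"
  unfolding is_mono_def by blast

lemma epi_Ar [simp]: "is_epi C f \<Longrightarrow> f \<in> Ar C"
  unfolding is_epi_def by blast

lemma mono_cmp:
  assumes "is_mono C f" "is_mono C g" "Cod C f = Dom C g"
  shows "is_mono C (g \<cdot> f)"
  unfolding is_mono_def
proof (intro conjI ballI impI)
  show "g \<cdot> f \<in> Ar C" using assms by simp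
  fix a b assume ab: "a \<in> Ar C" "b \<in> Ar C" "Dom C a = Dom C b" "Cod C a = Dom C (g \<cdot> f)"
    "Cod C b = Dom C (g \<cdot> f)" and eq: "(g \<cdot> f) \<cdot> a = (g \<cdot> f) \<cdot> b"
  have "g \<cdot> (f \<cdot> a) = g \<cdot> (f \<cdot> b)" using ab eq assms by simp
  then have "f \<cdot> a = f \<cdot> b"
    by (rule monoD[OF assms(2)]) (use ab assms in simp_all)
  then show "a = b" by (rule monoD[OF assms(1)]) (use ab assms in simp_all)
qed

lemma mono_of_cmp:
  assumes "is_mono C (g \<cdot> f)" "f \<in> Ar C" "g \<in> Ar C" "Cod C f = Dom C g"
  shows "is_mono C f"
  unfolding is_mono_def
proof (intro conjI ballI impI)
  show "f \<in> Ar C" by fact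
  fix a b assume ab: "a \<in> Ar C" "b \<in> Ar C" "Dom C a = Dom C b" "Cod C a = Dom C f"
    "Cod C b = Dom C f" and eq: "f \<cdot> a = f \<cdot> b"
  have "(g \<cdot> f) \<cdot> a = (g \<cdot> f) \<cdot> b" using ab eq assms by simp
  then show "a = b" by (rule monoD[OF assms(1)]) (use ab assms in simp_all)
qed

lemma mono_Idn: "X \<in> Ob C \<Longrightarrow> is_mono C (Idn C X)"
  unfolding is_mono_def by auto

lemma category_opc: "category (opc C)"
  by unfold_locales (rule is_category_opc[OF cat])

lemma epiD:
  assumes "is_epi C f" "g \<cdot> f = h \<cdot> f" "g \<in> Ar C" "h \<in> Ar C" "Cod C g = Cod C h"
    "Dom C g = Cod C f" "Dom C h = Cod C f"
  shows "g = h"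
  using assms unfolding is_epi_def by blast

lemma epi_cmp:
  assumes "is_epi C f" "is_epi C g" "Cod C f = Dom C g"
  shows "is_epi C (g \<cdot> f)"
  using category.mono_cmp[OF category_opc, of g f] assms by simp

lemma epi_of_cmp:
  assumes "is_epi C (g \<cdot> f)" "f \<in> Ar C" "g \<in> Ar C" "Cod C f = Dom C g"
  shows "is_epi C g"
  using category.mono_of_cmp[OF category_opc, of f g] assms by simp

lemma epi_Idn: "X \<in> Ob C \<Longrightarrow> is_epi C (Idn C X)"
  unfolding is_epi_def by auto

lemma pullbackD:
  assumes "is_pullback C f g p q"
  shows "f \<in> Ar C" "g \<in> Ar C" "Cod C f = Cod C g" "p \<in> Ar C" "q \<in> Ar C" "Dom C q = Dom C p"
    "Cod C p = Dom C f" "Cod C q = Dom C g" "f \<cdot> p = g \<cdot> q"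
  using assms unfolding is_pullback_def by auto

lemma pullback_lift:
  assumes "is_pullback C f g p q" "f \<cdot> h = g \<cdot> k" "h \<in> Ar C" "k \<in> Ar C" "Dom C h = Dom C k"
    "Cod C h = Dom C f" "Cod C k = Dom C g"
  obtains u where "u \<in> Ar C" "Dom C u = Dom C h" "Cod C u = Dom C p" "p \<cdot> u = h" "q \<cdot> u = k"
proof -
  have "\<exists>u. u \<in> Hom C (Dom C h) (Dom C p) \<and> p \<cdot> u = h \<and> q \<cdot> u = k"
    using assms unfolding is_pullback_def by blast
  then show thesis using that by auto
qed

lemma pullback_unique:
  assumes "is_pullback C f g p q" "u \<in> Ar C" "v \<in> Ar C" "Dom C u = Dom C v"
    "Cod C u = Dom C p" "Cod C v = Dom C p" "p \<cdot> u = p \<cdot> v" "q \<cdot> u = q \<cdot> v"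
  shows "u = v"
proof -
  note pb = pullbackD[OF assms(1)]
  have "\<exists>!w. w \<in> Hom C (Dom C (p \<cdot> u)) (Dom C p) \<and> p \<cdot> w = p \<cdot> u \<and> q \<cdot> w = q \<cdot> u"
  proof -
    have "f \<cdot> p \<cdot> u = g \<cdot> q \<cdot> u"
      by (rule cmp_eq_left) (use pb assms in simp_all)
    moreover have "p \<cdot> u \<in> Ar C" "q \<cdot> u \<in> Ar C" "Dom C (p \<cdot> u) = Dom C (q \<cdot> u)"
      "Cod C (p \<cdot> u) = Dom C f" "Cod C (q \<cdot> u) = Dom C g" using pb assms by simp_all
    ultimately show ?thesis using assms(1) unfolding is_pullback_def by blast
  qed
  moreover have "u \<in> Hom C (Dom C (p \<cdot> u)) (Dom C p)" "v \<in> Hom C (Dom C (p \<cdot> u)) (Dom C p)"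
    using pb assms by simp_all
  ultimately show ?thesis using assms(7,8) by metis
qed

lemma pullback_mono:
  assumes "is_pullback C f g p q" "is_mono C g"
  shows "is_mono C p"
  unfolding is_mono_def
proof (intro conjI ballI impI)
  note pb = pullbackD[OF assms(1)]
  show "p \<in> Ar C" using pb by simp
  fix a b assume ab: "a \<in> Ar C" "b \<in> Ar C" "Dom C a = Dom C b" "Cod C a = Dom C p"
    "Cod C b = Dom C p" and eq: "p \<cdot> a = p \<cdot> b"
  have "g \<cdot> q \<cdot> a = f \<cdot> p \<cdot> a" "g \<cdot> q \<cdot> b = f \<cdot> p \<cdot> b"
    by (rule cmp_eq_left; use pb ab in simp)+
  then have "g \<cdot> q \<cdot> a = g \<cdot> q \<cdot> b" using eq by simp
  then have "q \<cdot> a = q \<cdot> b" by (rule monoD[OF assms(2)]) (use pb ab in simp_all)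
  then show "a = b" using pullback_unique[OF assms(1)] ab eq by blast
qed

end

lemma (in category) pullback_sym: "is_pullback C f g p q \<Longrightarrow> is_pullback C g f q p"
proof -
  assume pb: "is_pullback C f g p q"
  note pd = pullbackD[OF pb]
  show ?thesis unfolding is_pullback_def
  proof (intro conjI ballI impI)
    fix h k assume hk: "h \<in> Ar C" "k \<in> Ar C" "Dom C h = Dom C k" "Cod C h = Dom C g"
      "Cod C k = Dom C f" "g \<cdot> h = f \<cdot> k"
    obtain u where u: "u \<in> Ar C" "Dom C u = Dom C k" "Cod C u = Dom C p" "p \<cdot> u = k" "q \<cdot> u = h"
      by (rule pullback_lift[OF pb hk(6)[symmetric]]) (use hk in simp_all)
    show "\<exists>!u. u \<in> Hom C (Dom C h) (Dom C q) \<and> q \<cdot> u = h \<and> p \<cdot> u = k"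
    proof (rule ex1I[of _ u])
      fix v assume v: "v \<in> Hom C (Dom C h) (Dom C q) \<and> q \<cdot> v = h \<and> p \<cdot> v = k"
      show "v = u" by (rule pullback_unique[OF pb]) (use u v hk(3) pd in auto)
    qed (use u hk(3) pd in auto)
  qed (use pd in auto)
qed

text \<open>The coprojections \<open>p\<close>, \<open>q\<close> of a pushout of \<open>f\<close> and \<open>g\<close>: \<open>p \<circ> f = q \<circ> g\<close>.\<close>

definition is_pushout :: "('o, 'm) cat \<Rightarrow> 'm \<Rightarrow> 'm \<Rightarrow> 'm \<Rightarrow> 'm \<Rightarrow> bool" where
  "is_pushout C f g p q \<longleftrightarrow> is_pullback (opc C) f g p q"

context category
begin

lemma pushoutD:
  assumes "is_pushout C f g p q"
  shows "f \<in> Ar C" "g \<in> Ar C" "Dom C f = Dom C g" "p \<in> Ar C" "q \<in> Ar C" "Cod C q = Cod C p"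
    "Dom C p = Cod C f" "Dom C q = Cod C g" "p \<cdot> f = q \<cdot> g"
  using category.pullbackD[OF category_opc assms[unfolded is_pushout_def]] by auto

lemma pushout_desc:
  assumes "is_pushout C f g p q" "h \<cdot> f = k \<cdot> g" "h \<in> Ar C" "k \<in> Ar C" "Cod C h = Cod C k"
    "Dom C h = Cod C f" "Dom C k = Cod C g"
  obtains u where "u \<in> Ar C" "Dom C u = Cod C p" "Cod C u = Cod C h" "u \<cdot> p = h" "u \<cdot> q = k"
  using category.pullback_lift[OF category_opc assms(1)[unfolded is_pushout_def], of h k] assms
  by auto

lemma pushout_epi:
  assumes "is_pushout C f g p q" "is_epi C g" shows "is_epi C p"
  using category.pullback_mono[OF category_opc assms(1)[unfolded is_pushout_def]] assms(2) by simp

lemma pushout_sym: "is_pushout C f g p q \<Longrightarrow> is_pushout C g f q p"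
  unfolding is_pushout_def by (rule category.pullback_sym[OF category_opc])

end

section \<open>Abelian categories\<close>

locale abelian_category = category C for C :: "('o, 'm) cat" +
  fixes add :: "'m \<Rightarrow> 'm \<Rightarrow> 'm" and z :: "'o \<Rightarrow> 'o \<Rightarrow> 'm"
  assumes abelian: "abelian C" and preadditive: "preadditive C add z"
begin

abbreviation zero where "zero f \<equiv> zero_arrow C f"

section \<open>Zero arrows\<close>

lemma zero_ob: obtains Z where "zero_object C Z"
  using abelian unfolding abelian_def by blast

lemma zero_ex:
  assumes "X \<in> Ob C" "Y \<in> Ob C"
  obtains f where "f \<in> Ar C" "Dom C f = X" "Cod C f = Y" "zero f"
proof -
  obtain Z where Z: "zero_object C Z" by (rule zero_ob)
  obtain a b where "a \<in> Hom C X Z" "b \<in> Hom C Z Y"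
    using Z assms unfolding zero_object_def by meson
  moreover have "zero (b \<cdot> a)"
    unfolding zero_arrow_def using Z calculation by auto
  ultimately show thesis using that[of "b \<cdot> a"] by simp
qed

text \<open>The definition of a zero arrow mentions some zero object; the comparison
  \<open>i\<close>, \<open>j\<close> of two zero objects lets it factor through a prescribed
  one.\<close>

lemma zeroE:
  assumes "zero f" "zero_object C Z"
  obtains a b where "a \<in> Hom C (Dom C f) Z" "b \<in> Hom C Z (Cod C f)" "f = b \<cdot> a"
proof -
  obtain Z' g h where Z': "zero_object C Z'" "g \<in> Hom C (Dom C f) Z'" "h \<in> Hom C Z' (Cod C f)"
    "f = h \<cdot> g" using assms unfolding zero_arrow_def by blast
  have "Z \<in> Ob C" "Z' \<in> Ob C" using assms Z' unfolding zero_object_def by auto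
  then obtain i j where ij: "i \<in> Hom C Z' Z" "j \<in> Hom C Z Z'"
    using assms unfolding zero_object_def by meson
  have "j \<cdot> i = Idn C Z'"
  proof -
    have "j \<cdot> i \<in> Hom C Z' Z'" "Idn C Z' \<in> Hom C Z' Z'" using ij \<open>Z' \<in> Ob C\<close> by auto
    then show ?thesis using Z'(1) \<open>Z' \<in> Ob C\<close> unfolding zero_object_def by blast
  qed
  then have "j \<cdot> i \<cdot> g = g"
    using cmp_eq_left1[of j i "Idn C Z'" g] ij Z'(2,3) \<open>Z' \<in> Ob C\<close> by simp
  then have "(h \<cdot> j) \<cdot> i \<cdot> g = h \<cdot> g" using ij Z'(2,3) by simp
  moreover have "i \<cdot> g \<in> Hom C (Dom C f) Z" "h \<cdot> j \<in> Hom C Z (Cod C f)" using ij Z'(2,3) by simp_all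
  ultimately show thesis using that[of "i \<cdot> g" "h \<cdot> j"] Z'(4) by metis
qed

lemma zero_unique:
  assumes "zero f" "zero g" "Dom C f = Dom C g" "Cod C f = Cod C g"
  shows "f = g"
proof -
  obtain Z where Z: "zero_object C Z" by (rule zero_ob)
  obtain a b where f: "a \<in> Hom C (Dom C f) Z" "b \<in> Hom C Z (Cod C f)" "f = b \<cdot> a"
    by (rule zeroE[OF assms(1) Z])
  obtain a' b' where g: "a' \<in> Hom C (Dom C g) Z" "b' \<in> Hom C Z (Cod C g)" "g = b' \<cdot> a'"
    by (rule zeroE[OF assms(2) Z])
  have "Dom C f \<in> Ob C" "Cod C f \<in> Ob C" using f(1,2) Dom_Cod_Ob[of a] Dom_Cod_Ob[of b] by auto
  moreover have "a' \<in> Hom C (Dom C f) Z" "b' \<in> Hom C Z (Cod C f)" using g(1,2) assms by simp_all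
  ultimately have "a = a'" "b = b'" using f(1,2) Z unfolding zero_object_def by blast+
  then show ?thesis using f(3) g(3) by metis
qed

lemma zero_cmp_left [simp]:
  assumes "zero f" "g \<in> Ar C" "Cod C f = Dom C g" shows "zero (g \<cdot> f)"
proof -
  obtain Z where Z: "zero_object C Z" by (rule zero_ob)
  obtain a b where f: "a \<in> Hom C (Dom C f) Z" "b \<in> Hom C Z (Cod C f)" "f = b \<cdot> a"
    by (rule zeroE[OF assms(1) Z])
  have fa: "f \<in> Ar C" by (subst f(3)) (use f(1,2) in simp)
  have "g \<cdot> f = (g \<cdot> b) \<cdot> a" by (subst f(3)) (use f(1,2) assms(2,3) in simp)
  moreover have "g \<cdot> b \<in> Hom C Z (Cod C g)" "Dom C (g \<cdot> f) = Dom C f" "Cod C (g \<cdot> f) = Cod C g"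
    using f(1,2) fa assms by auto
  ultimately show ?thesis using Z f(1) unfolding zero_arrow_def by metis
qed

lemma zero_cmp_right [simp]:
  assumes "zero f" "g \<in> Ar C" "Cod C g = Dom C f" shows "zero (f \<cdot> g)"
proof -
  obtain Z where Z: "zero_object C Z" by (rule zero_ob)
  obtain a b where f: "a \<in> Hom C (Dom C f) Z" "b \<in> Hom C Z (Cod C f)" "f = b \<cdot> a"
    by (rule zeroE[OF assms(1) Z])
  have fa: "f \<in> Ar C" by (subst f(3)) (use f(1,2) in simp)
  have "f \<cdot> g = b \<cdot> (a \<cdot> g)" by (subst f(3)) (use f(1,2) assms(2,3) in simp)
  moreover have "a \<cdot> g \<in> Hom C (Dom C g) Z" "Dom C (f \<cdot> g) = Dom C g" "Cod C (f \<cdot> g) = Cod C f"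
    using f(1,2) fa assms by auto
  ultimately show ?thesis using Z f(2) unfolding zero_arrow_def by metis
qed

lemma zero_Ar: "zero f \<Longrightarrow> f \<in> Ar C"
  unfolding zero_arrow_def by (metis (mono_tags, lifting) Hom_def cmp_simps(1) mem_Collect_eq)

lemma mono_zero:
  assumes "is_mono C m" "zero (m \<cdot> x)" "x \<in> Ar C" "Cod C x = Dom C m"
  shows "zero x"
proof -
  obtain y where y: "y \<in> Ar C" "Dom C y = Dom C x" "Cod C y = Cod C x" "zero y"
    using zero_ex[of "Dom C x" "Cod C x"] assms by auto
  have "m \<cdot> x = m \<cdot> y"
    by (rule zero_unique) (use assms y in simp_all)
  then have "x = y" by (rule monoD[OF assms(1)]) (use assms y in simp_all)
  then show ?thesis using y by simp
qed

section \<open>Addition and subtraction of arrows\<close>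

abbreviation homgrp where "homgrp X Y \<equiv> \<lparr>carrier = Hom C X Y, mult = add, one = z X Y\<rparr>"

definition sub :: "'m \<Rightarrow> 'm \<Rightarrow> 'm" where
  "sub f g = add f (m_inv (homgrp (Dom C f) (Cod C f)) g)"

lemma homgrp: "X \<in> Ob C \<Longrightarrow> Y \<in> Ob C \<Longrightarrow> comm_group (homgrp X Y)"
  using preadditive unfolding preadditive_def by blast

lemma add_distrib:
  assumes "f \<in> Ar C" "f' \<in> Ar C" "g \<in> Ar C" "g' \<in> Ar C" "Dom C f = Dom C f'" "Cod C f = Cod C f'"
    "Dom C g = Dom C g'" "Cod C g = Cod C g'" "Cod C f = Dom C g"
  shows "g \<cdot> add f f' = add (g \<cdot> f) (g \<cdot> f')" "add g g' \<cdot> f = add (g \<cdot> f) (g' \<cdot> f)"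
proof -
  have "f \<in> Hom C (Dom C f) (Cod C f)" "f' \<in> Hom C (Dom C f) (Cod C f)"
     "g \<in> Hom C (Cod C f) (Cod C g)" "g' \<in> Hom C (Cod C f) (Cod C g)" using assms by simp_all
  moreover have "Dom C f \<in> Ob C" "Cod C f \<in> Ob C" "Cod C g \<in> Ob C" using assms by simp_all
  ultimately show "g \<cdot> add f f' = add (g \<cdot> f) (g \<cdot> f')" "add g g' \<cdot> f = add (g \<cdot> f) (g' \<cdot> f)"
    using preadditive unfolding preadditive_def by blast+
qed

lemma add_simps [simp]:
  assumes "f \<in> Ar C" "g \<in> Ar C" "Dom C f = Dom C g" "Cod C f = Cod C g"
  shows "add f g \<in> Ar C" "Dom C (add f g) = Dom C g" "Cod C (add f g) = Cod C g"
proof -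
  interpret comm_group "homgrp (Dom C f) (Cod C f)" using homgrp assms by simp
  show "add f g \<in> Ar C" "Dom C (add f g) = Dom C g" "Cod C (add f g) = Cod C g"
    using m_closed[of f g] assms by auto
qed

text \<open>Links the categorical zero arrows with the neutral elements of the Hom groups. For a
  zero endomorphism \<open>o'\<close> of the domain, both \<open>f \<cdot> o'\<close> and
  \<open>f \<cdot> add o' o'\<close> are zero arrows, hence equal \<open>f\<close>; distributivity
  then gives \<open>add f f = f\<close>.\<close>

lemma zero_eq: "zero f \<Longrightarrow> f = z (Dom C f) (Cod C f)"
proof -
  assume f: "zero f"
  have obs: "Dom C f \<in> Ob C" "Cod C f \<in> Ob C" using zero_Ar[OF f] by auto
  interpret comm_group "homgrp (Dom C f) (Cod C f)" using homgrp obs by simp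
  obtain o' where o': "o' \<in> Ar C" "Dom C o' = Dom C f" "Cod C o' = Dom C f" "zero o'"
    using zero_ex obs by metis
  have "f \<cdot> o' = f" "f \<cdot> add o' o' = f"
    by (rule zero_unique; use f o' zero_Ar[OF f] in simp)
       (rule zero_unique, insert f o' zero_Ar[OF f], simp_all)
  moreover have "f \<cdot> add o' o' = add (f \<cdot> o') (f \<cdot> o')"
    by (rule add_distrib) (use o' zero_Ar[OF f] in simp_all)
  ultimately have "add f f = f" by simp
  then show ?thesis using r_cancel_one[of f f] zero_Ar[OF f] by simp
qed

lemma z_zero: "X \<in> Ob C \<Longrightarrow> Y \<in> Ob C \<Longrightarrow> zero (z X Y)"
  using zero_ex zero_eq by metis

lemma sub_simps [simp]:
  assumes "f \<in> Ar C" "g \<in> Ar C" "Dom C f = Dom C g" "Cod C f = Cod C g"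
  shows "sub f g \<in> Ar C" "Dom C (sub f g) = Dom C g" "Cod C (sub f g) = Cod C g"
proof -
  interpret comm_group "homgrp (Dom C f) (Cod C f)" using homgrp assms by simp
  have "m_inv (homgrp (Dom C f) (Cod C f)) g \<in> Hom C (Dom C f) (Cod C f)"
    using inv_closed[of g] assms by simp
  then show "sub f g \<in> Ar C" "Dom C (sub f g) = Dom C g" "Cod C (sub f g) = Cod C g"
    unfolding sub_def using assms by simp_all
qed

lemma add_sub:
  assumes "f \<in> Ar C" "g \<in> Ar C" "Dom C f = Dom C g" "Cod C f = Cod C g"
  shows "add (sub f g) g = f"
proof -
  interpret comm_group "homgrp (Dom C f) (Cod C f)" using homgrp assms by simp
  show ?thesis unfolding sub_def
    using m_assoc[of f "m_inv (homgrp (Dom C f) (Cod C f)) g" g] inv_closed[of g] l_inv[of g]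
      r_one[of f] assms by simp
qed

lemma sub_unique:
  assumes "f \<in> Ar C" "g \<in> Ar C" "h \<in> Ar C" "Dom C f = Dom C g" "Cod C f = Cod C g" 
    "Dom C h = Dom C g" "Cod C h = Cod C g" "add h g = f"
  shows "h = sub f g"
proof -
  interpret comm_group "homgrp (Dom C f) (Cod C f)" using homgrp assms by simp
  have "add h g = add (sub f g) g" using add_sub[of f g] assms by simp
  then show ?thesis using right_cancel[of g h "sub f g"] assms by simp
qed

lemma sub_zero_iff:
  assumes "f \<in> Ar C" "g \<in> Ar C" "Dom C f = Dom C g" "Cod C f = Cod C g"
  shows "zero (sub f g) \<longleftrightarrow> f = g"
proof -
  interpret comm_group "homgrp (Dom C f) (Cod C f)" using homgrp assms by simp
  have "add (z (Dom C f) (Cod C f)) g = g" using l_one[of g] assms by simp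
  moreover have "zero (z (Dom C f) (Cod C f))" using z_zero assms by simp
  moreover have "z (Dom C f) (Cod C f) \<in> Hom C (Dom C f) (Cod C f)" using one_closed by simp
  ultimately have z: "add (z (Dom C f) (Cod C f)) g = g" "zero (z (Dom C f) (Cod C f))"
    "z (Dom C f) (Cod C f) \<in> Hom C (Dom C f) (Cod C f)" by auto
  show ?thesis
  proof
    assume "zero (sub f g)"
    from zero_eq[OF this] have "sub f g = z (Dom C f) (Cod C f)" using assms by simp
    then show "f = g" using add_sub[OF assms] z(1) by simp
  next
    assume fg: "f = g"
    have "z (Dom C f) (Cod C f) = sub f g"
      by (rule sub_unique) (use z assms fg in auto)
    then show "zero (sub f g)" using z(2) by simp
  qed
qed

lemma sub_distrib:
  assumes "f \<in> Ar C" "g \<in> Ar C" "Dom C f = Dom C g" "Cod C f = Cod C g" "h \<in> Ar C"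
  shows "Cod C h = Dom C f \<Longrightarrow> sub f g \<cdot> h = sub (f \<cdot> h) (g \<cdot> h)"
    "Dom C h = Cod C f \<Longrightarrow> h \<cdot> sub f g = sub (h \<cdot> f) (h \<cdot> g)"
proof -
  assume [simp]: "Cod C h = Dom C f"
  have "add (sub f g \<cdot> h) (g \<cdot> h) = add (sub f g) g \<cdot> h"
    by (rule add_distrib(2)[of h h, symmetric]) (use assms in simp_all)
  then show "sub f g \<cdot> h = sub (f \<cdot> h) (g \<cdot> h)"
    using sub_unique[of "f \<cdot> h" "g \<cdot> h" "sub f g \<cdot> h"] add_sub[of f g] assms by simp
next
  assume [simp]: "Dom C h = Cod C f"
  have "add (h \<cdot> sub f g) (h \<cdot> g) = h \<cdot> add (sub f g) g"
    by (rule add_distrib(1)[of _ _ h h, symmetric]) (use assms in simp_all)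
  then show "h \<cdot> sub f g = sub (h \<cdot> f) (h \<cdot> g)"
    using sub_unique[of "h \<cdot> f" "h \<cdot> g" "h \<cdot> sub f g"] add_sub[of f g] assms by simp
qed

lemma sub_cmp_zero_iff:
  assumes "f \<in> Ar C" "g \<in> Ar C" "Dom C f = Dom C g" "Cod C f = Cod C g" "h \<in> Ar C" "Cod C h = Dom C f"
  shows "zero (sub f g \<cdot> h) \<longleftrightarrow> f \<cdot> h = g \<cdot> h"
proof -
  have "sub f g \<cdot> h = sub (f \<cdot> h) (g \<cdot> h)" using sub_distrib(1)[OF assms] .
  then show ?thesis using sub_zero_iff[of "f \<cdot> h" "g \<cdot> h"] assms by simp
qed

text \<open>Cancellation can be tested on zero arrows by applying the condition to a difference
  \<open>sub a b\<close>.\<close>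

lemma mono_iff:
  assumes "m \<in> Ar C"
  shows "is_mono C m \<longleftrightarrow> (\<forall>x\<in>Ar C. Cod C x = Dom C m \<longrightarrow> zero (m \<cdot> x) \<longrightarrow> zero x)"
proof
  assume "is_mono C m" then show "\<forall>x\<in>Ar C. Cod C x = Dom C m \<longrightarrow> zero (m \<cdot> x) \<longrightarrow> zero x"
    using mono_zero by blast
next
  assume *: "\<forall>x\<in>Ar C. Cod C x = Dom C m \<longrightarrow> zero (m \<cdot> x) \<longrightarrow> zero x"
  show "is_mono C m" unfolding is_mono_def
  proof (intro conjI ballI impI)
    show "m \<in> Ar C" by fact
    fix a b assume ab: "a \<in> Ar C" "b \<in> Ar C" "Dom C a = Dom C b" "Cod C a = Dom C m"
      "Cod C b = Dom C m" "m \<cdot> a = m \<cdot> b"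
    have "m \<cdot> sub a b = sub (m \<cdot> a) (m \<cdot> b)" by (rule sub_distrib) (use ab assms in simp_all)
    moreover have "zero (sub (m \<cdot> a) (m \<cdot> b))" using sub_zero_iff[of "m \<cdot> a" "m \<cdot> b"] ab assms by simp
    ultimately have "zero (sub a b)" using * ab by simp
    then show "a = b" using sub_zero_iff[of a b] ab by simp
  qed
qed

section \<open>Kernels and cokernels\<close>

lemma kernelD:
  assumes "is_kernel C f k"
  shows "f \<in> Ar C" "k \<in> Ar C" "Cod C k = Dom C f" "zero (f \<cdot> k)"
  using assms unfolding is_kernel_def by auto

lemma kernel_lift:
  assumes "is_kernel C f k" "zero (f \<cdot> g)" "g \<in> Ar C" "Cod C g = Dom C f"
  obtains u where "u \<in> Ar C" "Dom C u = Dom C g" "Cod C u = Dom C k" "k \<cdot> u = g"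
proof -
  have "\<exists>u. u \<in> Hom C (Dom C g) (Dom C k) \<and> k \<cdot> u = g"
    using assms unfolding is_kernel_def by blast
  then show thesis using that by auto
qed

lemma kernel_mono: "is_kernel C f k \<Longrightarrow> is_mono C k"
  unfolding is_mono_def
proof (intro conjI ballI impI)
  assume k: "is_kernel C f k"
  note kd = kernelD[OF k]
  show "k \<in> Ar C" using kd by simp
  fix a b assume ab: "a \<in> Ar C" "b \<in> Ar C" "Dom C a = Dom C b" "Cod C a = Dom C k"
      "Cod C b = Dom C k" "k \<cdot> a = k \<cdot> b"
  have "f \<cdot> k \<cdot> a = (f \<cdot> k) \<cdot> a" using kd ab by simp
  then have "zero (f \<cdot> k \<cdot> a)" using kd ab by (simp del: assoc)
  moreover have "k \<cdot> a \<in> Ar C" "Cod C (k \<cdot> a) = Dom C f" "Dom C (k \<cdot> a) = Dom C a"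
    using kd ab by simp_all
  ultimately have "\<exists>!u. u \<in> Hom C (Dom C a) (Dom C k) \<and> k \<cdot> u = k \<cdot> a"
    using k unfolding is_kernel_def by metis
  then show "a = b" using ab by auto
qed

lemma kernelI:
  assumes "is_mono C k" "f \<in> Ar C" "Cod C k = Dom C f" "zero (f \<cdot> k)"
    "\<And>g. g \<in> Ar C \<Longrightarrow> Cod C g = Dom C f \<Longrightarrow> zero (f \<cdot> g) \<Longrightarrow>
       \<exists>u\<in>Ar C. Dom C u = Dom C g \<and> Cod C u = Dom C k \<and> k \<cdot> u = g"
  shows "is_kernel C f k"
  unfolding is_kernel_def
proof (intro conjI ballI impI)
  fix g assume g: "g \<in> Ar C" "Cod C g = Dom C f" "zero (f \<cdot> g)"
  obtain u where u: "u\<in>Ar C" "Dom C u = Dom C g" "Cod C u = Dom C k" "k \<cdot> u = g"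
    using assms(5)[OF g] by blast
  show "\<exists>!u. u \<in> Hom C (Dom C g) (Dom C k) \<and> k \<cdot> u = g"
  proof (rule ex1I[of _ u])
    fix v assume "v \<in> Hom C (Dom C g) (Dom C k) \<and> k \<cdot> v = g"
    then show "v = u" using monoD[OF assms(1), of v u] u by simp
  qed (use u in simp)
qed (use assms in auto)

lemma kernel_ex: "f \<in> Ar C \<Longrightarrow> \<exists>k. is_kernel C f k"
  using abelian unfolding abelian_def by blast

lemma cokernel_ex: "f \<in> Ar C \<Longrightarrow> \<exists>k. is_cokernel C f k"
  using abelian unfolding abelian_def by blast

text \<open>\<open>abelian\<close> postulates products only; that they are also coproducts is what
  makes the notion self-dual. The coprojections are \<open>(id, 0)\<close> and
  \<open>(0, id)\<close>, and the identity \<open>add (i \<cdot> p) (j \<cdot> q) = Idn C P\<close>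
  determines every arrow out of \<open>P\<close> by its composites with \<open>i\<close> and
  \<open>j\<close>.\<close>

lemma biproduct:
  assumes "X \<in> Ob C" "Y \<in> Ob C"
  obtains p q i j P where "is_product C X Y p q" "is_product (opc C) X Y i j"
    "p \<in> Hom C P X" "q \<in> Hom C P Y" "i \<in> Hom C X P" "j \<in> Hom C Y P"
    "p \<cdot> i = Idn C X" "q \<cdot> j = Idn C Y" "zero (p \<cdot> j)" "zero (q \<cdot> i)"
proof -
  obtain p q where pq: "is_product C X Y p q" using abelian assms unfolding abelian_def by blast
  define P where "P = Dom C p"
  have p: "p \<in> Ar C" "Dom C p = P" "Cod C p = X" and q: "q \<in> Ar C" "Dom C q = P" "Cod C q = Y"
    using pq unfolding is_product_def P_def by auto
  obtain o1 where o1: "o1 \<in> Ar C" "Dom C o1 = X" "Cod C o1 = Y" "zero o1" using zero_ex assms by blast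
  obtain o2 where o2: "o2 \<in> Ar C" "Dom C o2 = Y" "Cod C o2 = X" "zero o2" using zero_ex assms by blast
  have lift: "\<exists>!u. u \<in> Hom C (Dom C f) P \<and> p \<cdot> u = f \<and> q \<cdot> u = g"
    if "f \<in> Ar C" "g \<in> Ar C" "Dom C f = Dom C g" "Cod C f = X" "Cod C g = Y" for f g
    using pq that unfolding is_product_def P_def by blast
  obtain i where i: "i \<in> Hom C X P" "p \<cdot> i = Idn C X" "q \<cdot> i = o1"
    using lift[of "Idn C X" o1] o1 assms by auto
  obtain j where j: "j \<in> Hom C Y P" "p \<cdot> j = o2" "q \<cdot> j = Idn C Y"
    using lift[of o2 "Idn C Y"] o2 assms by auto
  have o1': "o1 = z X Y" "o2 = z Y X" using zero_eq[of o1] zero_eq[of o2] o1 o2 by metis+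
  have oc: "a \<cdot> o1 = z X (Cod C a)" if "a \<in> Ar C" "Dom C a = Y" for a
    using zero_eq[OF zero_cmp_left[of o1 a]] that o1 by simp
  have oc2: "a \<cdot> o2 = z Y (Cod C a)" if "a \<in> Ar C" "Dom C a = X" for a
    using zero_eq[OF zero_cmp_left[of o2 a]] that o2 by simp
  have oc': "o1 \<cdot> a = z (Dom C a) Y" if "a \<in> Ar C" "Cod C a = X" for a
    using zero_eq[OF zero_cmp_right[of o1 a]] that o1 by simp
  have oc2': "o2 \<cdot> a = z (Dom C a) X" if "a \<in> Ar C" "Cod C a = Y" for a
    using zero_eq[OF zero_cmp_right[of o2 a]] that o2 by simp
  have addz: "add (z (Dom C a) (Cod C a)) a = a" "add a (z (Dom C a) (Cod C a)) = a" if "a \<in> Ar C" for a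
  proof -
    interpret comm_group "homgrp (Dom C a) (Cod C a)" using homgrp that by simp
    show "add (z (Dom C a) (Cod C a)) a = a" "add a (z (Dom C a) (Cod C a)) = a"
      using l_one[of a] r_one[of a] that by simp_all
  qed
  have P: "P \<in> Ob C" using p by auto
  have sumP: "add (i \<cdot> p) (j \<cdot> q) = Idn C P"
  proof -
    let ?s = "add (i \<cdot> p) (j \<cdot> q)"
    have s: "i \<cdot> p \<in> Ar C" "j \<cdot> q \<in> Ar C" "Dom C (i \<cdot> p) = P" "Dom C (j \<cdot> q) = P"
      "Cod C (i \<cdot> p) = P" "Cod C (j \<cdot> q) = P" using i(1) j(1) p q by simp_all
    have "p \<cdot> ?s = add (p \<cdot> i \<cdot> p) (p \<cdot> j \<cdot> q)"
      by (rule add_distrib(1)[of _ _ p p]) (use s p in simp_all)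
    also have "p \<cdot> i \<cdot> p = p" using cmp_eq_left1[OF i(2), of p] i(1) p by simp
    also have "p \<cdot> j \<cdot> q = z P X" using cmp_eq_left1[OF j(2), of q] j(1) p q oc2'[of q] by simp
    also have "add p (z P X) = p" using addz(2)[of p] p by simp
    finally have 1: "p \<cdot> ?s = p" .
    have "q \<cdot> ?s = add (q \<cdot> i \<cdot> p) (q \<cdot> j \<cdot> q)"
      by (rule add_distrib(1)[of _ _ q q]) (use s q in simp_all)
    also have "q \<cdot> j \<cdot> q = q" using cmp_eq_left1[OF j(3), of q] j(1) q by simp
    also have "q \<cdot> i \<cdot> p = z P Y" using cmp_eq_left1[OF i(3), of p] i(1) p q oc'[of p] by simp
    also have "add (z P Y) q = q" using addz(1)[of q] q by simp
    finally have 2: "q \<cdot> ?s = q" .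
    have "?s \<in> Hom C (Dom C p) P" "Idn C P \<in> Hom C (Dom C p) P" using s p P by simp_all
    moreover have "p \<cdot> Idn C P = p" "q \<cdot> Idn C P = q" using p q by simp_all
    ultimately show ?thesis using lift[of p q] 1 2 p q by metis
  qed
  have "is_product (opc C) X Y i j" unfolding is_product_def
  proof (intro conjI ballI impI)
    show "i \<in> Hom (opc C) (Dom (opc C) i) X" "j \<in> Hom (opc C) (Dom (opc C) i) Y" using i j by auto
    fix f g assume fg: "f \<in> Ar (opc C)" "g \<in> Ar (opc C)" "Dom (opc C) f = Dom (opc C) g"
      "Cod (opc C) f = X" "Cod (opc C) g = Y"
    let ?u = "add (f \<cdot> p) (g \<cdot> q)"
    have uu: "?u \<in> Hom C P (Cod C f)" using fg p q by simp
    have fp: "f \<cdot> p \<in> Ar C" "g \<cdot> q \<in> Ar C" "Dom C (f \<cdot> p) = P" "Dom C (g \<cdot> q) = P"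
      "Cod C (f \<cdot> p) = Cod C f" "Cod C (g \<cdot> q) = Cod C f" using fg p q by simp_all
    have "?u \<cdot> i = add ((f \<cdot> p) \<cdot> i) ((g \<cdot> q) \<cdot> i)"
      by (rule add_distrib(2)[of i i]) (use fp i(1) in simp_all)
    also have "(f \<cdot> p) \<cdot> i = f" using i fg p by simp
    also have "(g \<cdot> q) \<cdot> i = z X (Cod C f)" using i fg q oc[of g] by simp
    finally have ui: "?u \<cdot> i = f" using addz(2)[of f] fg by simp
    have "?u \<cdot> j = add ((f \<cdot> p) \<cdot> j) ((g \<cdot> q) \<cdot> j)"
      by (rule add_distrib(2)[of j j]) (use fp j(1) in simp_all)
    also have "(g \<cdot> q) \<cdot> j = g" using j fg q by simp
    also have "(f \<cdot> p) \<cdot> j = z Y (Cod C g)" using j fg p oc2[of f] by simp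
    finally have uj: "?u \<cdot> j = g" using addz(1)[of g] fg by simp
    have "v = ?u" if v: "v \<in> Hom C P (Cod C f)" "v \<cdot> i = f" "v \<cdot> j = g" for v
    proof -
      have "v = v \<cdot> add (i \<cdot> p) (j \<cdot> q)" using sumP v(1) by simp
      also have "\<dots> = add (v \<cdot> i \<cdot> p) (v \<cdot> j \<cdot> q)"
        by (rule add_distrib(1)[of _ _ v v]) (use i(1) j(1) p q v(1) in simp_all)
      also have "v \<cdot> i \<cdot> p = f \<cdot> p" using cmp_eq_left1[OF v(2), of p] v(1) i(1) p by simp
      also have "v \<cdot> j \<cdot> q = g \<cdot> q" using cmp_eq_left1[OF v(3), of q] v(1) j(1) q by simp
      finally show ?thesis .
    qed
    moreover have "Hom (opc C) (Dom (opc C) f) (Dom (opc C) i) = Hom C P (Cod C f)"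
      using i(1) by auto
    ultimately show "\<exists>!u. u \<in> Hom (opc C) (Dom (opc C) f) (Dom (opc C) i) \<and> Comp (opc C) i u = f \<and>
        Comp (opc C) j u = g"
      using uu ui uj unfolding opc_simps by metis
  qed
  moreover have "p \<in> Hom C P X" "q \<in> Hom C P Y" using p q by auto
  ultimately show thesis using that[of p q i j P] pq i j o1(4) o2(4) by metis
qed

lemma preadditive_opc: "preadditive (opc C) add (\<lambda>X Y. z Y X)"
  unfolding preadditive_def
proof (intro conjI ballI)
  show "is_category (opc C)" by (rule is_category_opc[OF cat])
  have hom: "Hom (opc C) X Y = Hom C Y X" for X Y by auto
  fix X Y assume "X \<in> Ob (opc C)" "Y \<in> Ob (opc C)"
  then show "comm_group \<lparr>carrier = Hom (opc C) X Y, mult = add, one = z Y X\<rparr>"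
    unfolding hom using homgrp by simp
  fix W f f' g g' 
  assume fg: "W \<in> Ob (opc C)" "f \<in> Hom (opc C) X Y" "f' \<in> Hom (opc C) X Y" "g \<in> Hom (opc C) Y W"
    "g' \<in> Hom (opc C) Y W"
  show "Comp (opc C) g (add f f') = add (Comp (opc C) g f) (Comp (opc C) g f')"
    "Comp (opc C) (add g g') f = add (Comp (opc C) g f) (Comp (opc C) g' f)"
    using add_distrib[of g g f f'] add_distrib[of g g' f f] fg by simp_all
qed

text \<open>The clauses on kernels and cokernels, and those on monos and epis, mirror each other.
  The clause on products has no such partner and is supplied by \<open>biproduct\<close>.\<close>

lemma abelian_opc: "abelian (opc C)"
  unfolding abelian_def
proof (intro conjI)
  show "\<exists>add z. preadditive (opc C) add z" using preadditive_opc by blast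
  show "\<forall>X\<in>Ob (opc C). \<forall>Y\<in>Ob (opc C). \<exists>p q. is_product (opc C) X Y p q"
    using biproduct by (metis opc_simps(1))
  show "\<forall>f\<in>Ar (opc C). (\<exists>k. is_kernel (opc C) f k) \<and> (\<exists>c. is_cokernel (opc C) f c)"
    using abelian unfolding abelian_def is_kernel_opc is_cokernel_opc opc_simps by blast
  show "\<forall>f. is_mono (opc C) f \<longrightarrow> (\<exists>g. is_kernel (opc C) g f)"
    "\<forall>f. is_epi (opc C) f \<longrightarrow> (\<exists>g. is_cokernel (opc C) g f)"
    "\<exists>Z. zero_object (opc C) Z"
    using abelian unfolding abelian_def is_kernel_opc is_cokernel_opc is_mono_opc is_epi_opc
      zero_object_opc by blast+
qed

lemma abelian_category_opc: "abelian_category (opc C) add (\<lambda>X Y. z Y X)"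
  by (intro abelian_category.intro category_opc abelian_category_axioms.intro abelian_opc preadditive_opc)

section \<open>Fiber products, exactness and images\<close>

lemma equalizer:
  assumes "f \<in> Ar C" "g \<in> Ar C" "Dom C f = Dom C g" "Cod C f = Cod C g"
  obtains e where "is_mono C e" "Cod C e = Dom C f" "f \<cdot> e = g \<cdot> e"
    "\<And>h. h \<in> Ar C \<Longrightarrow> Cod C h = Dom C f \<Longrightarrow> f \<cdot> h = g \<cdot> h \<Longrightarrow>
       \<exists>u\<in>Ar C. Dom C u = Dom C h \<and> Cod C u = Dom C e \<and> e \<cdot> u = h"
proof -
  obtain e where e: "is_kernel C (sub f g) e" using kernel_ex assms by fastforce
  have key: "zero (sub f g \<cdot> h) \<longleftrightarrow> f \<cdot> h = g \<cdot> h" if "h \<in> Ar C" "Cod C h = Dom C f" for h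
    using sub_distrib(1)[of f g h] sub_zero_iff[of "f \<cdot> h" "g \<cdot> h"] that assms by simp
  have "f \<cdot> e = g \<cdot> e" "Cod C e = Dom C f" using key[of e] kernelD[OF e] assms by auto
  moreover have "\<exists>u\<in>Ar C. Dom C u = Dom C h \<and> Cod C u = Dom C e \<and> e \<cdot> u = h"
    if "h \<in> Ar C" "Cod C h = Dom C f" "f \<cdot> h = g \<cdot> h" for h
  proof -
    have "zero (sub f g \<cdot> h)" using key that by simp
    from kernel_lift[OF e this] show ?thesis using that assms by auto
  qed
  ultimately show thesis using that kernel_mono[OF e] by blast
qed

lemma pullback_ex:
  assumes "f \<in> Ar C" "g \<in> Ar C" "Cod C f = Cod C g"
  shows "\<exists>p q. is_pullback C f g p q"
proof -
  have "Dom C f \<in> Ob C" "Dom C g \<in> Ob C" using assms by auto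
  then obtain p q where pq: "is_product C (Dom C f) (Dom C g) p q"
    using abelian unfolding abelian_def by blast
  have p: "p \<in> Ar C" "Cod C p = Dom C f" "q \<in> Ar C" "Dom C q = Dom C p" "Cod C q = Dom C g"
    using pq unfolding is_product_def by auto
  obtain e where e: "is_mono C e" "Cod C e = Dom C p" "(f \<cdot> p) \<cdot> e = (g \<cdot> q) \<cdot> e"
    "\<And>h. h \<in> Ar C \<Longrightarrow> Cod C h = Dom C p \<Longrightarrow> (f \<cdot> p) \<cdot> h = (g \<cdot> q) \<cdot> h \<Longrightarrow>
       \<exists>u\<in>Ar C. Dom C u = Dom C h \<and> Cod C u = Dom C e \<and> e \<cdot> u = h"
    using equalizer[of "f \<cdot> p" "g \<cdot> q"] assms p by auto
  have "is_pullback C f g (p \<cdot> e) (q \<cdot> e)" unfolding is_pullback_def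
  proof (intro conjI ballI impI)
    fix h k assume hk: "h \<in> Ar C" "k \<in> Ar C" "Dom C h = Dom C k" "Cod C h = Dom C f" "Cod C k = Dom C g"
      "f \<cdot> h = g \<cdot> k"
    have ex: "\<exists>!u. u \<in> Hom C (Dom C h) (Dom C p) \<and> p \<cdot> u = h \<and> q \<cdot> u = k"
      using pq hk unfolding is_product_def by blast
    then obtain u where u: "u \<in> Hom C (Dom C h) (Dom C p)" "p \<cdot> u = h" "q \<cdot> u = k" by blast
    then obtain v where v: "v \<in> Ar C" "Dom C v = Dom C h" "Cod C v = Dom C e" "e \<cdot> v = u"
      using e(4)[of u] p assms hk by auto
    show "\<exists>!u. u \<in> Hom C (Dom C h) (Dom C (p \<cdot> e)) \<and> (p \<cdot> e) \<cdot> u = h \<and> (q \<cdot> e) \<cdot> u = k"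
    proof (rule ex1I[of _ v])
      show "v \<in> Hom C (Dom C h) (Dom C (p \<cdot> e)) \<and> (p \<cdot> e) \<cdot> v = h \<and> (q \<cdot> e) \<cdot> v = k"
        using v u p e(1,2) by simp
      fix w assume w: "w \<in> Hom C (Dom C h) (Dom C (p \<cdot> e)) \<and> (p \<cdot> e) \<cdot> w = h \<and> (q \<cdot> e) \<cdot> w = k"
      then have "p \<cdot> e \<cdot> w = h" "q \<cdot> e \<cdot> w = k" "e \<cdot> w \<in> Hom C (Dom C h) (Dom C p)"
        using p e(1,2) by auto
      then have "e \<cdot> w = u" using ex u by blast
      then show "w = v" using monoD[OF e(1), of w v] v w p e(1,2) by simp
    qed
  qed (use e p assms in auto)
  then show ?thesis by blast
qed

lemma pushout_ex:
  assumes "f \<in> Ar C" "g \<in> Ar C" "Dom C f = Dom C g"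
  shows "\<exists>p q. is_pushout C f g p q"
  unfolding is_pushout_def
  using abelian_category.pullback_ex[OF abelian_category_opc] assms by simp

text \<open>\<open>m\<close> is a kernel of some \<open>g\<close>, and \<open>g\<close> factors
  through the cokernel \<open>c\<close>; so whatever \<open>c\<close> kills is killed by
  \<open>g\<close> and lifts along \<open>m\<close>.\<close>

lemma mono_is_kernel:
  assumes m: "is_mono C m" and c: "is_cokernel C m c"
  shows "is_kernel C c m"
proof -
  obtain g where g: "is_kernel C g m" using abelian m unfolding abelian_def by blast
  note gd = kernelD[OF g]
  have cd: "c \<in> Ar C" "Dom C c = Cod C m" "zero (c \<cdot> m)" using c unfolding is_cokernel_def by auto
  obtain u where u: "u \<in> Hom C (Cod C c) (Cod C g)" "u \<cdot> c = g"
    using c gd unfolding is_cokernel_def by metis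
  show ?thesis
  proof (rule kernelI[OF m])
    fix x assume x: "x \<in> Ar C" "Cod C x = Dom C c" "zero (c \<cdot> x)"
    have "u \<cdot> c \<cdot> x = g \<cdot> x" using cmp_eq_left1[OF u(2)] x u cd by simp
    then have "zero (g \<cdot> x)" using zero_cmp_left[OF x(3), of u] u cd x by simp
    then show "\<exists>u\<in>Ar C. Dom C u = Dom C x \<and> Cod C u = Dom C m \<and> m \<cdot> u = x"
      using kernel_lift[OF g, of x] x cd gd by (metis)
  qed (use cd in auto)
qed

lemma short_exact_of_mono: "is_mono C m \<Longrightarrow> is_cokernel C m c \<Longrightarrow> short_exact C m c"
  unfolding short_exact_def using mono_is_kernel by blast

lemma epi_is_cokernel: "is_epi C e \<Longrightarrow> is_kernel C e k \<Longrightarrow> is_cokernel C k e"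
  using abelian_category.mono_is_kernel[OF abelian_category_opc] by simp

lemma short_exact_of_epi: "is_epi C e \<Longrightarrow> is_kernel C e k \<Longrightarrow> short_exact C k e"
  unfolding short_exact_def using epi_is_cokernel by blast

lemma cokernelD:
  assumes "is_cokernel C f c"
  shows "f \<in> Ar C" "c \<in> Ar C" "Dom C c = Cod C f" "zero (c \<cdot> f)"
  using assms unfolding is_cokernel_def by auto

lemma cokernel_desc:
  assumes "is_cokernel C f k" "zero (g \<cdot> f)" "g \<in> Ar C" "Dom C g = Cod C f"
  obtains u where "u \<in> Ar C" "Cod C u = Cod C g" "Dom C u = Cod C k" "u \<cdot> k = g"
proof -
  have "\<exists>u. u \<in> Hom C (Cod C k) (Cod C g) \<and> u \<cdot> k = g"
    using assms unfolding is_cokernel_def by blast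
  then show thesis using that by auto
qed

lemma cokernel_epi: "is_cokernel C f c \<Longrightarrow> is_epi C c"
  using abelian_category.kernel_mono[OF abelian_category_opc] by simp

lemma epi_zero:
  assumes "is_epi C m" "zero (x \<cdot> m)" "x \<in> Ar C" "Dom C x = Cod C m"
  shows "zero x"
  using abelian_category.mono_zero[OF abelian_category_opc, of m x] assms by simp

lemma epi_iff:
  assumes "m \<in> Ar C"
  shows "is_epi C m \<longleftrightarrow> (\<forall>x\<in>Ar C. Dom C x = Cod C m \<longrightarrow> zero (x \<cdot> m) \<longrightarrow> zero x)"
  using abelian_category.mono_iff[OF abelian_category_opc, of m] assms by simp

text \<open>Unlike \<open>pullback_mono\<close>, this needs additivity. The fiber product is the
  kernel \<open>k\<close> of the difference \<open>d\<close> of \<open>g \<cdot> s\<close> and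
  \<open>f \<cdot> r\<close> on the product. Since \<open>d \<cdot> j = g\<close> is epic, so is
  \<open>d\<close>, which thus is a cokernel of \<open>k\<close>. If \<open>w \<cdot> p\<close> is
  zero, then \<open>w \<cdot> r = x \<cdot> d\<close> for some \<open>x\<close>; restricting to
  \<open>j\<close> shows that \<open>x \<cdot> g\<close> and hence \<open>x\<close> is zero, and
  restricting to \<open>i\<close> that \<open>w\<close> is zero.\<close>

lemma pullback_epi:
  assumes pb: "is_pullback C f g p q" and g: "is_epi C g"
  shows "is_epi C p"
proof -
  note pd = pullbackD[OF pb]
  obtain r s i j P where rs: "is_product C (Dom C f) (Dom C g) r s" 
    "r \<in> Hom C P (Dom C f)" "s \<in> Hom C P (Dom C g)" "i \<in> Hom C (Dom C f) P" "j \<in> Hom C (Dom C g) P"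
    "r \<cdot> i = Idn C (Dom C f)" "s \<cdot> j = Idn C (Dom C g)" "zero (r \<cdot> j)" "zero (s \<cdot> i)"
  proof -
    have "Dom C f \<in> Ob C" "Dom C g \<in> Ob C" using pd by auto
    then show thesis by (rule biproduct) (rule that)
  qed
  have lift: "\<exists>!u. u \<in> Hom C (Dom C a) P \<and> r \<cdot> u = a \<and> s \<cdot> u = b"
    if "a \<in> Ar C" "b \<in> Ar C" "Dom C a = Dom C b" "Cod C a = Dom C f" "Cod C b = Dom C g" for a b
    using rs(1,2) that unfolding is_product_def by auto
  define d where "d = sub (g \<cdot> s) (f \<cdot> r)"
  have d: "d \<in> Hom C P (Cod C g)" unfolding d_def using rs pd by auto
  have dz: "zero (d \<cdot> x) \<longleftrightarrow> g \<cdot> s \<cdot> x = f \<cdot> r \<cdot> x" if "x \<in> Ar C" "Cod C x = P" for x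
  proof -
    have "zero (d \<cdot> x) \<longleftrightarrow> (g \<cdot> s) \<cdot> x = (f \<cdot> r) \<cdot> x" unfolding d_def
      by (rule sub_cmp_zero_iff) (use that rs(2,3) pd in simp_all)
    then show ?thesis using that rs(2,3) pd by simp
  qed
  have dj: "d \<cdot> j = g"
  proof -
    have "d \<cdot> j = sub ((g \<cdot> s) \<cdot> j) ((f \<cdot> r) \<cdot> j)" unfolding d_def
      by (rule sub_distrib(1)) (use rs(2,3,5) pd in simp_all)
    also have "(g \<cdot> s) \<cdot> j = g" using rs(3,5,7) pd by simp
    also have "(f \<cdot> r) \<cdot> j = f \<cdot> r \<cdot> j" using rs(2,5) pd by simp
    also have "sub g (f \<cdot> r \<cdot> j) = g"
    proof -
      interpret comm_group "homgrp (Dom C g) (Cod C g)" using homgrp pd by simp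
      have "zero (f \<cdot> r \<cdot> j)" by (rule zero_cmp_left[OF rs(8)]) (use rs(2,5) pd in simp_all)
      from zero_eq[OF this] have eq: "add g (f \<cdot> r \<cdot> j) = g" using r_one[of g] rs(2,5) pd by simp
      have "g = sub g (f \<cdot> r \<cdot> j)" by (rule sub_unique) (use rs(2,5) pd eq in simp_all)
      then show ?thesis by simp
    qed
    finally show ?thesis .
  qed
  have "is_epi C (d \<cdot> j)" using dj g by simp
  then have depi: "is_epi C d" by (rule epi_of_cmp) (use d rs(5) in simp_all)
  obtain k where k: "k \<in> Hom C (Dom C p) P" "r \<cdot> k = p" "s \<cdot> k = q" using lift[of p q] pd by auto
  have ker: "is_kernel C d k"
  proof (rule kernelI)
    show "zero (d \<cdot> k)" using dz[of k] k pd(9) by simp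
    show "is_mono C k" unfolding is_mono_def
    proof (intro conjI ballI impI)
      fix a b assume ab: "a \<in> Ar C" "b \<in> Ar C" "Dom C a = Dom C b" "Cod C a = Dom C k"
        "Cod C b = Dom C k" "k \<cdot> a = k \<cdot> b"
      have "r \<cdot> k \<cdot> a = p \<cdot> a" "s \<cdot> k \<cdot> a = q \<cdot> a" "r \<cdot> k \<cdot> b = p \<cdot> b" "s \<cdot> k \<cdot> b = q \<cdot> b"
        by (rule cmp_eq_left1; use k rs(2,3) ab pd in simp)+
      then have "p \<cdot> a = p \<cdot> b" "q \<cdot> a = q \<cdot> b" using ab(6) by metis+
      then show "a = b" by (intro pullback_unique[OF pb ab(1,2)]) (use ab k in simp_all)
    qed (use k in simp)
    fix x assume x: "x \<in> Ar C" "Cod C x = Dom C d" "zero (d \<cdot> x)"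
    then have fx: "f \<cdot> r \<cdot> x = g \<cdot> s \<cdot> x" using dz[of x] d by simp
    obtain u where "u \<in> Ar C" "Dom C u = Dom C (r \<cdot> x)" "Cod C u = Dom C p" "p \<cdot> u = r \<cdot> x" "q \<cdot> u = s \<cdot> x"
      by (rule pullback_lift[OF pb fx]) (use x rs(2,3) d in simp_all)
    then have u: "u \<in> Ar C" "Dom C u = Dom C x" "Cod C u = Dom C p" "p \<cdot> u = r \<cdot> x" "q \<cdot> u = s \<cdot> x"
      using x rs(2) d by simp_all
    have "r \<cdot> k \<cdot> u = p \<cdot> u" "s \<cdot> k \<cdot> u = q \<cdot> u"
        by (rule cmp_eq_left1; use k rs(2,3) u pd in simp)+
    then have "r \<cdot> k \<cdot> u = r \<cdot> x" "s \<cdot> k \<cdot> u = s \<cdot> x" using u(4,5) by simp_all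
    moreover have "k \<cdot> u \<in> Hom C (Dom C (r \<cdot> x)) P" "x \<in> Hom C (Dom C (r \<cdot> x)) P"
      using u(1-3) k(1) rs(2) x d by simp_all
    moreover have "\<exists>!v. v \<in> Hom C (Dom C (r \<cdot> x)) P \<and> r \<cdot> v = r \<cdot> x \<and> s \<cdot> v = s \<cdot> x"
      by (rule lift) (use rs(2,3) x d in simp_all)
    ultimately have "k \<cdot> u = x" by blast
    then show "\<exists>u\<in>Ar C. Dom C u = Dom C x \<and> Cod C u = Dom C k \<and> k \<cdot> u = x" using u k by auto
  qed (use d k in auto)
  have cok: "is_cokernel C k d" using epi_is_cokernel[OF depi ker] .
  show ?thesis unfolding epi_iff[OF pd(4)]
  proof (intro ballI impI)
    fix w assume w: "w \<in> Ar C" "Dom C w = Cod C p" "zero (w \<cdot> p)"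
    have "zero ((w \<cdot> r) \<cdot> k)" using w rs(2) k pd by simp
    then obtain x where x: "x \<in> Ar C" "Dom C x = Cod C d" "Cod C x = Cod C w" "x \<cdot> d = w \<cdot> r"
      by (rule cokernel_desc[OF cok]) (use w rs(2) k pd d in simp_all)
    have "x \<cdot> g = x \<cdot> d \<cdot> j" using dj by simp
    also have "\<dots> = w \<cdot> r \<cdot> j" by (rule cmp_eq_left[OF x(4)]) (use x d rs(2,5) w pd in simp_all)
    finally have xg: "x \<cdot> g = w \<cdot> r \<cdot> j" .
    have "zero (w \<cdot> r \<cdot> j)" by (rule zero_cmp_left[OF rs(8)]) (use rs(2,5) w pd in simp_all)
    then have "zero x" using epi_zero[OF g, of x] xg x d by simp
    then have "zero (x \<cdot> d)" by (rule zero_cmp_right) (use x(1,2) d in simp_all)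
    then have "zero ((w \<cdot> r) \<cdot> i)" unfolding x(4) by (rule zero_cmp_right) (use w pd rs(2,4) in simp_all)
    then have "zero (w \<cdot> r \<cdot> i)" using w rs(2,4) pd by simp
    then show "zero w" unfolding rs(6) using w pd by simp
  qed
qed

lemma pushout_mono:
  assumes "is_pushout C f g p q" "is_mono C g"
  shows "is_mono C p"
  using abelian_category.pullback_epi[OF abelian_category_opc] assms unfolding is_pushout_def by simp

text \<open>Given \<open>m \<cdot> x\<close> zero, \<open>x\<close> is lifted along \<open>e\<close>
  after the epic base change \<open>p\<close>. The lift \<open>q\<close> lies in the kernel of
  \<open>f\<close>, which \<open>e\<close> kills, so \<open>x \<cdot> p\<close> and therefore
  \<open>x\<close> are zero.\<close>

lemma coimage_mono:
  assumes k: "is_kernel C f k" and e: "is_cokernel C k e" and m: "m \<in> Ar C" "Dom C m = Cod C e" "m \<cdot> e = f"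
  shows "is_mono C m"
  unfolding mono_iff[OF m(1)]
proof (intro ballI impI)
  note kd = kernelD[OF k] and ed = cokernelD[OF e]
  fix x assume x: "x \<in> Ar C" "Cod C x = Dom C m" "zero (m \<cdot> x)"
  obtain p q where pb: "is_pullback C x e p q" using pullback_ex[of x e] x ed m by auto
  note pd = pullbackD[OF pb]
  have "f \<cdot> q = m \<cdot> x \<cdot> p" using cmp_eq_left1[OF m(3), of q] m ed pd x by simp
  also have "\<dots> = (m \<cdot> x) \<cdot> p" using m x pd by simp
  finally have "zero (f \<cdot> q)" using x pd m by (simp del: assoc)
  then obtain y where y: "y \<in> Ar C" "Dom C y = Dom C q" "Cod C y = Dom C k" "k \<cdot> y = q"
    using kernel_lift[OF k, of q] pd kd ed by auto
  have "x \<cdot> p = e \<cdot> k \<cdot> y" using y pd by simp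
  also have "\<dots> = (e \<cdot> k) \<cdot> y" using y ed kd by simp
  finally have "x \<cdot> p = (e \<cdot> k) \<cdot> y" .
  moreover have "zero ((e \<cdot> k) \<cdot> y)" by (rule zero_cmp_right) (use ed kd y in simp_all)
  ultimately have "zero (x \<cdot> p)" by metis
  moreover have "is_epi C p" using pullback_epi[OF pb cokernel_epi[OF e]] .
  ultimately show "zero x" using epi_zero[of p x] x pd by simp
qed

lemma image_factorization:
  assumes f: "f \<in> Ar C"
  obtains m e where "is_mono C m" "is_epi C e" "Cod C e = Dom C m" "Dom C e = Dom C f" "Cod C m = Cod C f" "m \<cdot> e = f"
proof -
  obtain k where k: "is_kernel C f k" using kernel_ex[OF f] by blast
  note kd = kernelD[OF k]
  obtain e where e: "is_cokernel C k e" using cokernel_ex kd by blast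
  note ed = cokernelD[OF e]
  obtain m where m: "m \<in> Ar C" "Dom C m = Cod C e" "m \<cdot> e = f" "Cod C m = Cod C f"
    using cokernel_desc[OF e, of f] kd f by metis
  show thesis using that[of m e] coimage_mono[OF k e m(1-3)] cokernel_epi[OF e] m ed kd by simp
qed

end

section \<open>Serre subcategories\<close>

text \<open>The null arrows are those that vanish in \<open>C/L\<close>; \<open>lmonic\<close> and \<open>lepic\<close> arrows are those that
  become monic and epic there.  In these terms most closure properties of the inverted arrows are
  formal, and self-dual.\<close>

definition null :: "('o, 'm) cat \<Rightarrow> 'o set \<Rightarrow> 'm \<Rightarrow> bool" where
  "null C L f \<longleftrightarrow> (\<exists>x\<in>Ar C. \<exists>y\<in>Ar C. Cod C x = Dom C y \<and> Cod C x \<in> L \<and> f = Comp C y x)"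

definition lmonic :: "('o, 'm) cat \<Rightarrow> 'o set \<Rightarrow> 'm \<Rightarrow> bool" where
  "lmonic C L s \<longleftrightarrow> s \<in> Ar C \<and>
     (\<forall>a\<in>Ar C. Cod C a = Dom C s \<longrightarrow> null C L (Comp C s a) \<longrightarrow> null C L a)"

definition lepic :: "('o, 'm) cat \<Rightarrow> 'o set \<Rightarrow> 'm \<Rightarrow> bool" where
  "lepic C L s \<longleftrightarrow> s \<in> Ar C \<and>
     (\<forall>a\<in>Ar C. Dom C a = Cod C s \<longrightarrow> null C L (Comp C a s) \<longrightarrow> null C L a)"

lemma null_opc [simp]: "null (opc C) L f \<longleftrightarrow> null C L f"
  unfolding null_def by (simp, metis)

lemma lmonic_opc [simp]: "lmonic (opc C) L f \<longleftrightarrow> lepic C L f"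
  unfolding lmonic_def lepic_def by simp

lemma lepic_opc [simp]: "lepic (opc C) L f \<longleftrightarrow> lmonic C L f"
  unfolding lmonic_def lepic_def by simp

lemma quot_inverted_opc [simp]: "quot_inverted (opc C) L s \<longleftrightarrow> quot_inverted C L s"
  unfolding quot_inverted_def by auto

text \<open>Keeps the finite closure properties of a localizing subcategory, which are self-dual;
  closure under coproducts is not.\<close>

locale serre_subcategory = abelian_category C add z for C :: "('o, 'm) cat" and add z +
  fixes L :: "'o set"
  assumes L_Ob: "L \<subseteq> Ob C"
    and L_sub: "is_mono C f \<Longrightarrow> Cod C f \<in> L \<Longrightarrow> Dom C f \<in> L"
    and L_quot: "is_epi C f \<Longrightarrow> Dom C f \<in> L \<Longrightarrow> Cod C f \<in> L"
    and L_ext: "short_exact C f g \<Longrightarrow> Dom C f \<in> L \<Longrightarrow> Cod C g \<in> L \<Longrightarrow> Cod C f \<in> L"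
    and L_zero: "zero_object C Z \<Longrightarrow> Z \<in> L"
begin

abbreviation nul where "nul \<equiv> null C L"
abbreviation W where "W \<equiv> quot_inverted C L"

lemma serre_opc: "serre_subcategory (opc C) add (\<lambda>X Y. z Y X) L"
proof (intro serre_subcategory.intro abelian_category_opc serre_subcategory_axioms.intro)
  fix f g assume "short_exact (opc C) f g" "Dom (opc C) f \<in> L" "Cod (opc C) g \<in> L"
  moreover have "Cod C g = Dom C f" if "short_exact C g f" for f g
    using that unfolding short_exact_def is_kernel_def by simp
  ultimately show "Cod (opc C) f \<in> L" using L_ext[of g f] by simp
qed (use L_Ob L_sub L_quot L_zero in simp_all)

section \<open>Null arrows\<close>

lemma null_cmp_left:
  assumes "nul f" "g \<in> Ar C" "Cod C f = Dom C g" shows "nul (g \<cdot> f)"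
proof -
  obtain x y where xy: "x \<in> Ar C" "y \<in> Ar C" "Cod C x = Dom C y" "Cod C x \<in> L" "f = y \<cdot> x"
    using assms unfolding null_def by blast
  have "g \<cdot> f = (g \<cdot> y) \<cdot> x" "g \<cdot> y \<in> Ar C" "Dom C (g \<cdot> y) = Dom C y" using xy assms by simp_all
  then show ?thesis using xy unfolding null_def by metis
qed

lemma null_cmp_right:
  assumes "nul f" "g \<in> Ar C" "Cod C g = Dom C f" shows "nul (f \<cdot> g)"
proof -
  obtain x y where xy: "x \<in> Ar C" "y \<in> Ar C" "Cod C x = Dom C y" "Cod C x \<in> L" "f = y \<cdot> x"
    using assms unfolding null_def by blast
  have "f \<cdot> g = y \<cdot> (x \<cdot> g)" "x \<cdot> g \<in> Ar C" "Cod C (x \<cdot> g) = Cod C x" using xy assms by simp_all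
  then show ?thesis using xy unfolding null_def by metis
qed

lemma null_Dom:
  assumes "f \<in> Ar C" "Dom C f \<in> L" shows "nul f"
  unfolding null_def
  by (rule bexI[of _ "Idn C (Dom C f)"], rule bexI[of _ f]) (use assms in simp_all)

lemma null_Cod:
  assumes "f \<in> Ar C" "Cod C f \<in> L" shows "nul f"
  unfolding null_def
  by (rule bexI[of _ f], rule bexI[of _ "Idn C (Cod C f)"]) (use assms in simp_all)

lemma zero_null:
  assumes "zero f" shows "nul f"
proof -
  obtain Z where Z: "zero_object C Z" by (rule zero_ob)
  obtain a b where ab: "a \<in> Hom C (Dom C f) Z" "b \<in> Hom C Z (Cod C f)" "f = b \<cdot> a"
    by (rule zeroE[OF assms Z])
  show ?thesis unfolding null_def
    by (rule bexI[of _ a], rule bexI[of _ b]) (use ab L_zero[OF Z] in simp_all)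
qed

lemma null_mono:
  assumes "nul m" "is_mono C m" shows "Dom C m \<in> L"
proof -
  obtain x y where xy: "x \<in> Ar C" "y \<in> Ar C" "Cod C x = Dom C y" "Cod C x \<in> L" "m = y \<cdot> x"
    using assms unfolding null_def by blast
  then have "is_mono C x" using mono_of_cmp[of y x] assms by simp
  then show ?thesis using L_sub[of x] xy by simp
qed

lemma null_Idn: "X \<in> Ob C \<Longrightarrow> nul (Idn C X) \<longleftrightarrow> X \<in> L"
  using null_mono[of "Idn C X"] mono_Idn null_Cod[of "Idn C X"] by auto

section \<open>Arrows that become monic or epic in the quotient\<close>

lemma lmonicD:
  "lmonic C L s \<Longrightarrow> nul (s \<cdot> a) \<Longrightarrow> a \<in> Ar C \<Longrightarrow> Cod C a = Dom C s \<Longrightarrow> nul a"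
  unfolding lmonic_def by blast

lemma lmonic_Ar: "lmonic C L s \<Longrightarrow> s \<in> Ar C"
  unfolding lmonic_def by blast

lemma lepicD:
  "lepic C L s \<Longrightarrow> nul (a \<cdot> s) \<Longrightarrow> a \<in> Ar C \<Longrightarrow> Dom C a = Cod C s \<Longrightarrow> nul a"
  unfolding lepic_def by blast

lemma lepic_Ar: "lepic C L s \<Longrightarrow> s \<in> Ar C"
  unfolding lepic_def by blast

text \<open>If \<open>m \<cdot> a\<close> factors through an object of \<open>L\<close>, then
  \<open>a\<close> factors through the preimage of \<open>m\<close> in that object, a subobject of
  it.\<close>

lemma mono_lmonic:
  assumes "is_mono C m" shows "lmonic C L m"
  unfolding lmonic_def
proof (intro conjI ballI impI)
  show "m \<in> Ar C" using assms by simp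
  fix a assume a: "a \<in> Ar C" "Cod C a = Dom C m" "nul (m \<cdot> a)"
  obtain x y where xy: "x \<in> Ar C" "y \<in> Ar C" "Cod C x = Dom C y" "Cod C x \<in> L" "m \<cdot> a = y \<cdot> x"
    using a(3) unfolding null_def by blast
  have c: "Cod C y = Cod C m"
    using arg_cong[OF xy(5), of "Cod C"] xy(1-3) a assms by simp
  have d: "Dom C x = Dom C a"
    using arg_cong[OF xy(5), of "Dom C"] xy(1-3) a assms by simp
  obtain p q where pb: "is_pullback C y m p q" using pullback_ex[of y m] xy(2) c assms by auto
  note pd = pullbackD[OF pb]
  obtain u where u: "u \<in> Ar C" "Dom C u = Dom C x" "Cod C u = Dom C p" "p \<cdot> u = x" "q \<cdot> u = a"
    by (rule pullback_lift[OF pb xy(5)[symmetric]]) (use xy a d in simp_all)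
  have "Dom C p \<in> L" using L_sub[OF pullback_mono[OF pb assms]] xy pd by simp
  then have "nul u" using null_Cod u by simp
  then have "nul (q \<cdot> u)" by (rule null_cmp_left) (use u pd in simp_all)
  then show "nul a" using u by simp
qed

lemma epi_lepic: "is_epi C m \<Longrightarrow> lepic C L m"
  using serre_subcategory.mono_lmonic[OF serre_opc] by simp

text \<open>It is enough to treat the image \<open>m\<close> of \<open>a\<close>, as the epic part
  is \<open>lepic\<close>. The image of \<open>s \<cdot> m\<close> lies in \<open>L\<close> because
  \<open>s \<cdot> m\<close> is null, and the kernel of \<open>s \<cdot> m\<close> embeds in that of
  \<open>s\<close>; so \<open>Dom C m\<close> is an extension of objects of
  \<open>L\<close>.\<close>

lemma kernel_lmonic:
  assumes k: "is_kernel C s k" and kL: "Dom C k \<in> L"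
  shows "lmonic C L s"
  unfolding lmonic_def
proof (intro conjI ballI impI)
  note kd = kernelD[OF k]
  show "s \<in> Ar C" by fact
  fix a assume a: "a \<in> Ar C" "Cod C a = Dom C s" "nul (s \<cdot> a)"
  obtain m e where me: "is_mono C m" "is_epi C e" "Cod C e = Dom C m" "Dom C e = Dom C a"
    "Cod C m = Cod C a" "m \<cdot> e = a" by (rule image_factorization[OF a(1)])
  have "(s \<cdot> m) \<cdot> e = s \<cdot> a" using me a kd by auto
  then have "nul (s \<cdot> m)" using lepicD[OF epi_lepic[OF me(2)], of "s \<cdot> m"] a me kd by simp
  obtain n f where nf: "is_mono C n" "is_epi C f" "Cod C f = Dom C n" "Dom C f = Dom C (s \<cdot> m)"
    "Cod C n = Cod C (s \<cdot> m)" "n \<cdot> f = s \<cdot> m"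
    using image_factorization[of "s \<cdot> m"] me(1,5) a kd by auto
  have "nul f" using lmonicD[OF mono_lmonic[OF nf(1)], of f] nf \<open>nul (s \<cdot> m)\<close> by simp
  then have "nul (Idn C (Cod C f))"
    using lepicD[OF epi_lepic[OF nf(2)], of "Idn C (Cod C f)"] nf by simp
  then have fL: "Cod C f \<in> L" using null_Idn nf by simp
  obtain l where l: "is_kernel C f l" using kernel_ex[of f] epi_Ar[OF nf(2)] by blast
  note ld = kernelD[OF l]
  have lm: "Cod C l = Dom C m" using ld nf(4) me(1,5) a kd by simp
  have "n \<cdot> f \<cdot> l = s \<cdot> m \<cdot> l" by (rule cmp_eq_left[OF nf(6)]) (use ld lm me(1,5) nf(1-5) a kd in simp_all)
  then have "zero (s \<cdot> m \<cdot> l)" using zero_cmp_left[OF ld(4), of n] nf(1-3) ld by simp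
  then obtain t where "t \<in> Ar C" "Dom C t = Dom C (m \<cdot> l)" "Cod C t = Dom C k" "k \<cdot> t = m \<cdot> l"
    by (rule kernel_lift[OF k]) (use ld lm me(1,5) a in simp_all)
  moreover have "is_mono C (m \<cdot> l)" using mono_cmp[OF kernel_mono[OF l] me(1)] lm by simp
  ultimately have "is_mono C t" "Dom C t = Dom C l" "Cod C t \<in> L"
    using mono_of_cmp[of k t] kd kL lm ld me(1) by simp_all
  then have "Dom C l \<in> L" using L_sub[of t] by simp
  then have "Cod C l \<in> L" using L_ext[OF short_exact_of_epi[OF nf(2) l]] fL by simp
  then have "nul m" using null_Dom[of m] lm me(1) by simp
  then show "nul a" using null_cmp_right[of m e] me by simp
qed

lemma cokernel_lepic: "is_cokernel C s k \<Longrightarrow> Cod C k \<in> L \<Longrightarrow> lepic C L s"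
  using serre_subcategory.kernel_lmonic[OF serre_opc] by simp

lemma lmonic_kernel:
  assumes "lmonic C L s" "is_kernel C s k" shows "Dom C k \<in> L"
proof -
  note kd = kernelD[OF assms(2)]
  have "nul k" using lmonicD[OF assms(1) zero_null[OF kd(4)]] kd by simp
  then show ?thesis using null_mono kernel_mono assms(2) by blast
qed

lemma lepic_cokernel: "lepic C L s \<Longrightarrow> is_cokernel C s k \<Longrightarrow> Cod C k \<in> L"
  using serre_subcategory.lmonic_kernel[OF serre_opc] by simp

lemma W_iff: "W s \<longleftrightarrow> lmonic C L s \<and> lepic C L s"
proof
  assume "W s" then show "lmonic C L s \<and> lepic C L s"
    unfolding quot_inverted_def using kernel_lmonic cokernel_lepic by blast
next
  assume s: "lmonic C L s \<and> lepic C L s"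
  then have "s \<in> Ar C" using lmonic_Ar by blast
  then show "W s" unfolding quot_inverted_def
    using s kernel_ex[of s] cokernel_ex[of s] lmonic_kernel lepic_cokernel by meson
qed

lemma W_Ar: "W s \<Longrightarrow> s \<in> Ar C"
  unfolding quot_inverted_def by blast

section \<open>Composition, base change and cancellation\<close>

lemma lmonic_cmp:
  assumes "lmonic C L f" "lmonic C L g" "Cod C f = Dom C g" shows "lmonic C L (g \<cdot> f)"
  unfolding lmonic_def
proof (intro conjI ballI impI)
  note ar = lmonic_Ar[OF assms(1)] lmonic_Ar[OF assms(2)]
  show "g \<cdot> f \<in> Ar C" using ar assms by simp
  fix a assume a: "a \<in> Ar C" "Cod C a = Dom C (g \<cdot> f)" "nul ((g \<cdot> f) \<cdot> a)"
  have "nul (f \<cdot> a)" using lmonicD[OF assms(2), of "f \<cdot> a"] a ar assms by simp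
  then show "nul a" using lmonicD[OF assms(1), of a] a ar assms by simp
qed

lemma lepic_cmp:
  assumes "lepic C L f" "lepic C L g" "Cod C f = Dom C g" shows "lepic C L (g \<cdot> f)"
  using serre_subcategory.lmonic_cmp[OF serre_opc, of g f] assms by simp

lemma lmonic_of_cmp:
  assumes "lmonic C L (g \<cdot> f)" "f \<in> Ar C" "g \<in> Ar C" "Cod C f = Dom C g" shows "lmonic C L f"
  unfolding lmonic_def
proof (intro conjI ballI impI)
  fix a assume a: "a \<in> Ar C" "Cod C a = Dom C f" "nul (f \<cdot> a)"
  have "nul (g \<cdot> f \<cdot> a)" using null_cmp_left[OF a(3), of g] a assms(2-) by simp
  then show "nul a" using lmonicD[OF assms(1), of a] a assms(2-) by simp
qed fact

lemma lepic_of_cmp: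
  assumes "lepic C L (g \<cdot> f)" "f \<in> Ar C" "g \<in> Ar C" "Cod C f = Dom C g" shows "lepic C L g"
  using serre_subcategory.lmonic_of_cmp[OF serre_opc, of f g] assms by simp

text \<open>The projections remain jointly monic in the quotient. On the image \<open>m\<close> of
  \<open>b\<close>, the kernel \<open>k\<close> of \<open>p \<cdot> m\<close> is embedded by
  \<open>q \<cdot> m\<close>, which is null, so \<open>Dom C k\<close> lies in \<open>L\<close>.
  Hence \<open>p \<cdot> m\<close> is both \<open>lmonic\<close> and null, which forces
  \<open>Dom C m\<close> into \<open>L\<close>.\<close>

lemma null_pair:
  assumes pb: "is_pullback C f g p q" and b: "b \<in> Ar C" "Cod C b = Dom C p" "nul (p \<cdot> b)" "nul (q \<cdot> b)"
  shows "nul b"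
proof -
  note pd = pullbackD[OF pb]
  obtain m e where me: "is_mono C m" "is_epi C e" "Cod C e = Dom C m" "Dom C e = Dom C b"
    "Cod C m = Cod C b" "m \<cdot> e = b" by (rule image_factorization[OF b(1)])
  have "(p \<cdot> m) \<cdot> e = p \<cdot> b" "(q \<cdot> m) \<cdot> e = q \<cdot> b" using me b(1,2) pd by auto
  then have pm: "nul (p \<cdot> m)" and qm: "nul (q \<cdot> m)"
    using lepicD[OF epi_lepic[OF me(2)], of "p \<cdot> m"] lepicD[OF epi_lepic[OF me(2)], of "q \<cdot> m"] me b pd
    by simp_all
  obtain k where k: "is_kernel C (p \<cdot> m) k" using kernel_ex[of "p \<cdot> m"] me(1,5) b pd by auto
  note kd = kernelD[OF k]
  have ck: "Cod C k = Dom C m" using kd me(1,5) b pd by simp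
  have "is_mono C (q \<cdot> m \<cdot> k)" 
  proof (subst mono_iff)
    show "q \<cdot> m \<cdot> k \<in> Ar C" using kd(2) me(1,5) ck pd b by simp
    show "\<forall>x\<in>Ar C. Cod C x = Dom C (q \<cdot> m \<cdot> k) \<longrightarrow> zero ((q \<cdot> m \<cdot> k) \<cdot> x) \<longrightarrow> zero x"
    proof (intro ballI impI)
      fix x assume x: "x \<in> Ar C" "Cod C x = Dom C (q \<cdot> m \<cdot> k)" "zero ((q \<cdot> m \<cdot> k) \<cdot> x)"
      have cx: "Cod C x = Dom C k" using x kd(2) me(1,5) ck pd b by simp
      have z1: "zero (q \<cdot> (m \<cdot> k \<cdot> x))" using x(3) x(1) cx kd(2) me(1,5) ck pd b by simp
      have "zero ((p \<cdot> m) \<cdot> k)" using kd(4) .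
      then have "zero (((p \<cdot> m) \<cdot> k) \<cdot> x)" by (rule zero_cmp_right) (use x(1) cx kd me(1,5) ck pd b in simp_all)
      then have z2: "zero (p \<cdot> (m \<cdot> k \<cdot> x))" using x(1) cx kd(2) me(1,5) ck pd b by simp
      obtain o' where o': "o' \<in> Ar C" "Dom C o' = Dom C x" "Cod C o' = Dom C p" "zero o'"
        using zero_ex[of "Dom C x" "Dom C p"] x(1) pd by auto
      have "m \<cdot> k \<cdot> x = o'"
      proof (rule pullback_unique[OF pb])
        show "p \<cdot> m \<cdot> k \<cdot> x = p \<cdot> o'"
          by (rule zero_unique) (use z2 o' x(1) cx kd(2) me(1,5) ck pd b in simp_all)
        show "q \<cdot> m \<cdot> k \<cdot> x = q \<cdot> o'"
          by (rule zero_unique) (use z1 o' x(1) cx kd(2) me(1,5) ck pd b in simp_all)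
      qed (use o' x(1) cx kd(2) me(1,5) ck pd b in simp_all)
      then have "zero (m \<cdot> k \<cdot> x)" using o' by simp
      then have "zero (k \<cdot> x)" using mono_zero[OF me(1), of "k \<cdot> x"] x(1) cx kd(2) ck by simp
      then show "zero x" using mono_zero[OF kernel_mono[OF k], of x] x(1) cx by simp
    qed
  qed
  moreover have "nul (q \<cdot> m \<cdot> k)"
    using null_cmp_right[OF qm, of k] kd(2) ck me(1,5) pd b by simp
  ultimately have "Dom C k \<in> L" using null_mono[of "q \<cdot> m \<cdot> k"] kd(2) ck me(1,5) pd b by simp
  then have "lmonic C L (p \<cdot> m)" using kernel_lmonic[OF k] by simp
  then have "nul (Idn C (Dom C m))" using lmonicD[of "p \<cdot> m" "Idn C (Dom C m)"] pm me(1,5) pd b by simp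
  then have "Dom C m \<in> L" using null_Idn me(1) by simp
  then show "nul b" using null_cmp_right[OF null_Dom[of m], of e] me by simp
qed

lemma pullback_lmonic:
  assumes pb: "is_pullback C f g p q" and g: "lmonic C L g"
  shows "lmonic C L p"
  unfolding lmonic_def
proof (intro conjI ballI impI)
  note pd = pullbackD[OF pb]
  show "p \<in> Ar C" by fact
  fix b assume b: "b \<in> Ar C" "Cod C b = Dom C p" "nul (p \<cdot> b)"
  have "f \<cdot> p \<cdot> b = g \<cdot> q \<cdot> b" by (rule cmp_eq_left[OF pd(9)]) (use pd b in simp_all)
  then have "nul (g \<cdot> q \<cdot> b)" using null_cmp_left[OF b(3), of f] pd b by simp
  then have "nul (q \<cdot> b)" using lmonicD[OF g, of "q \<cdot> b"] pd b by simp
  then show "nul b" using null_pair[OF pb] b by simp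
qed

text \<open>The base change is done in two stages along \<open>g = m \<cdot> e\<close>. Pulling back
  the mono \<open>m\<close> gives the kernel of \<open>c \<cdot> f\<close>, whose cokernel embeds in
  \<open>Cod C c\<close> and so lies in \<open>L\<close>; pulling back the epi \<open>e\<close>
  gives an epi. The composite of the two factors through \<open>p\<close>.\<close>

lemma pullback_lepic:
  assumes pb: "is_pullback C f g p q" and g: "lepic C L g"
  shows "lepic C L p"
proof -
  note pd = pullbackD[OF pb]
  obtain m e where me: "is_mono C m" "is_epi C e" "Cod C e = Dom C m" "Dom C e = Dom C g"
    "Cod C m = Cod C g" "m \<cdot> e = g" by (rule image_factorization[OF pd(2)])
  have m: "lepic C L m" using lepic_of_cmp[of m e] g me by simp
  obtain c where c: "is_cokernel C m c" using cokernel_ex[of m] mono_Ar[OF me(1)] by blast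
  note cd = cokernelD[OF c]
  have cL: "Cod C c \<in> L" using lepic_cokernel[OF m c] .
  obtain p1 q1 where pb1: "is_pullback C f m p1 q1" using pullback_ex[of f m] pd me by auto
  note pd1 = pullbackD[OF pb1]
  have cf: "c \<cdot> f \<in> Ar C" "Dom C (c \<cdot> f) = Dom C f" "Cod C (c \<cdot> f) = Cod C c" using cd me(1,5) pd(1,3) by simp_all
  have ker: "is_kernel C (c \<cdot> f) p1"
  proof (rule kernelI)
    show "is_mono C p1" using pullback_mono[OF pb1 me(1)] .
    have "(c \<cdot> f) \<cdot> p1 = (c \<cdot> m) \<cdot> q1" using pd1 cd me(1,5) pd(1,3) by simp
    then show "zero ((c \<cdot> f) \<cdot> p1)" using zero_cmp_right[OF cd(4), of q1] pd1 cd me(1) by simp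
    fix y assume y: "y \<in> Ar C" "Cod C y = Dom C (c \<cdot> f)" "zero ((c \<cdot> f) \<cdot> y)"
    then have "zero (c \<cdot> (f \<cdot> y))" using cd me(1,5) pd(1,3) by simp
    then obtain w where w: "w \<in> Ar C" "Dom C w = Dom C (f \<cdot> y)" "Cod C w = Dom C m" "m \<cdot> w = f \<cdot> y"
      by (rule kernel_lift[OF mono_is_kernel[OF me(1) c]]) (use y cf cd pd(1,3) me(5) in simp_all)
    obtain u where "u \<in> Ar C" "Dom C u = Dom C y" "Cod C u = Dom C p1" "p1 \<cdot> u = y" "q1 \<cdot> u = w"
      by (rule pullback_lift[OF pb1 w(4)[symmetric]]) (use y w(1-3) cf pd(1) in simp_all)
    then show "\<exists>u\<in>Ar C. Dom C u = Dom C y \<and> Cod C u = Dom C p1 \<and> p1 \<cdot> u = y" by blast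
  qed (use pd1 cf in simp_all)
  obtain d where d: "is_cokernel C p1 d" using cokernel_ex pd1(4) by blast
  note dd = cokernelD[OF d]
  obtain n where n: "n \<in> Ar C" "Cod C n = Cod C (c \<cdot> f)" "Dom C n = Cod C d" "n \<cdot> d = c \<cdot> f"
    by (rule cokernel_desc[OF d kernelD(4)[OF ker] cf(1)]) (use pd1 cf in simp_all)
  have "is_mono C n" using coimage_mono[OF ker d n(1,3,4)] .
  then have "Cod C d \<in> L" using L_sub[of n] n cf cL by simp
  then have p1: "lepic C L p1" using cokernel_lepic[OF d] by simp
  obtain p2 q2 where pb2: "is_pullback C q1 e p2 q2" using pullback_ex[of q1 e] pd1 me by auto
  note pd2 = pullbackD[OF pb2]
  have p12: "lepic C L (p1 \<cdot> p2)"
    using lepic_cmp[OF epi_lepic[OF pullback_epi[OF pb2 me(2)]] p1] pd1 pd2 by simp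
  have "f \<cdot> p1 \<cdot> p2 = m \<cdot> q1 \<cdot> p2" by (rule cmp_eq_left[OF pd1(9)]) (use pd1(1-8) pd2(1-8) in simp_all)
  also have "\<dots> = m \<cdot> e \<cdot> q2" using pd2(9) by simp
  also have "\<dots> = g \<cdot> q2" by (rule cmp_eq_left1[OF me(6)]) (use me(1-5) pd2(1-8) in simp_all)
  finally have eq: "f \<cdot> p1 \<cdot> p2 = g \<cdot> q2" .
  obtain u where u: "u \<in> Ar C" "Dom C u = Dom C (p1 \<cdot> p2)" "Cod C u = Dom C p" "p \<cdot> u = p1 \<cdot> p2" "q \<cdot> u = q2"
    by (rule pullback_lift[OF pb eq]) (use pd1(1-8) pd2(1-8) me(4) in simp_all)
  then have "lepic C L (p \<cdot> u)" using p12 by simp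
  then show ?thesis by (rule lepic_of_cmp) (use u pd in simp_all)
qed

lemma W_pullback: "is_pullback C f g p q \<Longrightarrow> W g \<Longrightarrow> W p"
  using W_iff pullback_lmonic pullback_lepic by blast

lemma W_pushout: "is_pushout C f g p q \<Longrightarrow> W g \<Longrightarrow> W p"
  unfolding is_pushout_def using serre_subcategory.W_pullback[OF serre_opc] by simp

text \<open>Over the fiber product of \<open>a\<close> and \<open>f\<close>, the arrow
  \<open>g \<cdot> a\<close> turns into \<open>(g \<cdot> f) \<cdot> q\<close>; so \<open>q\<close>
  is null, hence \<open>a \<cdot> p\<close> is, and \<open>p\<close> is \<open>lepic\<close> as a
  base change of \<open>f\<close>.\<close>

lemma lmonic_cancel:
  assumes gf: "lmonic C L (g \<cdot> f)" and f: "lepic C L f" and g: "g \<in> Ar C" "Cod C f = Dom C g"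
  shows "lmonic C L g"
  unfolding lmonic_def
proof (intro conjI ballI impI)
  note fa = lepic_Ar[OF f]
  show "g \<in> Ar C" by fact
  fix a assume a: "a \<in> Ar C" "Cod C a = Dom C g" "nul (g \<cdot> a)"
  obtain p q where pb: "is_pullback C a f p q" using pullback_ex[of a f] a fa g by auto
  note pd = pullbackD[OF pb]
  have "(g \<cdot> f) \<cdot> q = (g \<cdot> a) \<cdot> p" using pd a g fa by simp
  moreover have "nul ((g \<cdot> a) \<cdot> p)" by (rule null_cmp_right[OF a(3)]) (use pd a g in simp_all)
  ultimately have "nul q" using lmonicD[OF gf, of q] pd fa g by simp
  then have "nul (a \<cdot> p)" using null_cmp_left[of q f] pd fa g by simp
  then show "nul a" using lepicD[OF pullback_lepic[OF pb f], of a] pd a by simp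
qed

lemma W_cmp: "W f \<Longrightarrow> W g \<Longrightarrow> Cod C f = Dom C g \<Longrightarrow> W (g \<cdot> f)"
  using W_iff lmonic_cmp lepic_cmp by blast

lemma W_cancel_right:
  assumes "W (g \<cdot> f)" "W f" "g \<in> Ar C" "Cod C f = Dom C g" shows "W g"
  using assms W_iff lmonic_cancel lepic_of_cmp W_Ar by metis

lemma W_cancel_left:
  assumes "W (g \<cdot> f)" "W g" "f \<in> Ar C" "Cod C f = Dom C g" shows "W f"
  using serre_subcategory.W_cancel_right[OF serre_opc, of f g] assms by simp

lemma W_mono_factor:
  assumes "W (m \<cdot> h)" "is_mono C m" "h \<in> Ar C" "Cod C h = Dom C m" shows "W m"
  using assms W_iff mono_lmonic lepic_of_cmp mono_Ar by metis

lemma W_Idn: "X \<in> Ob C \<Longrightarrow> W (Idn C X)"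
  unfolding W_iff using mono_lmonic[OF mono_Idn] epi_lepic[OF epi_Idn] by simp

lemma W_ore:
  assumes "W s" "f \<in> Ar C" "Cod C f = Cod C s"
  obtains t g where "W t" "g \<in> Ar C" "Dom C t = Dom C g" "Cod C t = Dom C f" "Cod C g = Dom C s"
    "f \<cdot> t = s \<cdot> g"
proof -
  obtain p q where pb: "is_pullback C f s p q" using pullback_ex[of f s] assms W_Ar by auto
  show thesis using that[of p q] W_pullback[OF pb assms(1)] pullbackD[OF pb] by simp
qed

text \<open>The diagonal of the kernel pair of \<open>s\<close> lies in \<open>W\<close>; pull it back along \<open>(f, g)\<close>.\<close>

lemma W_equalize:
  assumes s: "W s" and eq: "s \<cdot> f = s \<cdot> g" and fg: "f \<in> Ar C" "g \<in> Ar C" "Dom C f = Dom C g"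
    "Cod C f = Dom C s" "Cod C g = Dom C s"
  obtains t where "W t" "Cod C t = Dom C f" "f \<cdot> t = g \<cdot> t"
proof -
  note sa = W_Ar[OF s]
  obtain p q where pb: "is_pullback C s s p q" using pullback_ex[of s s] sa by auto
  note pd = pullbackD[OF pb]
  obtain d where "d \<in> Ar C" "Dom C d = Dom C (Idn C (Dom C s))" "Cod C d = Dom C p"
    "p \<cdot> d = Idn C (Dom C s)" "q \<cdot> d = Idn C (Dom C s)"
    by (rule pullback_lift[OF pb, of "Idn C (Dom C s)" "Idn C (Dom C s)"]) (use sa in simp_all)
  then have d: "d \<in> Ar C" "Dom C d = Dom C s" "Cod C d = Dom C p"
    "p \<cdot> d = Idn C (Dom C s)" "q \<cdot> d = Idn C (Dom C s)" using sa by simp_all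
  have Wd: "W d" using W_cancel_left[of p d] W_pullback[OF pb s] d W_Idn sa by simp
  obtain v where v: "v \<in> Ar C" "Dom C v = Dom C f" "Cod C v = Dom C p" "p \<cdot> v = f" "q \<cdot> v = g"
    by (rule pullback_lift[OF pb eq]) (use fg in simp_all)
  obtain t w where tw: "W t" "w \<in> Ar C" "Dom C t = Dom C w" "Cod C t = Dom C v" "Cod C w = Dom C d"
    "v \<cdot> t = d \<cdot> w" by (rule W_ore[OF Wd, of v]) (use v d in simp_all)
  note ta = W_Ar[OF tw(1)]
  have "f \<cdot> t = p \<cdot> d \<cdot> w" using cmp_eq_left1[OF v(4), of t] v(1-3) tw pd(4) ta by simp
  also have "\<dots> = w" using cmp_eq_left1[OF d(4), of w] d(1-3) tw pd(4) sa by simp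
  also have "w = q \<cdot> d \<cdot> w" using cmp_eq_left1[OF d(5), of w] d(1-3) tw pd(5,6) sa by simp
  also have "\<dots> = g \<cdot> t" using cmp_eq_left1[OF v(5), of t] v(1-3) tw pd(5,6) ta by simp
  finally show thesis using that[of t] tw(1,4) v(2) by simp
qed

end

section \<open>Varying the subcategory\<close>

lemma quot_inverted_mono: "quot_inverted C L s \<Longrightarrow> L \<subseteq> L' \<Longrightarrow> quot_inverted C L' s"
  unfolding quot_inverted_def by blast

text \<open>The kernel and cokernel witnessing inversion for \<open>L0\<close> may differ from those
  for \<open>L1\<close>. By \<open>lmonic_kernel\<close> and \<open>lepic_cokernel\<close> any
  choice qualifies, so one pair serves both.\<close>

lemma quot_inverted_Int:
  assumes "serre_subcategory C add z L0" "serre_subcategory C add z L1"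
  shows "quot_inverted C (L0 \<inter> L1) s \<longleftrightarrow> quot_inverted C L0 s \<and> quot_inverted C L1 s"
proof
  assume s: "quot_inverted C L0 s \<and> quot_inverted C L1 s"
  interpret s0: serre_subcategory C add z L0 by fact
  interpret s1: serre_subcategory C add z L1 by fact
  have sa: "s \<in> Ar C" using s s0.W_Ar by blast
  obtain k c where "is_kernel C s k" "is_cokernel C s c" using s0.kernel_ex[OF sa] s0.cokernel_ex[OF sa] by blast
  moreover from this have "Dom C k \<in> L0 \<inter> L1" "Cod C c \<in> L0 \<inter> L1"
    using s s0.W_iff s1.W_iff s0.lmonic_kernel s1.lmonic_kernel s0.lepic_cokernel s1.lepic_cokernel by blast+
  ultimately show "quot_inverted C (L0 \<inter> L1) s" unfolding quot_inverted_def using sa by blast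
qed (use quot_inverted_mono[of C "L0 \<inter> L1"] in blast)

lemma serre_subcategory_Int:
  assumes "serre_subcategory C add z L0" "serre_subcategory C add z L1"
  shows "serre_subcategory C add z (L0 \<inter> L1)"
proof -
  interpret s0: serre_subcategory C add z L0 by fact
  interpret s1: serre_subcategory C add z L1 by fact
  show ?thesis
    by unfold_locales
      (use s0.L_Ob s0.L_sub s1.L_sub s0.L_quot s1.L_quot s0.L_ext s1.L_ext s0.L_zero s1.L_zero in blast)+
qed

section \<open>Calculus of right fractions\<close>

definition frac :: "('o, 'm) cat \<Rightarrow> 'o set \<Rightarrow> 'm \<Rightarrow> 'm \<Rightarrow> ('o, 'm) qarr" where
  "frac C L s f = (Cod C s, Cod C f, fraction_rel C L (Cod C s) (Cod C f) `` {(s, f)})"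

text \<open>The conditions on inverted arrows under which fractions can be computed, detached from
  the abelian structure. \<open>fr_cancel\<close> goes beyond the Ore conditions; it lets the legs
  of a common refinement be inverted one by one.\<close>

locale fraction_calculus = category C for C :: "('o, 'm) cat" +
  fixes L :: "'o set"
  assumes fr_Idn: "X \<in> Ob C \<Longrightarrow> quot_inverted C L (Idn C X)"
    and fr_cmp: "quot_inverted C L f \<Longrightarrow> quot_inverted C L g \<Longrightarrow> Cod C f = Dom C g \<Longrightarrow>
      quot_inverted C L (g \<cdot> f)"
    and fr_cancel: "quot_inverted C L (g \<cdot> f) \<Longrightarrow> quot_inverted C L g \<Longrightarrow> f \<in> Ar C \<Longrightarrow>
      Cod C f = Dom C g \<Longrightarrow> quot_inverted C L f"
    and fr_ore: "quot_inverted C L s \<Longrightarrow> f \<in> Ar C \<Longrightarrow> Cod C f = Cod C s \<Longrightarrow>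
      \<exists>t g. quot_inverted C L t \<and> g \<in> Ar C \<and> Dom C t = Dom C g \<and> Cod C t = Dom C f \<and>
        Cod C g = Dom C s \<and> f \<cdot> t = s \<cdot> g"
    and fr_equalize: "quot_inverted C L s \<Longrightarrow> s \<cdot> f = s \<cdot> g \<Longrightarrow> f \<in> Ar C \<Longrightarrow> g \<in> Ar C \<Longrightarrow>
      Dom C f = Dom C g \<Longrightarrow> Cod C f = Dom C s \<Longrightarrow> Cod C g = Dom C s \<Longrightarrow>
      \<exists>t. quot_inverted C L t \<and> Cod C t = Dom C f \<and> f \<cdot> t = g \<cdot> t"
begin

abbreviation Wf where "Wf \<equiv> quot_inverted C L"
abbreviation rel where "rel X Y \<equiv> fraction_rel C L X Y"
abbreviation Q where "Q \<equiv> quot_cat C L"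
abbreviation fra where "fra s f \<equiv> frac C L s f"
abbreviation frc where "frc s f \<equiv> Wf s \<and> f \<in> Ar C \<and> Dom C s = Dom C f"

lemma Wf_Ar [simp]: "Wf s \<Longrightarrow> s \<in> Ar C"
  unfolding quot_inverted_def by blast

text \<open>\<open>fraction_rel\<close> requires only the composite \<open>s \<cdot> u\<close> to be
  inverted; \<open>fr_cancel\<close> upgrades this to both legs \<open>u\<close> and
  \<open>u'\<close>, which can then be refined further.\<close>

lemma rel_iff:
  "((s, f), (s', f')) \<in> rel X Y \<longleftrightarrow> frc s f \<and> frc s' f' \<and> Cod C s = X \<and> Cod C s' = X \<and>
     Cod C f = Y \<and> Cod C f' = Y \<and>
     (\<exists>u u'. Wf u \<and> Wf u' \<and> Dom C u = Dom C u' \<and> Cod C u = Dom C s \<and> Cod C u' = Dom C s' \<and>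
        s \<cdot> u = s' \<cdot> u' \<and> f \<cdot> u = f' \<cdot> u')" (is "?l \<longleftrightarrow> ?r")
proof
  assume ?l
  then obtain u u' where *: "frc s f" "frc s' f'" "Cod C s = X" "Cod C s' = X" "Cod C f = Y"
    "Cod C f' = Y" "u \<in> Ar C" "u' \<in> Ar C" "Dom C u = Dom C u'" "Cod C u = Dom C s"
    "Cod C u' = Dom C s'" "s \<cdot> u = s' \<cdot> u'" "Wf (s \<cdot> u)" "f \<cdot> u = f' \<cdot> u'"
    unfolding fraction_rel_def fractions_def by auto
  have "Wf u" using fr_cancel[of s u] * by blast
  moreover have "Wf u'" using fr_cancel[of s' u'] * by metis
  ultimately show ?r using * by blast
next
  assume ?r
  then obtain u u' where *: "Wf u" "Wf u'" "Dom C u = Dom C u'" "Cod C u = Dom C s" "Cod C u' = Dom C s'"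
        "s \<cdot> u = s' \<cdot> u'" "f \<cdot> u = f' \<cdot> u'" by blast
  moreover have "Wf (s \<cdot> u)" using fr_cmp[of u s] * \<open>?r\<close> by blast
  ultimately show ?l using \<open>?r\<close> unfolding fraction_rel_def fractions_def
    by (clarsimp) (metis Wf_Ar)
qed

lemma rel_fractions: "p \<in> fractions C L X Y \<longleftrightarrow> frc (fst p) (snd p) \<and> Cod C (fst p) = X \<and> Cod C (snd p) = Y"
  unfolding fractions_def by auto

lemma rel_trans:
  assumes "((s, f), (s', f')) \<in> rel X Y" "((s', f'), (s'', f'')) \<in> rel X Y"
  shows "((s, f), (s'', f'')) \<in> rel X Y"
proof -
  obtain u u' where u: "Wf u" "Wf u'" "Dom C u = Dom C u'" "Cod C u = Dom C s" "Cod C u' = Dom C s'"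
        "s \<cdot> u = s' \<cdot> u'" "f \<cdot> u = f' \<cdot> u'" using assms(1) unfolding rel_iff by blast
  obtain v v' where v: "Wf v" "Wf v'" "Dom C v = Dom C v'" "Cod C v = Dom C s'" "Cod C v' = Dom C s''"
        "s' \<cdot> v = s'' \<cdot> v'" "f' \<cdot> v = f'' \<cdot> v'" using assms(2) unfolding rel_iff by blast
  have f: "frc s f" "frc s' f'" "frc s'' f''" using assms unfolding rel_iff by blast+
  obtain t g where t: "Wf t" "g \<in> Ar C" "Dom C t = Dom C g" "Cod C t = Dom C u'" "Cod C g = Dom C v"
    "u' \<cdot> t = v \<cdot> g" using fr_ore[of v u'] u(1-5) v(1-5) by auto
  have g: "Wf (v \<cdot> g)" using fr_cmp[of t u'] t u by metis
  then have "Wf g" using fr_cancel[of v g] t v by blast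
  have "s \<cdot> u \<cdot> t = s' \<cdot> u' \<cdot> t" by (rule cmp_eq_left[OF u(6)]) (use u(1-5) f t in simp_all)
  also have "\<dots> = s' \<cdot> v \<cdot> g" using t by simp
  also have "\<dots> = s'' \<cdot> v' \<cdot> g" by (rule cmp_eq_left[OF v(6)]) (use v(1-5) f t in simp_all)
  finally have 1: "s \<cdot> u \<cdot> t = s'' \<cdot> v' \<cdot> g" .
  have "f \<cdot> u \<cdot> t = f' \<cdot> u' \<cdot> t" by (rule cmp_eq_left[OF u(7)]) (use u(1-5) f t in simp_all)
  also have "\<dots> = f' \<cdot> v \<cdot> g" using t by simp
  also have "\<dots> = f'' \<cdot> v' \<cdot> g" by (rule cmp_eq_left[OF v(7)]) (use v(1-5) f t in simp_all)
  finally have 2: "f \<cdot> u \<cdot> t = f'' \<cdot> v' \<cdot> g" .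
  have "Wf (u \<cdot> t)" "Wf (v' \<cdot> g)" using fr_cmp[of t u] fr_cmp[of g v'] u(1-5) v(1-5) t(1-5) \<open>Wf g\<close> by simp_all
  moreover have "Dom C (u \<cdot> t) = Dom C (v' \<cdot> g)" "Cod C (u \<cdot> t) = Dom C s" "Cod C (v' \<cdot> g) = Dom C s''"
    using u(1-5) v(1-5) t(1-5) by simp_all
  ultimately show ?thesis using assms 1 2 unfolding rel_iff by blast
qed

lemma rel_equiv: "equiv (fractions C L X Y) (rel X Y)"
proof (rule equivI)
  show "rel X Y \<subseteq> fractions C L X Y \<times> fractions C L X Y" unfolding fraction_rel_def by auto
  show "refl_on (fractions C L X Y) (rel X Y)"
  proof (rule refl_onI)
    fix p assume "p \<in> fractions C L X Y"
    then obtain s f where p: "p = (s, f)" "frc s f" "Cod C s = X" "Cod C f = Y"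
      unfolding fractions_def by auto
    then show "(p, p) \<in> rel X Y" using fr_Idn[of "Dom C f"] unfolding p(1) rel_iff
      by (intro conjI exI[of _ "Idn C (Dom C f)"]) auto
  qed
  show "sym (rel X Y)" by (rule symI) (auto simp: rel_iff, metis+)
  show "trans (rel X Y)"
    by (rule transI) (metis rel_trans surj_pair)
qed

lemma fra_eq_iff:
  assumes "frc s f" "frc s' f'" "Cod C s = Cod C s'" "Cod C f = Cod C f'"
  shows "fra s f = fra s' f' \<longleftrightarrow> (\<exists>u u'. Wf u \<and> Wf u' \<and> Dom C u = Dom C u' \<and> Cod C u = Dom C s \<and>
    Cod C u' = Dom C s' \<and> s \<cdot> u = s' \<cdot> u' \<and> f \<cdot> u = f' \<cdot> u')"
proof -
  have "fra s f = fra s' f' \<longleftrightarrow> ((s, f), (s', f')) \<in> rel (Cod C s) (Cod C f)"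
    unfolding frac_def using assms
      eq_equiv_class_iff[OF rel_equiv, of "(s, f)" "Cod C s" "Cod C f" "(s', f')"]
    by (auto simp: rel_fractions)
  then show ?thesis using assms unfolding rel_iff by simp
qed

lemma fra_refine:
  assumes "frc s f" "Wf a" "Cod C a = Dom C s"
  shows "fra (s \<cdot> a) (f \<cdot> a) = fra s f"
proof (subst fra_eq_iff)
  show "frc (s \<cdot> a) (f \<cdot> a)" using assms fr_cmp[of a s] by simp
  show "\<exists>u u'. Wf u \<and> Wf u' \<and> Dom C u = Dom C u' \<and> Cod C u = Dom C (s \<cdot> a) \<and>
    Cod C u' = Dom C s \<and> (s \<cdot> a) \<cdot> u = s \<cdot> u' \<and> (f \<cdot> a) \<cdot> u = f \<cdot> u'"
    by (intro exI[of _ "Idn C (Dom C a)"] exI[of _ a]) (use assms fr_Idn[of "Dom C a"] in simp)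
qed (use assms in simp_all)

section \<open>Composition of fractions\<close>

lemma quot_simps [simp]:
  "Ob Q = Ob C"
  "frc s f \<Longrightarrow> fra s f \<in> Ar Q" "Dom Q (fra s f) = Cod C s" "Cod Q (fra s f) = Cod C f"
  unfolding quot_cat_def frac_def
  by (auto intro!: quotientI simp: rel_fractions)

lemma quot_Ar:
  assumes "a \<in> Ar Q"
  obtains s f where "frc s f" "a = fra s f"
proof -
  obtain X Y c where a: "a = (X, Y, c)" "c \<in> fractions C L X Y // rel X Y"
    using assms unfolding quot_cat_def by auto
  obtain p where p: "p \<in> fractions C L X Y" "c = rel X Y `` {p}" using a(2) by (rule quotientE)
  show thesis using that[of "fst p" "snd p"] a p unfolding rel_fractions frac_def by auto
qed

lemma quot_Idn: "X \<in> Ob C \<Longrightarrow> Idn Q X = fra (Idn C X) (Idn C X)"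
  unfolding quot_cat_def frac_def by simp

text \<open>The squares are compared over an Ore square of \<open>u\<close> and \<open>u'\<close>.
  There \<open>v \<cdot> c\<close> and \<open>v' \<cdot> c'\<close> agree only after composing with
  \<open>t\<close>, so \<open>fr_equalize\<close> supplies one more refinement
  \<open>d\<close>.\<close>

lemma comp_square_indep:
  assumes "frc s f" "frc t g" "Wf u" "v \<in> Ar C" "Dom C u = Dom C v" "Cod C u = Dom C f"
    "Cod C v = Dom C t" "f \<cdot> u = t \<cdot> v"
    "Wf u'" "v' \<in> Ar C" "Dom C u' = Dom C v'" "Cod C u' = Dom C f" "Cod C v' = Dom C t" "f \<cdot> u' = t \<cdot> v'"
  shows "fra (s \<cdot> u) (g \<cdot> v) = fra (s \<cdot> u') (g \<cdot> v')"
proof -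
  have ct: "Cod C t = Cod C f" using arg_cong[OF assms(8), of "Cod C"] assms(1-7) by simp
  obtain c c' where c: "Wf c" "c' \<in> Ar C" "Dom C c = Dom C c'" "Cod C c = Dom C u" "Cod C c' = Dom C u'"
    "u \<cdot> c = u' \<cdot> c'" using fr_ore[of u' u] assms(3,6,9,12) by auto
  have "Wf (u' \<cdot> c')" using fr_cmp[of c u] c assms(3) by simp
  then have Wc': "Wf c'" using fr_cancel c assms(9) by blast
  have "t \<cdot> v \<cdot> c = f \<cdot> u \<cdot> c" by (rule cmp_eq_left[OF assms(8)[symmetric]]) (use assms(1-7) ct c(1-5) in simp_all)
  also have "\<dots> = f \<cdot> u' \<cdot> c'" using c by simp
  also have "\<dots> = t \<cdot> v' \<cdot> c'" by (rule cmp_eq_left[OF assms(14)]) (use assms(1,2,9-13) ct c in simp_all)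
  finally have tvc: "t \<cdot> v \<cdot> c = t \<cdot> v' \<cdot> c'" .
  have "\<exists>d. Wf d \<and> Cod C d = Dom C (v \<cdot> c) \<and> (v \<cdot> c) \<cdot> d = (v' \<cdot> c') \<cdot> d"
    by (rule fr_equalize[of t, OF _ tvc]) (use assms(1-7,9-13) c(1-5) in simp_all)
  then obtain d where d: "Wf d" "Cod C d = Dom C (v \<cdot> c)" "(v \<cdot> c) \<cdot> d = (v' \<cdot> c') \<cdot> d" by blast
  have dc: "Cod C d = Dom C c" using d(2) assms(4,5) c by simp
  show ?thesis
  proof (subst fra_eq_iff)
    show "frc (s \<cdot> u) (g \<cdot> v)" using assms(1-7) fr_cmp[of u s] by simp
    show "frc (s \<cdot> u') (g \<cdot> v')" using assms(1,2,9-13) fr_cmp[of u' s] by simp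
    have "u \<cdot> c \<cdot> d = u' \<cdot> c' \<cdot> d" by (rule cmp_eq_left[OF c(6)]) (use assms(3,9) c(1-5) d dc in simp_all)
    then have "(s \<cdot> u) \<cdot> (c \<cdot> d) = (s \<cdot> u') \<cdot> (c' \<cdot> d)"
      using assms(1-7,9-13) c(1-5) d(1) dc by simp
    moreover have "(g \<cdot> v) \<cdot> (c \<cdot> d) = (g \<cdot> v') \<cdot> (c' \<cdot> d)"
      using d(3) assms(1-7,9-13) c(1-5) d(1) dc by simp
    ultimately show "\<exists>ua u'a. Wf ua \<and> Wf u'a \<and> Dom C ua = Dom C u'a \<and> Cod C ua = Dom C (s \<cdot> u) \<and>
      Cod C u'a = Dom C (s \<cdot> u') \<and> (s \<cdot> u) \<cdot> ua = (s \<cdot> u') \<cdot> u'a \<and> (g \<cdot> v) \<cdot> ua = (g \<cdot> v') \<cdot> u'a"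
      using fr_cmp[of d c] fr_cmp[of d c'] d(1) dc c(1-5) Wc' assms(1-7,9-13)
      by (intro exI[of _ "c \<cdot> d"] exI[of _ "c' \<cdot> d"]) simp
  qed (use assms(1-7,9-13) in simp_all)
qed

text \<open>Over common refinements of the two representatives of each arrow, a single Ore square is
  a square for both choices; each given square is then compared with it.\<close>

lemma comp_well_defined:
  assumes st: "frc s f" "frc t g" and eq: "fra s f = fra s' f'" "fra t g = fra t' g'"
    and st': "frc s' f'" "frc t' g'"
    and uv: "Wf u" "v \<in> Ar C" "Dom C u = Dom C v" "Cod C u = Dom C f" "Cod C v = Dom C t" "f \<cdot> u = t \<cdot> v"
    and uv': "Wf u'" "v' \<in> Ar C" "Dom C u' = Dom C v'" "Cod C u' = Dom C f'" "Cod C v' = Dom C t'"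
      "f' \<cdot> u' = t' \<cdot> v'"
  shows "fra (s \<cdot> u) (g \<cdot> v) = fra (s' \<cdot> u') (g' \<cdot> v')"
proof -
  have cod: "Cod C s = Cod C s'" "Cod C f = Cod C f'" "Cod C t = Cod C t'" "Cod C g = Cod C g'"
    using eq unfolding frac_def by simp_all
  have ct: "Cod C t = Cod C f" using arg_cong[OF uv(6), of "Cod C"] st uv(1-5) by simp
  obtain a a' where a: "Wf a" "Wf a'" "Dom C a = Dom C a'" "Cod C a = Dom C s" "Cod C a' = Dom C s'"
    "s \<cdot> a = s' \<cdot> a'" "f \<cdot> a = f' \<cdot> a'" using eq(1) fra_eq_iff[OF st(1) st'(1)] cod by blast
  obtain b b' where b: "Wf b" "Wf b'" "Dom C b = Dom C b'" "Cod C b = Dom C t" "Cod C b' = Dom C t'"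
    "t \<cdot> b = t' \<cdot> b'" "g \<cdot> b = g' \<cdot> b'" using eq(2) fra_eq_iff[OF st(2) st'(2)] cod by blast
  obtain x y where x: "Wf x" "y \<in> Ar C" "Dom C x = Dom C y" "Cod C x = Dom C (f \<cdot> a)"
    "Cod C y = Dom C (t \<cdot> b)" "(f \<cdot> a) \<cdot> x = (t \<cdot> b) \<cdot> y"
    using fr_ore[of "t \<cdot> b" "f \<cdot> a"] fr_cmp[of b t] a(1-5) b(1-5) st ct by auto
  have cx: "Cod C x = Dom C a" "Cod C y = Dom C b" using x a(1-5) b(1-5) st by simp_all
  have "fra (s \<cdot> u) (g \<cdot> v) = fra (s \<cdot> a \<cdot> x) (g \<cdot> b \<cdot> y)"
    by (rule comp_square_indep[OF st uv])
      (use fr_cmp[of x a] x(1-3,6) cx a(1-5) b(1-5) st in simp_all)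
  also have "s \<cdot> a \<cdot> x = s' \<cdot> a' \<cdot> x"
    by (rule cmp_eq_left[OF a(6)]) (use x(1-3) cx a(1-5) st st' in simp_all)
  also have "g \<cdot> b \<cdot> y = g' \<cdot> b' \<cdot> y"
    by (rule cmp_eq_left[OF b(7)]) (use x(1-3) cx b(1-5) st st' in simp_all)
  also have "fra (s' \<cdot> a' \<cdot> x) (g' \<cdot> b' \<cdot> y) = fra (s' \<cdot> u') (g' \<cdot> v')"
  proof (rule comp_square_indep[OF st' _ _ _ _ _ _ uv'])
    have "(f' \<cdot> a') \<cdot> x = (t' \<cdot> b') \<cdot> y" using x(6) a(7) b(6) by simp
    then show "f' \<cdot> a' \<cdot> x = t' \<cdot> b' \<cdot> y" using x(1-3) cx a(1-5) b(1-5) st st' by simp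
    show "Wf (a' \<cdot> x)" using fr_cmp[of x a'] x(1-3) cx a(1-5) by simp
  qed (use x(1-3) cx a(1-5) b(1-5) st st' in simp_all)
  finally show ?thesis .
qed

text \<open>Evaluates the union in \<open>quot_comp\<close>: the family of classes runs over all
  representatives and squares, but is a singleton by \<open>comp_well_defined\<close>.\<close>

lemma fra_comp:
  assumes st: "frc s f" "frc t g"
    and uv: "Wf u" "v \<in> Ar C" "Dom C u = Dom C v" "Cod C u = Dom C f" "Cod C v = Dom C t" "f \<cdot> u = t \<cdot> v"
  shows "Comp Q (fra t g) (fra s f) = fra (s \<cdot> u) (g \<cdot> v)"
proof -
  let ?X = "Cod C s" and ?Z = "Cod C g"
  let ?c = "rel ?X (Cod C f) `` {(s, f)}" and ?d = "rel (Cod C t) ?Z `` {(t, g)}"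
  let ?S = "{rel ?X ?Z `` {(s \<cdot> u, g \<cdot> v)} | s f t g u v.
        (s, f) \<in> ?c \<and> (t, g) \<in> ?d \<and> Wf u \<and> v \<in> Ar C \<and> Dom C u = Dom C v \<and>
        Cod C u = Dom C f \<and> Cod C v = Dom C t \<and> f \<cdot> u = t \<cdot> v}"
  have "Comp Q (fra t g) (fra s f) = (?X, ?Z, \<Union>?S)"
    unfolding quot_cat_def quot_comp_def frac_def by simp
  moreover have "?S = {rel ?X ?Z `` {(s \<cdot> u, g \<cdot> v)}}"
  proof (rule equalityI)
    have "(s, f) \<in> ?c" "(t, g) \<in> ?d"
      using equiv_class_self[OF rel_equiv] st by (auto simp: rel_fractions)
    then show "{rel ?X ?Z `` {(s \<cdot> u, g \<cdot> v)}} \<subseteq> ?S" using uv by blast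
    show "?S \<subseteq> {rel ?X ?Z `` {(s \<cdot> u, g \<cdot> v)}}"
    proof
      fix A assume "A \<in> ?S"
      then obtain s' f' t' g' u' v' where A: "A = rel ?X ?Z `` {(s' \<cdot> u', g' \<cdot> v')}"
        "(s', f') \<in> ?c" "(t', g') \<in> ?d" and uv': "Wf u'" "v' \<in> Ar C" "Dom C u' = Dom C v'"
        "Cod C u' = Dom C f'" "Cod C v' = Dom C t'" "f' \<cdot> u' = t' \<cdot> v'" by blast
      have r: "((s, f), (s', f')) \<in> rel ?X (Cod C f)" "((t, g), (t', g')) \<in> rel (Cod C t) ?Z"
        using A(2,3) by auto
      then have st': "frc s' f'" "frc t' g'" and cod: "Cod C s' = ?X" "Cod C f' = Cod C f" "Cod C t' = Cod C t"
        "Cod C g' = ?Z" unfolding rel_iff by blast+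
      have "fra s f = fra s' f'" "fra t g = fra t' g'"
        unfolding frac_def cod using equiv_class_eq[OF rel_equiv] r by blast+
      from comp_well_defined[OF st this st' uv uv'] have "fra (s \<cdot> u) (g \<cdot> v) = fra (s' \<cdot> u') (g' \<cdot> v')" .
      then show "A \<in> {rel ?X ?Z `` {(s \<cdot> u, g \<cdot> v)}}"
        unfolding frac_def A(1) using st st' uv(1-5) uv'(1-5) cod by simp
    qed
  qed
  moreover have "fra (s \<cdot> u) (g \<cdot> v) = (?X, ?Z, rel ?X ?Z `` {(s \<cdot> u, g \<cdot> v)})"
    unfolding frac_def using st uv(1-5) by simp
  ultimately show ?thesis by simp
qed

lemma fra_ore:
  assumes "frc s f" "frc t g" "Cod C f = Cod C t"
  obtains u v where "Wf u" "v \<in> Ar C" "Dom C u = Dom C v" "Cod C u = Dom C f" "Cod C v = Dom C t" "f \<cdot> u = t \<cdot> v"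
  using fr_ore[of t f] assms by blast

theorem quot_category: "is_category Q"
  unfolding is_category_def
proof (intro conjI ballI impI)
  fix a assume "a \<in> Ar Q"
  then obtain s f where a: "frc s f" "a = fra s f" by (rule quot_Ar)
  then show "Dom Q a \<in> Ob Q" "Cod Q a \<in> Ob Q" by auto
  have sf: "Cod C s \<in> Ob C" "Cod C f \<in> Ob C" "Dom C f \<in> Ob C" using a by auto
  have "Comp Q (fra s f) (fra (Idn C (Cod C s)) (Idn C (Cod C s))) = fra (Idn C (Cod C s) \<cdot> s) (f \<cdot> Idn C (Dom C f))"
    by (rule fra_comp) (use a sf fr_Idn in simp_all)
  then show "Comp Q a (Idn Q (Dom Q a)) = a" using a quot_Idn sf by simp
  have "Comp Q (fra (Idn C (Cod C f)) (Idn C (Cod C f))) (fra s f) = fra (s \<cdot> Idn C (Dom C f)) (Idn C (Cod C f) \<cdot> f)"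
    by (rule fra_comp) (use a sf fr_Idn in simp_all)
  then show "Comp Q (Idn Q (Cod Q a)) a = a" using a quot_Idn sf by simp
  fix b assume "b \<in> Ar Q" and ab: "Cod Q a = Dom Q b"
  then obtain t g where b: "frc t g" "b = fra t g" using quot_Ar by blast
  have c: "Cod C f = Cod C t" using ab a b by simp
  obtain u v where uv: "Wf u" "v \<in> Ar C" "Dom C u = Dom C v" "Cod C u = Dom C f" "Cod C v = Dom C t"
    "f \<cdot> u = t \<cdot> v" using fra_ore[OF a(1) b(1) c] .
  have "Comp Q b a = fra (s \<cdot> u) (g \<cdot> v)" unfolding a(2) b(2) by (rule fra_comp[OF a(1) b(1) uv])
  then show "Comp Q b a \<in> Hom Q (Dom Q a) (Cod Q b)" using a b uv(1-5) fr_cmp[of u s] by simp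
next
  fix a b c assume "a \<in> Ar Q" "b \<in> Ar Q" "c \<in> Ar Q" and ab: "Cod Q a = Dom Q b" and bc: "Cod Q b = Dom Q c"
  obtain s f where a: "frc s f" "a = fra s f" using quot_Ar[OF \<open>a \<in> Ar Q\<close>] .
  obtain t g where b: "frc t g" "b = fra t g" using quot_Ar[OF \<open>b \<in> Ar Q\<close>] .
  obtain r h where c: "frc r h" "c = fra r h" using quot_Ar[OF \<open>c \<in> Ar Q\<close>] .
  have cod: "Cod C f = Cod C t" "Cod C g = Cod C r"
    using ab bc a(1) b(1) c(1) unfolding a(2) b(2) c(2) by simp_all
  obtain u v where uv: "Wf u" "v \<in> Ar C" "Dom C u = Dom C v" "Cod C u = Dom C g" "Cod C v = Dom C r"
    "g \<cdot> u = r \<cdot> v" using fra_ore[OF b(1) c(1) cod(2)] .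
  have tu: "frc (t \<cdot> u) (h \<cdot> v)" "Cod C f = Cod C (t \<cdot> u)" using fr_cmp[of u t] b c uv(1-5) cod by simp_all
  obtain x y where xy: "Wf x" "y \<in> Ar C" "Dom C x = Dom C y" "Cod C x = Dom C f" "Cod C y = Dom C (t \<cdot> u)"
    "f \<cdot> x = (t \<cdot> u) \<cdot> y" using fra_ore[OF a(1) tu] .
  have cy: "Cod C y = Dom C u" using xy(5) uv(1-5) b by simp
  have "Comp Q c b = fra (t \<cdot> u) (h \<cdot> v)" unfolding c(2) b(2) by (rule fra_comp[OF b(1) c(1) uv])
  moreover have "Comp Q (fra (t \<cdot> u) (h \<cdot> v)) a = fra (s \<cdot> x) ((h \<cdot> v) \<cdot> y)"
    unfolding a(2) by (rule fra_comp[OF a(1) tu(1) xy])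
  moreover have "(h \<cdot> v) \<cdot> y = h \<cdot> v \<cdot> y" using c uv(1-5) xy(1-3) cy by simp
  \<comment> \<open>The second square, extended by \<open>u\<close>, is also a square for
    \<open>f\<close> and \<open>t\<close>; so both bracketings are computed from the same two Ore
    squares.\<close>
  moreover have ba: "Comp Q b a = fra (s \<cdot> x) (g \<cdot> u \<cdot> y)"
    unfolding a(2) b(2)
    by (rule fra_comp) (use a b uv(1-5) xy(1-4,6) cy in simp_all)
  moreover have "Comp Q c (fra (s \<cdot> x) (g \<cdot> u \<cdot> y)) = fra ((s \<cdot> x) \<cdot> Idn C (Dom C x)) (h \<cdot> v \<cdot> y)"
    unfolding c(2)
  proof (rule fra_comp)
    have "g \<cdot> u \<cdot> y = r \<cdot> v \<cdot> y"
      by (rule cmp_eq_left[OF uv(6)]) (use uv(1-5) xy(1-3) cy b c in simp_all)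
    then show "(g \<cdot> u \<cdot> y) \<cdot> Idn C (Dom C x) = r \<cdot> v \<cdot> y"
      using uv(1-5) xy(1-3) cy b c by simp
  qed (use a b c uv(1-5) xy(1-4) cy fr_Idn fr_cmp[of x s] in simp_all)
  moreover have "(s \<cdot> x) \<cdot> Idn C (Dom C x) = s \<cdot> x" using a xy(1-4) by simp
  ultimately show "Comp Q c (Comp Q b a) = Comp Q (Comp Q c b) a" by simp
next
  fix X assume X: "X \<in> Ob Q"
  then have "X \<in> Ob C" by simp
  then show "Idn Q X \<in> Hom Q X X" using quot_Idn fr_Idn by simp
qed

section \<open>Isomorphisms and functors between quotients\<close>

lemma fra_inverse:
  assumes "Wf s" "Wf f" "Dom C s = Dom C f"
  shows "Comp Q (fra f s) (fra s f) = Idn Q (Cod C s)"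
proof -
  have o: "Cod C s \<in> Ob C" "Dom C f \<in> Ob C" using assms by auto
  have "Comp Q (fra f s) (fra s f) = fra (s \<cdot> Idn C (Dom C f)) (s \<cdot> Idn C (Dom C f))"
    by (rule fra_comp) (use assms o fr_Idn in simp_all)
  also have "\<dots> = fra (Idn C (Cod C s) \<cdot> s) (Idn C (Cod C s) \<cdot> s)" using assms o by simp
  also have "\<dots> = fra (Idn C (Cod C s)) (Idn C (Cod C s))"
    by (rule fra_refine) (use assms o fr_Idn in simp_all)
  finally show ?thesis using quot_Idn o by simp
qed

lemma fra_iso:
  assumes "Wf s" "Wf f" "Dom C s = Dom C f" shows "is_iso Q (fra s f)"
  unfolding is_iso_def
  by (intro conjI bexI[of _ "fra f s"]) (use assms fra_inverse[of s f] fra_inverse[of f s] in simp_all)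

end

lemma quot_functor_frac:
  assumes "fraction_calculus C L" "fraction_calculus C L'" "L \<subseteq> L'"
    "quot_inverted C L s" "f \<in> Ar C" "Dom C s = Dom C f"
  shows "far (quot_functor C L') (frac C L s f) = frac C L' s f"
proof -
  interpret l: fraction_calculus C L by fact
  interpret l': fraction_calculus C L' by fact
  let ?X = "Cod C s" and ?Y = "Cod C f"
  have sub: "fraction_rel C L ?X ?Y \<subseteq> fraction_rel C L' ?X ?Y"
    unfolding fraction_rel_def fractions_def
    using quot_inverted_mono[OF _ assms(3)] by fastforce
  have "fraction_rel C L' ?X ?Y `` (fraction_rel C L ?X ?Y `` {(s, f)}) = fraction_rel C L' ?X ?Y `` {(s, f)}"
    (is "?l = ?r")
  proof
    show "?l \<subseteq> ?r" using sub l'.rel_equiv[THEN equivE, of ?X ?Y] unfolding trans_def by blast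
    have "(s, f) \<in> fraction_rel C L ?X ?Y `` {(s, f)}"
      using equiv_class_self[OF l.rel_equiv] assms by (auto simp: l.rel_fractions)
    then show "?r \<subseteq> ?l" by blast
  qed
  then show ?thesis unfolding quot_functor_def frac_def by simp
qed

lemma quot_functor_is_functor:
  assumes "fraction_calculus C L" "fraction_calculus C L'" "L \<subseteq> L'"
  shows "is_functor (quot_cat C L) (quot_cat C L') (quot_functor C L')"
proof -
  interpret l: fraction_calculus C L by fact
  interpret l': fraction_calculus C L' by fact
  note fr = quot_functor_frac[OF assms]
  have W': "quot_inverted C L s \<Longrightarrow> quot_inverted C L' s" for s using quot_inverted_mono[OF _ assms(3)] .
  have fob: "fob (quot_functor C L') X = X" for X unfolding quot_functor_def by simp
  show ?thesis unfolding is_functor_def fob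
  proof (intro conjI ballI impI)
    show "is_category l.Q" "is_category l'.Q" by (rule l.quot_category l'.quot_category)+
    fix X assume "X \<in> Ob l.Q"
    then show "X \<in> Ob l'.Q" by simp
    show "far (quot_functor C L') (Idn l.Q X) = Idn l'.Q X"
      using \<open>X \<in> Ob l.Q\<close> fr[of "Idn C X" "Idn C X"] by (simp add: l.quot_Idn l'.quot_Idn l.fr_Idn)
  next
    fix a assume "a \<in> Ar l.Q"
    then obtain s f where a: "l.frc s f" "a = frac C L s f" by (rule l.quot_Ar)
    then have "l'.frc s f" using W' by blast
    then show "far (quot_functor C L') a \<in> Hom l'.Q (Dom l.Q a) (Cod l.Q a)"
      using a fr[of s f] by simp
    fix b assume "b \<in> Ar l.Q" and ab: "Cod l.Q a = Dom l.Q b"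
    then obtain t g where b: "l.frc t g" "b = frac C L t g" using l.quot_Ar by blast
    have c: "Cod C f = Cod C t" using ab a b by simp
    obtain u v where uv: "quot_inverted C L u" "v \<in> Ar C" "Dom C u = Dom C v" "Cod C u = Dom C f"
      "Cod C v = Dom C t" "Comp C f u = Comp C t v" using l.fra_ore[OF a(1) b(1) c] .
    have "Comp l.Q b a = frac C L (Comp C s u) (Comp C g v)"
      unfolding a(2) b(2) by (rule l.fra_comp[OF a(1) b(1) uv])
    moreover have "far (quot_functor C L') (frac C L (Comp C s u) (Comp C g v)) = frac C L' (Comp C s u) (Comp C g v)"
      by (rule fr) (use l.fr_cmp[of u s] a b uv(1-5) in simp_all)
    moreover have "Comp l'.Q (frac C L' t g) (frac C L' s f) = frac C L' (Comp C s u) (Comp C g v)"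
      by (rule l'.fra_comp) (use a(1) b(1) uv W' in simp_all)
    ultimately show "far (quot_functor C L') (Comp l.Q b a) =
        Comp l'.Q (far (quot_functor C L') b) (far (quot_functor C L') a)"
      using a b fr by simp
  qed
qed

lemma (in serre_subcategory) fraction_calculus: "fraction_calculus C L"
proof unfold_locales
  fix s f assume "W s" "f \<in> Ar C" "Cod C f = Cod C s"
  then show "\<exists>t g. W t \<and> g \<in> Ar C \<and> Dom C t = Dom C g \<and> Cod C t = Dom C f \<and>
        Cod C g = Dom C s \<and> f \<cdot> t = s \<cdot> g" using W_ore by metis
next
  fix s f g assume "W s" "s \<cdot> f = s \<cdot> g" "f \<in> Ar C" "g \<in> Ar C"
      "Dom C f = Dom C g" "Cod C f = Dom C s" "Cod C g = Dom C s"
  then show "\<exists>t. W t \<and> Cod C t = Dom C f \<and> f \<cdot> t = g \<cdot> t" using W_equalize by metis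
qed (use W_Idn W_cmp W_cancel_left in blast)+

lemma (in serre_subcategory) iso_frac_W:
  assumes sf: "W s" "f \<in> Ar C" "Dom C s = Dom C f" and iso: "is_iso (quot_cat C L) (frac C L s f)"
  shows "W f"
proof -
  interpret fr: fraction_calculus C L by (rule fraction_calculus)
  obtain b where b: "b \<in> Ar (quot_cat C L)" "Dom (quot_cat C L) b = Cod C f" "Cod (quot_cat C L) b = Cod C s"
    "Comp (quot_cat C L) b (frac C L s f) = Idn (quot_cat C L) (Cod C s)"
    "Comp (quot_cat C L) (frac C L s f) b = Idn (quot_cat C L) (Cod C f)"
    using iso unfolding is_iso_def by auto
  obtain t g where t: "fr.frc t g" "b = frac C L t g" using fr.quot_Ar[OF b(1)] .
  have c: "Cod C t = Cod C f" "Cod C g = Cod C s" using b(2,3) t by simp_all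
  \<comment> \<open>In the comparison with the identity fraction, both composites equal the leg
    \<open>u'\<close>.\<close>
  have idq: "\<exists>a. W a \<and> Cod C a = Dom C s \<and> f \<cdot> a = s \<cdot> a"
    if eq: "frac C L s f = Idn (quot_cat C L) X" and X: "X \<in> Ob C" and sf: "fr.frc s f" for s f X
  proof -
    have eq': "frac C L s f = frac C L (Idn C X) (Idn C X)" using eq fr.quot_Idn[OF X] by simp
    then have cod: "Cod C s = X" "Cod C f = X" unfolding frac_def using X by simp_all
    have "\<exists>u u'. W u \<and> W u' \<and> Dom C u = Dom C u' \<and> Cod C u = Dom C s \<and>
      Cod C u' = Dom C (Idn C X) \<and> s \<cdot> u = Idn C X \<cdot> u' \<and> f \<cdot> u = Idn C X \<cdot> u'"
      by (subst fr.fra_eq_iff[symmetric]) (use eq' sf cod X W_Idn in simp_all)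
    then show ?thesis by metis
  qed
  obtain u v where uv: "W u" "v \<in> Ar C" "Dom C u = Dom C v" "Cod C u = Dom C f" "Cod C v = Dom C t"
    "f \<cdot> u = t \<cdot> v" using W_ore[of t f] t c sf by metis
  have "Comp (quot_cat C L) b (frac C L s f) = frac C L (s \<cdot> u) (g \<cdot> v)"
    unfolding t(2) by (rule fr.fra_comp) (use sf t uv in simp_all)
  then have 1: "frac C L (s \<cdot> u) (g \<cdot> v) = Idn (quot_cat C L) (Cod C s)" using b(4) by simp
  have "fr.frc (s \<cdot> u) (g \<cdot> v)" using W_cmp[of u s] sf t(1) uv(1-5) by simp
  from idq[OF 1 _ this] obtain x where x: "W x" "Cod C x = Dom C (s \<cdot> u)" "(g \<cdot> v) \<cdot> x = (s \<cdot> u) \<cdot> x"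
    using sf by auto
  have cx: "Cod C x = Dom C u" "Cod C x = Dom C v" using x(2) sf uv(1-5) W_Ar by simp_all
  note ars = W_Ar[OF x(1)] W_Ar[OF uv(1)] W_Ar[OF sf(1)] W_Ar[of t]
  have "W ((s \<cdot> u) \<cdot> x)" by (rule W_cmp[OF x(1)]) (use W_cmp[of u s] uv(1-5) sf x(2) in simp_all)
  then have "lmonic C L ((g \<cdot> v) \<cdot> x)" using x(3) W_iff by simp
  then have "lmonic C L (g \<cdot> v \<cdot> x)" using ars t(1) uv(2,3,5) cx by simp
  then have "lmonic C L (v \<cdot> x)" by (rule lmonic_of_cmp) (use ars t(1) uv(2,3,5) cx in simp_all)
  then have "lmonic C L (t \<cdot> v \<cdot> x)" using lmonic_cmp[of "v \<cdot> x" t] t(1) W_iff ars uv(2,3,5) cx by simp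
  moreover have "f \<cdot> u \<cdot> x = t \<cdot> v \<cdot> x"
    by (rule cmp_eq_left[OF uv(6)]) (use ars t(1) uv(1-5) cx sf in simp_all)
  ultimately have lm: "lmonic C L (f \<cdot> u \<cdot> x)" by simp
  have "lepic C L (u \<cdot> x)" using W_cmp[OF x(1) uv(1) cx(1)] W_iff by simp
  then have "lmonic C L f"
    by (rule lmonic_cancel[OF lm]) (use sf uv(4) ars cx in simp_all)
  moreover have "lepic C L f"
  proof -
    obtain u v where uv: "W u" "v \<in> Ar C" "Dom C u = Dom C v" "Cod C u = Dom C g" "Cod C v = Dom C s"
      "g \<cdot> u = s \<cdot> v" using W_ore[of s g] t c sf by metis
    have "Comp (quot_cat C L) (frac C L s f) b = frac C L (t \<cdot> u) (f \<cdot> v)"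
      unfolding t(2) by (rule fr.fra_comp) (use sf t uv in simp_all)
    then have 1: "frac C L (t \<cdot> u) (f \<cdot> v) = Idn (quot_cat C L) (Cod C f)" using b(5) by simp
    have "fr.frc (t \<cdot> u) (f \<cdot> v)" using W_cmp[of u t] sf t(1) uv(1-5) by simp
    from idq[OF 1 _ this] obtain x where x: "W x" "Cod C x = Dom C (t \<cdot> u)" "(f \<cdot> v) \<cdot> x = (t \<cdot> u) \<cdot> x"
      using sf by auto
    note ars = W_Ar[OF x(1)] W_Ar[OF uv(1)] W_Ar[OF sf(1)] W_Ar[of t]
    have cx: "Cod C x = Dom C u" "Cod C x = Dom C v" using x(2) t(1) uv(1-5) ars by simp_all
    have "W ((t \<cdot> u) \<cdot> x)" by (rule W_cmp[OF x(1)]) (use W_cmp[of u t] uv(1-5) t(1) x(2) in simp_all)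
    then have "lepic C L ((f \<cdot> v) \<cdot> x)" using x(3) W_iff by simp
    then have "lepic C L (f \<cdot> v \<cdot> x)" using ars sf uv(2,3,5) cx by simp
    then show ?thesis by (rule lepic_of_cmp) (use ars sf uv(2,3,5) cx in simp_all)
  qed
  ultimately show "W f" using W_iff by simp
qed

section \<open>Small sets\<close>

lemma small_lepoll: "A \<lesssim> B \<Longrightarrow> small u B \<Longrightarrow> small u A"
  unfolding small_def by (rule lesspoll_trans1)

lemma small_subset: "A \<subseteq> B \<Longrightarrow> small u B \<Longrightarrow> small u A"
  using small_lepoll subset_imp_lepoll by blast

lemma small_image: "small u A \<Longrightarrow> small u (f ` A)"
  using small_lepoll image_lepoll by blast

lemma small_empty: "small u {}"
  unfolding small_def by (auto simp: lesspoll_def eqpoll_def bij_betw_def)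

lemma small_inj:
  fixes u :: "'u itself" and A :: "'a set"
  assumes "small u A"
  obtains f :: "'a \<Rightarrow> 'u" where "inj_on f A"
  using assms unfolding small_def lesspoll_def lepoll_def by blast

lemma small_Pow:
  fixes u :: "'u itself" and A :: "'a set"
  assumes "universe u" "small u A"
  shows "small u (Pow A)"
proof -
  obtain f :: "'a \<Rightarrow> 'u" where f: "inj_on f A" using small_inj[OF assms(2)] .
  have "small u (Pow (f ` A))" using assms small_image[OF assms(2), of f] unfolding universe_def by blast
  moreover have "Pow A \<lesssim> Pow (f ` A)"
    unfolding lepoll_def
  proof (intro exI[of _ "image f"] conjI)
    show "inj_on ((`) f) (Pow A)" using f by (rule inj_on_image_Pow)
  qed auto
  ultimately show ?thesis using small_lepoll by blast
qed

text \<open>Filtered colimits are indexed by categories whose arrows are elements of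
  \<open>'u\<close>, so pairs of indices must be coded in \<open>'u\<close>. This is possible since
  an infinite set is equipotent to its square.\<close>

lemma universe_pairing:
  fixes u :: "'u itself"
  assumes "universe u"
  obtains h :: "'u \<times> 'u \<Rightarrow> 'u" where "inj h"
proof -
  have "infinite (UNIV :: 'u set)" using assms unfolding universe_def by blast
  then have "\<exists>h. bij_betw h ((UNIV :: 'u set) \<times> (UNIV :: 'u set)) (UNIV :: 'u set)"
    using card_of_ordIso card_of_Times_same_infinite by blast
  then obtain h :: "'u \<times> 'u \<Rightarrow> 'u" where "bij_betw h (UNIV \<times> UNIV) UNIV" by blast
  then show thesis using that[of h] unfolding bij_betw_def by simp
qed

lemma small_pairs:
  fixes u :: "'u itself" and h :: "'u \<times> 'u \<Rightarrow> 'u"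
  assumes "universe u" "small u I"
  shows "small u (h ` (I \<times> I))"
proof -
  have "small u (\<Union>i\<in>I. (\<lambda>j. h (i, j)) ` I)"
  proof -
    have "\<forall>(I :: 'u set) (A :: 'u \<Rightarrow> 'u set). small u I \<longrightarrow> (\<forall>i\<in>I. small u (A i)) \<longrightarrow> small u (\<Union>i\<in>I. A i)"
      using assms(1) unfolding universe_def by blast
    from this[rule_format, OF assms(2), of "\<lambda>i. (\<lambda>j. h (i, j)) ` I"]
    show ?thesis using small_image[OF assms(2)] by blast
  qed
  moreover have "(\<Union>i\<in>I. (\<lambda>j. h (i, j)) ` I) = h ` (I \<times> I)" by auto
  ultimately show ?thesis by simp
qed

section \<open>Grothendieck categories\<close>

text \<open>The torsion-free objects for \<open>L\<close>: for a Serre subcategory the condition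
  means that \<open>Y\<close> has no nonzero subobject in \<open>L\<close>.\<close>

definition lfree :: "('o, 'm) cat \<Rightarrow> 'o set \<Rightarrow> 'o \<Rightarrow> bool" where
  "lfree C L Y \<longleftrightarrow> (\<forall>a\<in>Ar C. Cod C a = Y \<longrightarrow> null C L a \<longrightarrow> zero_arrow C a)"

locale grothendieck_category = abelian_category C add z
  for C :: "('o, 'm) cat" and add z +
  fixes u :: "'u itself" and G :: 'o
  assumes univ: "universe u" and groth: "grothendieck u C" and gen: "is_generator C G"
begin

lemma localizing_serre:
  assumes "localizing u C L" shows "serre_subcategory C add z L"
proof
  fix Z assume Z: "zero_object C Z"
  \<comment> \<open>A zero object is the coproduct of the empty family, and the empty set is
    small.\<close>
  have cop: "is_coproduct C ({} :: 'u set) (\<lambda>_. Z) Z (\<lambda>_. Idn C Z)"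
    using Z unfolding is_coproduct_def zero_object_def by auto
  have "\<forall>(I :: 'u set) X S j. small u I \<longrightarrow> (\<forall>i\<in>I. X i \<in> L) \<longrightarrow> is_coproduct C I X S j \<longrightarrow> S \<in> L"
    using assms unfolding localizing_def by blast
  then show "Z \<in> L" using cop small_empty by blast
qed (use assms in \<open>auto simp: localizing_def\<close>)

text \<open>The elements of a subobject at the generator determine it, so \<open>X\<close> has a small set of
  subobjects.\<close>

definition gens :: "'m \<Rightarrow> 'm set" where
  "gens m = {h. h \<in> Ar C \<and> Dom C h = G \<and> Cod C h = Cod C m \<and>
     (\<exists>w\<in>Ar C. Dom C w = G \<and> Cod C w = Dom C m \<and> m \<cdot> w = h)}"

text \<open>If \<open>m\<close> did not factor through \<open>m'\<close>, the generator would detect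
  \<open>c \<cdot> m\<close> on some \<open>h\<close>; but \<open>m \<cdot> h\<close> lies in
  \<open>gens m'\<close>, hence is killed by \<open>c\<close>.\<close>

lemma gens_le:
  assumes m: "m \<in> Ar C" "is_mono C m'" "Cod C m = Cod C m'" and le: "gens m \<subseteq> gens m'"
  obtains w where "w \<in> Ar C" "Dom C w = Dom C m" "Cod C w = Dom C m'" "m' \<cdot> w = m"
proof -
  obtain c where c: "is_cokernel C m' c" using cokernel_ex[of m'] m by auto
  note cd = cokernelD[OF c]
  have "zero (c \<cdot> m)"
  proof (rule ccontr)
    assume nz: "\<not> zero (c \<cdot> m)"
    have cm: "c \<cdot> m \<in> Ar C" "Dom C (c \<cdot> m) = Dom C m" "Cod C (c \<cdot> m) = Cod C c" using cd m by simp_all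
    obtain o' where o': "o' \<in> Ar C" "Dom C o' = Dom C m" "Cod C o' = Cod C c" "zero o'"
      using zero_ex[of "Dom C m" "Cod C c"] cd m by auto
    then have "c \<cdot> m \<noteq> o'" using nz by metis
    then obtain h where h: "h \<in> Hom C G (Dom C (c \<cdot> m))" "(c \<cdot> m) \<cdot> h \<noteq> o' \<cdot> h"
      using gen cm o' unfolding is_generator_def by metis
    have h': "h \<in> Ar C" "Dom C h = G" "Cod C h = Dom C m" using h(1) cm by simp_all
    then have "m \<cdot> h \<in> gens m" unfolding gens_def using m by auto
    then obtain w where w: "w \<in> Ar C" "Dom C w = G" "Cod C w = Dom C m'" "m' \<cdot> w = m \<cdot> h"
      using le unfolding gens_def by blast
    have "(c \<cdot> m) \<cdot> h = c \<cdot> m' \<cdot> w" using w(4) h' m cd by simp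
    also have "\<dots> = (c \<cdot> m') \<cdot> w" using w(1-3) m cd by simp
    finally have eq: "(c \<cdot> m) \<cdot> h = (c \<cdot> m') \<cdot> w" .
    have "zero ((c \<cdot> m') \<cdot> w)" by (rule zero_cmp_right) (use cd w(1-3) m in simp_all)
    moreover have "zero (o' \<cdot> h)" by (rule zero_cmp_right) (use o' h' in simp_all)
    ultimately have "(c \<cdot> m) \<cdot> h = o' \<cdot> h"
      unfolding eq by (rule zero_unique) (use cd w(1-3) m o' h' in simp_all)
    then show False using h by blast
  qed
  then obtain w where "w \<in> Ar C" "Dom C w = Dom C m" "Cod C w = Dom C m'" "m' \<cdot> w = m"
    by (rule kernel_lift[OF mono_is_kernel[OF m(2) c]]) (use m cd in simp_all)
  then show thesis by (rule that)
qed

lemma gens_cmp: "k \<in> Ar C \<Longrightarrow> l \<in> Ar C \<Longrightarrow> Cod C l = Dom C k \<Longrightarrow> gens (k \<cdot> l) \<subseteq> gens k"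
proof
  fix h assume k: "k \<in> Ar C" "l \<in> Ar C" "Cod C l = Dom C k" and "h \<in> gens (k \<cdot> l)"
  then obtain w where w: "h \<in> Ar C" "Dom C h = G" "Cod C h = Cod C (k \<cdot> l)" "w \<in> Ar C" "Dom C w = G"
    "Cod C w = Dom C (k \<cdot> l)" "(k \<cdot> l) \<cdot> w = h" unfolding gens_def by blast
  have lw: "l \<cdot> w \<in> Ar C" "Dom C (l \<cdot> w) = G" "Cod C (l \<cdot> w) = Dom C k" using w(4-6) k by simp_all
  have "(k \<cdot> l) \<cdot> w = k \<cdot> l \<cdot> w" using w(4-6) k by simp
  then have "k \<cdot> (l \<cdot> w) = h" using w(7) by simp
  moreover have "Cod C h = Cod C k" using w(3) k by simp
  ultimately show "h \<in> gens k" unfolding gens_def using w(1,2) lw by blast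
qed

lemma small_gens: "X \<in> Ob C \<Longrightarrow> small u (Pow (Hom C G X))"
  using small_Pow[OF univ] groth gen unfolding grothendieck_def is_generator_def by blast

lemma gens_Hom: "gens m \<subseteq> Hom C G (Cod C m)"
  unfolding gens_def by auto

text \<open>\<open>m\<close> is the largest subobject of \<open>X\<close> in \<open>L\<close>, built
  as the image of a coproduct with one summand \<open>Dom C (k i)\<close> for each value of
  \<open>gens\<close> on the subobjects in \<open>L\<close>. Indexing by these values keeps the
  coproduct small.\<close>

lemma torsion:
  assumes L: "localizing u C L" and X: "X \<in> Ob C"
  obtains m q where "short_exact C m q" "is_mono C m" "is_epi C q" "Cod C m = X" "Dom C q = X"
    "Dom C m \<in> L" "lfree C L (Cod C q)"
proof -
  interpret serre_subcategory C add z L by (rule localizing_serre[OF L])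
  let ?P = "\<lambda>m. is_mono C m \<and> Cod C m = X \<and> Dom C m \<in> L"
  define S where "S = gens ` {m. ?P m}"
  have "S \<subseteq> Pow (Hom C G X)" unfolding S_def using gens_Hom by auto
  then have sS: "small u S" using small_subset small_gens[OF X] by blast
  obtain f :: "'m set \<Rightarrow> 'u" where f: "inj_on f S" using small_inj[OF sS] .
  have sI: "small u (f ` S)" using small_image[OF sS] .
  have "\<forall>i\<in>f ` S. \<exists>m. ?P m \<and> f (gens m) = i" unfolding S_def by blast
  then obtain k where k: "\<And>i. i \<in> f ` S \<Longrightarrow> ?P (k i) \<and> f (gens (k i)) = i" by metis
  have "\<forall>i\<in>f ` S. Dom C (k i) \<in> Ob C" using k by auto
  then obtain T j where T: "is_coproduct C (f ` S) (\<lambda>i. Dom C (k i)) T j"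
    using groth sI unfolding grothendieck_def small_coproducts_def by meson
  have "\<forall>(I :: 'u set) X S j. small u I \<longrightarrow> (\<forall>i\<in>I. X i \<in> L) \<longrightarrow> is_coproduct C I X S j \<longrightarrow> S \<in> L"
    using L unfolding localizing_def by blast
  from this[rule_format, OF sI _ T] have TL: "T \<in> L" using k by blast
  have "\<forall>i\<in>f ` S. k i \<in> Hom C (Dom C (k i)) X" using k by auto
  then have "\<exists>!v. v \<in> Hom C T X \<and> (\<forall>i\<in>f ` S. v \<cdot> j i = k i)"
  proof -
    have "\<forall>Y\<in>Ob C. \<forall>g. (\<forall>i\<in>f ` S. g i \<in> Hom C (Dom C (k i)) Y) \<longrightarrow>
        (\<exists>!v. v \<in> Hom C T Y \<and> (\<forall>i\<in>f ` S. v \<cdot> j i = g i))"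
      using T unfolding is_coproduct_def by (elim conjE)
    from this[rule_format, OF X, of k] show ?thesis
      using \<open>\<forall>i\<in>f ` S. k i \<in> Hom C (Dom C (k i)) X\<close> by blast
  qed
  then obtain v where v: "v \<in> Ar C" "Dom C v = T" "Cod C v = X" "\<And>i. i \<in> f ` S \<Longrightarrow> v \<cdot> j i = k i" by auto
  have j: "j i \<in> Ar C \<and> Dom C (j i) = Dom C (k i) \<and> Cod C (j i) = T" if "i \<in> f ` S" for i
    using T that unfolding is_coproduct_def by auto
  obtain m e where me: "is_mono C m" "is_epi C e" "Cod C e = Dom C m" "Dom C e = Dom C v"
    "Cod C m = Cod C v" "m \<cdot> e = v" by (rule image_factorization[OF v(1)])
  have mL: "Dom C m \<in> L" using L_quot[OF me(2)] me v TL by simp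
  obtain q where q: "is_cokernel C m q" using cokernel_ex[of m] me by auto
  note qd = cokernelD[OF q]
  have se: "short_exact C m q" by (rule short_exact_of_mono[OF me(1) q])
  have lm: "lmonic C L q" using kernel_lmonic mono_is_kernel[OF me(1) q] mL by blast
  have qb: "zero (q \<cdot> b)" if b: "?P b" for b
  proof -
    let ?i = "f (gens b)"
    have i: "?i \<in> f ` S" unfolding S_def using b by blast
    have "gens (k ?i) \<in> S" "gens b \<in> S" unfolding S_def using b k[OF i] by blast+
    then have "gens (k ?i) = gens b" using f k[OF i] unfolding inj_on_def by blast
    then obtain w where w: "w \<in> Ar C" "Dom C w = Dom C b" "Cod C w = Dom C (k ?i)" "k ?i \<cdot> w = b"
      using gens_le[of b "k ?i"] b k[OF i] by auto
    have jw: "j ?i \<cdot> w \<in> Ar C" "Cod C (j ?i \<cdot> w) = T" using j[OF i] w by simp_all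
    have "b = v \<cdot> j ?i \<cdot> w" using cmp_eq_left1[OF v(4)[OF i], of w] w j[OF i] v(1-3) by simp
    also have "\<dots> = m \<cdot> e \<cdot> j ?i \<cdot> w"
      by (rule cmp_eq_left1[OF me(6), symmetric]) (use jw me(1-5) v(1-3) in simp_all)
    finally have "q \<cdot> b = q \<cdot> m \<cdot> e \<cdot> j ?i \<cdot> w" by (rule arg_cong)
    also have "\<dots> = (q \<cdot> m) \<cdot> e \<cdot> j ?i \<cdot> w" using jw me(1-5) qd v(1-3) by simp
    finally have eq: "q \<cdot> b = (q \<cdot> m) \<cdot> e \<cdot> j ?i \<cdot> w" .
    show ?thesis unfolding eq by (rule zero_cmp_right[OF qd(4)]) (use jw me(1-5) qd v(1-3) in simp_all)
  qed
  have "lfree C L (Cod C q)" unfolding lfree_def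
  proof (intro ballI impI)
    fix a assume a: "a \<in> Ar C" "Cod C a = Cod C q" "nul a"
    obtain m' e' where me': "is_mono C m'" "is_epi C e'" "Cod C e' = Dom C m'" "Dom C e' = Dom C a"
      "Cod C m' = Cod C a" "m' \<cdot> e' = a" by (rule image_factorization[OF a(1)])
    have "nul m'" using lepicD[OF epi_lepic[OF me'(2)], of m'] me' a by simp
    then have m'L: "Dom C m' \<in> L" using null_mono me' by blast
    \<comment> \<open>The preimage \<open>b\<close> of a subobject \<open>m'\<close> of the quotient
      that lies in \<open>L\<close>. Its projection \<open>p\<close> is null and, as a base change
      of \<open>q\<close>, \<open>lmonic\<close>; so \<open>Dom C b\<close> lies in \<open>L\<close>
      and \<open>q\<close> already kills \<open>b\<close>.\<close>
    obtain b p where pb: "is_pullback C q m' b p" using pullback_ex[of q m'] qd me' a by auto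
    note pd = pullbackD[OF pb]
    have bm: "is_mono C b" using pullback_mono[OF pb me'(1)] .
    have pe: "is_epi C p" using pullback_epi[OF pullback_sym[OF pb] cokernel_epi[OF q]] .
    have "lmonic C L p" using pullback_lmonic[OF pullback_sym[OF pb] lm] .
    then have "nul (Idn C (Dom C p))" using lmonicD[of p "Idn C (Dom C p)"] null_Cod[of p] pd m'L by simp
    then have "Dom C b \<in> L" using null_Idn pd by simp
    moreover have "Cod C b = X" using pd qd me v(3) by simp
    ultimately have "zero (q \<cdot> b)" using qb bm by blast
    then have "zero (m' \<cdot> p)" using pd by simp
    then have "zero m'" using epi_zero[OF pe, of m'] pd by simp
    then have "zero (m' \<cdot> e')" by (rule zero_cmp_right) (use me' in simp_all)
    then show "zero a" using me' by simp
  qed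
  then show thesis using that[OF se me(1) cokernel_epi[OF q]] qd me v mL by simp
qed

end

section \<open>Maximal complements\<close>

text \<open>The category of a preorder \<open>lq\<close> on \<open>I\<close>, with the pair \<open>(i, j)\<close> coded as \<open>h (i, j)\<close>.\<close>

definition preorder_cat :: "('u \<times> 'u \<Rightarrow> 'u) \<Rightarrow> 'u set \<Rightarrow> ('u \<Rightarrow> 'u \<Rightarrow> bool) \<Rightarrow> ('u, 'u) cat" where
  "preorder_cat h I lq = \<lparr>Ob = I, Ar = {h (i, j) | i j. i \<in> I \<and> j \<in> I \<and> lq i j},
     Dom = (\<lambda>a. fst (inv_into UNIV h a)), Cod = (\<lambda>a. snd (inv_into UNIV h a)), Idn = (\<lambda>i. h (i, i)),
     Comp = (\<lambda>b a. h (fst (inv_into UNIV h a), snd (inv_into UNIV h b)))\<rparr>"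

lemma preorder_cat_filtered:
  assumes h: "inj h" and refl: "\<And>i. i \<in> I \<Longrightarrow> lq i i"
    and trans: "\<And>i j k. i \<in> I \<Longrightarrow> j \<in> I \<Longrightarrow> k \<in> I \<Longrightarrow> lq i j \<Longrightarrow> lq j k \<Longrightarrow> lq i k"
    and total: "\<And>i j. i \<in> I \<Longrightarrow> j \<in> I \<Longrightarrow> lq i j \<or> lq j i" and ne: "I \<noteq> {}"
  shows "is_category (preorder_cat h I lq)" "filtered (preorder_cat h I lq)"
proof -
  have [simp]: "inv_into UNIV h (h p) = p" for p using h by simp
  show cat: "is_category (preorder_cat h I lq)"
  proof -
    have comp: "h (i, l) \<in> {h (i, j) | i j. i \<in> I \<and> j \<in> I \<and> lq i j}"
      if "i \<in> I" "j \<in> I" "l \<in> I" "lq i j" "lq j l" for i j l using that trans[of i j l] by blast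
    show ?thesis unfolding is_category_def preorder_cat_def
    proof (intro conjI ballI impI, goal_cases)
      case (4 f g) then show ?case using comp by auto
    qed (use refl in auto)
  qed
  show "filtered (preorder_cat h I lq)" unfolding filtered_def
  proof (intro conjI ballI impI)
    fix i j assume "i \<in> Ob (preorder_cat h I lq)" "j \<in> Ob (preorder_cat h I lq)"
    then have ij: "i \<in> I" "j \<in> I" unfolding preorder_cat_def by simp_all
    have H: "h (a, b) \<in> Hom (preorder_cat h I lq) a b" if "a \<in> I" "b \<in> I" "lq a b" for a b
      using that unfolding preorder_cat_def by auto
    show "\<exists>k\<in>Ob (preorder_cat h I lq). Hom (preorder_cat h I lq) i k \<noteq> {} \<and> Hom (preorder_cat h I lq) j k \<noteq> {}"
    proof (cases "lq i j")
      case True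
      then have "h (i, j) \<in> Hom (preorder_cat h I lq) i j" "h (j, j) \<in> Hom (preorder_cat h I lq) j j"
        using H ij refl by blast+
      moreover have "j \<in> Ob (preorder_cat h I lq)" using ij unfolding preorder_cat_def by simp
      ultimately show ?thesis by blast
    next
      case False
      then have "h (j, i) \<in> Hom (preorder_cat h I lq) j i" "h (i, i) \<in> Hom (preorder_cat h I lq) i i"
        using H ij refl total by blast+
      moreover have "i \<in> Ob (preorder_cat h I lq)" using ij unfolding preorder_cat_def by simp
      ultimately show ?thesis by blast
    qed
  next
    fix s t assume st: "s \<in> Ar (preorder_cat h I lq)" "t \<in> Ar (preorder_cat h I lq)"
      "Dom (preorder_cat h I lq) s = Dom (preorder_cat h I lq) t"
      "Cod (preorder_cat h I lq) s = Cod (preorder_cat h I lq) t"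
    then have "s = t" unfolding preorder_cat_def by auto
    moreover have "Idn (preorder_cat h I lq) (Cod (preorder_cat h I lq) s) \<in> Ar (preorder_cat h I lq)"
      "Dom (preorder_cat h I lq) (Idn (preorder_cat h I lq) (Cod (preorder_cat h I lq) s)) =
        Cod (preorder_cat h I lq) s"
      using st refl unfolding preorder_cat_def by (auto, blast)
    ultimately show "\<exists>w\<in>Ar (preorder_cat h I lq). Dom (preorder_cat h I lq) w = Cod (preorder_cat h I lq) s \<and>
      Comp (preorder_cat h I lq) w s = Comp (preorder_cat h I lq) w t" by blast
  qed (use cat ne in \<open>auto simp: preorder_cat_def\<close>)
qed

context grothendieck_category
begin

text \<open>A chain of subobjects of \<open>X\<close> that \<open>p\<close> embeds in \<open>Y\<close>: by exactness of the colimit of the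
  sequences \<open>K\<^sub>i \<rightarrow> Y \<rightarrow> Y/K\<^sub>i\<close>, \<open>p\<close> also embeds the colimit.\<close>

lemma chain_bound:
  fixes I :: "'u set" and lq :: "'u \<Rightarrow> 'u \<Rightarrow> bool" and k :: "'u \<Rightarrow> 'm" and tr :: "'u \<Rightarrow> 'u \<Rightarrow> 'm"
  assumes p: "p \<in> Ar C" and sI: "small u I"
    and refl: "\<And>i. i \<in> I \<Longrightarrow> lq i i"
    and trans: "\<And>i j k. i \<in> I \<Longrightarrow> j \<in> I \<Longrightarrow> k \<in> I \<Longrightarrow> lq i j \<Longrightarrow> lq j k \<Longrightarrow> lq i k"
    and total: "\<And>i j. i \<in> I \<Longrightarrow> j \<in> I \<Longrightarrow> lq i j \<or> lq j i" and ne: "I \<noteq> {}"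
    and k: "\<And>i. i \<in> I \<Longrightarrow> k i \<in> Ar C \<and> Cod C (k i) = Dom C p \<and> is_mono C (p \<cdot> k i)"
    and tr: "\<And>i j. i \<in> I \<Longrightarrow> j \<in> I \<Longrightarrow> lq i j \<Longrightarrow>
      tr i j \<in> Ar C \<and> Dom C (tr i j) = Dom C (k i) \<and> Cod C (tr i j) = Dom C (k j) \<and> k j \<cdot> tr i j = k i"
  obtains K l where "K \<in> Ar C" "Cod C K = Dom C p" "is_mono C (p \<cdot> K)"
    "\<And>i. i \<in> I \<Longrightarrow> l i \<in> Ar C \<and> Cod C (l i) = Dom C K \<and> K \<cdot> l i = k i"
proof -
  obtain h :: "'u \<times> 'u \<Rightarrow> 'u" where h: "inj h" using universe_pairing[OF univ] .
  have [simp]: "inv_into UNIV h (h x) = x" for x using h by simp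
  define J where "J = preorder_cat h I lq"
  have J: "is_category J" "filtered J" unfolding J_def
    by (rule preorder_cat_filtered[OF h]; use refl trans total ne in blast)+
  have J_simps: "Ob J = I" "\<And>i j. Dom J (h (i, j)) = i" "\<And>i j. Cod J (h (i, j)) = j"
    "\<And>i. Idn J i = h (i, i)" "\<And>i j k l. Comp J (h (k, l)) (h (i, j)) = h (i, l)"
    unfolding J_def preorder_cat_def by simp_all
  have J_Ar: "a \<in> Ar J \<longleftrightarrow> (\<exists>i\<in>I. \<exists>j\<in>I. lq i j \<and> a = h (i, j))" for a
    unfolding J_def preorder_cat_def by auto
  have sJ: "small u (Ob J)" "small u (Ar J)"
  proof -
    show "small u (Ob J)" using sI J_simps by simp
    have "Ar J \<subseteq> h ` (I \<times> I)" using J_Ar by auto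
    then show "small u (Ar J)" using small_subset small_pairs[OF univ sI] by blast
  qed
  have exact: "(\<forall>F. is_functor J C F \<longrightarrow> (\<exists>A l. is_colimit J C F A l)) \<and>
        (\<forall>F G H \<alpha> \<beta> A l B m K n a b.
           nat_trans J C F G \<alpha> \<longrightarrow> nat_trans J C G H \<beta> \<longrightarrow>
           (\<forall>j\<in>Ob J. short_exact C (\<alpha> j) (\<beta> j)) \<longrightarrow>
           is_colimit J C F A l \<longrightarrow> is_colimit J C G B m \<longrightarrow> is_colimit J C H K n \<longrightarrow>
           a \<in> Hom C A B \<longrightarrow> (\<forall>j\<in>Ob J. Comp C a (l j) = Comp C (m j) (\<alpha> j)) \<longrightarrow>
           b \<in> Hom C B K \<longrightarrow> (\<forall>j\<in>Ob J. Comp C b (m j) = Comp C (n j) (\<beta> j)) \<longrightarrow>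
           short_exact C a b)"
    using groth J(2) sJ unfolding grothendieck_def exact_filtered_colimits_def by blast
  let ?Y = "Cod C p"
  have pk: "p \<cdot> k i \<in> Ar C" "Dom C (p \<cdot> k i) = Dom C (k i)" "Cod C (p \<cdot> k i) = ?Y"
    if "i \<in> I" for i using k[OF that] p by simp_all
  have kmono: "is_mono C (k i)" if "i \<in> I" for i
    using mono_of_cmp[of p "k i"] k[OF that] p by simp
  have "\<forall>i\<in>I. \<exists>c. is_cokernel C (p \<cdot> k i) c" using cokernel_ex pk by blast
  then obtain c where c: "\<And>i. i \<in> I \<Longrightarrow> is_cokernel C (p \<cdot> k i) (c i)" by metis
  have cd: "c i \<in> Ar C" "Dom C (c i) = ?Y" "zero (c i \<cdot> p \<cdot> k i)" if "i \<in> I" for i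
    using cokernelD[OF c[OF that]] pk[OF that] by simp_all
  \<comment> \<open>Growing subobjects have quotients that map onwards, which makes the cokernels a
    diagram over the same index category.\<close>
  have "\<forall>i\<in>I. \<forall>j\<in>I. \<exists>w. lq i j \<longrightarrow> w \<in> Ar C \<and> Dom C w = Cod C (c i) \<and> Cod C w = Cod C (c j) \<and> w \<cdot> c i = c j"
  proof (intro ballI)
    fix i j assume i: "i \<in> I" and j: "j \<in> I"
    show "\<exists>w. lq i j \<longrightarrow> w \<in> Ar C \<and> Dom C w = Cod C (c i) \<and> Cod C w = Cod C (c j) \<and> w \<cdot> c i = c j"
    proof (cases "lq i j")
      case True
      note t = tr[OF i j True]
      have "c j \<cdot> p \<cdot> k i = (c j \<cdot> p \<cdot> k j) \<cdot> tr i j" using t cd[OF j] k[OF j] p by simp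
      then have "zero (c j \<cdot> p \<cdot> k i)" using zero_cmp_right[OF cd(3)[OF j], of "tr i j"] t cd[OF j] k[OF j] p by simp
      then obtain w where "w \<in> Ar C" "Cod C w = Cod C (c j)" "Dom C w = Cod C (c i)" "w \<cdot> c i = c j"
        by (rule cokernel_desc[OF c[OF i]]) (use cd[OF j] pk[OF i] in simp_all)
      then show ?thesis by blast
    qed blast
  qed
  then obtain ct where ct: "\<And>i j. i \<in> I \<Longrightarrow> j \<in> I \<Longrightarrow> lq i j \<Longrightarrow> ct i j \<in> Ar C \<and> Dom C (ct i j) = Cod C (c i) \<and>
    Cod C (ct i j) = Cod C (c j) \<and> ct i j \<cdot> c i = c j" by metis
  define F :: "('u, 'u, 'o, 'm) ftr" where
    "F = \<lparr>fob = (\<lambda>i. Dom C (k i)), far = (\<lambda>a. tr (Dom J a) (Cod J a))\<rparr>"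
  define Gc :: "('u, 'u, 'o, 'm) ftr" where "Gc = \<lparr>fob = (\<lambda>i. ?Y), far = (\<lambda>a. Idn C ?Y)\<rparr>"
  define H :: "('u, 'u, 'o, 'm) ftr" where
    "H = \<lparr>fob = (\<lambda>i. Cod C (c i)), far = (\<lambda>a. ct (Dom J a) (Cod J a))\<rparr>"
  have Y: "?Y \<in> Ob C" using p by simp
  have F: "is_functor J C F" unfolding is_functor_def
  proof (intro conjI ballI impI)
    fix i assume "i \<in> Ob J" then have i: "i \<in> I" using J_simps by simp
    show "fob F i \<in> Ob C" unfolding F_def using k[OF i] by simp
    note t = tr[OF i i refl[OF i]]
    have "tr i i = Idn C (Dom C (k i))"
      by (rule monoD[OF kmono[OF i]]) (use t k[OF i] in simp_all)
    then show "far F (Idn J i) = Idn C (fob F i)" unfolding F_def J_simps by (simp add: J_simps)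
  next
    fix a assume "a \<in> Ar J"
    then obtain i j where a: "i \<in> I" "j \<in> I" "lq i j" "a = h (i, j)" using J_Ar by blast
    show "far F a \<in> Hom C (fob F (Dom J a)) (fob F (Cod J a))"
      unfolding F_def a using tr[OF a(1-3)] by (simp add: J_simps)
    fix b assume "b \<in> Ar J" and ab: "Cod J a = Dom J b"
    then obtain j' l where b: "j' \<in> I" "l \<in> I" "lq j' l" "b = h (j', l)" using J_Ar by blast
    then have [simp]: "j' = j" using ab a J_simps by simp
    note b = b[unfolded \<open>j' = j\<close>]
    have il: "lq i l" using trans a b by blast
    have "tr i l = tr j l \<cdot> tr i j"
    proof (rule monoD[OF kmono[OF b(2)]])
      have "k l \<cdot> tr j l \<cdot> tr i j = k j \<cdot> tr i j"
        by (rule cmp_eq_left1) (use tr[OF a(1-3)] tr[OF b(1-3)] k[OF b(2)] in simp_all)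
      then show "k l \<cdot> tr i l = k l \<cdot> tr j l \<cdot> tr i j" using tr[OF a(1) b(2) il] tr[OF a(1-3)] by simp
    qed (use tr[OF a(1) b(2) il] tr[OF a(1-3)] tr[OF b(1-3)] in simp_all)
    then show "far F (Comp J b a) = Comp C (far F b) (far F a)"
      unfolding F_def a b by (simp add: J_simps)
  qed (use J cat in simp_all)
  have Gf: "is_functor J C Gc" unfolding is_functor_def Gc_def using J cat Y by simp
  have H: "is_functor J C H" unfolding is_functor_def
  proof (intro conjI ballI impI)
    fix i assume "i \<in> Ob J" then have i: "i \<in> I" using J_simps by simp
    show "fob H i \<in> Ob C" unfolding H_def using cd[OF i] by simp
    note t = ct[OF i i refl[OF i]]
    have "ct i i = Idn C (Cod C (c i))"
      by (rule epiD[OF cokernel_epi[OF c[OF i]]]) (use t cd[OF i] in simp_all)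
    then show "far H (Idn J i) = Idn C (fob H i)" unfolding H_def J_simps by (simp add: J_simps)
  next
    fix a assume "a \<in> Ar J"
    then obtain i j where a: "i \<in> I" "j \<in> I" "lq i j" "a = h (i, j)" using J_Ar by blast
    show "far H a \<in> Hom C (fob H (Dom J a)) (fob H (Cod J a))"
      unfolding H_def a using ct[OF a(1-3)] by (simp add: J_simps)
    fix b assume "b \<in> Ar J" and ab: "Cod J a = Dom J b"
    then obtain j' l where b: "j' \<in> I" "l \<in> I" "lq j' l" "b = h (j', l)" using J_Ar by blast
    then have [simp]: "j' = j" using ab a J_simps by simp
    note b = b[unfolded \<open>j' = j\<close>]
    have il: "lq i l" using trans a b by blast
    have "ct i l = ct j l \<cdot> ct i j"
      by (rule epiD[OF cokernel_epi[OF c[OF a(1)]]])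
        (use ct[OF a(1) b(2) il] ct[OF a(1-3)] ct[OF b(1-3)] cd[OF a(1)] in simp_all)
    then show "far H (Comp J b a) = Comp C (far H b) (far H a)"
      unfolding H_def a b by (simp add: J_simps)
  qed (use J cat in simp_all)
  have \<alpha>: "nat_trans J C F Gc (\<lambda>i. p \<cdot> k i)" unfolding nat_trans_def
  proof (intro conjI ballI impI)
    fix i assume "i \<in> Ob J" then have i: "i \<in> I" using J_simps by simp
    show "p \<cdot> k i \<in> Hom C (fob F i) (fob Gc i)" unfolding F_def Gc_def using pk[OF i] by simp
  next
    fix a assume "a \<in> Ar J"
    then obtain i j where a: "i \<in> I" "j \<in> I" "lq i j" "a = h (i, j)" using J_Ar by blast
    note t = tr[OF a(1-3)]
    have "(p \<cdot> k j) \<cdot> tr i j = p \<cdot> k i" using t k[OF a(2)] p by simp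
    then show "far Gc a \<cdot> p \<cdot> k (Dom J a) = (p \<cdot> k (Cod J a)) \<cdot> far F a"
      unfolding F_def Gc_def a using pk[OF a(1)] by (simp add: J_simps del: assoc)
  qed (use F Gf in simp_all)
  have \<beta>: "nat_trans J C Gc H c" unfolding nat_trans_def
  proof (intro conjI ballI impI)
    fix i assume "i \<in> Ob J" then have i: "i \<in> I" using J_simps by simp
    show "c i \<in> Hom C (fob Gc i) (fob H i)" unfolding H_def Gc_def using cd[OF i] by simp
  next
    fix a assume "a \<in> Ar J"
    then obtain i j where a: "i \<in> I" "j \<in> I" "lq i j" "a = h (i, j)" using J_Ar by blast
    then show "far H a \<cdot> c (Dom J a) = c (Cod J a) \<cdot> far Gc a"
      unfolding H_def Gc_def using ct[OF a(1-3)] cd[OF a(2)] by (simp add: J_simps)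
  qed (use H Gf in simp_all)
  have se: "\<forall>i\<in>Ob J. short_exact C (p \<cdot> k i) (c i)"
    using short_exact_of_mono k c J_simps by metis
  obtain A l where Al: "is_colimit J C F A l" using exact F by blast
  obtain D n where Dn: "is_colimit J C H D n" using exact H by blast
  have A: "A \<in> Ob C" and l: "\<And>i. i \<in> I \<Longrightarrow> l i \<in> Ar C \<and> Dom C (l i) = Dom C (k i) \<and> Cod C (l i) = A"
    using Al unfolding is_colimit_def is_cocone_def F_def J_simps by auto
  have D: "D \<in> Ob C" and n: "\<And>i. i \<in> I \<Longrightarrow> n i \<in> Ar C \<and> Dom C (n i) = Cod C (c i) \<and> Cod C (n i) = D"
    and nt: "\<And>i j. i \<in> I \<Longrightarrow> j \<in> I \<Longrightarrow> lq i j \<Longrightarrow> n j \<cdot> ct i j = n i"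
  proof -
    have cc: "is_cocone J C H D n" using Dn unfolding is_colimit_def by blast
    then show "D \<in> Ob C" "\<And>i. i \<in> I \<Longrightarrow> n i \<in> Ar C \<and> Dom C (n i) = Cod C (c i) \<and> Cod C (n i) = D"
      unfolding is_cocone_def H_def J_simps by auto
    fix i j assume "i \<in> I" "j \<in> I" "lq i j"
    then have "h (i, j) \<in> Ar J" using J_Ar by blast
    then have "n (Cod J (h (i, j))) \<cdot> far H (h (i, j)) = n (Dom J (h (i, j)))"
      using cc unfolding is_cocone_def by blast
    then show "n j \<cdot> ct i j = n i" unfolding H_def by (simp add: J_simps)
  qed
  \<comment> \<open>Any two indices are comparable and there is at least one, so all components of a
    cocone on the constant diagram coincide.\<close>
  have Gcolim: "is_colimit J C Gc ?Y (\<lambda>i. Idn C ?Y)"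
    unfolding is_colimit_def
  proof (intro conjI allI impI)
    show "is_cocone J C Gc ?Y (\<lambda>i. Idn C ?Y)" unfolding is_cocone_def Gc_def using Y by simp
    fix T f assume cc: "is_cocone J C Gc T f"
    have f: "f i \<in> Hom C ?Y T" if "i \<in> I" for i using cc that unfolding is_cocone_def Gc_def J_simps by auto
    have eq1: "f i = f j" if "i \<in> I" "j \<in> I" "lq i j" for i j
    proof -
      have "h (i, j) \<in> Ar J" using J_Ar that by blast
      then have "f (Cod J (h (i, j))) \<cdot> far Gc (h (i, j)) = f (Dom J (h (i, j)))"
        using cc unfolding is_cocone_def by blast
      then show ?thesis using f[OF that(2)] unfolding Gc_def by (simp add: J_simps)
    qed
    obtain i0 where i0: "i0 \<in> I" using ne by blast
    have eq0: "f i0 = f i" if "i \<in> I" for i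
      using eq1[OF i0 that] eq1[OF that i0] total[OF i0 that] by auto
    show "\<exists>!v. v \<in> Hom C ?Y T \<and> (\<forall>j\<in>Ob J. v \<cdot> Idn C ?Y = f j)"
    proof (rule ex1I[of _ "f i0"])
      have "f i0 \<cdot> Idn C ?Y = f i0" using f[OF i0] by simp
      then show "f i0 \<in> Hom C ?Y T \<and> (\<forall>j\<in>Ob J. f i0 \<cdot> Idn C ?Y = f j)"
        using f[OF i0] eq0 unfolding J_simps by metis
      fix v assume "v \<in> Hom C ?Y T \<and> (\<forall>j\<in>Ob J. v \<cdot> Idn C ?Y = f j)"
      then have "v \<in> Hom C ?Y T" "v \<cdot> Idn C ?Y = f i0" using i0 unfolding J_simps by blast+
      then show "v = f i0" by simp
    qed
  qed (rule Gf)
  have univF: "\<exists>!v. v \<in> Hom C A T \<and> (\<forall>j\<in>I. v \<cdot> l j = f j)"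
    if "T \<in> Ob C" "\<And>i. i \<in> I \<Longrightarrow> f i \<in> Hom C (Dom C (k i)) T"
      "\<And>i j. i \<in> I \<Longrightarrow> j \<in> I \<Longrightarrow> lq i j \<Longrightarrow> f j \<cdot> tr i j = f i" for T f
  proof -
    have "is_cocone J C F T f" unfolding is_cocone_def
    proof (intro conjI ballI)
      fix a assume "a \<in> Ar J"
      then obtain i j where a: "i \<in> I" "j \<in> I" "lq i j" "a = h (i, j)" using J_Ar by blast
      then show "f (Cod J a) \<cdot> far F a = f (Dom J a)" using that(3) unfolding F_def by (simp add: J_simps)
    qed (use that in \<open>auto simp: F_def J_simps\<close>)
    then show ?thesis using Al unfolding is_colimit_def J_simps by blast
  qed
  have X: "Dom C p \<in> Ob C" using p by simp
  obtain K where K: "K \<in> Hom C A (Dom C p)" "\<And>i. i \<in> I \<Longrightarrow> K \<cdot> l i = k i"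
  proof -
    have "\<exists>!v. v \<in> Hom C A (Dom C p) \<and> (\<forall>j\<in>I. v \<cdot> l j = k j)"
    proof (rule univF[OF X])
      show "k i \<in> Hom C (Dom C (k i)) (Dom C p)" if "i \<in> I" for i using k[OF that] by simp
      show "k j \<cdot> tr i j = k i" if "i \<in> I" "j \<in> I" "lq i j" for i j using tr[OF that] by simp
    qed
    then show thesis using that by blast
  qed
  have "(p \<cdot> K) \<cdot> l i = Idn C ?Y \<cdot> p \<cdot> k i" if "i \<in> I" for i
    using K(1) K(2)[OF that] l[OF that] p pk[OF that] by simp
  then have pK: "\<forall>i\<in>Ob J. (p \<cdot> K) \<cdot> l i = Idn C ?Y \<cdot> p \<cdot> k i" using J_simps by simp
  obtain i0 where i0: "i0 \<in> I" using ne by blast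
  \<comment> \<open>The arrow induced on colimits by the cokernels. The composites
    \<open>n i \<cdot> c i\<close> do not depend on \<open>i\<close>, so any index may define
    it.\<close>
  define b where "b = n i0 \<cdot> c i0"
  have nc: "n i \<cdot> c i = n j \<cdot> c j" if "i \<in> I" "j \<in> I" "lq i j" for i j
  proof -
    have "n i \<cdot> c i = n j \<cdot> ct i j \<cdot> c i"
      using cmp_eq_left1[OF nt[OF that], of "c i"] ct[OF that] n[OF that(2)] cd[OF that(1)] by simp
    then show ?thesis using ct[OF that] by simp
  qed
  have "b \<cdot> Idn C ?Y = n i \<cdot> c i" if "i \<in> I" for i
  proof -
    have "b = n i \<cdot> c i" unfolding b_def using nc[OF i0 that] nc[OF that i0] total[OF i0 that] by metis
    then show ?thesis using n[OF that] cd[OF that] by simp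
  qed
  then have b2: "\<forall>i\<in>Ob J. b \<cdot> Idn C ?Y = n i \<cdot> c i" using J_simps by simp
  have "b \<in> Hom C ?Y D" "p \<cdot> K \<in> Hom C A ?Y" using n[OF i0] cd[OF i0] K(1) p unfolding b_def by simp_all
  then have "short_exact C (p \<cdot> K) b" using exact \<alpha> \<beta> se Al Gcolim Dn pK b2 by blast
  then have "is_mono C (p \<cdot> K)" using kernel_mono unfolding short_exact_def by blast
  then show thesis using that[of K l] K l by simp
qed

text \<open>That \<open>p \<cdot> k\<close> is monic says that the subobject \<open>k\<close> meets
  the kernel of \<open>p\<close> in zero, so \<open>k\<close> is maximal with this property. Zorn is
  applied to the sets \<open>gens k\<close> under inclusion: they identify monos representing the
  same subobject, and they form a small set.\<close>

lemma maximal_complement: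
  assumes p: "p \<in> Ar C"
  obtains k where "k \<in> Ar C" "Cod C k = Dom C p" "is_mono C (p \<cdot> k)"
    "\<forall>k' w. k' \<in> Ar C \<longrightarrow> Cod C k' = Dom C p \<longrightarrow> is_mono C (p \<cdot> k') \<longrightarrow> w \<in> Ar C \<longrightarrow>
      Cod C w = Dom C k' \<longrightarrow> k' \<cdot> w = k \<longrightarrow>
      (\<exists>v\<in>Ar C. Dom C v = Dom C k' \<and> Cod C v = Dom C k \<and> k \<cdot> v = k')"
proof -
  let ?P = "\<lambda>k. k \<in> Ar C \<and> Cod C k = Dom C p \<and> is_mono C (p \<cdot> k)"
  define S where "S = gens ` {k. ?P k}"
  have SH: "S \<subseteq> Pow (Hom C G (Dom C p))" unfolding S_def using gens_Hom by force
  have mono: "is_mono C k" if "?P k" for k using mono_of_cmp[of p k] that p by simp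
  have "\<exists>M\<in>S. \<forall>X\<in>S. M \<subseteq> X \<longrightarrow> X = M"
  proof (rule subset_Zorn)
    fix Ch assume Ch: "subset.chain S Ch"
    show "\<exists>U\<in>S. \<forall>X\<in>Ch. X \<subseteq> U"
    proof (cases "Ch = {}")
      case True
      \<comment> \<open>The empty chain is bounded by the zero subobject.\<close>
      obtain Z where Z: "zero_object C Z" by (rule zero_ob)
      then obtain k where k: "k \<in> Hom C Z (Dom C p)" using p unfolding zero_object_def by (metis Dom_Cod_Ob(1))
      have "is_mono C (p \<cdot> k)" unfolding is_mono_def
      proof (intro conjI ballI impI)
        show "p \<cdot> k \<in> Ar C" using p k by simp
        fix g h assume gh: "g \<in> Ar C" "h \<in> Ar C" "Dom C g = Dom C h" "Cod C g = Dom C (p \<cdot> k)"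
          "Cod C h = Dom C (p \<cdot> k)"
        have "Dom C g \<in> Ob C" using gh by simp
        then have "\<exists>!f. f \<in> Hom C (Dom C g) Z" using Z unfolding zero_object_def by blast
        moreover have "g \<in> Hom C (Dom C g) Z" "h \<in> Hom C (Dom C g) Z" using gh p k by simp_all
        ultimately show "g = h" by blast
      qed
      then have "gens k \<in> S" unfolding S_def using k by auto
      then show ?thesis using True by blast
    next
      case False
      have ChS: "Ch \<subseteq> S" and tot: "\<And>A B. A \<in> Ch \<Longrightarrow> B \<in> Ch \<Longrightarrow> A \<subseteq> B \<or> B \<subseteq> A"
        using Ch unfolding subset.chain_def subset_chain_def by blast+
      have sCh: "small u Ch" using small_subset small_gens p ChS SH by (meson Dom_Cod_Ob(1) subset_trans)
      obtain f :: "'m set \<Rightarrow> 'u" where f: "inj_on f Ch" using small_inj[OF sCh] .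
      \<comment> \<open>The chain is reindexed by elements of \<open>'u\<close>; \<open>fi\<close>
        recovers a member from its index, and inclusion of members is the preorder.\<close>
      define fi where "fi = inv_into Ch f"
      have fi: "fi i \<in> Ch" if "i \<in> f ` Ch" for i unfolding fi_def using that by (rule inv_into_into)
      have fif: "fi (f A) = A" if "A \<in> Ch" for A unfolding fi_def using inv_into_f_f[OF f that] .
      have "\<forall>i\<in>f ` Ch. \<exists>k. ?P k \<and> gens k = fi i" using fi ChS unfolding S_def by blast
      then obtain k where k: "\<And>i. i \<in> f ` Ch \<Longrightarrow> ?P (k i) \<and> gens (k i) = fi i" by metis
      have "\<forall>i\<in>f ` Ch. \<forall>j\<in>f ` Ch. \<exists>w. fi i \<subseteq> fi j \<longrightarrow>
        w \<in> Ar C \<and> Dom C w = Dom C (k i) \<and> Cod C w = Dom C (k j) \<and> k j \<cdot> w = k i"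
      proof (intro ballI)
        fix i j assume i: "i \<in> f ` Ch" and j: "j \<in> f ` Ch"
        show "\<exists>w. fi i \<subseteq> fi j \<longrightarrow> w \<in> Ar C \<and> Dom C w = Dom C (k i) \<and> Cod C w = Dom C (k j) \<and> k j \<cdot> w = k i"
        proof (cases "fi i \<subseteq> fi j")
          case True
          obtain w where "w \<in> Ar C" "Dom C w = Dom C (k i)" "Cod C w = Dom C (k j)" "k j \<cdot> w = k i"
            by (rule gens_le[of "k i" "k j"]) (use True k[OF i] k[OF j] mono[of "k j"] in simp_all)
          then show ?thesis by blast
        qed blast
      qed
      then obtain tr where tr: "\<And>i j. i \<in> f ` Ch \<Longrightarrow> j \<in> f ` Ch \<Longrightarrow> fi i \<subseteq> fi j \<Longrightarrow>
        tr i j \<in> Ar C \<and> Dom C (tr i j) = Dom C (k i) \<and> Cod C (tr i j) = Dom C (k j) \<and> k j \<cdot> tr i j = k i"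
        by metis
      obtain K l where K: "K \<in> Ar C" "Cod C K = Dom C p" "is_mono C (p \<cdot> K)"
        "\<And>i. i \<in> f ` Ch \<Longrightarrow> l i \<in> Ar C \<and> Cod C (l i) = Dom C K \<and> K \<cdot> l i = k i"
      proof (rule chain_bound[where I = "f ` Ch" and lq = "\<lambda>i j. fi i \<subseteq> fi j" and k = k and tr = tr, OF p])
        show "small u (f ` Ch)" using small_image[OF sCh] .
        show "f ` Ch \<noteq> {}" using False by blast
        show "fi i \<subseteq> fi j \<or> fi j \<subseteq> fi i" if "i \<in> f ` Ch" "j \<in> f ` Ch" for i j
          using tot fi that by blast
        show "tr i j \<in> Ar C \<and> Dom C (tr i j) = Dom C (k i) \<and> Cod C (tr i j) = Dom C (k j) \<and> k j \<cdot> tr i j = k i"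
          if "i \<in> f ` Ch" "j \<in> f ` Ch" "fi i \<subseteq> fi j" for i j using tr that by blast
      qed (use k in \<open>blast+\<close>)
      have "gens K \<in> S" unfolding S_def using K by blast
      moreover have "A \<subseteq> gens K" if A: "A \<in> Ch" for A
      proof -
        have i: "f A \<in> f ` Ch" using A by blast
        have "A = gens (k (f A))" using k[OF i] fif[OF A] by simp
        also have "\<dots> \<subseteq> gens K" using gens_cmp[of K "l (f A)"] K(1) K(4)[OF i] by simp
        finally show ?thesis .
      qed
      ultimately show ?thesis by blast
    qed
  qed
  then obtain k where k: "?P k" and max: "\<And>k'. ?P k' \<Longrightarrow> gens k \<subseteq> gens k' \<Longrightarrow> gens k' = gens k"
    unfolding S_def by blast
  show thesis
  proof (rule that[of k], goal_cases)
    case 4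
    show ?case
    proof (intro allI impI)
    fix k' w assume k': "k' \<in> Ar C" "Cod C k' = Dom C p" "is_mono C (p \<cdot> k')" "w \<in> Ar C"
      "Cod C w = Dom C k'" "k' \<cdot> w = k"
    then have "gens k \<subseteq> gens k'" using gens_cmp[of k' w] by simp
    then have "gens k' = gens k" using max[of k'] k' by blast
    then have le: "gens k' \<subseteq> gens k" by simp
    obtain v where "v \<in> Ar C" "Dom C v = Dom C k'" "Cod C v = Dom C k" "k \<cdot> v = k'"
      by (rule gens_le[of k' k]) (use k k' mono[of k] le in simp_all)
    then show "\<exists>v\<in>Ar C. Dom C v = Dom C k' \<and> Cod C v = Dom C k \<and> k \<cdot> v = k'" by blast
    qed
  qed (use k in auto)
qed

end

section \<open>Stable localizing subcategories and their join\<close>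

lemma (in abelian_category) lfree_mono:
  assumes "lfree C L Y" "is_mono C m" "Cod C m = Y" "serre_subcategory C add z L"
  shows "lfree C L (Dom C m)"
  unfolding lfree_def
proof (intro ballI impI)
  interpret serre_subcategory C add z L by fact
  fix a assume a: "a \<in> Ar C" "Cod C a = Dom C m" "null C L a"
  have "null C L (m \<cdot> a)" by (rule null_cmp_left[OF a(3)]) (use a assms in simp_all)
  then have "zero (m \<cdot> a)" using assms a unfolding lfree_def by simp
  then show "zero a" using mono_zero[OF assms(2), of a] a by simp
qed

section \<open>Monic refinements and reversal of extensions\<close>

context grothendieck_category
begin

lemma stable_complement:
  assumes L: "stable_localizing u C L" and \<kappa>: "is_mono C \<kappa>" "Dom C \<kappa> \<in> L" and p: "is_cokernel C \<kappa> p"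
  obtains k where "is_mono C k" "Cod C k = Cod C \<kappa>" "quot_inverted C L k" "is_mono C (p \<cdot> k)"
proof -
  have loc: "localizing u C L" using L unfolding stable_localizing_def by blast
  interpret serre_subcategory C add z L by (rule localizing_serre[OF loc])
  note pd = cokernelD[OF p]
  have kerp: "is_kernel C p \<kappa>" by (rule mono_is_kernel[OF \<kappa>(1) p])
  obtain k where k: "k \<in> Ar C" "Cod C k = Dom C p" "is_mono C (p \<cdot> k)" and
    max: "\<forall>k' w. k' \<in> Ar C \<longrightarrow> Cod C k' = Dom C p \<longrightarrow> is_mono C (p \<cdot> k') \<longrightarrow> w \<in> Ar C \<longrightarrow>
      Cod C w = Dom C k' \<longrightarrow> k' \<cdot> w = k \<longrightarrow>
      (\<exists>v\<in>Ar C. Dom C v = Dom C k' \<and> Cod C v = Dom C k \<and> k \<cdot> v = k')"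
    using maximal_complement[OF pd(2)] .
  have km: "is_mono C k" using mono_of_cmp[of p k] k pd by simp
  obtain q where q: "is_cokernel C k q" using cokernel_ex k by blast
  note qd = cokernelD[OF q]
  have kerq: "is_kernel C q k" by (rule mono_is_kernel[OF km q])
  have c\<kappa>: "Cod C \<kappa> = Dom C q" using qd k pd by simp
  have \<kappa>a: "\<kappa> \<in> Ar C" using \<kappa> by simp
  have "is_mono C (q \<cdot> \<kappa>)"
  proof (subst mono_iff)
    show "q \<cdot> \<kappa> \<in> Ar C" using \<kappa> qd c\<kappa> by simp
    show "\<forall>x\<in>Ar C. Cod C x = Dom C (q \<cdot> \<kappa>) \<longrightarrow> zero ((q \<cdot> \<kappa>) \<cdot> x) \<longrightarrow> zero x"
    proof (intro ballI impI)
      fix x assume x: "x \<in> Ar C" "Cod C x = Dom C (q \<cdot> \<kappa>)" "zero ((q \<cdot> \<kappa>) \<cdot> x)"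
      have cx: "Cod C x = Dom C \<kappa>" using x \<kappa> qd c\<kappa> by simp
      have "zero (q \<cdot> \<kappa> \<cdot> x)" using x cx \<kappa> qd c\<kappa> by simp
      then obtain y where y: "y \<in> Ar C" "Dom C y = Dom C (\<kappa> \<cdot> x)" "Cod C y = Dom C k" "k \<cdot> y = \<kappa> \<cdot> x"
        by (rule kernel_lift[OF kerq]) (use x cx \<kappa> c\<kappa> in simp_all)
      have "(p \<cdot> k) \<cdot> y = (p \<cdot> \<kappa>) \<cdot> x" using y x(1) cx k(1,2) pd \<kappa> by simp
      moreover have "zero ((p \<cdot> \<kappa>) \<cdot> x)" by (rule zero_cmp_right[OF pd(4)]) (use x cx \<kappa> pd in simp_all)
      ultimately have "zero ((p \<cdot> k) \<cdot> y)" by simp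
      then have "zero y" by (rule mono_zero[OF k(3)]) (use y k(1,2) pd in simp_all)
      then have "zero (k \<cdot> y)" using k(1) y(3) by simp
      then have "zero (\<kappa> \<cdot> x)" using y by simp
      then show "zero x" by (rule mono_zero[OF \<kappa>(1)]) (use x cx in simp_all)
    qed
  qed
  \<comment> \<open>Essentiality from maximality: the kernel \<open>k'\<close> of
    \<open>g \<cdot> q\<close> contains \<open>k\<close> and still meets \<open>\<kappa>\<close> in
    zero, hence factors through \<open>k\<close> and is killed by \<open>q\<close>. An arrow
    \<open>x\<close> killed by \<open>g\<close> lifts to \<open>k'\<close> after the epic base
    change \<open>q'\<close>, so it vanishes.\<close>
  moreover have "is_mono C g" if g: "g \<in> Ar C" "Dom C g = Cod C (q \<cdot> \<kappa>)" "is_mono C (g \<cdot> q \<cdot> \<kappa>)" for g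
    unfolding mono_iff[OF g(1)]
  proof (intro ballI impI)
    have dg: "Dom C g = Cod C q" using g \<kappa> qd c\<kappa> by simp
    fix x assume x: "x \<in> Ar C" "Cod C x = Dom C g" "zero (g \<cdot> x)"
    obtain q' x' where pb: "is_pullback C x q q' x'" using pullback_ex[of x q] x qd dg by auto
    note pbd = pullbackD[OF pb]
    obtain k' where k': "is_kernel C (g \<cdot> q) k'" using kernel_ex[of "g \<cdot> q"] g(1) dg qd by auto
    note kd' = kernelD[OF k']
    have ck': "Cod C k' = Dom C q" using kd' g(1) dg qd by simp
    have "is_mono C (p \<cdot> k')"
    proof (subst mono_iff)
      show "p \<cdot> k' \<in> Ar C" using kd' ck' pd qd k by simp
      show "\<forall>y\<in>Ar C. Cod C y = Dom C (p \<cdot> k') \<longrightarrow> zero ((p \<cdot> k') \<cdot> y) \<longrightarrow> zero y"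
      proof (intro ballI impI)
        fix y assume y: "y \<in> Ar C" "Cod C y = Dom C (p \<cdot> k')" "zero ((p \<cdot> k') \<cdot> y)"
        have cy: "Cod C y = Dom C k'" using y kd' ck' pd qd k by simp
        have "zero (p \<cdot> k' \<cdot> y)" using y cy kd'(2) ck' pd qd k by simp
        then obtain w where w: "w \<in> Ar C" "Dom C w = Dom C (k' \<cdot> y)" "Cod C w = Dom C \<kappa>" "\<kappa> \<cdot> w = k' \<cdot> y"
          by (rule kernel_lift[OF kerp]) (use y cy kd'(2) ck' pd qd k in simp_all)
        have "(g \<cdot> q \<cdot> \<kappa>) \<cdot> w = ((g \<cdot> q) \<cdot> k') \<cdot> y"
          using w y(1) cy kd'(2) ck' g(1) dg qd \<kappa>a c\<kappa> by simp
        moreover have "zero (((g \<cdot> q) \<cdot> k') \<cdot> y)"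
          by (rule zero_cmp_right[OF kd'(4)]) (use y(1) cy kd'(2) ck' g(1) dg qd in simp_all)
        ultimately have "zero ((g \<cdot> q \<cdot> \<kappa>) \<cdot> w)" by simp
        then have "zero w" by (rule mono_zero[OF g(3)]) (use w g(1) dg qd \<kappa>a c\<kappa> in simp_all)
        then have "zero (\<kappa> \<cdot> w)" using \<kappa>a w(3) by simp
        then have "zero (k' \<cdot> y)" using w by simp
        then show "zero y" by (rule mono_zero[OF kernel_mono[OF k']]) (use y cy in simp_all)
      qed
    qed
    moreover obtain w where w: "w \<in> Ar C" "Dom C w = Dom C k" "Cod C w = Dom C k'" "k' \<cdot> w = k"
    proof -
      have "zero ((g \<cdot> q) \<cdot> k)" using zero_cmp_left[OF qd(4), of g] g(1) dg qd by simp
      then obtain w where "w \<in> Ar C" "Dom C w = Dom C k" "Cod C w = Dom C k'" "k' \<cdot> w = k"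
        by (rule kernel_lift[OF k']) (use k(1,2) qd dg g(1) in simp_all)
      then show thesis by (rule that)
    qed
    ultimately obtain v where v: "v \<in> Ar C" "Dom C v = Dom C k'" "Cod C v = Dom C k" "k \<cdot> v = k'"
      using max[rule_format, of k' w] kd' ck' qd k(2) by auto
    have "(q \<cdot> k) \<cdot> v = q \<cdot> k'" using v k qd by simp
    then have qk': "zero (q \<cdot> k')" using zero_cmp_right[OF qd(4), of v] v k qd by simp
    have "(g \<cdot> q) \<cdot> x' = (g \<cdot> x) \<cdot> q'" using pbd x(1,2) g(1) dg qd by simp
    moreover have "zero ((g \<cdot> x) \<cdot> q')" by (rule zero_cmp_right[OF x(3)]) (use pbd x(1,2) g(1) dg in simp_all)
    ultimately have "zero ((g \<cdot> q) \<cdot> x')" by simp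
    then obtain t where t: "t \<in> Ar C" "Dom C t = Dom C x'" "Cod C t = Dom C k'" "k' \<cdot> t = x'"
      by (rule kernel_lift[OF k']) (use pbd g(1) dg qd in simp_all)
    have "x \<cdot> q' = q \<cdot> k' \<cdot> t" using pbd t by simp
    moreover have "(q \<cdot> k') \<cdot> t = q \<cdot> k' \<cdot> t" using t kd' ck' qd by simp
    moreover have "zero ((q \<cdot> k') \<cdot> t)" by (rule zero_cmp_right[OF qk']) (use t kd'(2) ck' qd in simp_all)
    ultimately have "zero (x \<cdot> q')" by metis
    moreover have "is_epi C q'" by (rule pullback_epi[OF pb cokernel_epi[OF q]])
    ultimately show "zero x" using epi_zero[of q' x] x pbd by simp
  qed
  ultimately have ess: "essential_mono C (q \<cdot> \<kappa>)" unfolding essential_mono_def by blast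
  have "Dom C (q \<cdot> \<kappa>) \<in> L" "Cod C (q \<cdot> \<kappa>) = Cod C q" using \<kappa> \<kappa>a qd c\<kappa> by simp_all
  then have "Cod C q \<in> L" using L ess unfolding stable_localizing_def by metis
  then have "W k" unfolding W_iff using mono_lmonic[OF km] cokernel_lepic[OF q] by blast
  then show thesis using that[of k] km k pd by simp
qed

text \<open>The coimage of \<open>f\<close> is \<open>p\<close>, so \<open>f = m \<cdot> p\<close>
  with \<open>m\<close> monic; a complement \<open>k\<close> of the kernel makes
  \<open>p \<cdot> k\<close>, and hence \<open>f \<cdot> k\<close>, monic.\<close>

lemma refine_mono:
  assumes L: "stable_localizing u C L" and f: "lmonic C L f"
  obtains i where "is_mono C i" "quot_inverted C L i" "Cod C i = Dom C f" "is_mono C (f \<cdot> i)"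
proof -
  have loc: "localizing u C L" using L unfolding stable_localizing_def by blast
  interpret serre_subcategory C add z L by (rule localizing_serre[OF loc])
  note fa = lmonic_Ar[OF f]
  obtain \<kappa> where \<kappa>: "is_kernel C f \<kappa>" using kernel_ex[OF fa] by blast
  note kd = kernelD[OF \<kappa>]
  obtain p where p: "is_cokernel C \<kappa> p" using cokernel_ex kd by blast
  note pd = cokernelD[OF p]
  obtain m where m: "m \<in> Ar C" "Cod C m = Cod C f" "Dom C m = Cod C p" "m \<cdot> p = f"
    by (rule cokernel_desc[OF p kd(4)]) (use kd in simp_all)
  have mm: "is_mono C m" by (rule coimage_mono[OF \<kappa> p m(1,3,4)])
  obtain k where k: "is_mono C k" "Cod C k = Cod C \<kappa>" "quot_inverted C L k" "is_mono C (p \<cdot> k)"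
    using stable_complement[OF L kernel_mono[OF \<kappa>] lmonic_kernel[OF f \<kappa>] p] .
  have "is_mono C (m \<cdot> p \<cdot> k)" using mono_cmp[OF k(4) mm] k(1,2) pd m by simp
  moreover have "m \<cdot> p \<cdot> k = f \<cdot> k" by (rule cmp_eq_left1[OF m(4)]) (use k(1,2) pd m in simp_all)
  ultimately show thesis using that[of k] k kd by simp
qed

text \<open>An extension of an object of \<open>L0\<close> by one of \<open>L1\<close> is here
  forced into \<open>L1\<close> if it has no \<open>L0\<close>-torsion. On a subobject
  \<open>i\<close> inverted for \<open>L1\<close>, the arrow \<open>b\<close> is monic by stability,
  so \<open>Dom C i\<close> lies in \<open>L0\<close> and \<open>i\<close> is zero. A zero arrow
  into an object is inverted for \<open>L1\<close> only if that object is in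
  \<open>L1\<close>.\<close>

lemma swap_extension:
  assumes L0: "localizing u C L0" and L1: "stable_localizing u C L1"
    and b: "lmonic C L1 b" "Cod C b \<in> L0" "lfree C L0 (Dom C b)"
  shows "Dom C b \<in> L1"
proof -
  have loc: "localizing u C L1" using L1 unfolding stable_localizing_def by blast
  interpret s0: serre_subcategory C add z L0 by (rule localizing_serre[OF L0])
  interpret s1: serre_subcategory C add z L1 by (rule localizing_serre[OF loc])
  obtain i where i: "is_mono C i" "quot_inverted C L1 i" "Cod C i = Dom C b" "is_mono C (b \<cdot> i)"
    using refine_mono[OF L1 b(1)] .
  have ba: "b \<in> Ar C" using s1.lmonic_Ar[OF b(1)] .
  have "Dom C i \<in> L0" using s0.L_sub[OF i(4)] i(1,3) ba b(2) by simp
  then have "null C L0 i" using s0.null_Dom i(1) by simp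
  then have "zero i" using b(3) i(1,3) unfolding lfree_def by simp
  then have "null C L1 (Idn C (Dom C b) \<cdot> i)" using s1.zero_null i(1,3) by simp
  then have "null C L1 (Idn C (Dom C b))"
    using s1.lepicD[of i "Idn C (Dom C b)"] s1.W_iff i(2,3) ba by simp
  then show ?thesis using s1.null_Idn ba by simp
qed

text \<open>Since torsion exists, these are the extensions of objects of \<open>L1\<close> by objects of \<open>L0\<close>.  In the
  form chosen here, closure under coproducts needs no exactness of coproducts.\<close>

definition gabriel_product :: "'o set \<Rightarrow> 'o set \<Rightarrow> 'o set" where
  "gabriel_product L0 L1 = {X \<in> Ob C. \<forall>q. is_epi C q \<longrightarrow> Dom C q = X \<longrightarrow> lfree C L0 (Cod C q) \<longrightarrow> Cod C q \<in> L1}"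

lemma gabriel_product_localizing:
  assumes L0: "localizing u C L0" and L1: "stable_localizing u C L1"
  shows "localizing u C (gabriel_product L0 L1)"
proof -
  have loc: "localizing u C L1" using L1 unfolding stable_localizing_def by blast
  interpret s0: serre_subcategory C add z L0 by (rule localizing_serre[OF L0])
  interpret s1: serre_subcategory C add z L1 by (rule localizing_serre[OF loc])
  let ?S = "gabriel_product L0 L1"
  have S: "Cod C q \<in> L1" if "Dom C q \<in> ?S" "is_epi C q" "lfree C L0 (Cod C q)" for q
    using that unfolding gabriel_product_def by blast
  have SI: "X \<in> ?S" if "X \<in> Ob C"
    "\<And>q. is_epi C q \<Longrightarrow> Dom C q = X \<Longrightarrow> lfree C L0 (Cod C q) \<Longrightarrow> Cod C q \<in> L1" for X
    using that unfolding gabriel_product_def by blast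
  show ?thesis unfolding localizing_def
  proof (intro conjI allI impI)
    show "?S \<subseteq> Ob C" unfolding gabriel_product_def by blast
  next
    fix f assume f: "is_mono C f" "Cod C f \<in> ?S"
    show "Dom C f \<in> ?S"
    proof (rule SI)
      show "Dom C f \<in> Ob C" using f by simp
      fix q assume q: "is_epi C q" "Dom C q = Dom C f" "lfree C L0 (Cod C q)"
      \<comment> \<open>The quotient of the subobject is embedded by \<open>f'\<close> in a quotient
        of the whole object. Dividing out the \<open>L0\<close>-torsion there keeps the embedding
        monic, because \<open>Cod C q\<close> is torsion-free.\<close>
      obtain f' q' where po: "is_pushout C q f f' q'" using pushout_ex[of q f] q f by auto
      note pd = pushoutD[OF po]
      have f'm: "is_mono C f'" by (rule pushout_mono[OF po f(1)])
      have q'e: "is_epi C q'" by (rule pushout_epi[OF pushout_sym[OF po] q(1)])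
      obtain m r where mr: "short_exact C m r" "is_mono C m" "is_epi C r" "Cod C m = Cod C q'"
        "Dom C r = Cod C q'" "Dom C m \<in> L0" "lfree C L0 (Cod C r)"
        using torsion[OF L0, of "Cod C q'"] pd by auto
      have "is_epi C (r \<cdot> q')" using epi_cmp[OF q'e mr(3)] mr(5) by simp
      then have rL: "Cod C r \<in> L1" using S[of "r \<cdot> q'"] f(2) mr pd by simp
      have ker: "is_kernel C r m" using mr(1) unfolding short_exact_def by blast
      have "is_mono C (r \<cdot> f')"
      proof (subst mono_iff)
        show "r \<cdot> f' \<in> Ar C" using mr pd by simp
        show "\<forall>x\<in>Ar C. Cod C x = Dom C (r \<cdot> f') \<longrightarrow> zero ((r \<cdot> f') \<cdot> x) \<longrightarrow> zero x"
        proof (intro ballI impI)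
          fix x assume x: "x \<in> Ar C" "Cod C x = Dom C (r \<cdot> f')" "zero ((r \<cdot> f') \<cdot> x)"
          have cx: "Cod C x = Dom C f'" using x mr pd by simp
          have "zero (r \<cdot> f' \<cdot> x)" using x cx mr pd by simp
          then obtain w where w: "w \<in> Ar C" "Dom C w = Dom C (f' \<cdot> x)" "Cod C w = Dom C m" "m \<cdot> w = f' \<cdot> x"
            by (rule kernel_lift[OF ker]) (use x(1) cx pd mr in simp_all)
          have "null C L0 (m \<cdot> w)"
            by (rule s0.null_cmp_right[OF s0.null_Dom]) (use mr(2,6) w(1,3) in simp_all)
          then have "null C L0 (f' \<cdot> x)" using w by simp
          then have "null C L0 x" using s0.lmonicD[OF s0.mono_lmonic[OF f'm]] x cx by simp
          then show "zero x" using q(3) x cx pd unfolding lfree_def by simp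
        qed
      qed
      then have "Dom C (r \<cdot> f') \<in> L1" using s1.L_sub[of "r \<cdot> f'"] rL mr pd by simp
      then show "Cod C q \<in> L1" using mr pd by simp
    qed
  next
    fix f assume f: "is_epi C f" "Dom C f \<in> ?S"
    show "Cod C f \<in> ?S"
    proof (rule SI)
      show "Cod C f \<in> Ob C" using f by simp
      fix q assume q: "is_epi C q" "Dom C q = Cod C f" "lfree C L0 (Cod C q)"
      have "is_epi C (q \<cdot> f)" using epi_cmp[OF f(1) q(1)] q by simp
      then show "Cod C q \<in> L1" using S[of "q \<cdot> f"] f q by simp
    qed
  next
    fix f g assume fg: "short_exact C f g" "Dom C f \<in> ?S" "Cod C g \<in> ?S"
    have kg: "is_kernel C g f" and cg: "is_cokernel C f g" using fg unfolding short_exact_def by auto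
    note fd = cokernelD[OF cg]
    show "Cod C f \<in> ?S"
    proof (rule SI)
      show "Cod C f \<in> Ob C" using fd by simp
      fix q assume q: "is_epi C q" "Dom C q = Cod C f" "lfree C L0 (Cod C q)"
      have qf: "q \<cdot> f \<in> Ar C" "Dom C (q \<cdot> f) = Dom C f" "Cod C (q \<cdot> f) = Cod C q" using q fd by simp_all
      \<comment> \<open>\<open>Cod C q\<close> gets three layers: the image \<open>m\<close> of the
        subobject, in \<open>L1\<close>; the \<open>L0\<close>-torsion \<open>t\<close> of the
        quotient by it; and a top layer in \<open>L1\<close>. The preimage \<open>k\<close> of
        \<open>t\<close> comprises the lower two, and \<open>swap_extension\<close> puts it into
        \<open>L1\<close>.\<close>
      obtain m e where me: "is_mono C m" "is_epi C e" "Cod C e = Dom C m" "Dom C e = Dom C (q \<cdot> f)"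
        "Cod C m = Cod C (q \<cdot> f)" "m \<cdot> e = q \<cdot> f" by (rule image_factorization[OF qf(1)])
      have ma: "m \<in> Ar C" "e \<in> Ar C" using me by simp_all
      have "lfree C L0 (Dom C m)" using lfree_mono[OF q(3) me(1) _ s0.serre_subcategory_axioms] me qf by simp
      then have mL: "Dom C m \<in> L1" using S[of e] me fg qf by simp
      obtain r where r: "is_cokernel C m r" using cokernel_ex ma by blast
      note rd = cokernelD[OF r]
      have dr: "Dom C r = Cod C q" using rd me qf by simp
      have re: "is_epi C r" by (rule cokernel_epi[OF r])
      have "(r \<cdot> q) \<cdot> f = (r \<cdot> m) \<cdot> e" using me(3-6) ma rd dr q fd by simp
      moreover have "zero ((r \<cdot> m) \<cdot> e)" by (rule zero_cmp_right[OF rd(4)]) (use ma me(3) rd in simp_all)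
      ultimately have "zero ((r \<cdot> q) \<cdot> f)" by simp
      then obtain h where h: "h \<in> Ar C" "Cod C h = Cod C (r \<cdot> q)" "Dom C h = Cod C g" "h \<cdot> g = r \<cdot> q"
        by (rule cokernel_desc[OF cg]) (use rd dr q in simp_all)
      have "is_epi C (h \<cdot> g)" using epi_cmp[OF q(1) re] dr h by simp
      then have he: "is_epi C h" by (rule epi_of_cmp) (use h fd in simp_all)
      have ch: "Cod C h = Cod C r" using h rd dr q by simp
      obtain t s where ts: "short_exact C t s" "is_mono C t" "is_epi C s" "Cod C t = Cod C r"
        "Dom C s = Cod C r" "Dom C t \<in> L0" "lfree C L0 (Cod C s)"
        using torsion[OF L0, of "Cod C r"] rd by auto
      have "is_epi C (s \<cdot> h)" using epi_cmp[OF he ts(3)] ts(5) ch by simp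
      then have sL: "Cod C s \<in> L1" using S[of "s \<cdot> h"] fg(3) ts ch h by simp
      have sr: "s \<cdot> r \<in> Ar C" "Dom C (s \<cdot> r) = Cod C q" "Cod C (s \<cdot> r) = Cod C s" using ts rd dr by simp_all
      obtain k where k: "is_kernel C (s \<cdot> r) k" using kernel_ex sr by blast
      note kd = kernelD[OF k]
      have ck: "Cod C k = Dom C r" using kd sr dr by simp
      have kt: "is_kernel C s t" using ts(1) unfolding short_exact_def by blast
      have "zero (s \<cdot> r \<cdot> k)" using kd rd ck ts by simp
      then obtain b where b: "b \<in> Ar C" "Dom C b = Dom C (r \<cdot> k)" "Cod C b = Dom C t" "t \<cdot> b = r \<cdot> k"
        by (rule kernel_lift[OF kt]) (use kd(2) rd ck ts in simp_all)
      have "lmonic C L1 r" using s1.kernel_lmonic[OF mono_is_kernel[OF me(1) r] mL] .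
      then have "lmonic C L1 (r \<cdot> k)" using s1.lmonic_cmp[OF s1.mono_lmonic[OF kernel_mono[OF k]]] ck by simp
      then have "lmonic C L1 (t \<cdot> b)" using b by simp
      then have bm: "lmonic C L1 b" by (rule s1.lmonic_of_cmp) (use b ts in simp_all)
      have db: "Dom C b = Dom C k" using b kd(2) ck rd by simp
      have "lfree C L0 (Dom C b)"
        using lfree_mono[OF q(3) kernel_mono[OF k] _ s0.serre_subcategory_axioms] kd sr db by simp
      then have "Dom C b \<in> L1" using swap_extension[OF L0 L1 bm] b ts by simp
      moreover have "is_epi C (s \<cdot> r)" using epi_cmp[OF re ts(3)] ts by simp
      ultimately have "Cod C k \<in> L1" using s1.L_ext[OF short_exact_of_epi[OF _ k]] db sL sr by simp
      then show "Cod C q \<in> L1" using kd sr by simp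
    qed
  next
    fix I :: "'u set" and X T j
    assume sI: "small u I" and X: "\<forall>i\<in>I. X i \<in> ?S" and T: "is_coproduct C I X T j"
    have j: "j i \<in> Ar C" "Dom C (j i) = X i" "Cod C (j i) = T" if "i \<in> I" for i
      using T that unfolding is_coproduct_def by auto
    have Tuniv: "\<exists>!w. w \<in> Hom C T Y \<and> (\<forall>i\<in>I. w \<cdot> j i = f i)"
      if "Y \<in> Ob C" "\<forall>i\<in>I. f i \<in> Hom C (X i) Y" for Y f
    proof -
      have "\<forall>Y\<in>Ob C. \<forall>f. (\<forall>i\<in>I. f i \<in> Hom C (X i) Y) \<longrightarrow> (\<exists>!u. u \<in> Hom C T Y \<and> (\<forall>i\<in>I. u \<cdot> j i = f i))"
        using T unfolding is_coproduct_def by (elim conjE)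
      from this[rule_format, OF that(1), of f] show ?thesis using that(2) by blast
    qed
    show "T \<in> ?S"
    proof (rule SI)
      show "T \<in> Ob C" using T unfolding is_coproduct_def by blast
      fix q assume q: "is_epi C q" "Dom C q = T" "lfree C L0 (Cod C q)"
      have qj: "q \<cdot> j i \<in> Ar C" "Dom C (q \<cdot> j i) = X i" "Cod C (q \<cdot> j i) = Cod C q" if "i \<in> I" for i
        using q j[OF that] by simp_all
      \<comment> \<open>The image of each summand in \<open>Cod C q\<close> is torsion-free, hence
        in \<open>L1\<close>; the coproduct of these images lies in \<open>L1\<close> and maps onto
        \<open>Cod C q\<close>.\<close>
      have "\<forall>i\<in>I. \<exists>m e. is_mono C m \<and> is_epi C e \<and> Cod C e = Dom C m \<and> Dom C e = X i \<and>
        Cod C m = Cod C q \<and> m \<cdot> e = q \<cdot> j i"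
      proof
        fix i assume i: "i \<in> I"
        obtain m e where "is_mono C m" "is_epi C e" "Cod C e = Dom C m" "Dom C e = Dom C (q \<cdot> j i)"
          "Cod C m = Cod C (q \<cdot> j i)" "m \<cdot> e = q \<cdot> j i" by (rule image_factorization[OF qj(1)[OF i]])
        then show "\<exists>m e. is_mono C m \<and> is_epi C e \<and> Cod C e = Dom C m \<and> Dom C e = X i \<and>
          Cod C m = Cod C q \<and> m \<cdot> e = q \<cdot> j i" unfolding qj(2,3)[OF i] by blast
      qed
      then obtain m e where me: "\<And>i. i \<in> I \<Longrightarrow> is_mono C (m i) \<and> is_epi C (e i) \<and> Cod C (e i) = Dom C (m i) \<and>
        Dom C (e i) = X i \<and> Cod C (m i) = Cod C q \<and> m i \<cdot> e i = q \<cdot> j i" by metis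
      have mL: "Dom C (m i) \<in> L1" if "i \<in> I" for i
      proof -
        have "lfree C L0 (Dom C (m i))"
          using lfree_mono[OF q(3) _ _ s0.serre_subcategory_axioms, of "m i"] me[OF that] by simp
        then show ?thesis using S[of "e i"] X me[OF that] that by simp
      qed
      have "\<forall>i\<in>I. Dom C (m i) \<in> Ob C" using mL s1.L_Ob by blast
      then obtain P l where P: "is_coproduct C I (\<lambda>i. Dom C (m i)) P l"
        using groth sI unfolding grothendieck_def small_coproducts_def by meson
      have "\<forall>(I :: 'u set) X S j. small u I \<longrightarrow> (\<forall>i\<in>I. X i \<in> L1) \<longrightarrow> is_coproduct C I X S j \<longrightarrow> S \<in> L1"
        using loc unfolding localizing_def by blast
      from this[rule_format, OF sI _ P] have PL: "P \<in> L1" using mL by blast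
      have l: "l i \<in> Ar C" "Dom C (l i) = Dom C (m i)" "Cod C (l i) = P" if "i \<in> I" for i
        using P that unfolding is_coproduct_def by auto
      have mH: "\<forall>i\<in>I. m i \<in> Hom C (Dom C (m i)) (Cod C q)" using me by auto
      have Pu: "\<forall>Y\<in>Ob C. \<forall>f. (\<forall>i\<in>I. f i \<in> Hom C (Dom C (m i)) Y) \<longrightarrow>
          (\<exists>!u. u \<in> Hom C P Y \<and> (\<forall>i\<in>I. u \<cdot> l i = f i))"
        using P unfolding is_coproduct_def by (elim conjE)
      have "Cod C q \<in> Ob C" using q by simp
      from Pu[rule_format, OF this, of m] have "\<exists>!u. u \<in> Hom C P (Cod C q) \<and> (\<forall>i\<in>I. u \<cdot> l i = m i)"
        using mH by blast
      then obtain v where v: "v \<in> Ar C" "Dom C v = P" "Cod C v = Cod C q" "\<And>i. i \<in> I \<Longrightarrow> v \<cdot> l i = m i"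
        by auto
      have "is_epi C v" unfolding epi_iff[OF v(1)]
      proof (intro ballI impI)
        fix x assume x: "x \<in> Ar C" "Dom C x = Cod C v" "zero (x \<cdot> v)"
        have qa: "q \<in> Ar C" using q by simp
        obtain o' where o': "o' \<in> Ar C" "Dom C o' = T" "Cod C o' = Cod C x" "zero o'"
        proof -
          have "T \<in> Ob C" "Cod C x \<in> Ob C" using Dom_Cod_Ob(1)[OF qa] q(2) x(1) by simp_all
          then show thesis by (rule zero_ex) (rule that)
        qed
        have eq: "(x \<cdot> q) \<cdot> j i = o' \<cdot> j i" if i: "i \<in> I" for i
        proof -
          have mea: "m i \<in> Ar C" "e i \<in> Ar C" using me[OF i] by simp_all
          have "(x \<cdot> q) \<cdot> j i = x \<cdot> m i \<cdot> e i" using me[OF i] x(1,2) v(3) q j[OF i] by simp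
          also have "\<dots> = (x \<cdot> v) \<cdot> l i \<cdot> e i"
            using cmp_eq_left1[OF v(4)[OF i], of "e i"] v(1-3) x(1,2) l[OF i] mea me[OF i] by simp
          finally have 1: "(x \<cdot> q) \<cdot> j i = (x \<cdot> v) \<cdot> l i \<cdot> e i" .
          have "zero ((x \<cdot> v) \<cdot> l i \<cdot> e i)"
            by (rule zero_cmp_right[OF x(3)]) (use v(1-3) x(1,2) l[OF i] mea me[OF i] in simp_all)
          moreover have "zero (o' \<cdot> j i)" by (rule zero_cmp_right[OF o'(4)]) (use o' j[OF i] in simp_all)
          ultimately show ?thesis unfolding 1
            by (rule zero_unique) (use v(1-3) x(1,2) l[OF i] mea me[OF i] o' j[OF i] in simp_all)
        qed
        have "\<exists>!w. w \<in> Hom C T (Cod C x) \<and> (\<forall>i\<in>I. w \<cdot> j i = o' \<cdot> j i)"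
          by (rule Tuniv) (use o' j x in auto)
        moreover have "x \<cdot> q \<in> Hom C T (Cod C x)" using x v(3) q qa by simp
        moreover have "o' \<in> Hom C T (Cod C x)" using o' by simp
        ultimately have "x \<cdot> q = o'" using eq by blast
        then have "zero (x \<cdot> q)" using o' by simp
        then show "zero x" using epi_zero[OF q(1), of x] x v(3) by simp
      qed
      then show "Cod C q \<in> L1" using s1.L_quot[of v] v PL by simp
    qed
  qed
qed

lemma gabriel_product_le:
  assumes L0: "localizing u C L0" and L1: "localizing u C L1"
  shows "L0 \<subseteq> gabriel_product L0 L1" "L1 \<subseteq> gabriel_product L0 L1"
proof -
  interpret s0: serre_subcategory C add z L0 by (rule localizing_serre[OF L0])
  interpret s1: serre_subcategory C add z L1 by (rule localizing_serre[OF L1])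
  show "L1 \<subseteq> gabriel_product L0 L1" unfolding gabriel_product_def using s1.L_Ob s1.L_quot by blast
  show "L0 \<subseteq> gabriel_product L0 L1"
  proof
    fix X assume X: "X \<in> L0"
    have "Cod C q \<in> L1" if q: "is_epi C q" "Dom C q = X" "lfree C L0 (Cod C q)" for q
    proof -
      have o: "Cod C q \<in> Ob C" using q by simp
      have "Cod C q \<in> L0" using s0.L_quot q X by blast
      then have "null C L0 (Idn C (Cod C q))" using s0.null_Idn o by blast
      then have "zero (Idn C (Cod C q))" using q(3) o unfolding lfree_def by simp
      then show ?thesis using s1.zero_null s1.null_Idn o by blast
    qed
    then show "X \<in> gabriel_product L0 L1" unfolding gabriel_product_def using X s0.L_Ob by blast
  qed
qed

end

section \<open>The join of two stable subcategories\<close>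

lemma localizing_join_commute: "localizing_join u C L0 L1 = localizing_join u C L1 L0"
  unfolding localizing_join_def by (rule arg_cong[of _ _ Inter]) blast

locale stable_pair = grothendieck_category C add z u G
  for C :: "('o, 'm) cat" and add z and u :: "'u itself" and G +
  fixes L0 L1 :: "'o set"
  assumes st0: "stable_localizing u C L0" and st1: "stable_localizing u C L1"
begin

abbreviation LJ where "LJ \<equiv> localizing_join u C L0 L1"

lemma loc0: "localizing u C L0" and loc1: "localizing u C L1"
  using st0 st1 unfolding stable_localizing_def by blast+

sublocale s0: serre_subcategory C add z L0 by (rule localizing_serre[OF loc0])
sublocale s1: serre_subcategory C add z L1 by (rule localizing_serre[OF loc1])
sublocale sI: serre_subcategory C add z "L0 \<inter> L1"
  by (rule serre_subcategory_Int[OF s0.serre_subcategory_axioms s1.serre_subcategory_axioms])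

lemma join_le_product: "LJ \<subseteq> gabriel_product L0 L1"
  unfolding localizing_join_def
  using gabriel_product_localizing[OF loc0 st1] gabriel_product_le[OF loc0 loc1] by blast

lemma le_join: "L0 \<subseteq> LJ" "L1 \<subseteq> LJ"
  unfolding localizing_join_def by blast+

lemma join_localizing: "localizing u C LJ"
proof -
  have Ob: "LJ \<subseteq> Ob C" using join_le_product unfolding gabriel_product_def by blast
  have J: "X \<in> LJ \<longleftrightarrow> (\<forall>L. localizing u C L \<longrightarrow> L0 \<subseteq> L \<longrightarrow> L1 \<subseteq> L \<longrightarrow> X \<in> L)" for X
    unfolding localizing_join_def by blast
  show ?thesis unfolding localizing_def
  proof (intro conjI allI impI)
    fix f assume "is_mono C f" "Cod C f \<in> LJ"
    then show "Dom C f \<in> LJ" unfolding J localizing_def by blast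
  next
    fix f assume "is_epi C f" "Dom C f \<in> LJ"
    then show "Cod C f \<in> LJ" unfolding J localizing_def by blast
  next
    fix f g assume "short_exact C f g" "Dom C f \<in> LJ" "Cod C g \<in> LJ"
    then show "Cod C f \<in> LJ" unfolding J localizing_def by blast
  next
    fix I :: "'u set" and X S j
    assume a: "small u I" "\<forall>i\<in>I. X i \<in> LJ" "is_coproduct C I X S j"
    show "S \<in> LJ" unfolding J
    proof (intro allI impI)
      fix L assume L: "localizing u C L" "L0 \<subseteq> L" "L1 \<subseteq> L"
      have "\<forall>(I :: 'u set) X S j. small u I \<longrightarrow> (\<forall>i\<in>I. X i \<in> L) \<longrightarrow> is_coproduct C I X S j \<longrightarrow> S \<in> L"
        using L(1) unfolding localizing_def by blast
      from this[rule_format, OF a(1) _ a(3)] show "S \<in> L" using a(2) L unfolding J by blast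
    qed
  qed (rule Ob)
qed

sublocale sJ: serre_subcategory C add z LJ by (rule localizing_serre[OF join_localizing])

lemma join_exact:
  assumes "X \<in> LJ"
  obtains m q where "short_exact C m q" "is_mono C m" "is_epi C q" "Cod C m = X" "Dom C q = X"
    "Dom C m \<in> L0" "Cod C q \<in> L1"
proof -
  have X: "X \<in> gabriel_product L0 L1" using assms join_le_product by blast
  then have "X \<in> Ob C" unfolding gabriel_product_def by blast
  then obtain m q where mq: "short_exact C m q" "is_mono C m" "is_epi C q" "Cod C m = X" "Dom C q = X"
    "Dom C m \<in> L0" "lfree C L0 (Cod C q)" using torsion[OF loc0] by blast
  then have "Cod C q \<in> L1" using X unfolding gabriel_product_def by blast
  then show thesis using that mq by blast
qed

text \<open>\<open>refine_mono\<close> calls for stability, which is given for \<open>L0\<close> and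
  \<open>L1\<close> separately, so the kernel of \<open>v\<close> is removed in two stages. A
  complement \<open>i0\<close> of its \<open>L0\<close>-part \<open>\<kappa> \<cdot> m\<close>
  leaves a kernel that embeds by \<open>q \<cdot> y\<close> in an object of \<open>L1\<close>; the
  second refinement then is one for \<open>L1\<close>.\<close>

lemma join_refine_mono:
  assumes v: "lmonic C LJ v"
  obtains i where "is_mono C i" "quot_inverted C LJ i" "Cod C i = Dom C v" "is_mono C (v \<cdot> i)"
proof -
  have va: "v \<in> Ar C" using sJ.lmonic_Ar[OF v] .
  obtain \<kappa> where \<kappa>: "is_kernel C v \<kappa>" using kernel_ex[OF va] by blast
  note kd = kernelD[OF \<kappa>]
  have km: "is_mono C \<kappa>" by (rule kernel_mono[OF \<kappa>])
  obtain m q where mq: "short_exact C m q" "is_mono C m" "is_epi C q" "Cod C m = Dom C \<kappa>" "Dom C q = Dom C \<kappa>"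
    "Dom C m \<in> L0" "Cod C q \<in> L1" using join_exact[OF sJ.lmonic_kernel[OF v \<kappa>]] .
  have kq: "is_kernel C q m" using mq(1) unfolding short_exact_def by blast
  have kmm: "is_mono C (\<kappa> \<cdot> m)" using mono_cmp[OF mq(2) km mq(4)] .
  have kma: "\<kappa> \<cdot> m \<in> Ar C" "Dom C (\<kappa> \<cdot> m) = Dom C m" "Cod C (\<kappa> \<cdot> m) = Dom C v" using kd mq(2,4) by simp_all
  obtain p where p: "is_cokernel C (\<kappa> \<cdot> m) p" using cokernel_ex kma by blast
  note pd = cokernelD[OF p]
  obtain i0 where i0: "is_mono C i0" "Cod C i0 = Cod C (\<kappa> \<cdot> m)" "quot_inverted C L0 i0" "is_mono C (p \<cdot> i0)"
    by (rule stable_complement[OF st0 kmm _ p]) (use kma mq in simp_all)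
  have i0a: "i0 \<in> Ar C" "Cod C i0 = Dom C v" "Cod C i0 = Dom C p" using i0 kma pd by simp_all
  have vi0: "v \<cdot> i0 \<in> Ar C" "Dom C (v \<cdot> i0) = Dom C i0" using va i0a by simp_all
  obtain k where k: "is_kernel C (v \<cdot> i0) k" using kernel_ex vi0 by blast
  note kd' = kernelD[OF k]
  have ck: "Cod C k = Dom C i0" using kd' vi0 by simp
  have "zero (v \<cdot> i0 \<cdot> k)" using kd' ck i0a va by simp
  then obtain y where y: "y \<in> Ar C" "Dom C y = Dom C (i0 \<cdot> k)" "Cod C y = Dom C \<kappa>" "\<kappa> \<cdot> y = i0 \<cdot> k"
    by (rule kernel_lift[OF \<kappa>]) (use kd'(2) ck i0a in simp_all)
  have dy: "Dom C y = Dom C k" using y kd'(2) ck i0a by simp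
  have "is_mono C (q \<cdot> y)"
  proof (subst mono_iff)
    show "q \<cdot> y \<in> Ar C" using y mq by simp
    show "\<forall>x\<in>Ar C. Cod C x = Dom C (q \<cdot> y) \<longrightarrow> zero ((q \<cdot> y) \<cdot> x) \<longrightarrow> zero x"
    proof (intro ballI impI)
      fix x assume x: "x \<in> Ar C" "Cod C x = Dom C (q \<cdot> y)" "zero ((q \<cdot> y) \<cdot> x)"
      have cx: "Cod C x = Dom C y" using x y mq by simp
      have "zero (q \<cdot> y \<cdot> x)" using x cx y(1,3) mq by simp
      then obtain w where w: "w \<in> Ar C" "Dom C w = Dom C (y \<cdot> x)" "Cod C w = Dom C m" "m \<cdot> w = y \<cdot> x"
        by (rule kernel_lift[OF kq]) (use x(1) cx y(1,3) mq in simp_all)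
      have "(\<kappa> \<cdot> m) \<cdot> w = \<kappa> \<cdot> y \<cdot> x" using w kd mq(2,4) by simp
      also have "\<dots> = i0 \<cdot> k \<cdot> x"
        by (rule cmp_eq_left[OF y(4)]) (use x(1) cx y(1-3) kd'(2) kd ck dy i0a in simp_all)
      finally have "p \<cdot> i0 \<cdot> k \<cdot> x = (p \<cdot> (\<kappa> \<cdot> m)) \<cdot> w" using w(1-3) pd kma by simp
      moreover have "zero ((p \<cdot> (\<kappa> \<cdot> m)) \<cdot> w)"
        by (rule zero_cmp_right[OF pd(4)]) (use w(1-3) pd kma in simp_all)
      ultimately have "zero ((p \<cdot> i0) \<cdot> k \<cdot> x)" using x(1) cx dy kd'(2) ck i0a pd by simp
      then have "zero (k \<cdot> x)" by (rule mono_zero[OF i0(4)]) (use x(1) cx dy kd'(2) ck i0a pd in simp_all)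
      then show "zero x" by (rule mono_zero[OF kernel_mono[OF k]]) (use x(1) cx dy in simp_all)
    qed
  qed
  then have "Dom C k \<in> L1" using s1.L_sub[of "q \<cdot> y"] y(1,3) dy mq by simp
  then have "lmonic C L1 (v \<cdot> i0)" by (rule s1.kernel_lmonic[OF k])
  then obtain i1 where i1: "is_mono C i1" "quot_inverted C L1 i1" "Cod C i1 = Dom C (v \<cdot> i0)"
    "is_mono C ((v \<cdot> i0) \<cdot> i1)" using refine_mono[OF st1] by blast
  have i1a: "i1 \<in> Ar C" "Cod C i1 = Dom C i0" using i1 vi0 by simp_all
  show thesis
  proof (rule that[of "i0 \<cdot> i1"])
    show "is_mono C (i0 \<cdot> i1)" using mono_cmp[OF i1(1) i0(1) i1a(2)] .
    show "quot_inverted C LJ (i0 \<cdot> i1)"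
      using sJ.W_cmp quot_inverted_mono[OF i0(3) le_join(1)] quot_inverted_mono[OF i1(2) le_join(2)] i1a by blast
    show "is_mono C (v \<cdot> i0 \<cdot> i1)" using i1(4) i1a i0a va by simp
  qed (use i1a i0a in simp)
qed

text \<open>The quotient \<open>Cod m / Dom m\<close> has a subobject in \<open>L1\<close> with quotient in \<open>L0\<close>; take its
  preimage.\<close>

lemma join_mono_factor:
  assumes m: "is_mono C m" "quot_inverted C LJ m" and swap: "stable_pair C add z u G L1 L0"
  obtains w x where "is_mono C w" "is_mono C x" "quot_inverted C L0 w" "quot_inverted C L1 x"
    "Cod C x = Dom C w" "w \<cdot> x = m"
proof -
  interpret sw: stable_pair C add z u G L1 L0 by fact
  have ma: "m \<in> Ar C" using m by simp
  obtain c where c: "is_cokernel C m c" using cokernel_ex[OF ma] by blast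
  note cd = cokernelD[OF c]
  have "Cod C c \<in> LJ" using sJ.lepic_cokernel[OF _ c] m(2) sJ.W_iff by blast
  \<comment> \<open>\<open>join_exact\<close> itself would put the \<open>L0\<close>-part below; the
    outer factor \<open>w\<close> has cokernel \<open>Cod C r\<close>, so the \<open>L0\<close>-part
    has to be on top.\<close>
  then have "Cod C c \<in> localizing_join u C L1 L0" using localizing_join_commute by metis
  then obtain j r where jr: "short_exact C j r" "is_mono C j" "is_epi C r" "Cod C j = Cod C c" "Dom C r = Cod C c"
    "Dom C j \<in> L1" "Cod C r \<in> L0" by (rule sw.join_exact)
  have kr: "is_kernel C r j" using jr(1) unfolding short_exact_def by blast
  have rc: "r \<cdot> c \<in> Ar C" "Dom C (r \<cdot> c) = Cod C m" "Cod C (r \<cdot> c) = Cod C r" using jr cd by simp_all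
  obtain w where w: "is_kernel C (r \<cdot> c) w" using kernel_ex rc by blast
  note wd = kernelD[OF w]
  have cw: "Cod C w = Dom C c" using wd rc cd by simp
  have wm: "is_mono C w" by (rule kernel_mono[OF w])
  have rce: "is_epi C (r \<cdot> c)" using epi_cmp[OF cokernel_epi[OF c] jr(3)] jr(5) by simp
  have "is_cokernel C w (r \<cdot> c)" by (rule epi_is_cokernel[OF rce w])
  then have "lepic C L0 w" by (rule s0.cokernel_lepic) (use rc jr in simp)
  then have W0: "quot_inverted C L0 w" using s0.W_iff s0.mono_lmonic[OF wm] by blast
  have "zero ((r \<cdot> c) \<cdot> m)" using zero_cmp_left[OF cd(4), of r] jr cd by simp
  then obtain x where x: "x \<in> Ar C" "Dom C x = Dom C m" "Cod C x = Dom C w" "w \<cdot> x = m"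
    by (rule kernel_lift[OF w]) (use ma rc in simp_all)
  have xm: "is_mono C x" using mono_of_cmp[of w x] m x wd by simp
  have "zero (r \<cdot> c \<cdot> w)" using wd cw cd jr by simp
  then obtain d where d: "d \<in> Ar C" "Dom C d = Dom C (c \<cdot> w)" "Cod C d = Dom C j" "j \<cdot> d = c \<cdot> w"
    by (rule kernel_lift[OF kr]) (use wd(2) cw cd jr in simp_all)
  have dd: "Dom C d = Dom C w" using d wd(2) cw cd by simp
  \<comment> \<open>\<open>d\<close> is the restriction of \<open>c\<close> to the preimage
    \<open>w\<close>. Its kernel being \<open>m\<close> seen inside \<open>w\<close>, the cokernel
    of \<open>x\<close> embeds in \<open>Dom C j\<close>, an object of \<open>L1\<close>.\<close>
  have ker: "is_kernel C d x"
  proof (rule kernelI[OF xm d(1)])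
    show "Cod C x = Dom C d" using x dd by simp
    have "j \<cdot> d \<cdot> x = c \<cdot> w \<cdot> x" by (rule cmp_eq_left[OF d(4)]) (use d(1-3) dd x(1-3) wd(2) cw cd jr in simp_all)
    then have "j \<cdot> d \<cdot> x = c \<cdot> m" using x(4) by simp
    then have "zero (j \<cdot> d \<cdot> x)" using cd by simp
    then show "zero (d \<cdot> x)" by (rule mono_zero[OF jr(2)]) (use d(1-3) dd x(1-3) in simp_all)
    fix y assume y: "y \<in> Ar C" "Cod C y = Dom C d" "zero (d \<cdot> y)"
    have eq: "j \<cdot> d \<cdot> y = c \<cdot> w \<cdot> y" by (rule cmp_eq_left[OF d(4)]) (use d(1-3) dd y(1,2) wd(2) cw cd jr in simp_all)
    have "zero (j \<cdot> d \<cdot> y)" by (rule zero_cmp_left[OF y(3)]) (use d(1-3) y(1,2) jr in simp_all)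
    then have "zero (c \<cdot> w \<cdot> y)" using eq by simp
    then obtain t where t: "t \<in> Ar C" "Dom C t = Dom C (w \<cdot> y)" "Cod C t = Dom C m" "m \<cdot> t = w \<cdot> y"
      by (rule kernel_lift[OF mono_is_kernel[OF m(1) c]]) (use dd y(1,2) wd(2) cw cd in simp_all)
    have dt: "Dom C t = Dom C y" using t(2) y(1,2) dd wd(2) by simp
    have "w \<cdot> x \<cdot> t = m \<cdot> t" by (rule cmp_eq_left1[OF x(4)]) (use x(1-3) t(1-3) wd(2) in simp_all)
    then have "w \<cdot> x \<cdot> t = w \<cdot> y" using t(4) by simp
    then have "x \<cdot> t = y" by (rule monoD[OF wm]) (use x(1-3) t(1-3) dt y(1,2) dd in simp_all)
    then show "\<exists>u\<in>Ar C. Dom C u = Dom C y \<and> Cod C u = Dom C x \<and> x \<cdot> u = y" using t(1,3) dt x(2) by metis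
  qed
  obtain e where e: "is_cokernel C x e" using cokernel_ex x by blast
  note ed = cokernelD[OF e]
  obtain n where n: "n \<in> Ar C" "Cod C n = Cod C d" "Dom C n = Cod C e" "n \<cdot> e = d"
    by (rule cokernel_desc[OF e kernelD(4)[OF ker]]) (use d x dd in simp_all)
  have "is_mono C n" by (rule coimage_mono[OF ker e n(1,3,4)])
  then have "Cod C e \<in> L1" using s1.L_sub[of n] n d jr by simp
  then have "lepic C L1 x" by (rule s1.cokernel_lepic[OF e])
  then have "quot_inverted C L1 x" using s1.W_iff s1.mono_lmonic[OF xm] by blast
  then show thesis using that[of w x] wm xm W0 x by simp
qed

end

section \<open>Functors, equivalences and adjunctions\<close>

lemma functor_simps:
  assumes "is_functor C D F"
  shows "X \<in> Ob C \<Longrightarrow> fob F X \<in> Ob D"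
    "f \<in> Ar C \<Longrightarrow> far F f \<in> Ar D" "f \<in> Ar C \<Longrightarrow> Dom D (far F f) = fob F (Dom C f)"
    "f \<in> Ar C \<Longrightarrow> Cod D (far F f) = fob F (Cod C f)"
    "X \<in> Ob C \<Longrightarrow> far F (Idn C X) = Idn D (fob F X)"
    "f \<in> Ar C \<Longrightarrow> g \<in> Ar C \<Longrightarrow> Cod C f = Dom C g \<Longrightarrow> far F (Comp C g f) = Comp D (far F g) (far F f)"
  using assms unfolding is_functor_def by auto

lemma is_functor_cats:
  assumes "is_functor C D F" shows "category C" "category D"
  using assms unfolding is_functor_def category_def by auto

lemma is_functor_fid: "is_category C \<Longrightarrow> is_functor C C fid"
proof -
  assume "is_category C"
  then interpret category C by unfold_locales
  show ?thesis unfolding is_functor_def fid_def using cat by auto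
qed

lemma is_functor_fcomp:
  assumes F: "is_functor C D F" and G: "is_functor D E G"
  shows "is_functor C E (G \<odot> F)"
proof -
  interpret c: category C by (rule is_functor_cats[OF F])
  interpret d: category D by (rule is_functor_cats[OF G])
  interpret e: category E by (rule is_functor_cats[OF G])
  note [simp] = functor_simps[OF F] functor_simps[OF G]
  show ?thesis unfolding is_functor_def fcomp_def using c.cat e.cat by auto
qed

section \<open>Isomorphisms and equivalences\<close>

context category
begin

lemma isoE:
  assumes "is_iso C f"
  obtains g where "g \<in> Ar C" "Dom C g = Cod C f" "Cod C g = Dom C f" "g \<cdot> f = Idn C (Dom C f)"
    "f \<cdot> g = Idn C (Cod C f)"
  using assms unfolding is_iso_def by auto

lemma isoI:
  assumes "f \<in> Ar C" "g \<in> Ar C" "Dom C g = Cod C f" "Cod C g = Dom C f" "g \<cdot> f = Idn C (Dom C f)"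
    "f \<cdot> g = Idn C (Cod C f)"
  shows "is_iso C f"
  unfolding is_iso_def using assms by auto

lemma iso_Idn: "X \<in> Ob C \<Longrightarrow> is_iso C (Idn C X)"
  by (rule isoI[of _ "Idn C X"]) simp_all

lemma iso_mono: "is_iso C f \<Longrightarrow> is_mono C f"
proof -
  assume f: "is_iso C f"
  have fa: "f \<in> Ar C" using f unfolding is_iso_def by blast
  obtain g where g: "g \<in> Ar C" "Dom C g = Cod C f" "Cod C g = Dom C f" "g \<cdot> f = Idn C (Dom C f)"
    by (rule isoE[OF f])
  show ?thesis
    by (rule mono_of_cmp[of g f]) (use fa g mono_Idn in simp_all)
qed

end

lemma full_faithful_surjective_equivalence:
  assumes F: "is_functor C D F"
    and faithful: "\<And>f g. f \<in> Ar C \<Longrightarrow> g \<in> Ar C \<Longrightarrow> Dom C f = Dom C g \<Longrightarrow> Cod C f = Cod C g \<Longrightarrow>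
      far F f = far F g \<Longrightarrow> f = g"
    and full: "\<And>X Y h. X \<in> Ob C \<Longrightarrow> Y \<in> Ob C \<Longrightarrow> h \<in> Hom D (fob F X) (fob F Y) \<Longrightarrow>
      \<exists>f\<in>Hom C X Y. far F f = h"
    and surj: "\<And>Y. Y \<in> Ob D \<Longrightarrow> \<exists>X\<in>Ob C. \<exists>h\<in>Hom D (fob F X) Y. is_iso D h"
  shows "is_equivalence C D F"
proof -
  interpret c: category C by (rule is_functor_cats[OF F])
  interpret d: category D by (rule is_functor_cats[OF F])
  note [simp] = functor_simps[OF F]
  have "\<forall>Y\<in>Ob D. \<exists>X h h'. X \<in> Ob C \<and> h \<in> Ar D \<and> Dom D h = fob F X \<and> Cod D h = Y \<and> is_iso D h \<and>
    h' \<in> Ar D \<and> Dom D h' = Y \<and> Cod D h' = fob F X \<and> Comp D h' h = Idn D (fob F X) \<and> Comp D h h' = Idn D Y"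
  proof
    fix Y assume "Y \<in> Ob D"
    then obtain X h where h: "X \<in> Ob C" "h \<in> Hom D (fob F X) Y" "is_iso D h" using surj by blast
    obtain h' where "h' \<in> Ar D" "Dom D h' = Cod D h" "Cod D h' = Dom D h" "Comp D h' h = Idn D (Dom D h)"
      "Comp D h h' = Idn D (Cod D h)" by (rule d.isoE[OF h(3)])
    then show "\<exists>X h h'. X \<in> Ob C \<and> h \<in> Ar D \<and> Dom D h = fob F X \<and> Cod D h = Y \<and> is_iso D h \<and>
      h' \<in> Ar D \<and> Dom D h' = Y \<and> Cod D h' = fob F X \<and> Comp D h' h = Idn D (fob F X) \<and> Comp D h h' = Idn D Y"
      using h by (intro exI[of _ X] exI[of _ h] exI[of _ h']) simp
  qed
  then obtain go e e' where e: "\<And>Y. Y \<in> Ob D \<Longrightarrow> go Y \<in> Ob C \<and> e Y \<in> Ar D \<and> Dom D (e Y) = fob F (go Y) \<and>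
    Cod D (e Y) = Y \<and> is_iso D (e Y) \<and> e' Y \<in> Ar D \<and> Dom D (e' Y) = Y \<and> Cod D (e' Y) = fob F (go Y) \<and>
    Comp D (e' Y) (e Y) = Idn D (fob F (go Y)) \<and> Comp D (e Y) (e' Y) = Idn D Y" by metis
  have "\<forall>k\<in>Ar D. \<exists>f. f \<in> Ar C \<and> Dom C f = go (Dom D k) \<and> Cod C f = go (Cod D k) \<and>
    far F f = Comp D (e' (Cod D k)) (Comp D k (e (Dom D k)))"
  proof
    fix k assume k: "k \<in> Ar D"
    then have o: "Dom D k \<in> Ob D" "Cod D k \<in> Ob D" by simp_all
    have "\<exists>f\<in>Hom C (go (Dom D k)) (go (Cod D k)). far F f = Comp D (e' (Cod D k)) (Comp D k (e (Dom D k)))"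
      by (rule full) (use e[OF o(1)] e[OF o(2)] k in simp_all)
    then show "\<exists>f. f \<in> Ar C \<and> Dom C f = go (Dom D k) \<and> Cod C f = go (Cod D k) \<and>
      far F f = Comp D (e' (Cod D k)) (Comp D k (e (Dom D k)))" by auto
  qed
  \<comment> \<open>The inverse functor conjugates \<open>k\<close> by the chosen isomorphisms
    \<open>e\<close> and lifts the result along \<open>F\<close>; its laws are checked after
    applying \<open>F\<close> and cancelling \<open>e\<close>.\<close>
  then obtain ga where ga: "\<And>k. k \<in> Ar D \<Longrightarrow> ga k \<in> Ar C \<and> Dom C (ga k) = go (Dom D k) \<and>
    Cod C (ga k) = go (Cod D k) \<and> far F (ga k) = Comp D (e' (Cod D k)) (Comp D k (e (Dom D k)))" by metis
  have nat: "Comp D (e (Cod D k)) (far F (ga k)) = Comp D k (e (Dom D k))" if k: "k \<in> Ar D" for k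
  proof -
    have o: "Dom D k \<in> Ob D" "Cod D k \<in> Ob D" using k by simp_all
    have "Comp D (e (Cod D k)) (Comp D (e' (Cod D k)) (Comp D k (e (Dom D k)))) = Comp D (Idn D (Cod D k)) (Comp D k (e (Dom D k)))"
      by (rule d.cmp_eq_left1) (use e[OF o(1)] e[OF o(2)] k in simp_all)
    also have "\<dots> = Comp D k (e (Dom D k))" using e[OF o(1)] k by simp
    finally show ?thesis using ga[OF k] by simp
  qed
  have emono: "is_mono D (e Y)" if "Y \<in> Ob D" for Y using e[OF that] d.iso_mono by blast
  define G where "G = \<lparr>fob = go, far = ga\<rparr>"
  have G: "is_functor D C G" unfolding is_functor_def
  proof (intro conjI ballI impI)
    fix Y assume Y: "Y \<in> Ob D"
    show "fob G Y \<in> Ob C" using e[OF Y] unfolding G_def by simp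
    have "ga (Idn D Y) = Idn C (go Y)"
    proof (rule faithful)
      have g: "ga (Idn D Y) \<in> Ar C" "Dom C (ga (Idn D Y)) = go Y" "Cod C (ga (Idn D Y)) = go Y"
        using ga[of "Idn D Y"] Y by simp_all
      then show "ga (Idn D Y) \<in> Ar C" "Dom C (ga (Idn D Y)) = Dom C (Idn C (go Y))"
        "Cod C (ga (Idn D Y)) = Cod C (Idn C (go Y))" using e[OF Y] by simp_all
      show "far F (ga (Idn D Y)) = far F (Idn C (go Y))"
        using ga[of "Idn D Y"] Y e[OF Y] by simp
    qed (use e[OF Y] in simp)
    then show "far G (Idn D Y) = Idn C (fob G Y)" unfolding G_def by simp
  next
    fix k assume k: "k \<in> Ar D"
    show "far G k \<in> Hom C (fob G (Dom D k)) (fob G (Cod D k))" unfolding G_def using ga[OF k] by simp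
    fix l assume l: "l \<in> Ar D" and kl: "Cod D k = Dom D l"
    have lk: "Comp D l k \<in> Ar D" "Dom D (Comp D l k) = Dom D k" "Cod D (Comp D l k) = Cod D l" using k l kl by simp_all
    have o: "Dom D k \<in> Ob D" "Cod D k \<in> Ob D" "Cod D l \<in> Ob D" using k l by simp_all
    note gk = ga[OF k] and gl = ga[OF l] and glk = ga[OF lk(1), unfolded lk(2,3)]
    have gk': "ga k \<in> Ar C" "Dom C (ga k) = go (Dom D k)" "Cod C (ga k) = go (Dom D l)"
      and gl': "ga l \<in> Ar C" "Dom C (ga l) = go (Dom D l)" "Cod C (ga l) = go (Cod D l)"
      and glk': "ga (Comp D l k) \<in> Ar C" "Dom C (ga (Comp D l k)) = go (Dom D k)" "Cod C (ga (Comp D l k)) = go (Cod D l)"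
      using gk gl glk kl by simp_all
    have "ga (Comp D l k) = Comp C (ga l) (ga k)"
    proof (rule faithful)
      show "far F (ga (Comp D l k)) = far F (Comp C (ga l) (ga k))"
      proof (rule d.monoD[OF emono[OF o(3)]])
        have "Comp D (e (Cod D l)) (far F (Comp C (ga l) (ga k))) =
          Comp D (e (Cod D l)) (Comp D (far F (ga l)) (far F (ga k)))" using gk' gl' by simp
        also have "\<dots> = Comp D l (Comp D (e (Dom D l)) (far F (ga k)))"
          by (rule d.cmp_eq_left[OF nat[OF l]]) (use gk' gl' l e[OF o(3)] e[OF o(2)] kl in simp_all)
        also have "Comp D (e (Dom D l)) (far F (ga k)) = Comp D k (e (Dom D k))" using nat[OF k] kl by simp
        also have "Comp D l (Comp D k (e (Dom D k))) = Comp D (Comp D l k) (e (Dom D k))"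
          using k l kl e[OF o(1)] by simp
        also have "\<dots> = Comp D (e (Cod D l)) (far F (ga (Comp D l k)))" using nat[OF lk(1)] lk by simp
        finally show "Comp D (e (Cod D l)) (far F (ga (Comp D l k))) = Comp D (e (Cod D l)) (far F (Comp C (ga l) (ga k)))" by simp
      qed (use gk' gl' glk' e[OF o(3)] in simp_all)
    qed (use gk' gl' glk' in simp_all)
    then show "far G (Comp D l k) = Comp C (far G l) (far G k)" unfolding G_def by simp
  qed (use c.cat d.cat in simp_all)
  have \<beta>: "nat_iso D D (F \<odot> G) fid e"
    unfolding nat_iso_def nat_trans_def
  proof (intro conjI ballI)
    show "is_functor D D (F \<odot> G)" by (rule is_functor_fcomp[OF G F])
    show "is_functor D D fid" by (rule is_functor_fid[OF d.cat])
    fix Y assume "Y \<in> Ob D"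
    then show "e Y \<in> Hom D (fob (F \<odot> G) Y) (fob fid Y)" "is_iso D (e Y)"
      using e unfolding fcomp_def fid_def G_def by simp_all
  next
    fix k assume "k \<in> Ar D"
    then show "Comp D (far fid k) (e (Dom D k)) = Comp D (e (Cod D k)) (far (F \<odot> G) k)"
      using nat unfolding fcomp_def fid_def G_def by simp
  qed
  have "\<forall>X\<in>Ob C. \<exists>a. a \<in> Ar C \<and> Dom C a = go (fob F X) \<and> Cod C a = X \<and> far F a = e (fob F X)"
  proof
    fix X assume X: "X \<in> Ob C"
    have FX: "fob F X \<in> Ob D" using X by simp
    have "\<exists>f\<in>Hom C (go (fob F X)) X. far F f = e (fob F X)"
      by (rule full) (use X e[OF FX] in simp_all)
    then show "\<exists>a. a \<in> Ar C \<and> Dom C a = go (fob F X) \<and> Cod C a = X \<and> far F a = e (fob F X)" by auto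
  qed
  then obtain \<alpha> where \<alpha>: "\<And>X. X \<in> Ob C \<Longrightarrow> \<alpha> X \<in> Ar C \<and> Dom C (\<alpha> X) = go (fob F X) \<and> Cod C (\<alpha> X) = X \<and>
    far F (\<alpha> X) = e (fob F X)" by metis
  have \<alpha>_iso: "is_iso C (\<alpha> X)" if X: "X \<in> Ob C" for X
  proof -
    note a = \<alpha>[OF X]
    have FX: "fob F X \<in> Ob D" using X by simp
    obtain b where b: "b \<in> Hom C X (go (fob F X))" "far F b = e' (fob F X)"
      using full[of X "go (fob F X)" "e' (fob F X)"] X e[OF FX] by auto
    show ?thesis
    proof (rule c.isoI[of _ b])
      show "Comp C b (\<alpha> X) = Idn C (Dom C (\<alpha> X))"
        by (rule faithful) (use a b e[OF FX] in simp_all)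
      show "Comp C (\<alpha> X) b = Idn C (Cod C (\<alpha> X))"
        by (rule faithful) (use a b e[OF FX] X in simp_all)
    qed (use a b in simp_all)
  qed
  have "nat_iso C C (G \<odot> F) fid \<alpha>"
    unfolding nat_iso_def nat_trans_def
  proof (intro conjI ballI)
    show "is_functor C C (G \<odot> F)" by (rule is_functor_fcomp[OF F G])
    show "is_functor C C fid" by (rule is_functor_fid[OF c.cat])
    fix X assume X: "X \<in> Ob C"
    then show "\<alpha> X \<in> Hom C (fob (G \<odot> F) X) (fob fid X)" using \<alpha>[OF X] unfolding fcomp_def fid_def G_def by simp
    show "is_iso C (\<alpha> X)" using \<alpha>_iso[OF X] .
  next
    fix f assume f: "f \<in> Ar C"
    have o: "Dom C f \<in> Ob C" "Cod C f \<in> Ob C" using f by simp_all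
    note g = ga[of "far F f"]
    have "Comp C f (\<alpha> (Dom C f)) = Comp C (\<alpha> (Cod C f)) (ga (far F f))"
      by (rule faithful) (use f \<alpha>[OF o(1)] \<alpha>[OF o(2)] g nat[of "far F f"] in simp_all)
    then show "Comp C (far fid f) (\<alpha> (Dom C f)) = Comp C (\<alpha> (Cod C f)) (far (G \<odot> F) f)"
      unfolding fcomp_def fid_def G_def by simp
  qed
  then show ?thesis unfolding is_equivalence_def using F G \<beta> by blast
qed

section \<open>Units, counits and transposition\<close>

lemma nat_transD:
  assumes "nat_trans C D F G \<alpha>"
  shows "is_functor C D F" "is_functor C D G" "X \<in> Ob C \<Longrightarrow> \<alpha> X \<in> Ar D"
    "X \<in> Ob C \<Longrightarrow> Dom D (\<alpha> X) = fob F X" "X \<in> Ob C \<Longrightarrow> Cod D (\<alpha> X) = fob G X"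
    "f \<in> Ar C \<Longrightarrow> Comp D (far G f) (\<alpha> (Dom C f)) = Comp D (\<alpha> (Cod C f)) (far F f)"
  using assms unfolding nat_trans_def by auto

locale adjoint_pair =
  fixes A :: "('o, 'm) cat" and B :: "('p, 'n) cat" and F G \<eta> \<epsilon>
  assumes adj: "adjunction A B F G \<eta> \<epsilon>"
begin

lemma F: "is_functor A B F" and G: "is_functor B A G"
  using adj unfolding adjunction_def by auto

lemma unit_nat: "nat_trans A A fid (G \<odot> F) \<eta>" and counit_nat: "nat_trans B B (F \<odot> G) fid \<epsilon>"
  using adj unfolding adjunction_def by auto

sublocale a: category A by (rule is_functor_cats[OF F])
sublocale b: category B by (rule is_functor_cats[OF F])

lemmas F_simps [simp] = functor_simps[OF F]
lemmas G_simps [simp] = functor_simps[OF G]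

lemma unit_simps [simp]:
  "X \<in> Ob A \<Longrightarrow> \<eta> X \<in> Ar A" "X \<in> Ob A \<Longrightarrow> Dom A (\<eta> X) = X" "X \<in> Ob A \<Longrightarrow> Cod A (\<eta> X) = fob G (fob F X)"
  using nat_transD[OF unit_nat] unfolding fid_def fcomp_def by simp_all

lemma counit_simps [simp]:
  "X \<in> Ob B \<Longrightarrow> \<epsilon> X \<in> Ar B" "X \<in> Ob B \<Longrightarrow> Cod B (\<epsilon> X) = X" "X \<in> Ob B \<Longrightarrow> Dom B (\<epsilon> X) = fob F (fob G X)"
  using nat_transD[OF counit_nat] unfolding fid_def fcomp_def by simp_all

lemma unit_natural: "f \<in> Ar A \<Longrightarrow> Comp A (\<eta> (Cod A f)) f = Comp A (far G (far F f)) (\<eta> (Dom A f))"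
  using nat_transD(6)[OF unit_nat, of f] unfolding fid_def fcomp_def by simp

lemma counit_natural: "f \<in> Ar B \<Longrightarrow> Comp B (\<epsilon> (Cod B f)) (far F (far G f)) = Comp B f (\<epsilon> (Dom B f))"
  using nat_transD(6)[OF counit_nat, of f] unfolding fid_def fcomp_def by simp

lemma triangles:
  "X \<in> Ob A \<Longrightarrow> Comp B (\<epsilon> (fob F X)) (far F (\<eta> X)) = Idn B (fob F X)"
  "Y \<in> Ob B \<Longrightarrow> Comp A (far G (\<epsilon> Y)) (\<eta> (fob G Y)) = Idn A (fob G Y)"
  using adj unfolding adjunction_def by auto

lemma transpose:
  assumes "h \<in> Ar A" "Cod A h = fob G X" "X \<in> Ob B"
  shows "Comp A (far G (Comp B (\<epsilon> X) (far F h))) (\<eta> (Dom A h)) = h"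
proof -
  have o: "Dom A h \<in> Ob A" "fob G X \<in> Ob A" using assms by simp_all
  have "Comp A (far G (Comp B (\<epsilon> X) (far F h))) (\<eta> (Dom A h)) =
    Comp A (far G (\<epsilon> X)) (Comp A (far G (far F h)) (\<eta> (Dom A h)))" using assms o by simp
  also have "Comp A (far G (far F h)) (\<eta> (Dom A h)) = Comp A (\<eta> (fob G X)) h"
    using unit_natural[OF assms(1)] assms by simp
  also have "Comp A (far G (\<epsilon> X)) (Comp A (\<eta> (fob G X)) h) = Comp A (Idn A (fob G X)) h"
    by (rule a.cmp_eq_left1[OF triangles(2)]) (use assms o in simp_all)
  finally show ?thesis using assms by simp
qed

lemma untranspose:
  assumes "b \<in> Ar B" "Dom B b = fob F Y" "Y \<in> Ob A"
  shows "Comp B (\<epsilon> (Cod B b)) (far F (Comp A (far G b) (\<eta> Y))) = b"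
proof -
  have o: "Cod B b \<in> Ob B" "fob F Y \<in> Ob B" using assms by simp_all
  have "Comp B (\<epsilon> (Cod B b)) (far F (Comp A (far G b) (\<eta> Y))) =
    Comp B (\<epsilon> (Cod B b)) (Comp B (far F (far G b)) (far F (\<eta> Y)))" using assms o by simp
  also have "\<dots> = Comp B b (Comp B (\<epsilon> (Dom B b)) (far F (\<eta> Y)))"
    by (rule b.cmp_eq_left[OF counit_natural[OF assms(1)]]) (use assms o in simp_all)
  also have "\<dots> = b" using triangles(1)[OF assms(3)] assms by simp
  finally show ?thesis .
qed

lemma transpose_inj:
  assumes "b \<in> Ar B" "Dom B b = fob F Y" "Y \<in> Ob A" "b' \<in> Ar B" "Dom B b' = fob F Y" "Cod B b = Cod B b'"
    "Comp A (far G b) (\<eta> Y) = Comp A (far G b') (\<eta> Y)"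
  shows "b = b'"
proof -
  have "b = Comp B (\<epsilon> (Cod B b)) (far F (Comp A (far G b) (\<eta> Y)))"
    using untranspose[OF assms(1-3)] by (rule sym)
  also have "\<dots> = Comp B (\<epsilon> (Cod B b')) (far F (Comp A (far G b') (\<eta> Y)))"
    unfolding assms(6,7) ..
  also have "\<dots> = b'" by (rule untranspose[OF assms(4,5,3)])
  finally show ?thesis .
qed

end

section \<open>The recollement\<close>

text \<open>Isolates the formal part from the computation with fractions. The square commutes
  strictly, on objects and on arrows, which is what lets the third component of \<open>R\<close> be
  an identity.\<close>

locale recollement_square =
  fixes B :: "('o, 'm) cat" and A0 :: "('o0, 'm0) cat" and A1 :: "('o1, 'm1) cat" and E :: "('q, 'e) cat"
    and Q0 Q1 F0 F1
  assumes Q0: "is_functor B A0 Q0" and Q1: "is_functor B A1 Q1"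
    and F0: "is_functor A0 E F0" and F1: "is_functor A1 E F1"
    and ob_eq: "X \<in> Ob B \<Longrightarrow> fob F1 (fob Q1 X) = fob F0 (fob Q0 X)"
    and ar_eq: "f \<in> Ar B \<Longrightarrow> far F1 (far Q1 f) = far F0 (far Q0 f)"
begin

sublocale b: category B by (rule is_functor_cats[OF Q0])
sublocale a0: category A0 by (rule is_functor_cats[OF Q0])
sublocale a1: category A1 by (rule is_functor_cats[OF Q1])
sublocale e: category E by (rule is_functor_cats[OF F0])

lemmas fun_simps [simp] = functor_simps[OF Q0] functor_simps[OF Q1] functor_simps[OF F0] functor_simps[OF F1]

abbreviation D where "D \<equiv> recollement A0 A1 E F0 F1"
abbreviation R where "R \<equiv> restriction_functor B E Q0 Q1 F0"

lemma Ob_D: "(X0, X1, \<sigma>) \<in> Ob D \<longleftrightarrow> X0 \<in> Ob A0 \<and> X1 \<in> Ob A1 \<and> \<sigma> \<in> Ar E \<and> Dom E \<sigma> = fob F0 X0 \<and>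
    Cod E \<sigma> = fob F1 X1 \<and> is_iso E \<sigma>"
  unfolding recollement_def Let_def by auto

lemma Ar_D: "((X0, X1, \<sigma>), (X0', X1', \<sigma>'), f0, f1) \<in> Ar D \<longleftrightarrow>
    (X0, X1, \<sigma>) \<in> Ob D \<and> (X0', X1', \<sigma>') \<in> Ob D \<and> f0 \<in> Ar A0 \<and> Dom A0 f0 = X0 \<and> Cod A0 f0 = X0' \<and>
    f1 \<in> Ar A1 \<and> Dom A1 f1 = X1 \<and> Cod A1 f1 = X1' \<and>
    Comp E \<sigma>' (far F0 f0) = Comp E (far F1 f1) \<sigma>"
  unfolding recollement_def Let_def by auto

lemma D_simps [simp]:
  "Dom D (\<Theta>, \<Theta>', f) = \<Theta>" "Cod D (\<Theta>, \<Theta>', f) = \<Theta>'"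
  "Idn D (X0, X1, \<sigma>) = ((X0, X1, \<sigma>), (X0, X1, \<sigma>), Idn A0 X0, Idn A1 X1)"
  "Comp D (\<Theta>', \<Theta>'', g0, g1) (\<Theta>, \<Theta>1, f0, f1) = (\<Theta>, \<Theta>'', Comp A0 g0 f0, Comp A1 g1 f1)"
  unfolding recollement_def Let_def by auto

lemma D_ArE:
  assumes "a \<in> Ar D"
  obtains X0 X1 \<sigma> X0' X1' \<sigma>' f0 f1 where "a = ((X0, X1, \<sigma>), (X0', X1', \<sigma>'), f0, f1)"
    "(X0, X1, \<sigma>) \<in> Ob D" "(X0', X1', \<sigma>') \<in> Ob D" "f0 \<in> Ar A0" "Dom A0 f0 = X0" "Cod A0 f0 = X0'"
    "f1 \<in> Ar A1" "Dom A1 f1 = X1" "Cod A1 f1 = X1'" "Comp E \<sigma>' (far F0 f0) = Comp E (far F1 f1) \<sigma>"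
proof -
  obtain X0 X1 \<sigma> X0' X1' \<sigma>' f0 f1 where a: "a = ((X0, X1, \<sigma>), (X0', X1', \<sigma>'), f0, f1)"
    by (metis prod.exhaust)
  show thesis using that[OF a] assms unfolding a Ar_D by blast
qed

lemma D_compat_comp:
  assumes "\<sigma> \<in> Ar E" "\<sigma>' \<in> Ar E" "\<sigma>'' \<in> Ar E"
    "Dom E \<sigma> = fob F0 (Dom A0 f0)" "Cod E \<sigma> = fob F1 (Dom A1 f1)"
    "Dom E \<sigma>' = fob F0 (Cod A0 f0)" "Cod E \<sigma>' = fob F1 (Cod A1 f1)"
    "Dom E \<sigma>'' = fob F0 (Cod A0 g0)" "Cod E \<sigma>'' = fob F1 (Cod A1 g1)"
    "f0 \<in> Ar A0" "g0 \<in> Ar A0" "Cod A0 f0 = Dom A0 g0" "f1 \<in> Ar A1" "g1 \<in> Ar A1" "Cod A1 f1 = Dom A1 g1"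
    "Comp E \<sigma>' (far F0 f0) = Comp E (far F1 f1) \<sigma>" "Comp E \<sigma>'' (far F0 g0) = Comp E (far F1 g1) \<sigma>'"
  shows "Comp E \<sigma>'' (far F0 (Comp A0 g0 f0)) = Comp E (far F1 (Comp A1 g1 f1)) \<sigma>"
proof -
  have "Comp E \<sigma>'' (far F0 (Comp A0 g0 f0)) = Comp E \<sigma>'' (Comp E (far F0 g0) (far F0 f0))"
    using assms(1-15) by simp
  also have "\<dots> = Comp E (far F1 g1) (Comp E \<sigma>' (far F0 f0))"
    by (rule e.cmp_eq_left[OF assms(17)]) (use assms(1-15) in simp_all)
  also have "\<dots> = Comp E (far F1 g1) (Comp E (far F1 f1) \<sigma>)" using assms(16) by simp
  also have "\<dots> = Comp E (far F1 (Comp A1 g1 f1)) \<sigma>" using assms(1-15) by simp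
  finally show ?thesis .
qed

lemma D_category: "is_category D"
  unfolding is_category_def
proof (intro conjI ballI impI)
  fix a assume "a \<in> Ar D"
  then show "Dom D a \<in> Ob D" "Cod D a \<in> Ob D" "Comp D a (Idn D (Dom D a)) = a"
    "Comp D (Idn D (Cod D a)) a = a" by (auto elim!: D_ArE)
next
  fix \<Theta> assume "\<Theta> \<in> Ob D"
  moreover obtain X0 X1 \<sigma> where "\<Theta> = (X0, X1, \<sigma>)" by (rule prod_cases3)
  ultimately show "Idn D \<Theta> \<in> Hom D \<Theta> \<Theta>" by (auto simp: Ar_D Ob_D)
next
  fix a b assume a: "a \<in> Ar D" and b: "b \<in> Ar D" and ab: "Cod D a = Dom D b"
  obtain X0 X1 \<sigma> X0' X1' \<sigma>' f0 f1 where a': "a = ((X0, X1, \<sigma>), (X0', X1', \<sigma>'), f0, f1)"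
    "(X0, X1, \<sigma>) \<in> Ob D" "(X0', X1', \<sigma>') \<in> Ob D" "f0 \<in> Ar A0" "Dom A0 f0 = X0" "Cod A0 f0 = X0'"
    "f1 \<in> Ar A1" "Dom A1 f1 = X1" "Cod A1 f1 = X1'" "Comp E \<sigma>' (far F0 f0) = Comp E (far F1 f1) \<sigma>"
    by (rule D_ArE[OF a])
  obtain Y0 Y1 \<tau> X0'' X1'' \<sigma>'' g0 g1 where b': "b = ((Y0, Y1, \<tau>), (X0'', X1'', \<sigma>''), g0, g1)"
    "(Y0, Y1, \<tau>) \<in> Ob D" "(X0'', X1'', \<sigma>'') \<in> Ob D" "g0 \<in> Ar A0" "Dom A0 g0 = Y0" "Cod A0 g0 = X0''"
    "g1 \<in> Ar A1" "Dom A1 g1 = Y1" "Cod A1 g1 = X1''" "Comp E \<sigma>'' (far F0 g0) = Comp E (far F1 g1) \<tau>"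
    by (rule D_ArE[OF b])
  have eq: "Y0 = X0'" "Y1 = X1'" "\<tau> = \<sigma>'" using ab a' b' by simp_all
  have "Comp E \<sigma>'' (far F0 (Comp A0 g0 f0)) = Comp E (far F1 (Comp A1 g1 f1)) \<sigma>"
    by (rule D_compat_comp[of _ \<sigma>']) (use a'(2-) b'(2-) eq in \<open>simp_all add: Ob_D\<close>)
  then show "Comp D b a \<in> Hom D (Dom D a) (Cod D b)"
    unfolding a'(1) b'(1) using a'(2-9) b'(2-9) eq by (simp add: Ar_D)
next
  fix a b c assume "a \<in> Ar D" "b \<in> Ar D" "c \<in> Ar D" "Cod D a = Dom D b" "Cod D b = Dom D c"
  then show "Comp D c (Comp D b a) = Comp D (Comp D c b) a"
    by (elim D_ArE) simp
qed

sublocale d: category D by unfold_locales (rule D_category)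

lemma D_iso:
  assumes a: "((X0, X1, \<sigma>), (X0', X1', \<sigma>'), f0, f1) \<in> Ar D" and f0: "is_iso A0 f0" and f1: "is_iso A1 f1"
  shows "is_iso D ((X0, X1, \<sigma>), (X0', X1', \<sigma>'), f0, f1)"
proof -
  note a' = a[unfolded Ar_D Ob_D]
  obtain g0 where g0: "g0 \<in> Ar A0" "Dom A0 g0 = Cod A0 f0" "Cod A0 g0 = Dom A0 f0"
    "Comp A0 g0 f0 = Idn A0 (Dom A0 f0)" "Comp A0 f0 g0 = Idn A0 (Cod A0 f0)" by (rule a0.isoE[OF f0])
  obtain g1 where g1: "g1 \<in> Ar A1" "Dom A1 g1 = Cod A1 f1" "Cod A1 g1 = Dom A1 f1"
    "Comp A1 g1 f1 = Idn A1 (Dom A1 f1)" "Comp A1 f1 g1 = Idn A1 (Cod A1 f1)" by (rule a1.isoE[OF f1])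
  have F0g: "Comp E (far F0 f0) (far F0 g0) = Idn E (fob F0 X0')"
    using functor_simps(6)[OF F0, of g0 f0] g0 a' by simp
  have F1g: "Comp E (far F1 g1) (far F1 f1) = Idn E (fob F1 X1)"
    using functor_simps(6)[OF F1, of f1 g1] g1 a' by simp
  have eq: "Comp E \<sigma>' (far F0 f0) = Comp E (far F1 f1) \<sigma>" using a' by blast
  have "Comp E (far F1 g1) \<sigma>' = Comp E (far F1 g1) (Comp E \<sigma>' (Comp E (far F0 f0) (far F0 g0)))"
    unfolding F0g using a' by simp
  also have "Comp E \<sigma>' (Comp E (far F0 f0) (far F0 g0)) = Comp E (far F1 f1) (Comp E \<sigma> (far F0 g0))"
    by (rule e.cmp_eq_left[OF eq]) (use a' g0(1-3) in simp_all)
  also have "Comp E (far F1 g1) (Comp E (far F1 f1) (Comp E \<sigma> (far F0 g0))) =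
    Comp E (Idn E (fob F1 X1)) (Comp E \<sigma> (far F0 g0))"
    by (rule e.cmp_eq_left1[OF F1g]) (use a' g0(1-3) g1(1-3) in simp_all)
  also have "\<dots> = Comp E \<sigma> (far F0 g0)" using a' g0(1-3) by simp
  finally have "((X0', X1', \<sigma>'), (X0, X1, \<sigma>), g0, g1) \<in> Ar D"
    unfolding Ar_D Ob_D using a' g0(1-3) g1(1-3) by simp
  then show ?thesis
    by (rule d.isoI[OF a]) (use a' g0 g1 in simp_all)
qed

lemma R_simps:
  "fob R X = (fob Q0 X, fob Q1 X, Idn E (fob F0 (fob Q0 X)))"
  "far R f = (fob R (Dom B f), fob R (Cod B f), far Q0 f, far Q1 f)"
  unfolding restriction_functor_def Let_def by simp_all

lemma R_Ob: "X \<in> Ob B \<Longrightarrow> fob R X \<in> Ob D"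
  unfolding R_simps Ob_D using ob_eq e.iso_Idn by simp

lemma R_functor: "is_functor B D R"
  unfolding is_functor_def
proof (intro conjI ballI impI)
  show "is_category B" "is_category D" using b.cat D_category by auto
  fix X assume X: "X \<in> Ob B"
  show "fob R X \<in> Ob D" using R_Ob[OF X] .
  show "far R (Idn B X) = Idn D (fob R X)" using X by (simp add: R_simps)
next
  fix f assume f: "f \<in> Ar B"
  show "far R f \<in> Hom D (fob R (Dom B f)) (fob R (Cod B f))"
    using f R_Ob[of "Dom B f"] R_Ob[of "Cod B f"] ar_eq[of f] ob_eq by (simp add: R_simps Ar_D)
  fix g assume g: "g \<in> Ar B" "Cod B f = Dom B g"
  then show "far R (Comp B g f) = Comp D (far R g) (far R f)" using f by (simp add: R_simps)
qed

lemma R_arrow: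
  assumes "Y \<in> Ob B" "(X0, X1, \<sigma>) \<in> Ob D"
  shows "(fob R Y, (X0, X1, \<sigma>), f0, f1) \<in> Ar D \<longleftrightarrow> f0 \<in> Ar A0 \<and> Dom A0 f0 = fob Q0 Y \<and> Cod A0 f0 = X0 \<and>
    f1 \<in> Ar A1 \<and> Dom A1 f1 = fob Q1 Y \<and> Cod A1 f1 = X1 \<and> Comp E \<sigma> (far F0 f0) = far F1 f1"
proof -
  have "Comp E (far F1 f1) (Idn E (fob F0 (fob Q0 Y))) = far F1 f1" if "f1 \<in> Ar A1" "Dom A1 f1 = fob Q1 Y"
    using that assms ob_eq by simp
  then show ?thesis unfolding R_simps Ar_D using R_Ob[OF assms(1)] assms unfolding R_simps by auto
qed

end

section \<open>The fiber product functor and its counit\<close>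

locale glueing = recollement_square B A0 A1 E Q0 Q1 F0 F1
  for B :: "('o, 'm) cat" and A0 :: "('o0, 'm0) cat" and A1 :: "('o1, 'm1) cat" and E :: "('q, 'e) cat"
    and Q0 Q1 F0 F1 +
  fixes U0 U1 H0 H1 \<mu>0 \<mu>1 \<gamma>0 \<gamma>1 \<eta>0 \<eta>1 \<delta>0 \<delta>1 \<iota> \<pi>0 \<pi>1
  assumes adjQ0: "adjunction B A0 Q0 U0 \<mu>0 \<gamma>0" and adjQ1: "adjunction B A1 Q1 U1 \<mu>1 \<gamma>1"
    and adjF0: "adjunction A0 E F0 H0 \<eta>0 \<delta>0" and adjF1: "adjunction A1 E F1 H1 \<eta>1 \<delta>1"
    and comparison: "adjoint_comparison B E (F0 \<odot> Q0)
          (U0 \<odot> H0) (comp_unit B Q0 U0 \<mu>0 \<eta>0) (comp_counit E F0 H0 \<gamma>0 \<delta>0)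
          (U1 \<odot> H1) (comp_unit B Q1 U1 \<mu>1 \<eta>1) (comp_counit E F1 H1 \<gamma>1 \<delta>1) \<iota>"
    and pullback: "\<Theta> \<in> Ob D \<Longrightarrow> is_pullback B
           (glue_leg0 B U0 H0 F1 \<eta>0 \<iota> \<Theta>) (glue_leg1 U1 \<eta>1 \<Theta>) (\<pi>0 \<Theta>) (\<pi>1 \<Theta>)"
begin

sublocale q0: adjoint_pair B A0 Q0 U0 \<mu>0 \<gamma>0 by unfold_locales (rule adjQ0)
sublocale q1: adjoint_pair B A1 Q1 U1 \<mu>1 \<gamma>1 by unfold_locales (rule adjQ1)
sublocale f0: adjoint_pair A0 E F0 H0 \<eta>0 \<delta>0 by unfold_locales (rule adjF0)
sublocale f1: adjoint_pair A1 E F1 H1 \<eta>1 \<delta>1 by unfold_locales (rule adjF1)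

abbreviation leg0 where "leg0 \<equiv> glue_leg0 B U0 H0 F1 \<eta>0 \<iota>"
abbreviation leg1 where "leg1 \<equiv> glue_leg1 U1 \<eta>1"
abbreviation V where "V \<equiv> glue_functor B U0 U1 \<pi>0 \<pi>1"
abbreviation counit where "counit \<equiv> glue_counit A0 A1 Q0 Q1 \<gamma>0 \<gamma>1 \<pi>0 \<pi>1 (R \<odot> V)"

lemma \<iota>_simps [simp]:
  "Y \<in> Ob E \<Longrightarrow> \<iota> Y \<in> Ar B" "Y \<in> Ob E \<Longrightarrow> Dom B (\<iota> Y) = fob U0 (fob H0 Y)"
  "Y \<in> Ob E \<Longrightarrow> Cod B (\<iota> Y) = fob U1 (fob H1 Y)"
  using nat_transD(3-5)[of E B "U0 \<odot> H0" "U1 \<odot> H1" \<iota>] comparison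
  unfolding adjoint_comparison_def nat_iso_def fcomp_def by simp_all

lemma \<iota>_natural: "c \<in> Ar E \<Longrightarrow> Comp B (far U1 (far H1 c)) (\<iota> (Dom E c)) = Comp B (\<iota> (Cod E c)) (far U0 (far H0 c))"
  using nat_transD(6)[of E B "U0 \<odot> H0" "U1 \<odot> H1" \<iota> c] comparison
  unfolding adjoint_comparison_def nat_iso_def fcomp_def by simp

lemma \<iota>_unit: "Y \<in> Ob B \<Longrightarrow> Comp B (\<iota> (fob F0 (fob Q0 Y))) (Comp B (far U0 (\<eta>0 (fob Q0 Y))) (\<mu>0 Y)) =
    Comp B (far U1 (\<eta>1 (fob Q1 Y))) (\<mu>1 Y)"
  using comparison unfolding adjoint_comparison_def comp_unit_def fcomp_def by simp

lemma legs:
  assumes "(X0, X1, \<sigma>) \<in> Ob D"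
  shows "leg0 (X0, X1, \<sigma>) \<in> Ar B" "Dom B (leg0 (X0, X1, \<sigma>)) = fob U0 X0"
    "Cod B (leg0 (X0, X1, \<sigma>)) = fob U1 (fob H1 (fob F1 X1))"
    "leg1 (X0, X1, \<sigma>) \<in> Ar B" "Dom B (leg1 (X0, X1, \<sigma>)) = fob U1 X1"
    "Cod B (leg1 (X0, X1, \<sigma>)) = fob U1 (fob H1 (fob F1 X1))"
  unfolding glue_leg0_def glue_leg1_def using assms[unfolded Ob_D] by simp_all

text \<open>Both composites are transposed to arrows of \<open>E\<close> out of
  \<open>F1 (Q1 Y) = F0 (Q0 Y)\<close>. The second leg gives the transpose of
  \<open>far F1 b1\<close> under the composite of the adjunctions with index 1. The first gives a
  transpose of \<open>Comp E \<sigma> (far F0 b0)\<close> under those with index 0, which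
  \<open>\<iota>\<close>, being natural and compatible with units, converts to index 1.
  Transposition is injective.\<close>

lemma legs_transpose:
  assumes \<Theta>: "(X0, X1, \<sigma>) \<in> Ob D" and Y: "Y \<in> Ob B"
    and b0: "b0 \<in> Ar A0" "Dom A0 b0 = fob Q0 Y" "Cod A0 b0 = X0"
    and b1: "b1 \<in> Ar A1" "Dom A1 b1 = fob Q1 Y" "Cod A1 b1 = X1"
  shows "Comp B (leg0 (X0, X1, \<sigma>)) (Comp B (far U0 b0) (\<mu>0 Y)) = Comp B (leg1 (X0, X1, \<sigma>)) (Comp B (far U1 b1) (\<mu>1 Y))
    \<longleftrightarrow> Comp E \<sigma> (far F0 b0) = far F1 b1"
proof -
  note th = \<Theta>[unfolded Ob_D]
  have ob: "fob Q0 Y \<in> Ob A0" "fob Q1 Y \<in> Ob A1" "fob F0 (fob Q0 Y) \<in> Ob E" using Y by simp_all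
  let ?c = "Comp E \<sigma> (far F0 b0)"
  have c: "?c \<in> Ar E" "Dom E ?c = fob F0 (fob Q0 Y)" "Cod E ?c = fob F1 X1" using th b0 by simp_all
  have F1b: "far F1 b1 \<in> Ar E" "Dom E (far F1 b1) = fob F0 (fob Q0 Y)" "Cod E (far F1 b1) = fob F1 X1"
    using b1 ob_eq[OF Y] by simp_all
  have \<eta>: "\<eta>1 (fob Q1 Y) \<in> Ar A1" "Dom A1 (\<eta>1 (fob Q1 Y)) = fob Q1 Y" "Cod A1 (\<eta>1 (fob Q1 Y)) = fob H1 (fob F0 (fob Q0 Y))"
    using ob ob_eq[OF Y] by simp_all
  let ?t = "\<lambda>c. Comp B (far U1 (Comp A1 (far H1 c) (\<eta>1 (fob Q1 Y)))) (\<mu>1 Y)"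
  have "Comp A1 (\<eta>1 X1) b1 = Comp A1 (far H1 (far F1 b1)) (\<eta>1 (fob Q1 Y))"
    using f1.unit_natural[OF b1(1)] b1 by simp
  then have 1: "Comp B (leg1 (X0, X1, \<sigma>)) (Comp B (far U1 b1) (\<mu>1 Y)) = ?t (far F1 b1)"
    unfolding glue_leg1_def using q1.G_simps(6)[of b1 "\<eta>1 X1"] b1 th Y by simp
  have n0: "Comp A0 (\<eta>0 X0) b0 = Comp A0 (far H0 (far F0 b0)) (\<eta>0 (fob Q0 Y))"
    using f0.unit_natural[OF b0(1)] b0 by simp
  have "Comp B (leg0 (X0, X1, \<sigma>)) (Comp B (far U0 b0) (\<mu>0 Y)) =
    Comp B (\<iota> (fob F1 X1)) (Comp B (far U0 (far H0 \<sigma>)) (Comp B (far U0 (\<eta>0 X0)) (Comp B (far U0 b0) (\<mu>0 Y))))"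
    unfolding glue_leg0_def using th b0 Y by simp
  also have "Comp B (far U0 (\<eta>0 X0)) (Comp B (far U0 b0) (\<mu>0 Y)) = Comp B (far U0 (Comp A0 (\<eta>0 X0) b0)) (\<mu>0 Y)"
    using th b0 Y by simp
  also have "\<dots> = Comp B (far U0 (far H0 (far F0 b0))) (Comp B (far U0 (\<eta>0 (fob Q0 Y))) (\<mu>0 Y))"
    unfolding n0 using th b0 Y by simp
  also have "Comp B (far U0 (far H0 \<sigma>)) \<dots> = Comp B (far U0 (far H0 ?c)) (Comp B (far U0 (\<eta>0 (fob Q0 Y))) (\<mu>0 Y))"
    using th b0 Y by simp
  \<comment> \<open>Naturality moves \<open>\<iota>\<close> to the right until it meets the
    composite unit of index 0, which it turns into the one of index 1.\<close>
  also have "Comp B (\<iota> (fob F1 X1)) \<dots> = Comp B (far U1 (far H1 ?c))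
    (Comp B (\<iota> (fob F0 (fob Q0 Y))) (Comp B (far U0 (\<eta>0 (fob Q0 Y))) (\<mu>0 Y)))"
    by (rule b.cmp_eq_left[OF \<iota>_natural[OF c(1), symmetric, unfolded c(2,3)]]) (use c th Y in simp_all)
  also have "\<dots> = Comp B (far U1 (far H1 ?c)) (Comp B (far U1 (\<eta>1 (fob Q1 Y))) (\<mu>1 Y))"
    unfolding \<iota>_unit[OF Y] ..
  also have "\<dots> = ?t ?c" using c \<eta> Y by simp
  finally have 0: "Comp B (leg0 (X0, X1, \<sigma>)) (Comp B (far U0 b0) (\<mu>0 Y)) = ?t ?c" .
  have "?t ?c = ?t (far F1 b1) \<longleftrightarrow> ?c = far F1 b1"
  proof
    assume eq: "?t ?c = ?t (far F1 b1)"
    have "Comp A1 (far H1 ?c) (\<eta>1 (fob Q1 Y)) = Comp A1 (far H1 (far F1 b1)) (\<eta>1 (fob Q1 Y))"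
      by (rule q1.transpose_inj[OF _ _ Y _ _ _ eq]) (use c F1b \<eta> in simp_all)
    then show "?c = far F1 b1"
      by (intro f1.transpose_inj[OF c(1) _ ob(2) F1b(1)]) (use c F1b ob_eq[OF Y] in simp_all)
  qed simp
  then show ?thesis unfolding 0 1 .
qed

text \<open>Every \<open>h0\<close> and \<open>h1\<close> is a transpose, so cones with vertex
  \<open>Y\<close> over the cospan of \<Theta> are the same as arrows from \<open>R Y\<close> to
  \<Theta> in the recollement.\<close>

lemma legs_eq_iff:
  assumes \<Theta>: "(X0, X1, \<sigma>) \<in> Ob D"
    and h0: "h0 \<in> Ar B" "Dom B h0 = Y" "Cod B h0 = fob U0 X0" and h1: "h1 \<in> Ar B" "Dom B h1 = Y" "Cod B h1 = fob U1 X1"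
  shows "Comp B (leg0 (X0, X1, \<sigma>)) h0 = Comp B (leg1 (X0, X1, \<sigma>)) h1 \<longleftrightarrow>
    (fob R Y, (X0, X1, \<sigma>), Comp A0 (\<gamma>0 X0) (far Q0 h0), Comp A1 (\<gamma>1 X1) (far Q1 h1)) \<in> Ar D"
proof -
  note th = \<Theta>[unfolded Ob_D]
  have Y: "Y \<in> Ob B" using h0 by auto
  let ?b0 = "Comp A0 (\<gamma>0 X0) (far Q0 h0)" and ?b1 = "Comp A1 (\<gamma>1 X1) (far Q1 h1)"
  have b0: "?b0 \<in> Ar A0" "Dom A0 ?b0 = fob Q0 Y" "Cod A0 ?b0 = X0"
    and b1: "?b1 \<in> Ar A1" "Dom A1 ?b1 = fob Q1 Y" "Cod A1 ?b1 = X1" using h0 h1 th by simp_all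
  have t: "Comp B (far U0 ?b0) (\<mu>0 Y) = h0" "Comp B (far U1 ?b1) (\<mu>1 Y) = h1"
    using q0.transpose[of h0 X0] q1.transpose[of h1 X1] h0 h1 th by auto
  show ?thesis using legs_transpose[OF \<Theta> Y b0 b1] b0 b1 unfolding t R_arrow[OF Y \<Theta>] by blast
qed

lemma \<pi>_simps:
  assumes \<Theta>: "(X0, X1, \<sigma>) \<in> Ob D"
  shows "\<pi>0 (X0, X1, \<sigma>) \<in> Ar B" "Cod B (\<pi>0 (X0, X1, \<sigma>)) = fob U0 X0"
    "\<pi>1 (X0, X1, \<sigma>) \<in> Ar B" "Cod B (\<pi>1 (X0, X1, \<sigma>)) = fob U1 X1"
    "Dom B (\<pi>0 (X0, X1, \<sigma>)) = fob V (X0, X1, \<sigma>)" "Dom B (\<pi>1 (X0, X1, \<sigma>)) = fob V (X0, X1, \<sigma>)"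
  using b.pullbackD[OF pullback[OF \<Theta>]] legs[OF \<Theta>] unfolding glue_functor_def by simp_all

lemma counit_eq: "counit (X0, X1, \<sigma>) = (fob R (fob V (X0, X1, \<sigma>)), (X0, X1, \<sigma>),
    Comp A0 (\<gamma>0 X0) (far Q0 (\<pi>0 (X0, X1, \<sigma>))), Comp A1 (\<gamma>1 X1) (far Q1 (\<pi>1 (X0, X1, \<sigma>))))"
  unfolding glue_counit_def fcomp_def by simp

lemma V_Ob: "\<Theta> \<in> Ob D \<Longrightarrow> fob V \<Theta> \<in> Ob B"
  unfolding glue_functor_def using b.pullbackD(4)[OF pullback] by simp

lemma counit_Ar:
  assumes "\<Theta> \<in> Ob D"
  shows "counit \<Theta> \<in> Ar D" "Dom D (counit \<Theta>) = fob R (fob V \<Theta>)" "Cod D (counit \<Theta>) = \<Theta>"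
proof -
  obtain X0 X1 \<sigma> where th: "\<Theta> = (X0, X1, \<sigma>)" by (rule prod_cases3)
  note \<Theta> = assms[unfolded th]
  note p = \<pi>_simps[OF \<Theta>]
  show "counit \<Theta> \<in> Ar D" unfolding th counit_eq
    using legs_eq_iff[OF \<Theta> p(1,5,2) p(3,6,4)] b.pullbackD(9)[OF pullback[OF \<Theta>]] by blast
  show "Dom D (counit \<Theta>) = fob R (fob V \<Theta>)" "Cod D (counit \<Theta>) = \<Theta>" unfolding th counit_eq by simp_all
qed

lemma counit_comp:
  assumes \<Theta>: "(X0, X1, \<sigma>) \<in> Ob D" and h: "h \<in> Ar B" "Cod B h = fob V (X0, X1, \<sigma>)"
  shows "Comp D (counit (X0, X1, \<sigma>)) (far R h) = (fob R (Dom B h), (X0, X1, \<sigma>),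
    Comp A0 (\<gamma>0 X0) (far Q0 (Comp B (\<pi>0 (X0, X1, \<sigma>)) h)), Comp A1 (\<gamma>1 X1) (far Q1 (Comp B (\<pi>1 (X0, X1, \<sigma>)) h)))"
  unfolding counit_eq R_simps(2) using h \<pi>_simps[OF \<Theta>] \<Theta>[unfolded Ob_D] by simp

text \<open>The transposes of the two components of \<open>k\<close> form a cone over the cospan,
  and \<open>h\<close> is the arrow it induces into the fiber product. With
  \<open>counit_unique\<close> this is the universal property of the counit of an adjunction with
  left adjoint \<open>R\<close>.\<close>

lemma counit_universal:
  assumes \<Theta>: "\<Theta> \<in> Ob D" and Y: "Y \<in> Ob B" and k: "k \<in> Ar D" "Dom D k = fob R Y" "Cod D k = \<Theta>"
  shows "\<exists>h. h \<in> Ar B \<and> Dom B h = Y \<and> Cod B h = fob V \<Theta> \<and> Comp D (counit \<Theta>) (far R h) = k"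
proof -
  obtain X0 X1 \<sigma> where th: "\<Theta> = (X0, X1, \<sigma>)" by (rule prod_cases3)
  note \<Theta> = \<Theta>[unfolded th]
  obtain b0 b1 where k': "k = (fob R Y, (X0, X1, \<sigma>), b0, b1)"
    using k th by (cases k) auto
  note b = k(1)[unfolded k' R_arrow[OF Y \<Theta>]]
  let ?h0 = "Comp B (far U0 b0) (\<mu>0 Y)" and ?h1 = "Comp B (far U1 b1) (\<mu>1 Y)"
  have h: "?h0 \<in> Ar B" "Dom B ?h0 = Y" "Cod B ?h0 = fob U0 X0" "?h1 \<in> Ar B" "Dom B ?h1 = Y" "Cod B ?h1 = fob U1 X1"
    using b Y by simp_all
  have "Comp B (leg0 (X0, X1, \<sigma>)) ?h0 = Comp B (leg1 (X0, X1, \<sigma>)) ?h1"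
    using legs_transpose[OF \<Theta> Y] b by blast
  then obtain h where h': "h \<in> Ar B" "Dom B h = Dom B ?h0" "Cod B h = Dom B (\<pi>0 (X0, X1, \<sigma>))"
    "Comp B (\<pi>0 (X0, X1, \<sigma>)) h = ?h0" "Comp B (\<pi>1 (X0, X1, \<sigma>)) h = ?h1"
    by (rule b.pullback_lift[OF pullback[OF \<Theta>]]) (use h legs[OF \<Theta>] in simp_all)
  have d: "Dom B h = Y" "Cod B h = fob V (X0, X1, \<sigma>)" using h'(2,3) h \<pi>_simps[OF \<Theta>] by simp_all
  have "Comp A0 (\<gamma>0 X0) (far Q0 ?h0) = b0" "Comp A1 (\<gamma>1 X1) (far Q1 ?h1) = b1"
    using q0.untranspose[of b0 Y] q1.untranspose[of b1 Y] b Y by auto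
  then have "Comp D (counit (X0, X1, \<sigma>)) (far R h) = k"
    unfolding counit_comp[OF \<Theta> h'(1) d(2)] h'(4,5) d(1) k' by simp
  then show ?thesis unfolding th using h'(1) d by blast
qed

lemma counit_unique:
  assumes \<Theta>: "\<Theta> \<in> Ob D" and h: "h \<in> Ar B" "Cod B h = fob V \<Theta>" and h': "h' \<in> Ar B" "Cod B h' = fob V \<Theta>"
    "Dom B h' = Dom B h" and eq: "Comp D (counit \<Theta>) (far R h) = Comp D (counit \<Theta>) (far R h')"
  shows "h = h'"
proof -
  obtain X0 X1 \<sigma> where th: "\<Theta> = (X0, X1, \<sigma>)" by (rule prod_cases3)
  note \<Theta> = \<Theta>[unfolded th] and h = h[unfolded th] and h' = h'[unfolded th]
  note p = \<pi>_simps[OF \<Theta>] and o = \<Theta>[unfolded Ob_D]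
  have e: "Comp A0 (\<gamma>0 X0) (far Q0 (Comp B (\<pi>0 (X0, X1, \<sigma>)) h)) = Comp A0 (\<gamma>0 X0) (far Q0 (Comp B (\<pi>0 (X0, X1, \<sigma>)) h'))"
    "Comp A1 (\<gamma>1 X1) (far Q1 (Comp B (\<pi>1 (X0, X1, \<sigma>)) h)) = Comp A1 (\<gamma>1 X1) (far Q1 (Comp B (\<pi>1 (X0, X1, \<sigma>)) h'))"
    using eq unfolding th counit_comp[OF \<Theta> h] counit_comp[OF \<Theta> h'(1,2)] by simp_all
  have ph: "Comp B (\<pi>0 (X0, X1, \<sigma>)) k \<in> Ar B" "Dom B (Comp B (\<pi>0 (X0, X1, \<sigma>)) k) = Dom B k"
    "Cod B (Comp B (\<pi>0 (X0, X1, \<sigma>)) k) = fob U0 X0" "Comp B (\<pi>1 (X0, X1, \<sigma>)) k \<in> Ar B"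
    "Dom B (Comp B (\<pi>1 (X0, X1, \<sigma>)) k) = Dom B k" "Cod B (Comp B (\<pi>1 (X0, X1, \<sigma>)) k) = fob U1 X1"
    if "k \<in> Ar B" "Cod B k = fob V (X0, X1, \<sigma>)" for k using that p by simp_all
  have o': "X0 \<in> Ob A0" "X1 \<in> Ob A1" using o by simp_all
  have 0: "Comp B (\<pi>0 (X0, X1, \<sigma>)) h = Comp B (\<pi>0 (X0, X1, \<sigma>)) h'"
    using q0.transpose[OF ph(1,3)[OF h] o'(1)] q0.transpose[OF ph(1,3)[OF h'(1,2)] o'(1)]
    unfolding e(1) ph(2)[OF h] ph(2)[OF h'(1,2)] h'(3) by metis
  have 1: "Comp B (\<pi>1 (X0, X1, \<sigma>)) h = Comp B (\<pi>1 (X0, X1, \<sigma>)) h'"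
    using q1.transpose[OF ph(4,6)[OF h] o'(2)] q1.transpose[OF ph(4,6)[OF h'(1,2)] o'(2)]
    unfolding e(2) ph(5)[OF h] ph(5)[OF h'(1,2)] h'(3) by metis
  show ?thesis
    by (rule b.pullback_unique[OF pullback[OF \<Theta>] h(1) h'(1) _ _ _ 0 1]) (use h h' p in simp_all)
qed

text \<open>\<open>a\<close> after the counit is an arrow out of an object of the form
  \<open>R Y\<close>, hence a cone, whose components are the prescribed composites with
  \<open>U0 f0\<close> and \<open>U1 f1\<close>. So the description in \<open>glue_functor\<close>
  has exactly one solution, and naturality of the counit results at the same time.\<close>

lemma V_arrow:
  assumes a: "a \<in> Ar D"
  shows "far V a \<in> Ar B" "Dom B (far V a) = fob V (Dom D a)" "Cod B (far V a) = fob V (Cod D a)"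
    "Comp D (counit (Cod D a)) (far R (far V a)) = Comp D a (counit (Dom D a))"
proof -
  obtain X0 X1 \<sigma> X0' X1' \<sigma>' f0 f1 where a': "a = ((X0, X1, \<sigma>), (X0', X1', \<sigma>'), f0, f1)"
    "(X0, X1, \<sigma>) \<in> Ob D" "(X0', X1', \<sigma>') \<in> Ob D" "f0 \<in> Ar A0" "Dom A0 f0 = X0" "Cod A0 f0 = X0'"
    "f1 \<in> Ar A1" "Dom A1 f1 = X1" "Cod A1 f1 = X1'" "Comp E \<sigma>' (far F0 f0) = Comp E (far F1 f1) \<sigma>"
    by (rule D_ArE[OF a])
  let ?\<Theta> = "(X0, X1, \<sigma>)" and ?\<Theta>' = "(X0', X1', \<sigma>')"
  note p = \<pi>_simps[OF a'(2)] and p' = \<pi>_simps[OF a'(3)] and o = a'(2)[unfolded Ob_D] and o' = a'(3)[unfolded Ob_D]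
  have ka: "Comp D a (counit ?\<Theta>) \<in> Ar D" "Dom D (Comp D a (counit ?\<Theta>)) = fob R (fob V ?\<Theta>)"
    "Cod D (Comp D a (counit ?\<Theta>)) = ?\<Theta>'"
    using counit_Ar[OF a'(2)] a unfolding a'(1) by simp_all
  have comps: "Comp D a (counit ?\<Theta>) = (fob R (fob V ?\<Theta>), ?\<Theta>',
    Comp A0 (\<gamma>0 X0') (far Q0 (Comp B (far U0 f0) (\<pi>0 ?\<Theta>))), Comp A1 (\<gamma>1 X1') (far Q1 (Comp B (far U1 f1) (\<pi>1 ?\<Theta>))))"
  proof -
    have "Comp A0 (\<gamma>0 X0') (far Q0 (Comp B (far U0 f0) (\<pi>0 ?\<Theta>))) =
      Comp A0 (\<gamma>0 X0') (Comp A0 (far Q0 (far U0 f0)) (far Q0 (\<pi>0 ?\<Theta>)))" using a'(4-6) p by simp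
    also have "\<dots> = Comp A0 f0 (Comp A0 (\<gamma>0 X0) (far Q0 (\<pi>0 ?\<Theta>)))"
      by (rule a0.cmp_eq_left[OF q0.counit_natural[OF a'(4), unfolded a'(5,6)]]) (use a'(4-6) p o o' in simp_all)
    finally have 0: "Comp A0 (\<gamma>0 X0') (far Q0 (Comp B (far U0 f0) (\<pi>0 ?\<Theta>))) =
      Comp A0 f0 (Comp A0 (\<gamma>0 X0) (far Q0 (\<pi>0 ?\<Theta>)))" .
    have "Comp A1 (\<gamma>1 X1') (far Q1 (Comp B (far U1 f1) (\<pi>1 ?\<Theta>))) =
      Comp A1 (\<gamma>1 X1') (Comp A1 (far Q1 (far U1 f1)) (far Q1 (\<pi>1 ?\<Theta>)))" using a'(7-9) p by simp
    also have "\<dots> = Comp A1 f1 (Comp A1 (\<gamma>1 X1) (far Q1 (\<pi>1 ?\<Theta>)))"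
      by (rule a1.cmp_eq_left[OF q1.counit_natural[OF a'(7), unfolded a'(8,9)]]) (use a'(7-9) p o o' in simp_all)
    finally have 1: "Comp A1 (\<gamma>1 X1') (far Q1 (Comp B (far U1 f1) (\<pi>1 ?\<Theta>))) =
      Comp A1 f1 (Comp A1 (\<gamma>1 X1) (far Q1 (\<pi>1 ?\<Theta>)))" .
    show ?thesis unfolding a'(1) counit_eq 0 1 by simp
  qed
  let ?h0 = "Comp B (far U0 f0) (\<pi>0 ?\<Theta>)" and ?h1 = "Comp B (far U1 f1) (\<pi>1 ?\<Theta>)"
  have h: "?h0 \<in> Ar B" "Dom B ?h0 = fob V ?\<Theta>" "Cod B ?h0 = fob U0 X0'"
    "?h1 \<in> Ar B" "Dom B ?h1 = fob V ?\<Theta>" "Cod B ?h1 = fob U1 X1'" using a'(4-9) p by simp_all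
  have "Comp B (leg0 ?\<Theta>') ?h0 = Comp B (leg1 ?\<Theta>') ?h1"
    using legs_eq_iff[OF a'(3) h] ka(1) unfolding comps by blast
  then obtain w where w: "w \<in> Ar B" "Dom B w = Dom B ?h0" "Cod B w = Dom B (\<pi>0 ?\<Theta>')"
    "Comp B (\<pi>0 ?\<Theta>') w = ?h0" "Comp B (\<pi>1 ?\<Theta>') w = ?h1"
    by (rule b.pullback_lift[OF pullback[OF a'(3)]]) (use h legs[OF a'(3)] in simp_all)
  have "far V a = (THE h. h \<in> Hom B (Dom B (\<pi>0 ?\<Theta>)) (Dom B (\<pi>0 ?\<Theta>')) \<and>
        Comp B (\<pi>0 ?\<Theta>') h = ?h0 \<and> Comp B (\<pi>1 ?\<Theta>') h = ?h1)"
    unfolding glue_functor_def a'(1) by simp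
  also have "\<dots> = w"
  proof (rule the_equality)
    show "w \<in> Hom B (Dom B (\<pi>0 ?\<Theta>)) (Dom B (\<pi>0 ?\<Theta>')) \<and> Comp B (\<pi>0 ?\<Theta>') w = ?h0 \<and> Comp B (\<pi>1 ?\<Theta>') w = ?h1"
      using w h(2) p(5) by simp
    fix v assume v: "v \<in> Hom B (Dom B (\<pi>0 ?\<Theta>)) (Dom B (\<pi>0 ?\<Theta>')) \<and> Comp B (\<pi>0 ?\<Theta>') v = ?h0 \<and> Comp B (\<pi>1 ?\<Theta>') v = ?h1"
    show "v = w"
    proof (rule b.pullback_unique[OF pullback[OF a'(3)]])
      show "v \<in> Ar B" "Dom B v = Dom B w" "Cod B v = Dom B (\<pi>0 ?\<Theta>')" using v w(2) h(2) p(5) by auto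
      show "Comp B (\<pi>0 ?\<Theta>') v = Comp B (\<pi>0 ?\<Theta>') w" "Comp B (\<pi>1 ?\<Theta>') v = Comp B (\<pi>1 ?\<Theta>') w"
        using v w(4,5) by auto
    qed (use w in simp_all)
  qed
  finally have V: "far V a = w" .
  have wd: "Dom B w = fob V ?\<Theta>" "Cod B w = fob V ?\<Theta>'" using w(2,3) h(2) p'(5) by simp_all
  show "far V a \<in> Ar B" "Dom B (far V a) = fob V (Dom D a)" "Cod B (far V a) = fob V (Cod D a)"
    unfolding V using w(1) wd a'(1) by simp_all
  have "Comp D (counit ?\<Theta>') (far R w) = Comp D a (counit ?\<Theta>)"
    unfolding counit_comp[OF a'(3) w(1) wd(2)] w(4,5) comps wd(1) ..
  then show "Comp D (counit (Cod D a)) (far R (far V a)) = Comp D a (counit (Dom D a))"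
    unfolding V using a'(1) by simp
qed

lemmas R_fun = functor_simps[OF R_functor]

text \<open>Identities and composites are compared after applying \<open>R\<close> and composing
  with the counit, where \<open>V_arrow\<close> reduces them to the laws of
  \<open>D\<close>.\<close>

lemma V_functor: "is_functor D B V"
  unfolding is_functor_def
proof (intro conjI ballI impI)
  show "is_category D" "is_category B" using D_category b.cat by auto
  fix \<Theta> assume \<Theta>: "\<Theta> \<in> Ob D"
  show V: "fob V \<Theta> \<in> Ob B" using V_Ob[OF \<Theta>] .
  note c = counit_Ar[OF \<Theta>]
  note i = V_arrow[of "Idn D \<Theta>", unfolded d.Idn_simps[OF \<Theta>]]
  show "far V (Idn D \<Theta>) = Idn B (fob V \<Theta>)"
  proof (rule counit_unique[OF \<Theta>])
    have "Comp D (counit \<Theta>) (far R (far V (Idn D \<Theta>))) = counit \<Theta>" using i(4) c \<Theta> by simp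
    also have "\<dots> = Comp D (counit \<Theta>) (far R (Idn B (fob V \<Theta>)))" using c R_fun(5)[OF V] by simp
    finally show "Comp D (counit \<Theta>) (far R (far V (Idn D \<Theta>))) = Comp D (counit \<Theta>) (far R (Idn B (fob V \<Theta>)))" .
  qed (use i V \<Theta> in simp_all)
next
  fix a assume a: "a \<in> Ar D"
  note va = V_arrow[OF a]
  show "far V a \<in> Hom B (fob V (Dom D a)) (fob V (Cod D a))" using va by simp
  fix b assume b: "b \<in> Ar D" and ab: "Cod D a = Dom D b"
  note vb = V_arrow[OF b]
  have ba: "Comp D b a \<in> Ar D" "Dom D (Comp D b a) = Dom D a" "Cod D (Comp D b a) = Cod D b" using a b ab by simp_all
  note vba = V_arrow[OF ba(1), unfolded ba(2,3)]
  have o: "Dom D a \<in> Ob D" "Cod D a \<in> Ob D" "Cod D b \<in> Ob D" using a b by simp_all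
  note ca = counit_Ar[OF o(1)] and cb = counit_Ar[OF o(2)] and cc = counit_Ar[OF o(3)]
  show "far V (Comp D b a) = Comp B (far V b) (far V a)"
  proof (rule counit_unique[OF o(3)])
    have R: "far R (Comp B (far V b) (far V a)) = Comp D (far R (far V b)) (far R (far V a))"
      by (rule R_fun(6)) (use va vb ab in simp_all)
    have "Comp D (counit (Cod D b)) (Comp D (far R (far V b)) (far R (far V a))) =
      Comp D b (Comp D (counit (Dom D b)) (far R (far V a)))"
      by (rule d.cmp_eq_left[OF vb(4)]) (use va(1-3) vb(1-3) ab R_fun(2-4) cb cc b in simp_all)
    also have "Comp D (counit (Dom D b)) (far R (far V a)) = Comp D a (counit (Dom D a))" using va(4) ab by simp
    also have "Comp D b (Comp D a (counit (Dom D a))) = Comp D (Comp D b a) (counit (Dom D a))"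
      using a b ab ca by simp
    also have "\<dots> = Comp D (counit (Cod D b)) (far R (far V (Comp D b a)))" using vba(4) by simp
    finally show "Comp D (counit (Cod D b)) (far R (far V (Comp D b a))) =
      Comp D (counit (Cod D b)) (far R (Comp B (far V b) (far V a)))" unfolding R by simp
  qed (use va vb vba ab in simp_all)
qed

text \<open>\<open>R\<close> being full, every object being isomorphic to some \<open>R Y\<close>, and \<open>counit \<Theta>\<close> being terminal
  among arrows from objects \<open>R Y\<close> to \<open>\<Theta>\<close>, the counit is invertible.\<close>

lemma counit_iso:
  assumes full: "\<And>X Y h. X \<in> Ob B \<Longrightarrow> Y \<in> Ob B \<Longrightarrow> h \<in> Hom D (fob R X) (fob R Y) \<Longrightarrow> \<exists>f\<in>Hom B X Y. far R f = h"
    and surj: "\<And>Y. Y \<in> Ob D \<Longrightarrow> \<exists>X\<in>Ob B. \<exists>h\<in>Hom D (fob R X) Y. is_iso D h"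
    and \<Theta>: "\<Theta> \<in> Ob D"
  shows "is_iso D (counit \<Theta>)"
proof -
  note c = counit_Ar[OF \<Theta>] and V = V_Ob[OF \<Theta>]
  obtain Y t where Y: "Y \<in> Ob B" and t: "t \<in> Hom D (fob R Y) \<Theta>" "is_iso D t" using surj[OF \<Theta>] by blast
  obtain s where s: "s \<in> Ar D" "Dom D s = Cod D t" "Cod D s = Dom D t" "Comp D s t = Idn D (Dom D t)"
    "Comp D t s = Idn D (Cod D t)" by (rule d.isoE[OF t(2)])
  obtain h where h: "h \<in> Ar B" "Dom B h = Y" "Cod B h = fob V \<Theta>" "Comp D (counit \<Theta>) (far R h) = t"
    using counit_universal[OF \<Theta> Y, of t] t by auto
  have Rh: "far R h \<in> Ar D" "Dom D (far R h) = fob R Y" "Cod D (far R h) = fob R (fob V \<Theta>)"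
    using R_fun(2-4)[OF h(1)] h by simp_all
  let ?g = "Comp D (far R h) s"
  have g: "?g \<in> Ar D" "Dom D ?g = \<Theta>" "Cod D ?g = fob R (fob V \<Theta>)" using Rh s(1-3) t(1) by simp_all
  have "Comp D (counit \<Theta>) ?g = Comp D t s"
    by (rule d.cmp_eq_left1[OF h(4)]) (use Rh s(1-3) t(1) c in simp_all)
  then have cg: "Comp D (counit \<Theta>) ?g = Idn D \<Theta>" using s(5) t(1) by simp
  have "Comp D ?g (counit \<Theta>) \<in> Hom D (fob R (fob V \<Theta>)) (fob R (fob V \<Theta>))" using g c by (simp del: d.assoc)
  \<comment> \<open>Uniqueness of factorizations through the counit concerns arrows of
    \<open>B\<close>, so the endomorphism must be lifted along \<open>R\<close> before it can be
    recognized as an identity.\<close>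
  then obtain e where e: "e \<in> Hom B (fob V \<Theta>) (fob V \<Theta>)" "far R e = Comp D ?g (counit \<Theta>)"
    using full[OF V V] by blast
  have "e = Idn B (fob V \<Theta>)"
  proof (rule counit_unique[OF \<Theta>])
    have "Comp D (counit \<Theta>) (far R e) = Comp D (Comp D (counit \<Theta>) ?g) (counit \<Theta>)"
      unfolding e(2) using Rh s(1-3) t(1) c by simp
    also have "\<dots> = counit \<Theta>" unfolding cg using c by simp
    also have "\<dots> = Comp D (counit \<Theta>) (far R (Idn B (fob V \<Theta>)))" using R_fun(5)[OF V] c by simp
    finally show "Comp D (counit \<Theta>) (far R e) = Comp D (counit \<Theta>) (far R (Idn B (fob V \<Theta>)))" .
  qed (use e V in simp_all)
  then have "Comp D ?g (counit \<Theta>) = Idn D (fob R (fob V \<Theta>))" using e(2) R_fun(5)[OF V] by simp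
  then show ?thesis by (intro d.isoI[OF c(1) g(1)]) (use c g cg in simp_all)
qed

lemma counit_nat_iso:
  assumes full: "\<And>X Y h. X \<in> Ob B \<Longrightarrow> Y \<in> Ob B \<Longrightarrow> h \<in> Hom D (fob R X) (fob R Y) \<Longrightarrow> \<exists>f\<in>Hom B X Y. far R f = h"
    and surj: "\<And>Y. Y \<in> Ob D \<Longrightarrow> \<exists>X\<in>Ob B. \<exists>h\<in>Hom D (fob R X) Y. is_iso D h"
  shows "nat_iso D D (R \<odot> V) fid counit"
  unfolding nat_iso_def nat_trans_def
proof (intro conjI ballI)
  show "is_functor D D (R \<odot> V)" by (rule is_functor_fcomp[OF V_functor R_functor])
  show "is_functor D D fid" by (rule is_functor_fid[OF D_category])
  fix \<Theta> assume \<Theta>: "\<Theta> \<in> Ob D"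
  show "counit \<Theta> \<in> Hom D (fob (R \<odot> V) \<Theta>) (fob fid \<Theta>)"
    using counit_Ar[OF \<Theta>] by (simp add: fcomp_def fid_def)
  show "is_iso D (counit \<Theta>)" by (rule counit_iso[OF full surj \<Theta>])
next
  fix a assume a: "a \<in> Ar D"
  show "Comp D (far fid a) (counit (Dom D a)) = Comp D (counit (Cod D a)) (far (R \<odot> V) a)"
    using V_arrow(4)[OF a] by (simp add: fcomp_def fid_def)
qed

end

section \<open>The restriction functor is an equivalence\<close>

context stable_pair
begin

section \<open>The square of quotient functors\<close>

sublocale f0: fraction_calculus C L0 by (rule s0.fraction_calculus)
sublocale f1: fraction_calculus C L1 by (rule s1.fraction_calculus)
sublocale fI: fraction_calculus C "L0 \<inter> L1" by (rule sI.fraction_calculus)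
sublocale fJ: fraction_calculus C LJ by (rule sJ.fraction_calculus)

abbreviation W0 where "W0 \<equiv> quot_inverted C L0"
abbreviation W1 where "W1 \<equiv> quot_inverted C L1"
abbreviation WI where "WI \<equiv> quot_inverted C (L0 \<inter> L1)"
abbreviation WJ where "WJ \<equiv> quot_inverted C LJ"

lemma W_le: "WI s \<Longrightarrow> W0 s" "WI s \<Longrightarrow> W1 s" "W0 s \<Longrightarrow> WJ s" "W1 s \<Longrightarrow> WJ s"
  using quot_inverted_mono[of C] le_join by blast+

lemma WI_iff: "WI s \<longleftrightarrow> W0 s \<and> W1 s"
  by (rule quot_inverted_Int[OF s0.serre_subcategory_axioms s1.serre_subcategory_axioms])

lemma Q_frac:
  "WI s \<Longrightarrow> f \<in> Ar C \<Longrightarrow> Dom C s = Dom C f \<Longrightarrow> far (quot_functor C L0) (frac C (L0 \<inter> L1) s f) = frac C L0 s f"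
  "WI s \<Longrightarrow> f \<in> Ar C \<Longrightarrow> Dom C s = Dom C f \<Longrightarrow> far (quot_functor C L1) (frac C (L0 \<inter> L1) s f) = frac C L1 s f"
  "W0 s \<Longrightarrow> f \<in> Ar C \<Longrightarrow> Dom C s = Dom C f \<Longrightarrow> far (quot_functor C LJ) (frac C L0 s f) = frac C LJ s f"
  "W1 s \<Longrightarrow> f \<in> Ar C \<Longrightarrow> Dom C s = Dom C f \<Longrightarrow> far (quot_functor C LJ) (frac C L1 s f) = frac C LJ s f"
  using quot_functor_frac[OF fI.fraction_calculus_axioms f0.fraction_calculus_axioms]
    quot_functor_frac[OF fI.fraction_calculus_axioms f1.fraction_calculus_axioms]
    quot_functor_frac[OF f0.fraction_calculus_axioms fJ.fraction_calculus_axioms le_join(1)]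
    quot_functor_frac[OF f1.fraction_calculus_axioms fJ.fraction_calculus_axioms le_join(2)]
  by blast+

lemma fob_quot_functor [simp]: "fob (quot_functor C L) X = X"
  unfolding quot_functor_def by simp

sublocale sq: recollement_square fI.Q f0.Q f1.Q fJ.Q "quot_functor C L0" "quot_functor C L1"
  "quot_functor C LJ" "quot_functor C LJ"
proof
  show "is_functor fI.Q f0.Q (quot_functor C L0)"
    by (rule quot_functor_is_functor[OF fI.fraction_calculus_axioms f0.fraction_calculus_axioms]) blast
  show "is_functor fI.Q f1.Q (quot_functor C L1)"
    by (rule quot_functor_is_functor[OF fI.fraction_calculus_axioms f1.fraction_calculus_axioms]) blast
  show "is_functor f0.Q fJ.Q (quot_functor C LJ)"
    by (rule quot_functor_is_functor[OF f0.fraction_calculus_axioms fJ.fraction_calculus_axioms le_join(1)])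
  show "is_functor f1.Q fJ.Q (quot_functor C LJ)"
    by (rule quot_functor_is_functor[OF f1.fraction_calculus_axioms fJ.fraction_calculus_axioms le_join(2)])
  fix a assume "a \<in> Ar fI.Q"
  then obtain s f where a: "fI.frc s f" "a = fI.fra s f" by (rule fI.quot_Ar)
  show "far (quot_functor C LJ) (far (quot_functor C L1) a) = far (quot_functor C LJ) (far (quot_functor C L0) a)"
    using a Q_frac W_le[of s] by simp
qed simp

lemma swap: "stable_pair C add z u G L1 L0"
  by unfold_locales (rule st1 st0)+

text \<open>A refinement witnessing equality in the quotient factors through the fiber product of
  the denominators by some inverted \<open>t\<close>, and \<open>t\<close> factors through the
  equalizer \<open>e\<close>. As \<open>e\<close> is constructed without reference to
  \<open>L\<close>, the same \<open>e\<close> can be used for \<open>L0\<close> and for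
  \<open>L1\<close>, hence for their intersection.\<close>

lemma equal_frac_equalizer:
  assumes L: "serre_subcategory C add z L" and sf: "quot_inverted C L s" "f \<in> Ar C" "Dom C s = Dom C f"
    and sf': "quot_inverted C L s'" "f' \<in> Ar C" "Dom C s' = Dom C f'"
    and cod: "Cod C s = Cod C s'" "Cod C f = Cod C f'"
    and eq: "frac C L s f = frac C L s' f'" and pb: "is_pullback C s s' p p'"
    and e: "is_mono C e" "Cod C e = Dom C p"
      "\<And>h. h \<in> Ar C \<Longrightarrow> Cod C h = Dom C p \<Longrightarrow> (f \<cdot> p) \<cdot> h = (f' \<cdot> p') \<cdot> h \<Longrightarrow>
       \<exists>u\<in>Ar C. Dom C u = Dom C h \<and> Cod C u = Dom C e \<and> e \<cdot> u = h"
  shows "quot_inverted C L e"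
proof -
  interpret s: serre_subcategory C add z L by fact
  interpret fr: fraction_calculus C L by (rule s.fraction_calculus)
  note pd = pullbackD[OF pb]
  obtain v v' where v: "s.W v" "s.W v'" "Dom C v = Dom C v'" "Cod C v = Dom C s" "Cod C v' = Dom C s'"
    "s \<cdot> v = s' \<cdot> v'" "f \<cdot> v = f' \<cdot> v'"
    using eq fr.fra_eq_iff[of s f s' f'] sf sf' cod by auto
  obtain t where t: "t \<in> Ar C" "Dom C t = Dom C v" "Cod C t = Dom C p" "p \<cdot> t = v" "p' \<cdot> t = v'"
    by (rule pullback_lift[OF pb v(6)]) (use v s.W_Ar in simp_all)
  have "s.W t" by (rule s.W_cancel_left[of p]) (use t v s.W_pullback[OF pb sf'(1)] in simp_all)
  have "(f \<cdot> p) \<cdot> t = f \<cdot> v" "(f' \<cdot> p') \<cdot> t = f' \<cdot> v'" using t(1-3) pd sf sf' t(4,5) by auto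
  then have "(f \<cdot> p) \<cdot> t = (f' \<cdot> p') \<cdot> t" using v(7) by simp
  then obtain x where x: "x \<in> Ar C" "Dom C x = Dom C t" "Cod C x = Dom C e" "e \<cdot> x = t"
    using e(3)[OF t(1,3)] by blast
  show ?thesis by (rule s.W_mono_factor[of e x]) (use x \<open>s.W t\<close> e in simp_all)
qed

lemma R_faithful:
  assumes a: "a \<in> Ar fI.Q" and b: "b \<in> Ar fI.Q" and par: "Dom fI.Q a = Dom fI.Q b" "Cod fI.Q a = Cod fI.Q b"
    and eq: "far sq.R a = far sq.R b"
  shows "a = b"
proof -
  obtain s f where sf: "fI.frc s f" "a = fI.fra s f" by (rule fI.quot_Ar[OF a])
  obtain s' f' where sf': "fI.frc s' f'" "b = fI.fra s' f'" by (rule fI.quot_Ar[OF b])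
  have cod: "Cod C s = Cod C s'" "Cod C f = Cod C f'" using par sf(1) sf'(1) unfolding sf(2) sf'(2) by simp_all
  have e0: "frac C L0 s f = frac C L0 s' f'" and e1: "frac C L1 s f = frac C L1 s' f'"
    using eq sf(1) sf'(1) unfolding sf(2) sf'(2) sq.R_simps(2) by (simp_all add: Q_frac)
  have Ws: "W0 s" "W0 s'" "W1 s" "W1 s'" using sf(1) sf'(1) W_le by blast+
  obtain p p' where pb: "is_pullback C s s' p p'" using pullback_ex[of s s'] Ws cod s0.W_Ar by auto
  note pd = pullbackD[OF pb]
  obtain e where e: "is_mono C e" "Cod C e = Dom C (f \<cdot> p)" "(f \<cdot> p) \<cdot> e = (f' \<cdot> p') \<cdot> e"
    "\<And>h. h \<in> Ar C \<Longrightarrow> Cod C h = Dom C (f \<cdot> p) \<Longrightarrow> (f \<cdot> p) \<cdot> h = (f' \<cdot> p') \<cdot> h \<Longrightarrow>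
       \<exists>u\<in>Ar C. Dom C u = Dom C h \<and> Cod C u = Dom C e \<and> e \<cdot> u = h"
    by (rule equalizer[of "f \<cdot> p" "f' \<cdot> p'"]) (use pd sf(1) sf'(1) cod in simp_all)
  have dfp: "Dom C (f \<cdot> p) = Dom C p" using pd sf(1) by simp
  note e = e[unfolded dfp]
  have "W0 e"
    by (rule equal_frac_equalizer[OF s0.serre_subcategory_axioms Ws(1) _ _ Ws(2) _ _ cod e0 pb e(1,2,4)])
      (use sf(1) sf'(1) in simp_all)
  moreover have "W1 e"
    by (rule equal_frac_equalizer[OF s1.serre_subcategory_axioms Ws(3) _ _ Ws(4) _ _ cod e1 pb e(1,2,4)])
      (use sf(1) sf'(1) in simp_all)
  ultimately have We: "WI e" using WI_iff by blast
  have Wp: "WI p" "WI p'"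
    using sI.W_pullback[OF pb] sI.W_pullback[OF pullback_sym[OF pb]] sf(1) sf'(1) by blast+
  have ea: "e \<in> Ar C" using e by simp
  show ?thesis unfolding sf(2) sf'(2) fI.fra_eq_iff[OF sf(1) sf'(1) cod]
  proof (intro exI conjI)
    show "WI (p \<cdot> e)" "WI (p' \<cdot> e)" using sI.W_cmp[OF We] Wp e(2) pd by simp_all
    show "s \<cdot> p \<cdot> e = s' \<cdot> p' \<cdot> e" by (rule cmp_eq_left[OF pd(9)]) (use pd(1-8) e(2) ea in simp_all)
    show "f \<cdot> p \<cdot> e = f' \<cdot> p' \<cdot> e" using e(2,3) ea pd sf(1) sf'(1) by simp
  qed (use pd e(2) ea in simp_all)
qed

section \<open>Fullness and surjectivity up to isomorphism\<close>

lemma mono_refinement: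
  assumes "WJ v" "WJ v'" "Dom C v = Dom C v'"
  obtains i where "WJ i" "Cod C i = Dom C v" "is_mono C (v \<cdot> i)" "is_mono C (v' \<cdot> i)"
proof -
  obtain i where i: "is_mono C i" "WJ i" "Cod C i = Dom C v" "is_mono C (v \<cdot> i)"
    using join_refine_mono[of v] assms(1) sJ.W_iff by blast
  have v: "v \<in> Ar C" "v' \<in> Ar C" using assms sJ.W_Ar by blast+
  have "WJ (v' \<cdot> i)" using sJ.W_cmp[OF i(2) assms(2)] i assms by simp
  then obtain j where j: "is_mono C j" "WJ j" "Cod C j = Dom C (v' \<cdot> i)" "is_mono C ((v' \<cdot> i) \<cdot> j)"
    using join_refine_mono[of "v' \<cdot> i"] sJ.W_iff by blast
  have ja: "j \<in> Ar C" "Cod C j = Dom C i" using j v i assms by simp_all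
  show thesis
  proof (rule that[of "i \<cdot> j"])
    show "WJ (i \<cdot> j)" using sJ.W_cmp[OF j(2) i(2) ja(2)] .
    have "is_mono C ((v \<cdot> i) \<cdot> j)" using mono_cmp[OF j(1) i(4)] ja v i by simp
    then show "is_mono C (v \<cdot> i \<cdot> j)" using ja v i(1,3) by simp
    show "is_mono C (v' \<cdot> i \<cdot> j)" using j(4) ja v i(1,3) assms(3) by simp
  qed (use ja i in simp)
qed

lemma mono_factors:
  assumes "is_mono C v" "WJ v"
  obtains w x where "is_mono C w" "is_mono C x" "W0 w" "W1 x" "Cod C x = Dom C w" "w \<cdot> x = v"
  using join_mono_factor[OF assms swap] .

lemma mono_factors':
  assumes "is_mono C v" "WJ v"
  obtains w x where "is_mono C w" "is_mono C x" "W1 w" "W0 x" "Cod C x = Dom C w" "w \<cdot> x = v"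
  using stable_pair.join_mono_factor[OF swap assms(1) _ stable_pair_axioms] assms(2)
    localizing_join_commute[of u C L0 L1] by metis

text \<open>Arrows \<open>f0 s0\<^sup>-\<^sup>1\<close> and \<open>f1 s1\<^sup>-\<^sup>1\<close> of \<open>C/L0\<close> and \<open>C/L1\<close> that agree on \<open>v\<close>, \<open>v'\<close>
  over \<open>X\<close> glue over the pushout of the factors of \<open>v\<close> and \<open>v'\<close>.\<close>

lemma R_full:
  assumes X: "X \<in> Ob fI.Q" and Y: "Y \<in> Ob fI.Q" and h: "h \<in> Hom sq.D (fob sq.R X) (fob sq.R Y)"
  shows "\<exists>f\<in>Hom fI.Q X Y. far sq.R f = h"
proof -
  obtain a0 a1 where h': "h = (fob sq.R X, fob sq.R Y, a0, a1)" using h by (cases h) auto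
  have "(fob sq.R X, (Y, Y, Idn fJ.Q Y), a0, a1) \<in> Ar sq.D" "(Y, Y, Idn fJ.Q Y) \<in> Ob sq.D"
    using h sq.R_Ob[OF Y] unfolding h' sq.R_simps by simp_all
  note a = this(1)[unfolded sq.R_arrow[OF X this(2)]]
  have a0: "a0 \<in> Ar f0.Q" "Dom f0.Q a0 = X" "Cod f0.Q a0 = Y" and a1: "a1 \<in> Ar f1.Q" "Dom f1.Q a1 = X" "Cod f1.Q a1 = Y"
    and eq: "Comp fJ.Q (Idn fJ.Q Y) (far (quot_functor C LJ) a0) = far (quot_functor C LJ) a1"
    using a by simp_all
  obtain s0 f0 where sf0: "f0.frc s0 f0" "a0 = f0.fra s0 f0" by (rule f0.quot_Ar[OF a0(1)])
  obtain s1 f1 where sf1: "f1.frc s1 f1" "a1 = f1.fra s1 f1" by (rule f1.quot_Ar[OF a1(1)])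
  have cod: "Cod C s0 = X" "Cod C f0 = Y" "Cod C s1 = X" "Cod C f1 = Y"
    using a0 a1 sf0(1) sf1(1) unfolding sf0(2) sf1(2) by simp_all
  have J: "fJ.frc s0 f0" "fJ.frc s1 f1" using sf0(1) sf1(1) W_le by blast+
  have "fJ.fra s0 f0 = fJ.fra s1 f1"
    using eq J cod sf0(1) sf1(1) sq.e.cmp_Idn(2)[of "fJ.fra s0 f0" Y] unfolding sf0(2) sf1(2) by (simp add: Q_frac)
  moreover have "Cod C s0 = Cod C s1" "Cod C f0 = Cod C f1" using cod by simp_all
  ultimately obtain v v' where v: "WJ v" "WJ v'" "Dom C v = Dom C v'" "Cod C v = Dom C s0" "Cod C v' = Dom C s1"
    "s0 \<cdot> v = s1 \<cdot> v'" "f0 \<cdot> v = f1 \<cdot> v'"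
    using fJ.fra_eq_iff[OF J] by blast
  have va: "v \<in> Ar C" "v' \<in> Ar C" "s0 \<in> Ar C" "s1 \<in> Ar C" "f0 \<in> Ar C" "f1 \<in> Ar C"
    using v(1,2) J by simp_all
  obtain i where i: "WJ i" "Cod C i = Dom C v" "is_mono C (v \<cdot> i)" "is_mono C (v' \<cdot> i)"
    by (rule mono_refinement[OF v(1-3)])
  have ia: "i \<in> Ar C" using i(1) by simp
  have Wvi: "WJ (v \<cdot> i)" "WJ (v' \<cdot> i)" using sJ.W_cmp[OF i(1)] v(1-3) i(2) by simp_all
  \<comment> \<open>The two splittings are in opposite order: the outer factors refine the given
    fractions within \<open>C/L0\<close> and \<open>C/L1\<close>, while the inner ones
    \<open>x1\<close> and \<open>x0\<close> are of opposite kinds, so that each coprojection of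
    their pushout is inverted on the side where it is used.\<close>
  obtain w0 x1 where wx: "is_mono C w0" "is_mono C x1" "W0 w0" "W1 x1" "Cod C x1 = Dom C w0" "w0 \<cdot> x1 = v \<cdot> i"
    by (rule mono_factors[OF i(3) Wvi(1)])
  obtain w1 x0 where wx': "is_mono C w1" "is_mono C x0" "W1 w1" "W0 x0" "Cod C x0 = Dom C w1" "w1 \<cdot> x0 = v' \<cdot> i"
    by (rule mono_factors'[OF i(4) Wvi(2)])
  have wa: "w0 \<in> Ar C" "x1 \<in> Ar C" "w1 \<in> Ar C" "x0 \<in> Ar C" using wx wx' by simp_all
  have cw: "Cod C w0 = Dom C s0" "Cod C w1 = Dom C s1" "Dom C x1 = Dom C i" "Dom C x0 = Dom C i"
    using arg_cong[OF wx(6), of "Cod C"] arg_cong[OF wx'(6), of "Cod C"] arg_cong[OF wx(6), of "Dom C"]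
      arg_cong[OF wx'(6), of "Dom C"] wa wx(5) wx'(5) va ia i(2) v(3-5) by simp_all
  obtain j0 j1 where po: "is_pushout C x1 x0 j0 j1" using pushout_ex[OF wa(2,4)] cw by auto
  note pd = pushoutD[OF po]
  have W0j: "W0 j0" by (rule s0.W_pushout[OF po wx'(4)])
  have W1j: "W1 j1" by (rule s1.W_pushout[OF pushout_sym[OF po] wx(4)])
  \<comment> \<open>Stated for a general pair since it serves twice: for the denominators
    \<open>s0\<close>, \<open>s1\<close> and for the numerators \<open>f0\<close>,
    \<open>f1\<close>.\<close>
  have glue: "(g0 \<cdot> w0) \<cdot> x1 = (g1 \<cdot> w1) \<cdot> x0"
    if g: "g0 \<in> Ar C" "g1 \<in> Ar C" "Dom C g0 = Dom C s0" "Dom C g1 = Dom C s1" "g0 \<cdot> v = g1 \<cdot> v'" for g0 g1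
  proof -
    have "(g0 \<cdot> w0) \<cdot> x1 = g0 \<cdot> v \<cdot> i" using g wa wx(5,6) cw by simp
    also have "\<dots> = g1 \<cdot> v' \<cdot> i" by (rule cmp_eq_left[OF g(5)]) (use g(1-4) va ia i(2) v(3-5) in simp_all)
    also have "\<dots> = (g1 \<cdot> w1) \<cdot> x0" using g wa wx'(5,6) cw by simp
    finally show ?thesis .
  qed
  obtain s where s: "s \<in> Ar C" "Dom C s = Cod C j0" "Cod C s = Cod C (s0 \<cdot> w0)" "s \<cdot> j0 = s0 \<cdot> w0" "s \<cdot> j1 = s1 \<cdot> w1"
    by (rule pushout_desc[OF po glue[OF va(3,4) refl refl v(6)]]) (use va wa cw wx(5) wx'(5) cod in simp_all)
  obtain f where f: "f \<in> Ar C" "Dom C f = Cod C j0" "Cod C f = Cod C (f0 \<cdot> w0)" "f \<cdot> j0 = f0 \<cdot> w0" "f \<cdot> j1 = f1 \<cdot> w1"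
    by (rule pushout_desc[OF po glue[OF va(5,6) _ _ v(7)]]) (use va wa cw wx(5) wx'(5) cod J in simp_all)
  have cs: "Cod C s = X" "Cod C f = Y" using s(3) f(3) va wa cw cod J by simp_all
  have "W0 (s0 \<cdot> w0)" "W1 (s1 \<cdot> w1)" using s0.W_cmp[OF wx(3)] s1.W_cmp[OF wx'(3)] sf0(1) sf1(1) cw by simp_all
  \<comment> \<open>The denominator on the pushout is inverted for \<open>L0\<close> when read along
    \<open>j0\<close> and for \<open>L1\<close> when read along \<open>j1\<close>, so it is a
    denominator for the intersection.\<close>
  then have "W0 s" "W1 s"
    using s0.W_cancel_right[of s j0] s1.W_cancel_right[of s j1] W0j W1j s pd by simp_all
  then have Ws: "WI s" "W0 s" "W1 s" using WI_iff by blast+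
  have fr: "fI.frc s f" "f0.frc s f" "f1.frc s f" using Ws s f by simp_all
  have "f0.fra s f = f0.fra s0 f0"
  proof (subst f0.fra_eq_iff[OF fr(2) sf0(1)])
    show "\<exists>u u'. W0 u \<and> W0 u' \<and> Dom C u = Dom C u' \<and> Cod C u = Dom C s \<and> Cod C u' = Dom C s0 \<and>
      s \<cdot> u = s0 \<cdot> u' \<and> f \<cdot> u = f0 \<cdot> u'"
      by (intro exI[of _ j0] exI[of _ w0]) (use W0j wx s f pd cw in simp)
  qed (use cs cod in simp_all)
  moreover have "f1.fra s f = f1.fra s1 f1"
  proof (subst f1.fra_eq_iff[OF fr(3) sf1(1)])
    show "\<exists>u u'. W1 u \<and> W1 u' \<and> Dom C u = Dom C u' \<and> Cod C u = Dom C s \<and> Cod C u' = Dom C s1 \<and>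
      s \<cdot> u = s1 \<cdot> u' \<and> f \<cdot> u = f1 \<cdot> u'"
      by (intro exI[of _ j1] exI[of _ w1]) (use W1j wx' s f pd cw in simp)
  qed (use cs cod in simp_all)
  ultimately have "far sq.R (fI.fra s f) = h"
    unfolding sq.R_simps(2) h' sf0(2) sf1(2) using fr cs by (simp add: Q_frac)
  moreover have "fI.fra s f \<in> Hom fI.Q X Y" using fr cs by simp
  ultimately show ?thesis by blast
qed

text \<open>The isomorphism \<open>\<sigma> = f s\<^sup>-\<^sup>1\<close> with \<open>s = s0 s1\<close> and \<open>f = f1 f0\<close> splits as
  \<open>(f1 t1\<^sup>-\<^sup>1) (g0 s0\<^sup>-\<^sup>1)\<close>, where \<open>g0\<close>, \<open>t1\<close> are the coprojections of the pushout of \<open>s1\<close>, \<open>f0\<close>.\<close>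

lemma R_surj:
  assumes \<Theta>: "\<Theta> \<in> Ob sq.D"
  shows "\<exists>X\<in>Ob fI.Q. \<exists>h\<in>Hom sq.D (fob sq.R X) \<Theta>. is_iso sq.D h"
proof -
  obtain X0 X1 \<sigma> where th: "\<Theta> = (X0, X1, \<sigma>)" by (rule prod_cases3)
  note \<Theta> = \<Theta>[unfolded th]
  have \<sigma>: "\<sigma> \<in> Ar fJ.Q" "Dom fJ.Q \<sigma> = X0" "Cod fJ.Q \<sigma> = X1" "is_iso fJ.Q \<sigma>"
    using \<Theta>[unfolded sq.Ob_D] by simp_all
  obtain s f where sf: "fJ.frc s f" "\<sigma> = fJ.fra s f" by (rule fJ.quot_Ar[OF \<sigma>(1)])
  have cod: "Cod C s = X0" "Cod C f = X1" using \<sigma>(2,3) sf(1) unfolding sf(2) by simp_all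
  \<comment> \<open>By saturation, invertibility of \<sigma> makes its numerator inverted too;
    numerator and denominator can then be split alike.\<close>
  have Wf: "WJ f" using sJ.iso_frac_W[of s f] sf \<sigma>(4) by simp
  have sa: "s \<in> Ar C" "f \<in> Ar C" "Dom C s = Dom C f" "WJ s" using sf(1) by simp_all
  obtain i where i: "WJ i" "Cod C i = Dom C s" "is_mono C (s \<cdot> i)" "is_mono C (f \<cdot> i)"
    by (rule mono_refinement[OF sa(4) Wf sa(3)])
  have ia: "i \<in> Ar C" using i(1) by simp
  have Wsi: "WJ (s \<cdot> i)" "WJ (f \<cdot> i)" using sJ.W_cmp[OF i(1)] sa Wf i(2) by simp_all
  obtain s0 s1 where ss: "is_mono C s0" "is_mono C s1" "W0 s0" "W1 s1" "Cod C s1 = Dom C s0" "s0 \<cdot> s1 = s \<cdot> i"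
    by (rule mono_factors[OF i(3) Wsi(1)])
  obtain f1 f0 where ff: "is_mono C f1" "is_mono C f0" "W1 f1" "W0 f0" "Cod C f0 = Dom C f1" "f1 \<cdot> f0 = f \<cdot> i"
    by (rule mono_factors'[OF i(4) Wsi(2)])
  have ar: "s0 \<in> Ar C" "s1 \<in> Ar C" "f1 \<in> Ar C" "f0 \<in> Ar C" using ss ff by simp_all
  have cs: "Cod C s0 = X0" "Cod C f1 = X1" "Dom C s1 = Dom C i" "Dom C f0 = Dom C i"
    using arg_cong[OF ss(6), of "Cod C"] arg_cong[OF ff(6), of "Cod C"] arg_cong[OF ss(6), of "Dom C"]
      arg_cong[OF ff(6), of "Dom C"] ar ss(5) ff(5) sa ia i(2) cod by simp_all
  obtain g0 t1 where po: "is_pushout C s1 f0 g0 t1" using pushout_ex[OF ar(2,4)] cs by auto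
  note pd = pushoutD[OF po]
  have W0g: "W0 g0" by (rule s0.W_pushout[OF po ff(4)])
  have W1t: "W1 t1" by (rule s1.W_pushout[OF pushout_sym[OF po] ss(4)])
  let ?P = "Cod C g0"
  have P: "?P \<in> Ob fI.Q" using pd by simp
  have k0: "f0.frc g0 s0" and k1: "f1.frc t1 f1" using W0g W1t ar pd ss(5) ff(5) by simp_all
  have J: "fJ.frc g0 s0" "fJ.frc t1 f1" "WJ s1" "WJ f0" using k0 k1 W_le ss(4) ff(4) by blast+
  have "\<sigma> = fJ.fra (s \<cdot> i) (f \<cdot> i)" unfolding sf(2) using fJ.fra_refine[OF sf(1) i(1,2)] by simp
  also have "\<dots> = fJ.fra (s0 \<cdot> s1) (f1 \<cdot> f0)" using ss(6) ff(6) by simp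
  finally have \<sigma>': "\<sigma> = fJ.fra (s0 \<cdot> s1) (f1 \<cdot> f0)" .
  have o: "Dom C s1 \<in> Ob C" using ar by simp
  \<comment> \<open>Compatibility of the two components with \<sigma>. The pushout relation
    \<open>g0 \<cdot> s1 = t1 \<cdot> f0\<close> turns the composite into a fraction in which
    \<open>f0\<close> cancels.\<close>
  have "Comp fJ.Q \<sigma> (fJ.fra g0 s0) = fJ.fra (g0 \<cdot> s1) ((f1 \<cdot> f0) \<cdot> Idn C (Dom C s1))"
    unfolding \<sigma>'
    by (rule fJ.fra_comp[OF J(1)]) (use Wsi(1)[folded ss(6)] ss(5) ff(5) J ar cs o in simp_all)
  also have "\<dots> = fJ.fra (t1 \<cdot> f0) (f1 \<cdot> f0)" using ff(5) ar cs pd by simp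
  also have "\<dots> = fJ.fra t1 f1" by (rule fJ.fra_refine[OF J(2,4)]) (use pd in simp)
  finally have comp: "Comp fJ.Q \<sigma> (fJ.fra g0 s0) = fJ.fra t1 f1" .
  have "(fob sq.R ?P, (X0, X1, \<sigma>), f0.fra g0 s0, f1.fra t1 f1) \<in> Ar sq.D"
    unfolding sq.R_arrow[OF P \<Theta>] using k0 k1 cs comp pd by (simp add: Q_frac)
  moreover from this have "is_iso sq.D (fob sq.R ?P, (X0, X1, \<sigma>), f0.fra g0 s0, f1.fra t1 f1)"
    unfolding sq.R_simps(1)
    by (rule sq.D_iso) (use f0.fra_iso f1.fra_iso k0 k1 ss(3) ff(3) in blast)+
  moreover have "(fob sq.R ?P, (X0, X1, \<sigma>), f0.fra g0 s0, f1.fra t1 f1) \<in> Hom sq.D (fob sq.R ?P) \<Theta>"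
    using calculation(1) unfolding th by simp
  ultimately show ?thesis using P by blast
qed

lemma R_equivalence: "is_equivalence fI.Q sq.D sq.R"
  by (rule full_faithful_surjective_equivalence[OF sq.R_functor R_faithful R_full R_surj])

end

theorem proposition4p5:
  fixes C :: "('o, 'm) cat" and L0 L1 :: "'o set"
    and B A0 A1 E :: "('o, ('o, 'm) qarr) cat"
    and Q0 Q1 F0 F1 :: "('o, ('o, 'm) qarr, 'o, ('o, 'm) qarr) ftr"
  assumes "universe TYPE('u)"
    and "grothendieck TYPE('u) C"
    and "stable_localizing TYPE('u) C L0"
    and "stable_localizing TYPE('u) C L1"
    and "B = quot_cat C (L0 \<inter> L1)"
    and "A0 = quot_cat C L0"
    and "A1 = quot_cat C L1"
    and "E = quot_cat C (localizing_join TYPE('u) C L0 L1)"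
    and "Q0 = quot_functor C L0"
    and "Q1 = quot_functor C L1"
    and "F0 = quot_functor C (localizing_join TYPE('u) C L0 L1)"
    and "F1 = quot_functor C (localizing_join TYPE('u) C L0 L1)"
    and "D = recollement A0 A1 E F0 F1"
    and "R = restriction_functor B E Q0 Q1 F0"
  shows
    "(\<forall>U0 U1 H0 H1 \<mu>0 \<mu>1 \<gamma>0 \<gamma>1 \<eta>0 \<eta>1 \<delta>0 \<delta>1 \<iota> \<pi>0 \<pi>1 V.
        adjunction B A0 Q0 U0 \<mu>0 \<gamma>0 \<longrightarrow>
        adjunction B A1 Q1 U1 \<mu>1 \<gamma>1 \<longrightarrow>
        adjunction A0 E F0 H0 \<eta>0 \<delta>0 \<longrightarrow>
        adjunction A1 E F1 H1 \<eta>1 \<delta>1 \<longrightarrow>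
        adjoint_comparison B E (F0 \<odot> Q0)
          (U0 \<odot> H0) (comp_unit B Q0 U0 \<mu>0 \<eta>0) (comp_counit E F0 H0 \<gamma>0 \<delta>0)
          (U1 \<odot> H1) (comp_unit B Q1 U1 \<mu>1 \<eta>1) (comp_counit E F1 H1 \<gamma>1 \<delta>1) \<iota> \<longrightarrow>
        (\<forall>\<Theta>\<in>Ob D. is_pullback B
           (glue_leg0 B U0 H0 F1 \<eta>0 \<iota> \<Theta>) (glue_leg1 U1 \<eta>1 \<Theta>) (\<pi>0 \<Theta>) (\<pi>1 \<Theta>)) \<longrightarrow>
        V = glue_functor B U0 U1 \<pi>0 \<pi>1 \<longrightarrow>
        nat_iso D D (R \<odot> V) fid (glue_counit A0 A1 Q0 Q1 \<gamma>0 \<gamma>1 \<pi>0 \<pi>1 (R \<odot> V))) \<and>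
     is_equivalence B D R"
proof -
  have "is_category C" "abelian C" "\<exists>G. is_generator C G"
    using assms(2) unfolding grothendieck_def by auto
  \<comment> \<open>The definitions assert only the existence of an addition and a generator; the
    locales work with fixed ones.\<close>
  then obtain add z G where "preadditive C add z" "is_generator C G" unfolding abelian_def by blast
  then interpret stable_pair C add z "TYPE('u)" G L0 L1
    by unfold_locales (use assms(1-4) \<open>is_category C\<close> \<open>abelian C\<close> in blast)+
  note defs = assms(5-14)
  show ?thesis
  proof (intro conjI allI impI)
    show "is_equivalence B D R" unfolding defs by (rule R_equivalence)
  next
    fix U0 U1 H0 H1 \<mu>0 \<mu>1 \<gamma>0 \<gamma>1 \<eta>0 \<eta>1 \<delta>0 \<delta>1 \<iota> \<pi>0 \<pi>1 V
    assume a: "adjunction B A0 Q0 U0 \<mu>0 \<gamma>0" "adjunction B A1 Q1 U1 \<mu>1 \<gamma>1"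
      "adjunction A0 E F0 H0 \<eta>0 \<delta>0" "adjunction A1 E F1 H1 \<eta>1 \<delta>1"
      "adjoint_comparison B E (F0 \<odot> Q0)
          (U0 \<odot> H0) (comp_unit B Q0 U0 \<mu>0 \<eta>0) (comp_counit E F0 H0 \<gamma>0 \<delta>0)
          (U1 \<odot> H1) (comp_unit B Q1 U1 \<mu>1 \<eta>1) (comp_counit E F1 H1 \<gamma>1 \<delta>1) \<iota>"
      "\<forall>\<Theta>\<in>Ob D. is_pullback B
           (glue_leg0 B U0 H0 F1 \<eta>0 \<iota> \<Theta>) (glue_leg1 U1 \<eta>1 \<Theta>) (\<pi>0 \<Theta>) (\<pi>1 \<Theta>)"
      and V: "V = glue_functor B U0 U1 \<pi>0 \<pi>1"
    interpret g: glueing fI.Q f0.Q f1.Q fJ.Q "quot_functor C L0" "quot_functor C L1"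
      "quot_functor C LJ" "quot_functor C LJ" U0 U1 H0 H1 \<mu>0 \<mu>1 \<gamma>0 \<gamma>1 \<eta>0 \<eta>1 \<delta>0 \<delta>1 \<iota> \<pi>0 \<pi>1
      by unfold_locales (use a[unfolded defs] in blast)+
    show "nat_iso D D (R \<odot> V) fid (glue_counit A0 A1 Q0 Q1 \<gamma>0 \<gamma>1 \<pi>0 \<pi>1 (R \<odot> V))"
      unfolding V defs by (rule g.counit_nat_iso[OF R_full R_surj])
  qed
qed

end
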